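(* Let $n\geq 2$ and $1/2<\sigma<1$, and assume that the infimum $S_{n,\sigma}(\mathbb{R}^n_+)$ is attained. Let $\Omega\subset\mathbb{R}^n_+$ be an open set such that for some $\epsilon>0$ and some $a\in\partial\mathbb{R}^n_+$ one has $B_\epsilon^+(a)\subset\Omega$, and such that $\mathbb{R}^n_+\setminus\Omega$ has non-empty interior. Then $$S_{n,\sigma}(\Omega)<S_{n,\sigma}(\mathbb{R}^n_+).$$
   Context: $\mathbb{R}^n_+=\{(x',x_n)\in\mathbb{R}^{n-1}\times\mathbb{R}:x_n>0\}$, $\partial\mathbb{R}^n_+=\mathbb{R}^{n-1}\times\{0\}$, and $B_\epsilon^+(a)=\{x\in\mathbb{R}^n_+:|x-a|<\epsilon\}$. For an open set $\Omega\subset\mathbb{R}^n$ let $I_{n,\sigma,\Omega}[u]=\iint_{\Omega\times\Omega}\frac{(u(x)-u(y))^2}{|x-y|^{n+2\sigma}}\,dx\,dy$, let $\mathring H^\sigma(\Omega)$ be the completion of $C^1_c(\Omega)$ with respect to $I_{n,\sigma,\Omega}$, and $S_{n,\sigma}(\Omega)=\inf_{0\not\equiv u\in C^1_c(\Omega)} I_{n,\sigma,\Omega}[u]\big/\big(\int_\Omega|u|^{\frac{2n}{n-2\sigma}}dx\big)^{\frac{n-2\sigma}{n}}$ (equivalently, the infimum over nonzero $u\in\mathring H^\sigma(\Omega)$ when this is a function space). "$S_{n,\sigma}(\mathbb{R}^n_+)$ is attained" means there is $0\not\equiv u\in\mathring H^\sigma(\mathbb{R}^n_+)$ realizing the infimum.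 *)

theory Defs
  imports "HOL-Analysis.Analysis"
begin

text \<open>Points of R^n are modelled as pairs (x', x_n) :: 'a \<times> real with 'a an
  (n-1)-dimensional Euclidean space, so n = DIM('a \<times> real) \<ge> 2 automatically.\<close>

definition dimn :: "('a::euclidean_space \<times> real) itself \<Rightarrow> real" where
  "dimn _ = real DIM('a \<times> real)"

definition half_space :: "('a::euclidean_space \<times> real) set" where
  "half_space = {x. snd x > 0}"

definition half_ball :: "('a::euclidean_space \<times> real) \<Rightarrow> real \<Rightarrow> ('a \<times> real) set" where
  "half_ball a e = {x \<in> half_space. dist x a < e}"

definition crit_exp :: "real \<Rightarrow> ('a::euclidean_space \<times> real) itself \<Rightarrow> real" where
  "crit_exp \<sigma> T = 2 * dimn T / (dimn T - 2 * \<sigma>)"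

definition gag :: "real \<Rightarrow> ('a::euclidean_space \<times> real) set \<Rightarrow> (('a \<times> real) \<Rightarrow> real) \<Rightarrow> ennreal" where
  "gag \<sigma> \<Omega> u = (\<integral>\<^sup>+ x. \<integral>\<^sup>+ y. indicator (\<Omega> \<times> \<Omega>) (x, y) *
      ennreal ((u x - u y)\<^sup>2 / (dist x y) powr (dimn TYPE('a \<times> real) + 2 * \<sigma>)) \<partial>lborel \<partial>lborel)"

definition lp_int :: "real \<Rightarrow> ('a::euclidean_space \<times> real) set \<Rightarrow> (('a \<times> real) \<Rightarrow> real) \<Rightarrow> ennreal" where
  "lp_int \<sigma> \<Omega> u = (\<integral>\<^sup>+ x. indicator \<Omega> x * ennreal (\<bar>u x\<bar> powr crit_exp \<sigma> TYPE('a \<times> real)) \<partial>lborel)"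

definition lp_den :: "real \<Rightarrow> ('a::euclidean_space \<times> real) set \<Rightarrow> (('a \<times> real) \<Rightarrow> real) \<Rightarrow> ennreal" where
  "lp_den \<sigma> \<Omega> u = (if lp_int \<sigma> \<Omega> u = \<infinity> then \<infinity> else
      ennreal ((enn2real (lp_int \<sigma> \<Omega> u)) powr
        ((dimn TYPE('a \<times> real) - 2 * \<sigma>) / dimn TYPE('a \<times> real))))"

definition C1c :: "('a::euclidean_space \<times> real) set \<Rightarrow> (('a \<times> real) \<Rightarrow> real) set" where
  "C1c \<Omega> = {u. (\<exists>u'. (\<forall>x. (u has_derivative blinfun_apply (u' x)) (at x)) \<and> continuous_on UNIV u')
      \<and> compact (closure {x. u x \<noteq> 0}) \<and> closure {x. u x \<noteq> 0} \<subseteq> \<Omega>}"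

definition quot :: "real \<Rightarrow> ('a::euclidean_space \<times> real) set \<Rightarrow> (('a \<times> real) \<Rightarrow> real) \<Rightarrow> ennreal" where
  "quot \<sigma> \<Omega> u = gag \<sigma> \<Omega> u / lp_den \<sigma> \<Omega> u"

definition S_const :: "real \<Rightarrow> ('a::euclidean_space \<times> real) set \<Rightarrow> ennreal" where
  "S_const \<sigma> \<Omega> = (INF u \<in> {u \<in> C1c \<Omega>. \<exists>x. u x \<noteq> 0}. quot \<sigma> \<Omega> u)"

text \<open>Concrete realization of the completion \<mathring>H^\<sigma>(\<Omega>) of C^1_c(\<Omega>) w.r.t. I:
  measurable functions that are limits of C^1_c(\<Omega>) functions both in the seminorm I
  and in L^p(\<Omega>), p = 2n/(n-2\<sigma>) (the two are tied by the fractional Sobolev inequality).\<close>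
definition Hdot :: "real \<Rightarrow> ('a::euclidean_space \<times> real) set \<Rightarrow> (('a \<times> real) \<Rightarrow> real) set" where
  "Hdot \<sigma> \<Omega> = {u. u \<in> borel_measurable lborel \<and> (AE x in lborel. x \<notin> \<Omega> \<longrightarrow> u x = 0) \<and>
      (\<exists>\<phi>. (\<forall>k. \<phi> k \<in> C1c \<Omega>) \<and>
         ((\<lambda>k. gag \<sigma> \<Omega> (\<lambda>x. \<phi> k x - u x)) \<longlongrightarrow> 0) sequentially \<and>
         ((\<lambda>k. lp_int \<sigma> \<Omega> (\<lambda>x. \<phi> k x - u x)) \<longlongrightarrow> 0) sequentially)}"

definition S_attained :: "real \<Rightarrow> ('a::euclidean_space \<times> real) set \<Rightarrow> bool" where
  "S_attained \<sigma> \<Omega> = (\<exists>u \<in> Hdot \<sigma> \<Omega>. \<not> (AE x in lborel. u x = 0) \<and> quot \<sigma> \<Omega> u = S_const \<sigma> \<Omega>)"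

end

theory Submission
  imports Defs
begin

text \<open>Let \<open>u\<close> be a minimizer for the half-space and suppose that \<open>\<Omega>\<close> does not have a smaller constant.
  A function supported in a small half-ball inside \<open>\<Omega>\<close> has a larger energy on the half-space than on
  \<open>\<Omega>\<close>, by at least a multiple of its squared \<open>L\<^sup>2\<close> norm, since it interacts with the missing ball.
  The Kelvin transform about a boundary point \<open>b\<close> carries functions vanishing within distance \<open>r\<close> of \<open>b\<close>
  into the half-ball, so for these the Sobolev inequality of the half-space improves by
  \<open>c r\<^bsup>2\<sigma>\<^esup> \<integral> v\<^sup>2 |x - b|\<^bsup>-4\<sigma>\<^esup>\<close>. Testing with \<open>u\<close> cut off near \<open>b\<close> at scale \<open>r\<close>, and using the
  Euler--Lagrange inequality to bound the cost of the cutoff, shows that the mass of \<open>u\<close> away from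
  \<open>b\<close>, weighted by \<open>|x - b|\<^bsup>-4\<sigma>\<^esup>\<close>, is controlled by a local average at scale \<open>r\<close>. A minimizer decays
  at the boundary (the ground state form of Hardy's inequality, where \<open>\<sigma> > 1/2\<close> enters), so \<open>b\<close> can be
  chosen such that \<open>\<integral> u\<^sup>2 |x - b|\<^bsup>s-4\<sigma>\<^esup>\<close> is finite for the small \<open>s > 0\<close> needed. Integrating the bound
  against \<open>r\<^bsup>s-1\<^esup> dr\<close> gains a factor \<open>1/s\<close> on one side only, which is absurd as \<open>s\<close> tends to 0.\<close>

section \<open>Inversions and Lebesgue measure\<close>

text \<open>The bound obtained at one radius \<open>r\<close> scales alike on both sides, so no
  single \<open>r\<close> refutes it; only all scales together do. Write
  \<open>\<rho> = dist x b\<close>. Against \<open>r powr (s - 1)\<close>, the far mass meets all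
  \<open>r\<close> up to a multiple of \<open>\<rho>\<close> and collects about
  \<open>\<rho> powr s / s\<close>. The cutoff side carries \<open>r powr (- 4 * \<sigma>) * min 1
  (r / \<rho>) powr (n + 2 * \<sigma>)\<close>, whose integral is a multiple of
  \<open>\<rho> powr (s - 4 * \<sigma>)\<close> uniformly in \<open>s\<close>, because
  \<open>n - 2 * \<sigma> > 0\<close> and \<open>4 * \<sigma> > 1\<close>. The price is finiteness
  of the mass with weight \<open>\<rho> powr (s - 4 * \<sigma>)\<close>. Hardy's inequality gives
  the weight \<open>x\<^sub>n powr (- 2 * \<sigma>)\<close>; the ground state form improves the
  exponent to anything above \<open>1 - 4 * \<sigma>\<close>; averaging over \<open>b\<close> in the
  boundary, of dimension at least 1, yields almost one further power of the distance. What is still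
  missing is exactly the \<open>s\<close> that is allowed. The minimizer may change sign and no
  regularity of it is established: everything is tested with products \<open>m u\<close>.\<close>

text \<open>The library has the change of variables formula only on \<open>real ^ 'n\<close> with \<open>'n\<close>
  well-ordered; this type supplies such an index type for an arbitrary Euclidean space.\<close>

typedef (overloaded) 'a dim_index = "{..<DIM('a::euclidean_space)}"
  by (rule exI[of _ 0]) auto

setup_lifting type_definition_dim_index

instantiation dim_index :: (euclidean_space) linorder
begin
lift_definition less_eq_dim_index :: "'a dim_index \<Rightarrow> 'a dim_index \<Rightarrow> bool" is "(\<le>)" .
lift_definition less_dim_index :: "'a dim_index \<Rightarrow> 'a dim_index \<Rightarrow> bool" is "(<)" .
instance by standard (transfer; auto)+
end

instance dim_index :: (euclidean_space) finite
proof
  have "finite ((Abs_dim_index :: nat \<Rightarrow> 'a dim_index) ` {..<DIM('a)})" by blast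
  moreover have "(UNIV::'a dim_index set) = Abs_dim_index ` {..<DIM('a)}"
    by (metis type_definition.Abs_image type_definition_dim_index)
  ultimately show "finite (UNIV::'a dim_index set)" by simp
qed

instance dim_index :: (euclidean_space) wellorder
proof
  fix P :: "'a dim_index \<Rightarrow> bool" and a
  assume *: "\<And>x. (\<And>y. y < x \<Longrightarrow> P y) \<Longrightarrow> P x"
  show "P a"
  proof (induction a rule: measure_induct_rule[where f=Rep_dim_index])
    case (less x)
    then show ?case by (rule *) (simp add: less_dim_index.rep_eq)
  qed
qed

lemma card_dim_index: "CARD('a::euclidean_space dim_index) = DIM('a)"
  using type_definition.card[OF type_definition_dim_index] by simp

text \<open>Coordinates in an enumerated orthonormal basis: boxes pull back to boxes with the same
  side lengths, and boxes determine Lebesgue measure. Preservation of the norm is recorded because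
  it makes \<open>T\<close> commute with \<open>inversion\<close>.\<close>

lemma ex_coordinate_isometry:
  obtains T :: "'a::euclidean_space \<Rightarrow> real ^ ('a dim_index)"
  where "linear T" "bij T" "\<And>x. norm (T x) = norm x" "distr lborel borel T = lborel"
proof -
  obtain e :: "'a dim_index \<Rightarrow> 'a" where e: "bij_betw e UNIV Basis"
    using finite_same_card_bij[OF finite[of UNIV] finite_Basis] card_dim_index by metis
  have eB: "e i \<in> Basis" for i using e by (auto simp: bij_betw_def)
  have ee: "e i \<bullet> e j = (if i = j then 1 else 0)" for i j
    using e inner_Basis[OF eB eB, of i j] by (auto simp: bij_betw_def inj_on_def)
  define T where "T x = (\<chi> i. x \<bullet> e i)" for x :: 'a
  define U where "U v = (\<Sum>i\<in>UNIV. (v$i) *\<^sub>R e i)" for v :: "real ^ ('a dim_index)"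
  have sumB: "(\<Sum>b\<in>Basis. h b) = (\<Sum>i\<in>UNIV. h (e i))" for h :: "'a \<Rightarrow> 'b::comm_monoid_add"
    using sum.reindex_bij_betw[OF e, of h] by simp
  have prodB: "(\<Prod>b\<in>Basis. h b) = (\<Prod>i\<in>UNIV. h (e i))" for h :: "'a \<Rightarrow> real"
    using prod.reindex_bij_betw[OF e, of h] by simp
  have ballB: "(\<forall>b\<in>Basis. P b) \<longleftrightarrow> (\<forall>i. P (e i))" for P
  proof -
    have "range e = Basis" using e by (simp add: bij_betw_def)
    then have "(\<forall>b\<in>Basis. P b) \<longleftrightarrow> (\<forall>b\<in>range e. P b)" by simp
    then show ?thesis by simp
  qed
  have Ue: "U v \<bullet> e i = v $ i" for v i
    by (simp add: U_def inner_sum_left ee if_distrib[of "\<lambda>x. _ * x"] cong: if_cong)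
  have UT: "U (T x) = x" for x
    using euclidean_representation[of x] sumB[of "\<lambda>b. (x \<bullet> b) *\<^sub>R b"]
    by (simp add: U_def T_def)
  have TU: "T (U v) = v" for v
    by (simp add: T_def Ue vec_eq_iff)
  have lin: "linear T"
    by (rule linearI) (simp_all add: T_def vec_eq_iff inner_add_left)
  have bij: "bij T" by (rule bijI') (metis UT, metis TU)
  have nrm: "norm (T x) = norm x" for x
  proof -
    have "norm (T x) ^ 2 = (\<Sum>i\<in>UNIV. (x \<bullet> e i)^2)"
      unfolding power2_norm_eq_inner by (simp add: inner_vec_def T_def power2_eq_square)
    also have "\<dots> = (\<Sum>b\<in>Basis. (x \<bullet> b)^2)" by (simp add: sumB)
    also have "\<dots> = norm x ^ 2"
      by (subst power2_norm_eq_inner, subst euclidean_inner) (simp add: power2_eq_square)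
    finally show ?thesis by simp
  qed
  have cont: "continuous_on UNIV T"
    using lin linear_continuous_on linear_conv_bounded_linear by blast
  have [measurable]: "T \<in> borel_measurable borel"
    using cont by (rule borel_measurable_continuous_onI)
  have "lborel = distr lborel borel T"
  proof (rule lborel_eqI)
    fix l u :: "real ^ ('a dim_index)"
    assume le: "\<And>b. b \<in> Basis \<Longrightarrow> l \<bullet> b \<le> u \<bullet> b"
    have le': "l $ i \<le> u $ i" for i
    proof -
      have "axis i 1 \<in> (Basis :: (real ^ ('a dim_index)) set)" by (auto simp: Basis_vec_def)
      from le[OF this] show ?thesis unfolding inner_axis inner_real_def mult_1_right .
    qed
    have vim: "T -` box l u = box (U l) (U u)"
    proof -
      have "x \<in> T -` box l u \<longleftrightarrow> x \<in> box (U l) (U u)" for x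
      proof -
        have "x \<in> box (U l) (U u) \<longleftrightarrow> (\<forall>i. U l \<bullet> e i < x \<bullet> e i \<and> x \<bullet> e i < U u \<bullet> e i)"
          unfolding mem_box by (rule ballB)
        then show ?thesis by (simp add: Ue mem_box_cart T_def)
      qed
      then show ?thesis by blast
    qed
    have "emeasure (distr lborel borel T) (box l u) = emeasure lborel (box (U l) (U u))"
      by (subst emeasure_distr) (auto simp: vim)
    also have "\<dots> = (\<Prod>b\<in>Basis. (U u - U l) \<bullet> b)"
    proof (subst emeasure_lborel_box)
      fix b :: 'a assume "b \<in> Basis"
      then obtain i where "b = e i" using e by (auto simp: bij_betw_def)
      then show "U l \<bullet> b \<le> U u \<bullet> b" using le' by (simp add: Ue)
    qed simp
    also have "(\<Prod>b\<in>Basis. (U u - U l) \<bullet> b) = (\<Prod>i\<in>UNIV. (u - l) $ i)"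
      by (simp add: prodB inner_diff_left Ue)
    also have "\<dots> = (\<Prod>b\<in>Basis. (u - l) \<bullet> b)"
    proof -
      have B: "Basis = range (\<lambda>i. axis i 1 :: real ^ ('a dim_index))"
        by (auto simp: Basis_vec_def)
      have "inj (\<lambda>i. axis i 1 :: real ^ ('a dim_index))"
        by (auto simp: inj_on_def axis_eq_axis)
      then show ?thesis by (simp add: B prod.reindex inner_axis)
    qed
    finally show "emeasure (distr lborel borel T) (box l u) = (\<Prod>b\<in>Basis. (u - l) \<bullet> b)" .
  qed simp
  then show ?thesis using that[OF lin bij nrm] by simp
qed

text \<open>Division by zero makes 0 a fixed point, so the map is a total involution and preimages
  equal images without any side condition.\<close>

definition inversion :: "'a::real_inner \<Rightarrow> 'a" where
  "inversion x = (1 / (x \<bullet> x)) *\<^sub>R x"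

lemma inversion_inversion [simp]: "inversion (inversion x) = x"
  by (cases "x = 0") (auto simp: inversion_def)

lemma inversion_eq_0_iff [simp]: "inversion x = 0 \<longleftrightarrow> x = 0"
  by (auto simp: inversion_def)

lemma norm_inversion: "norm (inversion x) = 1 / norm x"
  by (cases "x = 0") (auto simp: inversion_def power2_norm_eq_inner[symmetric] power2_eq_square)

lemma norm_inversion_diff:
  assumes "x \<noteq> 0" "y \<noteq> 0"
  shows "norm (inversion x - inversion y) = norm (x - y) / (norm x * norm y)"
proof -
  have "(norm (inversion x - inversion y))\<^sup>2 = (norm (x - y) / (norm x * norm y))\<^sup>2"
  proof -
    have *: "X \<noteq> 0 \<Longrightarrow> Y \<noteq> 0 \<Longrightarrow> 1 / X * (1 / X * X) - 2 * (1 / X * (1 / Y * Z)) + 1 / Y * (1 / Y * Y)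
       = (X - 2 * Z + Y) / (X * Y)" for X Y Z :: real
      by (simp add: field_simps)
    have "x \<bullet> x \<noteq> 0" "y \<bullet> y \<noteq> 0" using assms by auto
    from *[OF this, of "x \<bullet> y"] show ?thesis
      unfolding power_divide power_mult_distrib power2_norm_eq_inner inversion_def
        inner_diff_left inner_diff_right inner_scaleR_left inner_scaleR_right inner_commute[of y x]
      by (simp add: algebra_simps)
  qed
  then show ?thesis by simp
qed

text \<open>The derivative is a reflection in the hyperplane orthogonal to \<open>x\<close>, scaled
  by \<open>1 / (x \<bullet> x)\<close>. Being conformal, it has a Jacobian determined by the
  scaling factor alone.\<close>

lemma has_derivative_inversion:
  fixes x :: "'a::real_inner"
  assumes "x \<noteq> 0"
  shows "(inversion has_derivative (\<lambda>h. (1 / (x \<bullet> x)) *\<^sub>R (h - (2 * (x \<bullet> h) / (x \<bullet> x)) *\<^sub>R x))) (at x within S)"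
proof -
  have d1: "((\<lambda>x. x \<bullet> x) has_derivative (\<lambda>h. x \<bullet> h + h \<bullet> x)) (at x within S)"
    by (intro has_derivative_inner has_derivative_ident)
  have "x \<bullet> x \<noteq> 0" using assms by simp
  have 1: "((\<lambda>x. inverse (x \<bullet> x) *\<^sub>R x) has_derivative
     (\<lambda>h. inverse (x \<bullet> x) *\<^sub>R h + (- (inverse (x \<bullet> x) * (x \<bullet> h + h \<bullet> x) * inverse (x \<bullet> x))) *\<^sub>R x)) (at x within S)"
    by (rule has_derivative_scaleR[OF Deriv.has_derivative_inverse[OF \<open>x \<bullet> x \<noteq> 0\<close> d1] has_derivative_ident])
  have 2: "(\<lambda>h. inverse (x \<bullet> x) *\<^sub>R h + (- (inverse (x \<bullet> x) * (x \<bullet> h + h \<bullet> x) * inverse (x \<bullet> x))) *\<^sub>R x)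
     = (\<lambda>h. (1 / (x \<bullet> x)) *\<^sub>R (h - (2 * (x \<bullet> h) / (x \<bullet> x)) *\<^sub>R x))"
    by (rule ext) (simp add: scaleR_diff_right inner_commute divide_inverse ac_simps)
  have 3: "inversion = (\<lambda>x::'a. inverse (x \<bullet> x) *\<^sub>R x)"
    by (simp add: inversion_def fun_eq_iff divide_inverse)
  show ?thesis using 1 unfolding 2 3 .
qed

lemma orthogonal_transformation_reflection:
  assumes "x \<noteq> 0"
  shows "orthogonal_transformation (\<lambda>h. h - (2 * (x \<bullet> h) / (x \<bullet> x)) *\<^sub>R x)"
  unfolding orthogonal_transformation_def
proof
  show "linear (\<lambda>h. h - (2 * (x \<bullet> h) / (x \<bullet> x)) *\<^sub>R x)"
    by (rule linearI) (auto simp: algebra_simps inner_simps add_divide_distrib)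
  show "\<forall>v w. (v - (2 * (x \<bullet> v) / (x \<bullet> x)) *\<^sub>R x) \<bullet> (w - (2 * (x \<bullet> w) / (x \<bullet> x)) *\<^sub>R x) = v \<bullet> w"
    using assms by (auto simp: inner_simps inner_commute field_simps)
qed

lemma borel_measurable_inversion [measurable]: "inversion \<in> borel_measurable (borel :: 'a::euclidean_space measure)"
  unfolding inversion_def[abs_def] by measurable

text \<open>Both measures are compared on boxes. The origin, a null set, is first removed from the
  box because \<open>inversion\<close> is not differentiable there; on the preimage \<open>S\<close>
  of the rest the map is injective and the measure of its image is the integral of the absolute
  Jacobian.\<close>

lemma lborel_inversion_cart:
  "lborel = distr (density lborel (\<lambda>x. ennreal (norm x powr (- 2 * real CARD('n))))) borel
     (inversion :: real ^ 'n::{finite,wellorder} \<Rightarrow> real ^ 'n::_)"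
proof (rule lborel_eqI)
  fix l u :: "real ^ 'n::_"
  assume le: "\<And>b. b \<in> Basis \<Longrightarrow> l \<bullet> b \<le> u \<bullet> b"
  let ?w = "\<lambda>x::real^'n::_. norm x powr (- 2 * real CARD('n))"
  define A where "A = box l u - {0}"
  define S where "S = inversion ` A"
  have Ab [measurable]: "A \<in> sets borel" by (simp add: A_def)
  have S_eq: "S = inversion -` A"
    unfolding S_def by (force simp: image_iff)
  have "inversion -` A \<inter> space borel \<in> sets borel" by (rule measurable_sets[OF borel_measurable_inversion Ab])
  then have Sb [measurable]: "S \<in> sets borel" by (simp add: S_eq)
  have S0: "x \<in> S \<Longrightarrow> x \<noteq> 0" for x by (auto simp: S_def A_def)
  have img: "inversion ` S = A" by (auto simp: S_def image_iff)
  let ?D = "\<lambda>x h. (1 / (x \<bullet> x)) *\<^sub>R (h - (2 * (x \<bullet> h) / (x \<bullet> x)) *\<^sub>R x) :: real^'n::_"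
  have det: "\<bar>det (matrix (?D x))\<bar> = ?w x" if "x \<noteq> 0" for x
  proof -
    have "matrix (?D x) = (1 / (x \<bullet> x)) *\<^sub>R matrix (\<lambda>h. h - (2 * (x \<bullet> h) / (x \<bullet> x)) *\<^sub>R x)"
      by (simp add: matrix_def vec_eq_iff)
    \<comment> \<open>A reflection has determinant 1 or -1, so only the scalar factor, once per row,
      survives.\<close>
    then have "\<bar>det (matrix (?D x))\<bar> = (1 / (x \<bullet> x)) ^ CARD('n)"
      using orthogonal_transformation_det[OF orthogonal_transformation_reflection[OF that]]
        det_rows_mul[of "\<lambda>_. 1 / (x \<bullet> x)" "\<lambda>i. matrix (\<lambda>h. h - (2 * (x \<bullet> h) / (x \<bullet> x)) *\<^sub>R x) $ i"]
      by (simp add: abs_mult power_abs scaleR_vec_def scalar_mult_eq_scaleR)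
    also have "\<dots> = ?w x" using that
      by (simp add: powr_minus powr_realpow[symmetric] power2_norm_eq_inner[symmetric] powr_powr powr_mult
           divide_simps flip: powr_numeral)
    finally show ?thesis .
  qed
  have "A \<in> lmeasurable" unfolding A_def
    by (rule bounded_set_imp_lmeasurable) (auto intro: bounded_subset[OF bounded_box])
  have inj: "inj_on inversion S" by (metis inj_onI inversion_inversion)
  have der: "(inversion has_derivative ?D x) (at x within S)" if "x \<in> S" for x
    using has_derivative_inversion[OF S0[OF that]] .
  have "((\<lambda>x. \<bar>det (matrix (?D x))\<bar>) has_integral measure lebesgue A) S"
    using has_measure_differentiable_image[OF _ der inj, of "measure lebesgue A"]
      \<open>A \<in> lmeasurable\<close> img by simp
  then have "(?w has_integral measure lebesgue A) S"
    by (rule has_integral_eq[rotated]) (use det S0 in auto)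
  then have "((\<lambda>x. indicator S x * ?w x) has_integral measure lebesgue A) UNIV"
  proof -
    have "(\<lambda>x. indicator S x * ?w x) = (\<lambda>x. if x \<in> S then ?w x else 0)"
      by (auto simp: fun_eq_iff)
    then show ?thesis using \<open>(?w has_integral measure lebesgue A) S\<close>
      by (simp only: has_integral_restrict_UNIV)
  qed
  then have "(\<integral>\<^sup>+x. ennreal (indicator S x * ?w x) \<partial>lborel) = ennreal (measure lebesgue A)"
    by (intro nn_integral_has_integral_lborel) auto
  moreover have "emeasure lborel A = ennreal (measure lebesgue A)"
  proof -
    have "emeasure lebesgue A = emeasure lborel A" by simp
    then show ?thesis using emeasure_eq_measure2[OF \<open>A \<in> lmeasurable\<close>] by simp
  qed
  moreover have "emeasure lborel A = emeasure lborel (box l u)"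
    unfolding A_def by (rule emeasure_Diff_null_set) auto
  moreover have "(\<integral>\<^sup>+x. ennreal (indicator S x * ?w x) \<partial>lborel) =
     emeasure (distr (density lborel (\<lambda>x. ennreal (?w x))) borel inversion) (box l u)"
  proof -
    have "emeasure (distr (density lborel (\<lambda>x. ennreal (?w x))) borel inversion) (box l u)
      = (\<integral>\<^sup>+x. ennreal (?w x) * indicator (inversion -` box l u) x \<partial>lborel)"
    proof -
      have "inversion -` box l u \<inter> space borel \<in> sets borel"
        by (rule measurable_sets[OF borel_measurable_inversion]) simp
      then show ?thesis by (subst emeasure_distr) (auto simp: emeasure_density)
    qed
    also have "\<dots> = (\<integral>\<^sup>+x. ennreal (indicator S x * ?w x) \<partial>lborel)"
      by (rule nn_integral_cong) (auto simp: S_eq A_def indicator_def)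
    finally show ?thesis by simp
  qed
  ultimately show "emeasure (distr (density lborel (\<lambda>x. ennreal (?w x))) borel inversion) (box l u)
      = (\<Prod>b\<in>Basis. (u - l) \<bullet> b)"
    using le by (simp add: emeasure_lborel_box)
qed simp

text \<open>The isometry \<open>T\<close> preserves norms and commutes with
  \<open>inversion\<close>, so the Cartesian formula carries over to the abstract space.\<close>

lemma nn_integral_inversion:
  fixes f :: "'a::euclidean_space \<Rightarrow> ennreal"
  assumes [measurable]: "f \<in> borel_measurable borel"
  shows "(\<integral>\<^sup>+x. f x \<partial>lborel) =
    (\<integral>\<^sup>+x. ennreal (norm x powr (- 2 * real DIM('a))) * f (inversion x) \<partial>lborel)"
proof -
  obtain T :: "'a \<Rightarrow> real ^ ('a dim_index)"
    where T: "linear T" "bij T" "\<And>x. norm (T x) = norm x" "distr lborel borel T = lborel"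
    by (rule ex_coordinate_isometry) blast
  define U where "U = inv T"
  have UT [simp]: "U (T x) = x" for x using T(2) by (simp add: U_def bij_is_inj)
  have TU [simp]: "T (U x) = x" for x using T(2) by (simp add: U_def bij_is_surj surj_f_inv_f)
  have "U (x + y) = U x + U y" "U (c *\<^sub>R x) = c *\<^sub>R U x" for x y c
    by (metis TU UT linear_add[OF T(1)], metis TU UT linear_scale[OF T(1)])
  then have linU: "linear U" by (rule linearI)
  have [measurable]: "T \<in> borel_measurable borel" "U \<in> borel_measurable borel"
    using T(1) linU by (auto intro!: borel_measurable_continuous_onI linear_continuous_on simp: linear_conv_bounded_linear)
  have inner: "T x \<bullet> T x = x \<bullet> x" for x
    using T(3)[of x] by (metis power2_norm_eq_inner)
  have invT: "inversion (T x) = T (inversion x)" for x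
    using linear_scale[OF T(1)] by (simp add: inversion_def inner)
  have pull: "(\<integral>\<^sup>+x. g x \<partial>lborel) = (\<integral>\<^sup>+x. g (T x) \<partial>lborel)" if [measurable]: "g \<in> borel_measurable borel" for g
    by (subst T(4)[symmetric]) (simp add: nn_integral_distr)
  have "(\<integral>\<^sup>+x. f x \<partial>lborel) = (\<integral>\<^sup>+x. f (U x) \<partial>lborel)"
    by (subst pull) simp_all
  also have "\<dots> = (\<integral>\<^sup>+x. ennreal (norm x powr (- 2 * real DIM('a))) * f (U (inversion x)) \<partial>lborel)"
    by (subst lborel_inversion_cart) (simp add: nn_integral_distr nn_integral_density card_dim_index)
  also have "\<dots> = (\<integral>\<^sup>+x. ennreal (norm x powr (- 2 * real DIM('a))) * f (inversion x) \<partial>lborel)"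
    by (subst pull) (simp_all add: T(3) invT)
  finally show ?thesis .
qed

lemma nn_integral_affine:
  fixes f :: "'a::euclidean_space \<Rightarrow> ennreal"
  assumes [measurable]: "f \<in> borel_measurable borel" and c: "c > 0"
  shows "(\<integral>\<^sup>+x. f x \<partial>lborel) = ennreal (c powr real DIM('a)) * (\<integral>\<^sup>+x. f (t + c *\<^sub>R x) \<partial>lborel)"
  using c by (subst lborel_affine[of c t])
     (simp_all add: nn_integral_density nn_integral_distr nn_integral_cmult powr_realpow)

text \<open>The inversion in the sphere of radius \<open>sqrt l\<close> about \<open>b\<close>,
  followed by the translation taking \<open>b\<close> to \<open>a\<close>. Spheres of radius
  \<open>t\<close> about \<open>b\<close> go to spheres of radius \<open>l / t\<close> about
  \<open>a\<close>, so a neighbourhood of infinity and a small ball at \<open>a\<close>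
  correspond.\<close>

definition sphere_inv :: "'a::real_inner \<Rightarrow> real \<Rightarrow> 'a \<Rightarrow> 'a \<Rightarrow> 'a" where
  "sphere_inv a l b x = a + l *\<^sub>R inversion (x - b)"

lemma borel_measurable_sphere_inv [measurable]:
  "sphere_inv a l b \<in> borel_measurable (borel :: 'a::euclidean_space measure)"
  unfolding sphere_inv_def[abs_def] by measurable

lemma nn_integral_sphere_inv:
  fixes f :: "'a::euclidean_space \<Rightarrow> ennreal"
  assumes [measurable]: "f \<in> borel_measurable borel" and l: "l > 0"
  shows "(\<integral>\<^sup>+x. f x \<partial>lborel) =
    (\<integral>\<^sup>+x. ennreal (l powr real DIM('a) * norm (x - b) powr (- 2 * real DIM('a))) * f (sphere_inv a l b x) \<partial>lborel)"
proof -
  have "(\<integral>\<^sup>+x. f x \<partial>lborel) = ennreal (l powr real DIM('a)) * (\<integral>\<^sup>+x. f (a + l *\<^sub>R x) \<partial>lborel)"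
    by (rule nn_integral_affine) (use l in auto)
  also have "(\<integral>\<^sup>+x. f (a + l *\<^sub>R x) \<partial>lborel) =
     (\<integral>\<^sup>+x. ennreal (norm x powr (- 2 * real DIM('a))) * f (a + l *\<^sub>R inversion x) \<partial>lborel)"
    by (subst nn_integral_inversion) simp_all
  also have "\<dots> = (\<integral>\<^sup>+x. ennreal (norm (x - b) powr (- 2 * real DIM('a))) * f (a + l *\<^sub>R inversion (x - b)) \<partial>lborel)"
    by (subst nn_integral_affine[of _ 1 "- b"]) simp_all
  finally show ?thesis
    by (simp add: nn_integral_cmult[symmetric] ennreal_mult sphere_inv_def mult.assoc)
qed

section \<open>The Gagliardo kernel on the half-space\<close>

lemma nn_integral_powr_tail:
  fixes a c :: real
  assumes "a > 0" "c > 0"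
  shows "(\<integral>\<^sup>+r. ennreal (r powr (- a - 1)) * indicator {c..} r \<partial>lborel) = ennreal (c powr (- a) / a)"
proof -
  have "(\<integral>\<^sup>+r. ennreal (r powr (- a - 1)) * indicator {c..} r \<partial>lborel) = ennreal (0 - (- (c powr (- a) / a)))"
  proof (rule nn_integral_FTC_atLeast)
    fix x :: real assume "c \<le> x"
    then have "x > 0" using assms by simp
    then show "((\<lambda>x. - (x powr (- a) / a)) has_real_derivative x powr (- a - 1)) (at x)"
      using assms by (auto intro!: derivative_eq_intros)
    show "0 \<le> x powr (- a - 1)" by simp
  next
    have "((\<lambda>x. x powr (- a)) \<longlongrightarrow> 0) at_top"
      using assms by (intro tendsto_neg_powr filterlim_ident) auto
    then have "((\<lambda>x. - (x powr (- a) / a)) \<longlongrightarrow> - (0 / a)) at_top"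
      using assms by (intro tendsto_intros) auto
    then show "((\<lambda>x. - (x powr (- a) / a)) \<longlongrightarrow> 0) at_top" by simp
  qed measurable
  then show ?thesis by simp
qed

text \<open>The substitution \<open>r \<mapsto> 1 / r\<close>, which is the inversion in dimension
  one, reduces the singular endpoint 0 to the tail integral.\<close>

lemma nn_integral_powr_head:
  fixes a c :: real
  assumes a: "a > 0" and c: "c > 0"
  shows "(\<integral>\<^sup>+r. ennreal (r powr (a - 1)) * indicator {0<..c} r \<partial>lborel) = ennreal (c powr a / a)"
proof -
  have inv: "inversion r = 1 / r" for r :: real by (simp add: inversion_def)
  have "(\<integral>\<^sup>+r. ennreal (r powr (a - 1)) * indicator {0<..c} r \<partial>lborel) =
    (\<integral>\<^sup>+r. ennreal (norm r powr (- 2 * real DIM(real))) * (ennreal (inversion r powr (a - 1)) * indicator {0<..c} (inversion r)) \<partial>lborel)"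
    by (rule nn_integral_inversion) measurable
  also have "\<dots> = (\<integral>\<^sup>+r. ennreal (r powr (- a - 1)) * indicator {1 / c..} r \<partial>lborel)"
  proof (rule nn_integral_cong)
    fix r :: real
    show "ennreal (norm r powr (- 2 * real DIM(real))) * (ennreal (inversion r powr (a - 1)) * indicator {0<..c} (inversion r)) = ennreal (r powr (- a - 1)) * indicator {1 / c..} r"
    proof (cases "r > 0")
      case True
      have "(1 / r) powr (a - 1) = r powr (- (a - 1))" using True by (simp add: powr_divide powr_minus_divide del: minus_diff_eq)
      then have "r powr (- 2) * (1 / r) powr (a - 1) = r powr (- 2 + - (a - 1))" by (simp only: powr_add)
      moreover have "- 2 + - (a - 1) = - a - 1" by simp
      ultimately have "r powr (- 2) * (1 / r) powr (a - 1) = r powr (- a - 1)" by (simp only:)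
      moreover have "1 / r \<le> c \<longleftrightarrow> 1 / c \<le> r" using True c by (simp add: field_simps)
      ultimately show ?thesis using True by (auto simp: inv indicator_def ennreal_mult[symmetric])
    next
      case False
      moreover have "1 / c > 0" using c by simp
      ultimately have "\<not> 1 / c \<le> r" by linarith
      then show ?thesis using False by (simp add: inv)
    qed
  qed
  also have "\<dots> = ennreal ((1 / c) powr (- a) / a)" using a c by (intro nn_integral_powr_tail) auto
  also have "(1 / c) powr (- a) = c powr a" using c by (simp add: powr_divide powr_minus_divide)
  finally show ?thesis .
qed

text \<open>Layer cake instead of polar coordinates: \<open>norm z powr (- (n + s))\<close> is the
  integral of \<open>(n + s) * t powr (- (n + s) - 1)\<close> over \<open>t \<ge> norm z\<close>.
  After exchanging the integrals, the inner one is bounded by the volume of a ball, which leaves a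
  convergent tail in \<open>t\<close>.\<close>

lemma nn_integral_norm_powr_outside:
  assumes s: "s > 0"
  shows "(\<integral>\<^sup>+z. indicator {1..} (norm z) * ennreal (norm z powr (- (real DIM('a) + s))) \<partial>(lborel :: 'a::euclidean_space measure)) < \<infinity>"
proof -
  let ?n = "real DIM('a)"
  define V where "V = unit_ball_vol ?n"
  have V0: "V \<ge> 0" by (simp add: V_def)
  have tail: "(\<integral>\<^sup>+t. ennreal (b * t powr (- b - 1)) * indicator {a..} t \<partial>lborel) = ennreal (a powr (- b))"
    if "b > 0" "a > 0" for a b :: real
  proof -
    have "(\<integral>\<^sup>+t. ennreal (b * t powr (- b - 1)) * indicator {a..} t \<partial>lborel)
      = (\<integral>\<^sup>+t. ennreal b * (ennreal (t powr (- b - 1)) * indicator {a..} t) \<partial>lborel)"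
      using that by (simp add: ennreal_mult mult.assoc)
    also have "\<dots> = ennreal b * ennreal (a powr (- b) / b)"
      by (subst nn_integral_cmult) (simp, simp only: nn_integral_powr_tail[OF that])
    finally show ?thesis using that by (simp add: ennreal_mult[symmetric])
  qed
  have "(\<integral>\<^sup>+z. indicator {1..} (norm z) * ennreal (norm z powr (- (?n + s))) \<partial>(lborel :: 'a measure))
    = (\<integral>\<^sup>+z. \<integral>\<^sup>+t. indicator {1..} (norm z) * (ennreal ((?n + s) * t powr (- (?n + s) - 1)) * indicator {norm z..} t) \<partial>lborel \<partial>(lborel :: 'a measure))"
  proof (rule nn_integral_cong)
    fix z :: 'a
    show "indicator {1..} (norm z) * ennreal (norm z powr (- (?n + s))) =
      (\<integral>\<^sup>+t. indicator {1..} (norm z) * (ennreal ((?n + s) * t powr (- (?n + s) - 1)) * indicator {norm z..} t) \<partial>lborel)"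
    proof (cases "norm z \<ge> 1")
      case True
      then have "norm z > 0" by linarith
      with True show ?thesis using tail[of "?n + s" "norm z"] s by simp
    qed simp
  qed
  also have "\<dots> = (\<integral>\<^sup>+z. \<integral>\<^sup>+t. indicator {(z,t). 1 \<le> norm z \<and> norm z \<le> t} (z,t) * ennreal ((?n + s) * t powr (- (?n + s) - 1)) \<partial>lborel \<partial>(lborel :: 'a measure))"
    by (intro nn_integral_cong) (auto simp: indicator_def)
  also have "\<dots> = (\<integral>\<^sup>+t. \<integral>\<^sup>+z. indicator {(z,t). 1 \<le> norm z \<and> norm z \<le> t} (z,t) * ennreal ((?n + s) * t powr (- (?n + s) - 1)) \<partial>(lborel :: 'a measure) \<partial>lborel)"
    by (rule lborel_pair.Fubini'[symmetric]) (auto simp: case_prod_beta' pred_def)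
  also have "\<dots> \<le> (\<integral>\<^sup>+t. ennreal (V * (?n + s) / s) * (ennreal (s * t powr (- s - 1)) * indicator {1..} t) \<partial>lborel)"
  proof (rule nn_integral_mono)
    fix t :: real
    show "(\<integral>\<^sup>+z. indicator {(z,t). 1 \<le> norm z \<and> norm z \<le> t} (z,t) * ennreal ((?n + s) * t powr (- (?n + s) - 1)) \<partial>(lborel :: 'a measure))
      \<le> ennreal (V * (?n + s) / s) * (ennreal (s * t powr (- s - 1)) * indicator {1..} t)"
    proof (cases "t \<ge> 1")
      case False
      then have "\<not> (1 \<le> norm z \<and> norm z \<le> t)" for z :: 'a by linarith
      then show ?thesis by simp
    next
      case True
      have "(\<integral>\<^sup>+z. indicator {(z,t). 1 \<le> norm z \<and> norm z \<le> t} (z,t) * ennreal ((?n + s) * t powr (- (?n + s) - 1)) \<partial>(lborel :: 'a measure))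
        \<le> (\<integral>\<^sup>+z. ennreal ((?n + s) * t powr (- (?n + s) - 1)) * indicator (cball 0 t) z \<partial>(lborel :: 'a measure))"
        by (intro nn_integral_mono) (auto simp: indicator_def)
      also have "\<dots> = ennreal ((?n + s) * t powr (- (?n + s) - 1)) * ennreal (V * t ^ DIM('a))"
        using True by (subst nn_integral_cmult_indicator) (auto simp: emeasure_cball V_def)
      also have "\<dots> = ennreal (V * (?n + s) / s) * (ennreal (s * t powr (- s - 1)) * indicator {1..} t)"
      proof -
        have e: "t powr (- (?n + s) - 1) * t ^ DIM('a) = t powr (- s - 1)"
          using True by (subst powr_realpow[symmetric]) (auto simp: powr_add[symmetric])
        have "((?n + s) * t powr (- (?n + s) - 1)) * (V * t ^ DIM('a)) = (?n + s) * V * (t powr (- (?n + s) - 1) * t ^ DIM('a))"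
          by (simp only: ac_simps)
        also have "\<dots> = (V * (?n + s) / s) * (s * t powr (- s - 1))"
          unfolding e using s by simp
        finally show ?thesis using True s V0 by (simp add: ennreal_mult[symmetric])
      qed
      finally show ?thesis .
    qed
  qed
  also have "\<dots> = ennreal (V * (?n + s) / s) * ennreal (1 powr (- s))"
    using s by (subst nn_integral_cmult) (auto simp: tail)
  also have "\<dots> < \<infinity>" by (simp add: ennreal_mult_less_top)
  finally show ?thesis .
qed

text \<open>The inversion maps the unit ball to its exterior, and its Jacobian turns the exponent
  \<open>- (n - s)\<close> into \<open>- (n + s)\<close>.\<close>

lemma nn_integral_norm_powr_inside:
  assumes s: "s > 0"
  shows "(\<integral>\<^sup>+z. indicator {..1} (norm z) * ennreal (norm z powr (- (real DIM('a) - s))) \<partial>(lborel :: 'a::euclidean_space measure)) < \<infinity>"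
proof -
  let ?n = "real DIM('a)"
  have "(\<integral>\<^sup>+z. indicator {..1} (norm z) * ennreal (norm z powr (- (?n - s))) \<partial>(lborel :: 'a measure))
    = (\<integral>\<^sup>+x. ennreal (norm x powr (- 2 * ?n)) * (indicator {..1} (norm (inversion x)) * ennreal (norm (inversion x) powr (- (?n - s)))) \<partial>(lborel :: 'a measure))"
    by (rule nn_integral_inversion) measurable
  also have "\<dots> = (\<integral>\<^sup>+z. indicator {1..} (norm z) * ennreal (norm z powr (- (?n + s))) \<partial>(lborel :: 'a measure))"
  proof (rule nn_integral_cong)
    fix x :: 'a
    show "ennreal (norm x powr (- 2 * ?n)) * (indicator {..1} (norm (inversion x)) * ennreal (norm (inversion x) powr (- (?n - s))))
       = indicator {1..} (norm x) * ennreal (norm x powr (- (?n + s)))"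
    proof (cases "x = 0")
      case False
      then have "(1 / norm x) powr (- (?n - s)) = norm x powr (?n - s)"
        by (simp add: powr_divide powr_minus_divide)
           (simp add: powr_minus_divide[symmetric] divide_simps powr_add[symmetric])
      then have "norm x powr (- 2 * ?n) * (1 / norm x) powr (- (?n - s)) = norm x powr (- (?n + s))"
        by (simp add: powr_add[symmetric])
      moreover have "1 / norm x \<le> 1 \<longleftrightarrow> 1 \<le> norm x" using False by (simp add: field_simps)
      ultimately show ?thesis by (auto simp: norm_inversion indicator_def ennreal_mult[symmetric])
    qed simp
  qed
  also have "\<dots> < \<infinity>" by (rule nn_integral_norm_powr_outside[OF s])
  finally show ?thesis .
qed

lemma nn_integral_radial_scale:
  fixes x :: "'a::euclidean_space" and h :: "real \<Rightarrow> ennreal"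
  assumes [measurable]: "h \<in> borel_measurable borel" and s: "s > 0"
  shows "(\<integral>\<^sup>+y. h (dist x y / s) * ennreal (dist x y powr (- (real DIM('a) + t))) \<partial>lborel) =
    ennreal (s powr (- t)) * (\<integral>\<^sup>+z. h (norm z) * ennreal (norm z powr (- (real DIM('a) + t))) \<partial>(lborel :: 'a measure))"
proof -
  have "(\<integral>\<^sup>+y. h (dist x y / s) * ennreal (dist x y powr (- (real DIM('a) + t))) \<partial>lborel)
    = ennreal (s powr real DIM('a)) * (\<integral>\<^sup>+z. h (dist x (x + s *\<^sub>R z) / s) * ennreal (dist x (x + s *\<^sub>R z) powr (- (real DIM('a) + t))) \<partial>lborel)"
    by (rule nn_integral_affine[OF _ s]) measurable
  also have "\<dots> = ennreal (s powr real DIM('a)) * (\<integral>\<^sup>+z. ennreal (s powr (- (real DIM('a) + t))) * (h (norm z) * ennreal (norm z powr (- (real DIM('a) + t)))) \<partial>(lborel :: 'a measure))"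
  proof -
    have "h (dist x (x + s *\<^sub>R z) / s) * ennreal (dist x (x + s *\<^sub>R z) powr (- (real DIM('a) + t))) =
       ennreal (s powr (- (real DIM('a) + t))) * (h (norm z) * ennreal (norm z powr (- (real DIM('a) + t))))" for z
      using s by (simp add: dist_norm powr_mult ennreal_mult ac_simps)
    then show ?thesis by simp
  qed
  also have "\<dots> = ennreal (s powr (- t)) * (\<integral>\<^sup>+z. h (norm z) * ennreal (norm z powr (- (real DIM('a) + t))) \<partial>(lborel :: 'a measure))"
    by (subst nn_integral_cmult) (auto simp: mult.assoc[symmetric] ennreal_mult[symmetric] powr_add[symmetric])
  finally show ?thesis .
qed

section \<open>The kernel, its truncations, and the measure that carries the energy\<close>

definition gker :: "real \<Rightarrow> ('a::euclidean_space \<times> real) \<Rightarrow> ('a \<times> real) \<Rightarrow> real" where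
  "gker \<sigma> x y = dist x y powr (- (dimn TYPE('a \<times> real) + 2 * \<sigma>))"

lemma gker_nonneg [simp]: "gker \<sigma> x y \<ge> 0" by (simp add: gker_def)
lemma gker_commute: "gker \<sigma> x y = gker \<sigma> y x" by (simp add: gker_def dist_commute)

lemma borel_measurable_fst_snd [measurable (raw)]:
  fixes f :: "'c \<Rightarrow> 'a::second_countable_topology \<times> 'b::second_countable_topology"
  assumes "f \<in> borel_measurable M"
  shows "(\<lambda>x. fst (f x)) \<in> borel_measurable M" "(\<lambda>x. snd (f x)) \<in> borel_measurable M"
  using assms unfolding borel_prod[symmetric] by measurable

lemma borel_measurable_gker [measurable]:
  assumes [measurable]: "f \<in> borel_measurable M" "g \<in> borel_measurable M"
  shows "(\<lambda>w. gker \<sigma> (f w) (g w)) \<in> borel_measurable M"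
  unfolding gker_def by measurable

lemma half_space_borel [measurable]: "half_space \<in> sets borel"
  unfolding half_space_def by measurable

lemma dimn_ge_2: "dimn TYPE('a::euclidean_space \<times> real) \<ge> 2"
  using DIM_positive[where 'a='a] by (simp add: dimn_def Suc_le_eq)

lemma dimn_prod: "dimn TYPE('a::euclidean_space \<times> real) = real DIM('a) + 1"
  by (simp add: dimn_def)

text \<open>The factor \<open>min 1 ((dist x y / s)\<^sup>2)\<close> is what a bounded function with
  Lipschitz constant of order \<open>1 / s\<close> produces. It is integrable near the diagonal
  because \<open>2 - 2 * \<sigma> > 0\<close> and far away because \<open>2 * \<sigma> > 0\<close>;
  scaling then gives the power of \<open>s\<close>, with one constant for all \<open>x\<close> and
  \<open>s\<close>.\<close>

lemma ex_gker_truncated: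
  assumes "0 < \<sigma>" "\<sigma> < 1"
  obtains C where "C > 0" "\<And>(x::'a::euclidean_space \<times> real) s. s > 0 \<Longrightarrow>
    (\<integral>\<^sup>+y. ennreal (min 1 ((dist x y / s)\<^sup>2) * gker \<sigma> x y) \<partial>lborel) \<le> ennreal (C * s powr (- 2 * \<sigma>))"
    and "\<And>(x::'a \<times> real) s. s > 0 \<Longrightarrow>
    (\<integral>\<^sup>+y. indicator {s..} (dist x y) * ennreal (gker \<sigma> x y) \<partial>lborel) \<le> ennreal (C * s powr (- 2 * \<sigma>))"
proof -
  let ?L = "lborel :: ('a \<times> real) measure"
  let ?k = "\<lambda>z::'a \<times> real. norm z powr (- (real DIM('a \<times> real) + 2 * \<sigma>))"
  define K where "K = (\<integral>\<^sup>+z. ennreal (min 1 ((norm z)\<^sup>2)) * ennreal (?k z) \<partial>?L)"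
  have "K \<le> (\<integral>\<^sup>+z. indicator {..1} (norm z) * ennreal (norm z powr (- (real DIM('a \<times> real) - (2 - 2 * \<sigma>)))) +
     indicator {1..} (norm z) * ennreal (?k z) \<partial>?L)"
    unfolding K_def
  proof (rule nn_integral_mono)
    fix z :: "'a \<times> real"
    show "ennreal (min 1 ((norm z)\<^sup>2)) * ennreal (?k z) \<le> indicator {..1} (norm z) * ennreal (norm z powr (- (real DIM('a \<times> real) - (2 - 2 * \<sigma>)))) +
     indicator {1..} (norm z) * ennreal (?k z)"
    proof (cases "norm z \<ge> 1")
      case True
      have "ennreal (min 1 ((norm z)\<^sup>2)) * ennreal (?k z) \<le> 1 * ennreal (?k z)"
        by (intro mult_right_mono) (auto simp: ennreal_le_1)
      also have "\<dots> \<le> indicator {..1} (norm z) * ennreal (norm z powr (- (real DIM('a \<times> real) - (2 - 2 * \<sigma>)))) +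
         indicator {1..} (norm z) * ennreal (?k z)"
        using True by simp
      finally show ?thesis .
    next
      case False
      have "(norm z)\<^sup>2 * ?k z = norm z powr (- (real DIM('a \<times> real) - (2 - 2 * \<sigma>)))"
      proof (cases "z = 0")
        case False
        then have "(norm z)\<^sup>2 = norm z powr 2" by simp
        then show ?thesis by (simp only: powr_add[symmetric]) (simp add: algebra_simps)
      qed simp
      moreover have "min 1 ((norm z)\<^sup>2) = (norm z)\<^sup>2" using False by (simp add: power_le_one)
      ultimately show ?thesis using False by (simp add: ennreal_mult[symmetric])
    qed
  qed
  also have "\<dots> = (\<integral>\<^sup>+z. indicator {..1} (norm z) * ennreal (norm z powr (- (real DIM('a \<times> real) - (2 - 2 * \<sigma>)))) \<partial>?L) +
     (\<integral>\<^sup>+z. indicator {1..} (norm z) * ennreal (?k z) \<partial>?L)"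
    by (rule nn_integral_add) measurable
  also have "\<dots> < \<infinity>"
    using nn_integral_norm_powr_inside[where 'a="'a \<times> real", of "2 - 2 * \<sigma>"]
      nn_integral_norm_powr_outside[where 'a="'a \<times> real", of "2 * \<sigma>"] assms by (simp add: infinity_ennreal_def)
  finally have K: "K < \<infinity>" .
  \<comment> \<open>Adding 1 makes the constant positive without a lower bound for
    \<open>K\<close>.\<close>
  define C where "C = enn2real K + 1"
  have C: "C > 0" by (simp add: C_def add_nonneg_pos)
  have KC: "K \<le> ennreal C"
    using K by (cases K) (auto simp: C_def ennreal_le_iff2)
  have 1: "(\<integral>\<^sup>+y. ennreal (min 1 ((dist x y / s)\<^sup>2) * gker \<sigma> x y) \<partial>lborel) \<le> ennreal (C * s powr (- 2 * \<sigma>))"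
    if "s > 0" for x :: "'a \<times> real" and s
  proof -
    have "(\<integral>\<^sup>+y. ennreal (min 1 ((dist x y / s)\<^sup>2) * gker \<sigma> x y) \<partial>lborel) = ennreal (s powr (- (2 * \<sigma>))) * K"
      unfolding K_def gker_def dimn_def
      by (subst nn_integral_radial_scale[OF _ that, of "\<lambda>t. ennreal (min 1 (t\<^sup>2))", symmetric])
         (auto simp: ennreal_mult)
    also have "\<dots> \<le> ennreal (s powr (- (2 * \<sigma>))) * ennreal C"
      by (intro mult_left_mono KC) simp
    finally show ?thesis using C by (simp add: ennreal_mult[symmetric] mult.commute)
  qed
  have 2: "(\<integral>\<^sup>+y. indicator {s..} (dist x y) * ennreal (gker \<sigma> x y) \<partial>lborel) \<le> ennreal (C * s powr (- 2 * \<sigma>))"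
    if "s > 0" for x :: "'a \<times> real" and s
  proof (rule order_trans[OF nn_integral_mono 1[OF that]])
    fix y :: "'a \<times> real"
    show "indicator {s..} (dist x y) * ennreal (gker \<sigma> x y) \<le> ennreal (min 1 ((dist x y / s)\<^sup>2) * gker \<sigma> x y)"
    proof (cases "s \<le> dist x y")
      case True
      then have "1 \<le> dist x y / s" using that by (simp add: field_simps)
      then have "1 \<le> (dist x y / s)\<^sup>2" by (rule one_le_power)
      then show ?thesis using True by simp
    qed simp
  qed
  show ?thesis by (rule that[OF C 1 2])
qed

text \<open>Putting the kernel and both restrictions to the half-space into one measure turns the
  energy into a plain square integral, so energy estimates become pointwise inequalities in
  \<open>fst z\<close> and \<open>snd z\<close>, followed by Tonelli and the symmetry of the
  measure.\<close>

definition gmeas :: "real \<Rightarrow> (('a::euclidean_space \<times> real) \<times> ('a \<times> real)) measure" where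
  "gmeas \<sigma> = density (lborel \<Otimes>\<^sub>M lborel)
     (\<lambda>(x, y). indicator half_space x * indicator half_space y * ennreal (gker \<sigma> x y))"

lemma sets_gmeas [measurable_cong, simp]: "sets (gmeas \<sigma>) = sets (borel \<Otimes>\<^sub>M borel)"
  by (simp add: gmeas_def cong: sets_pair_measure_cong)

lemma space_gmeas [simp]: "space (gmeas \<sigma>) = UNIV"
  by (simp add: gmeas_def space_pair_measure)

lemma nn_integral_gmeas:
  fixes h :: "('a::euclidean_space \<times> real) \<times> ('a \<times> real) \<Rightarrow> ennreal"
  assumes [measurable]: "h \<in> borel_measurable (borel \<Otimes>\<^sub>M borel)"
  shows "(\<integral>\<^sup>+z. h z \<partial>gmeas \<sigma>) = (\<integral>\<^sup>+x. indicator half_space x *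
     (\<integral>\<^sup>+y. indicator half_space y * (ennreal (gker \<sigma> x y) * h (x, y)) \<partial>lborel) \<partial>lborel)"
proof -
  have "(\<integral>\<^sup>+z. h z \<partial>gmeas \<sigma>) =
    (\<integral>\<^sup>+z. (case z of (x, y) \<Rightarrow> indicator half_space x * indicator half_space y * ennreal (gker \<sigma> x y)) * h z \<partial>(lborel \<Otimes>\<^sub>M lborel))"
    unfolding gmeas_def by (subst nn_integral_density) auto
  also have "\<dots> = (\<integral>\<^sup>+x. \<integral>\<^sup>+y. (indicator half_space x * indicator half_space y * ennreal (gker \<sigma> x y)) * h (x, y) \<partial>lborel \<partial>lborel)"
    by (subst lborel.nn_integral_fst[symmetric]) auto
  also have "\<dots> = (\<integral>\<^sup>+x. indicator half_space x *
     (\<integral>\<^sup>+y. indicator half_space y * (ennreal (gker \<sigma> x y) * h (x, y)) \<partial>lborel) \<partial>lborel)"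
    by (intro nn_integral_cong, subst nn_integral_cmult[symmetric]) (auto simp: mult.assoc)
  finally show ?thesis .
qed

lemma nn_integral_gmeas_fst:
  fixes F :: "'a::euclidean_space \<times> real \<Rightarrow> ennreal"
  assumes [measurable]: "F \<in> borel_measurable borel" "\<rho> \<in> borel_measurable (borel \<Otimes>\<^sub>M borel)"
  shows "(\<integral>\<^sup>+z. F (fst z) * \<rho> z \<partial>gmeas \<sigma>) = (\<integral>\<^sup>+x. indicator half_space x * F x *
     (\<integral>\<^sup>+y. indicator half_space y * (ennreal (gker \<sigma> x y) * \<rho> (x, y)) \<partial>lborel) \<partial>lborel)"
  by (subst nn_integral_gmeas) (auto simp: nn_integral_cmult[symmetric] ac_simps intro!: nn_integral_cong)

lemma nn_integral_gmeas_swap: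
  fixes h :: "('a::euclidean_space \<times> real) \<times> ('a \<times> real) \<Rightarrow> ennreal"
  assumes [measurable]: "h \<in> borel_measurable (borel \<Otimes>\<^sub>M borel)"
  shows "(\<integral>\<^sup>+z. h (snd z, fst z) \<partial>gmeas \<sigma>) = (\<integral>\<^sup>+z. h z \<partial>gmeas \<sigma>)"
proof -
  let ?w = "\<lambda>z. (case z of (x, y) \<Rightarrow> indicator half_space x * indicator half_space y * ennreal (gker \<sigma> x y))"
  have "(\<integral>\<^sup>+z. h z \<partial>gmeas \<sigma>) = (\<integral>\<^sup>+z. ?w z * h z \<partial>(lborel \<Otimes>\<^sub>M lborel))"
    unfolding gmeas_def by (subst nn_integral_density) auto
  also have "\<dots> = (\<integral>\<^sup>+z. ?w z * h z \<partial>(distr (lborel \<Otimes>\<^sub>M lborel) (lborel \<Otimes>\<^sub>M lborel) (\<lambda>(x, y). (y, x))))"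
    by (subst lborel_pair.distr_pair_swap) simp
  also have "\<dots> = (\<integral>\<^sup>+z. ?w z * h (snd z, fst z) \<partial>(lborel \<Otimes>\<^sub>M lborel))"
    by (subst nn_integral_distr) (auto simp: case_prod_beta' gker_commute ac_simps intro!: nn_integral_cong)
  also have "\<dots> = (\<integral>\<^sup>+z. h (snd z, fst z) \<partial>gmeas \<sigma>)"
    unfolding gmeas_def by (subst nn_integral_density) auto
  finally show ?thesis by simp
qed

lemma gag_eq_gmeas:
  fixes u :: "'a::euclidean_space \<times> real \<Rightarrow> real"
  assumes [measurable]: "u \<in> borel_measurable borel"
  shows "gag \<sigma> half_space u = (\<integral>\<^sup>+z. ennreal ((u (fst z) - u (snd z))\<^sup>2) \<partial>gmeas \<sigma>)"
proof -
  have "X / Y powr Z = X * Y powr (- Z)" for X Y Z :: real by (simp add: powr_minus divide_inverse)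
  then show ?thesis unfolding gag_def
    by (subst nn_integral_gmeas)
       (auto simp: nn_integral_cmult[symmetric] gker_def ennreal_mult
        indicator_times simp del: powr_minus_divide intro!: nn_integral_cong simp: ac_simps)
qed

lemma AE_gmeas:
  assumes P: "AE x in lborel. x \<in> half_space \<longrightarrow> P x"
  shows "AE z in gmeas \<sigma>. P (fst z) \<and> P (snd z)"
proof -
  obtain N where N: "N \<in> null_sets lborel" "\<And>x. x \<notin> N \<Longrightarrow> x \<in> half_space \<longrightarrow> P x"
    using P by (auto elim!: AE_E3)
  \<comment> \<open>The complement of the half-space is added because the density of
    \<open>gmeas\<close> vanishes there; this is why \<open>P\<close> is only assumed almost
    everywhere on the half-space.\<close>
  define N' where "N' = N \<union> - half_space"
  have [measurable]: "N \<in> sets borel" using N(1) by (auto simp: null_sets_def)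
  have [measurable]: "N' \<in> sets borel" by (simp add: N'_def)
  have "AE x in lborel. x \<notin> N" using N(1) by (rule AE_not_in)
  then have "(\<integral>\<^sup>+z. indicator N' (fst z) * 1 \<partial>gmeas \<sigma>) = (\<integral>\<^sup>+x. 0 \<partial>(lborel :: ('a \<times> real) measure))"
    by (subst nn_integral_gmeas_fst, measurable)
       (intro nn_integral_cong_AE, auto simp: N'_def indicator_def elim!: eventually_mono)
  then have 1: "(\<integral>\<^sup>+z. indicator N' (fst z) \<partial>gmeas \<sigma>) = 0" by simp
  then have 2: "(\<integral>\<^sup>+z. indicator N' (snd z) \<partial>gmeas \<sigma>) = 0"
    using nn_integral_gmeas_swap[of "\<lambda>z. indicator N' (fst z)" \<sigma>] by simp
  have "AE z in gmeas \<sigma>. indicator N' (fst z) = (0::ennreal)" "AE z in gmeas \<sigma>. indicator N' (snd z) = (0::ennreal)"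
    using 1 2 by (simp_all add: nn_integral_0_iff_AE)
  then show ?thesis
  proof eventually_elim
    case (elim z)
    then have "fst z \<notin> N'" "snd z \<notin> N'" by (simp_all add: indicator_eq_0_iff)
    then show ?case using N(2) by (simp add: N'_def)
  qed
qed

lemma nn_integral_gmeas_sym:
  fixes F :: "'a::euclidean_space \<times> real \<Rightarrow> ennreal"
  assumes [measurable]: "F \<in> borel_measurable borel" "\<rho> \<in> borel_measurable (borel \<Otimes>\<^sub>M borel)"
  shows "(\<integral>\<^sup>+z. F (snd z) * \<rho> (snd z, fst z) \<partial>gmeas \<sigma>) = (\<integral>\<^sup>+z. F (fst z) * \<rho> z \<partial>gmeas \<sigma>)"
  using nn_integral_gmeas_swap[of "\<lambda>z. F (fst z) * \<rho> z" \<sigma>] by simp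

text \<open>For a factor depending only on \<open>y\<^sub>n / x\<^sub>n\<close>, the kernel integral
  over \<open>y\<close> is determined by horizontal translation and dilation up to a power of
  \<open>x\<^sub>n\<close>. This is the remaining constant, computed at the base point
  \<open>(0, 1)\<close>.\<close>

definition kap :: "real \<Rightarrow> 'a::euclidean_space itself \<Rightarrow> (real \<Rightarrow> ennreal) \<Rightarrow> ennreal" where
  "kap \<sigma> T \<rho> = (\<integral>\<^sup>+p. indicator half_space p * (ennreal (gker \<sigma> (0, 1) p) * \<rho> (snd p)) \<partial>(lborel :: ('a \<times> real) measure))"

lemma nn_integral_slice:
  fixes x :: "'a::euclidean_space \<times> real"
  assumes [measurable]: "\<rho> \<in> borel_measurable borel" and x: "x \<in> half_space"
  shows "(\<integral>\<^sup>+y. indicator half_space y * (ennreal (gker \<sigma> x y) * \<rho> (snd y / snd x)) \<partial>lborel) =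
    ennreal (snd x powr (- 2 * \<sigma>)) * kap \<sigma> TYPE('a) \<rho>"
proof -
  let ?N = "dimn TYPE('a \<times> real)"
  define c where "c = snd x"
  have c: "c > 0" using x by (simp add: c_def half_space_def)
  have x_eq: "x = (fst x, 0) + c *\<^sub>R (0, 1)" by (simp add: c_def)
  have dist: "dist x ((fst x, 0) + c *\<^sub>R p) = c * dist (0, 1) p" for p :: "'a \<times> real"
    by (subst x_eq) (use c in \<open>simp add: dist_norm del: scaleR_Pair add: scaleR_diff_right[symmetric]\<close>)
  have mem: "(fst x, 0) + c *\<^sub>R p \<in> half_space \<longleftrightarrow> p \<in> half_space" for p :: "'a \<times> real"
    using c by (auto simp: half_space_def zero_less_mult_iff)
  have "(\<integral>\<^sup>+y. indicator half_space y * (ennreal (gker \<sigma> x y) * \<rho> (snd y / snd x)) \<partial>lborel) =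
     ennreal (c powr ?N) * (\<integral>\<^sup>+p. indicator half_space ((fst x, 0) + c *\<^sub>R p) * (ennreal (gker \<sigma> x ((fst x, 0) + c *\<^sub>R p))
        * \<rho> (snd ((fst x, 0) + c *\<^sub>R p) / snd x)) \<partial>lborel)"
    unfolding dimn_def by (rule nn_integral_affine[OF _ c]) measurable
  also have "\<dots> = ennreal (c powr ?N) * (\<integral>\<^sup>+p. ennreal (c powr (- (?N + 2 * \<sigma>))) * (indicator half_space p * (ennreal (gker \<sigma> (0, 1) p) * \<rho> (snd p))) \<partial>(lborel :: ('a \<times> real) measure))"
  proof -
    have "indicator half_space ((fst x, 0) + c *\<^sub>R p) * (ennreal (gker \<sigma> x ((fst x, 0) + c *\<^sub>R p))
        * \<rho> (snd ((fst x, 0) + c *\<^sub>R p) / snd x)) = ennreal (c powr (- (?N + 2 * \<sigma>))) * (indicator half_space p * (ennreal (gker \<sigma> (0, 1) p) * \<rho> (snd p)))" for p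
      unfolding gker_def dist
    proof -
      have "indicator half_space ((fst x, 0) + c *\<^sub>R p) = (indicator half_space p :: ennreal)"
        by (simp only: indicator_def mem)
      moreover have "snd ((fst x, 0) + c *\<^sub>R p) / snd x = snd p" using c by (simp add: c_def)
      ultimately show "indicator half_space ((fst x, 0) + c *\<^sub>R p) * (ennreal ((c * dist (0, 1) p) powr (- (?N + 2 * \<sigma>)))
        * \<rho> (snd ((fst x, 0) + c *\<^sub>R p) / snd x)) = ennreal (c powr (- (?N + 2 * \<sigma>))) * (indicator half_space p * (ennreal (dist (0, 1) p powr (- (?N + 2 * \<sigma>))) * \<rho> (snd p)))"
        using c by (simp only: powr_mult zero_le_dist less_imp_le ennreal_mult powr_ge_zero) (simp add: ac_simps)
    qed
    then show ?thesis by simp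
  qed
  also have "\<dots> = ennreal (c powr (- 2 * \<sigma>)) * kap \<sigma> TYPE('a) \<rho>"
    unfolding kap_def
    by (subst nn_integral_cmult) (auto simp: mult.assoc[symmetric] ennreal_mult[symmetric] powr_add[symmetric])
  finally show ?thesis by (simp add: c_def)
qed

lemma kap_cong: "(\<And>s. s > 0 \<Longrightarrow> \<rho> s = \<rho>' s) \<Longrightarrow> kap \<sigma> T \<rho> = kap \<sigma> T \<rho>'"
  unfolding kap_def by (intro nn_integral_cong) (auto simp: half_space_def indicator_def)

text \<open>This is the harmonicity of \<open>x\<^sub>n powr (2 * \<sigma> - 1)\<close> in disguise.\<close>
lemma kap_inverse:
  assumes [measurable]: "\<rho> \<in> borel_measurable borel"
  shows "kap \<sigma> TYPE('a::euclidean_space) \<rho> = kap \<sigma> TYPE('a) (\<lambda>s. ennreal (s powr (2 * \<sigma> - 1)) * \<rho> (1 / s))"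
proof -
  let ?d = "real DIM('a)"
  let ?q = "?d + 1 + 2 * \<sigma>"
  define G where "G s = (\<integral>\<^sup>+z. ennreal (((norm z)\<^sup>2 + (s - 1)\<^sup>2) powr (- (?q / 2))) \<partial>(lborel :: 'a measure))" for s :: real
  have [measurable]: "G \<in> borel_measurable borel"
    unfolding G_def by measurable
  have ker: "gker \<sigma> (0, 1) (z, s) = ((norm z)\<^sup>2 + (s - 1)\<^sup>2) powr (- (?q / 2))" for z :: 'a and s
    by (simp add: gker_def dimn_prod dist_prod_def dist_real_def power2_commute powr_half_sqrt[symmetric] powr_powr
         diff_divide_distrib add_divide_distrib)
  have kap_G: "kap \<sigma> TYPE('a) r = (\<integral>\<^sup>+s. indicator {0<..} s * (r s * G s) \<partial>lborel)"
    if [measurable]: "r \<in> borel_measurable borel" for r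
  proof -
    have "kap \<sigma> TYPE('a) r = (\<integral>\<^sup>+p. indicator half_space p * (ennreal (gker \<sigma> (0, 1) p) * r (snd p)) \<partial>((lborel :: 'a measure) \<Otimes>\<^sub>M lborel))"
      unfolding kap_def lborel_prod ..
    also have "\<dots> = (\<integral>\<^sup>+s. \<integral>\<^sup>+z. indicator half_space (z, s) * (ennreal (gker \<sigma> (0, 1) (z, s)) * r s) \<partial>(lborel :: 'a measure) \<partial>lborel)"
    proof (subst lborel_pair.nn_integral_snd[symmetric])
      show "(\<lambda>p. indicator half_space p * (ennreal (gker \<sigma> (0, 1) p) * r (snd p))) \<in> borel_measurable ((lborel :: 'a measure) \<Otimes>\<^sub>M lborel)"
        unfolding lborel_prod by measurable
    qed simp
    also have "\<dots> = (\<integral>\<^sup>+s. indicator {0<..} s * (r s * G s) \<partial>lborel)"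
    proof (rule nn_integral_cong)
      fix s :: real
      have "(\<integral>\<^sup>+z. indicator half_space (z, s) * (ennreal (gker \<sigma> (0, 1) (z, s)) * r s) \<partial>(lborel :: 'a measure)) =
        (\<integral>\<^sup>+z. (indicator {0<..} s * r s) * ennreal (((norm z)\<^sup>2 + (s - 1)\<^sup>2) powr (- (?q / 2))) \<partial>(lborel :: 'a measure))"
        by (intro nn_integral_cong) (auto simp: ker half_space_def indicator_def mult.commute)
      also have "\<dots> = (indicator {0<..} s * r s) * G s"
        unfolding G_def by (rule nn_integral_cmult) measurable
      finally show "(\<integral>\<^sup>+z. indicator half_space (z, s) * (ennreal (gker \<sigma> (0, 1) (z, s)) * r s) \<partial>(lborel :: 'a measure)) = indicator {0<..} s * (r s * G s)"
        by (simp add: mult.assoc)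
    qed
    finally show ?thesis .
  qed
  \<comment> \<open>Substituting \<open>z / s\<close> for \<open>z\<close> works because
    \<open>(norm z / s)\<^sup>2 + (1 / s - 1)\<^sup>2\<close> equals \<open>s powr (- 2)\<close>
    times \<open>(norm z)\<^sup>2 + (s - 1)\<^sup>2\<close>.\<close>
  have G_inv: "G (1 / s) = ennreal (s powr (1 + 2 * \<sigma>)) * G s" if s: "s > 0" for s
  proof -
    have "G (1 / s) = ennreal ((1 / s) powr ?d) * (\<integral>\<^sup>+z. ennreal (((norm (0 + (1 / s) *\<^sub>R z))\<^sup>2 + (1 / s - 1)\<^sup>2) powr (- (?q / 2))) \<partial>(lborel :: 'a measure))"
      unfolding G_def by (rule nn_integral_affine) (use s in auto)
    also have "(\<integral>\<^sup>+z. ennreal (((norm (0 + (1 / s) *\<^sub>R z))\<^sup>2 + (1 / s - 1)\<^sup>2) powr (- (?q / 2))) \<partial>(lborel :: 'a measure))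
      = (\<integral>\<^sup>+z. ennreal (s powr ?q) * ennreal (((norm z)\<^sup>2 + (s - 1)\<^sup>2) powr (- (?q / 2))) \<partial>(lborel :: 'a measure))"
    proof (rule nn_integral_cong)
      fix z :: 'a
      have "(norm (0 + (1 / s) *\<^sub>R z))\<^sup>2 + (1 / s - 1)\<^sup>2 = s powr (- 2) * ((norm z)\<^sup>2 + (s - 1)\<^sup>2)"
        using s by (simp add: powr_minus power_divide field_simps power2_eq_square)
      then have "((norm (0 + (1 / s) *\<^sub>R z))\<^sup>2 + (1 / s - 1)\<^sup>2) powr (- (?q / 2)) = s powr ?q * ((norm z)\<^sup>2 + (s - 1)\<^sup>2) powr (- (?q / 2))"
      proof -
        have "- 2 * (- (?q / 2)) = ?q" by (simp add: field_simps)
        then have "(s powr (- 2)) powr (- (?q / 2)) = s powr ?q" by (simp only: powr_powr)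
        moreover assume "(norm (0 + (1 / s) *\<^sub>R z))\<^sup>2 + (1 / s - 1)\<^sup>2 = s powr (- 2) * ((norm z)\<^sup>2 + (s - 1)\<^sup>2)"
        ultimately show ?thesis by (simp only: powr_mult powr_ge_zero)
      qed
      then show "ennreal (((norm (0 + (1 / s) *\<^sub>R z))\<^sup>2 + (1 / s - 1)\<^sup>2) powr (- (?q / 2))) = ennreal (s powr ?q) * ennreal (((norm z)\<^sup>2 + (s - 1)\<^sup>2) powr (- (?q / 2)))"
        by (simp add: ennreal_mult)
    qed
    also have "\<dots> = ennreal (s powr ?q) * G s"
      unfolding G_def by (rule nn_integral_cmult) measurable
    also have "(1 / s) powr ?d = s powr (- ?d)"
      using s by (simp add: powr_divide powr_minus_divide)
    finally show ?thesis
      by (simp add: mult.assoc[symmetric] ennreal_mult[symmetric] powr_add[symmetric])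
  qed
  have inv: "inversion s = 1 / s" for s :: real by (simp add: inversion_def)
  have "kap \<sigma> TYPE('a) \<rho> = (\<integral>\<^sup>+s. indicator {0<..} s * (\<rho> s * G s) \<partial>lborel)"
    by (rule kap_G) measurable
  also have "\<dots> = (\<integral>\<^sup>+s. ennreal (norm s powr (- 2 * real DIM(real))) * (indicator {0<..} (inversion s) * (\<rho> (inversion s) * G (inversion s))) \<partial>lborel)"
    by (rule nn_integral_inversion) measurable
  also have "\<dots> = (\<integral>\<^sup>+s. indicator {0<..} s * ((ennreal (s powr (2 * \<sigma> - 1)) * \<rho> (1 / s)) * G s) \<partial>lborel)"
  proof (rule nn_integral_cong)
    fix s :: real
    show "ennreal (norm s powr (- 2 * real DIM(real))) * (indicator {0<..} (inversion s) * (\<rho> (inversion s) * G (inversion s))) =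
      indicator {0<..} s * ((ennreal (s powr (2 * \<sigma> - 1)) * \<rho> (1 / s)) * G s)"
    proof (cases "s > 0")
      case True
      \<comment> \<open>The Jacobian \<open>s powr (- 2)\<close> of \<open>s \<mapsto> 1 / s\<close>
        times the factor of \<open>G_inv\<close> leaves the exponent
        \<open>2 * \<sigma> - 1\<close>.\<close>
      have "ennreal (s powr (- 2)) * ennreal (s powr (1 + 2 * \<sigma>)) = ennreal (s powr (2 * \<sigma> - 1))"
        by (simp add: ennreal_mult[symmetric] powr_add[symmetric])
      then show ?thesis using True by (simp add: inv G_inv ac_simps)
    qed (simp add: inv)
  qed
  also have "\<dots> = kap \<sigma> TYPE('a) (\<lambda>s. ennreal (s powr (2 * \<sigma> - 1)) * \<rho> (1 / s))"
    by (rule kap_G[symmetric]) measurable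
  finally show ?thesis .
qed

text \<open>A point whose height differs from 1 by at least \<open>c\<close> has distance at least
  \<open>c\<close> from \<open>(0, 1)\<close>, so the singularity of the kernel is avoided and the
  tail bound applies.\<close>

lemma kap_finite:
  assumes "0 < \<sigma>" "\<sigma> < 1" and "c > 0"
    and \<rho>: "\<And>s. s > 0 \<Longrightarrow> \<bar>s - 1\<bar> < c \<Longrightarrow> \<rho> s = 0" "\<And>s. s > 0 \<Longrightarrow> \<rho> s \<le> 1"
  shows "kap \<sigma> TYPE('a::euclidean_space) \<rho> < \<infinity>"
proof -
  obtain C where C: "C > 0" "\<And>(x::'a \<times> real) s. s > 0 \<Longrightarrow>
    (\<integral>\<^sup>+y. indicator {s..} (dist x y) * ennreal (gker \<sigma> x y) \<partial>lborel) \<le> ennreal (C * s powr (- 2 * \<sigma>))"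
    using ex_gker_truncated[OF assms(1,2), where 'a='a] by metis
  have "kap \<sigma> TYPE('a) \<rho> \<le> (\<integral>\<^sup>+y. indicator {c..} (dist (0, 1) y) * ennreal (gker \<sigma> (0, 1) y) \<partial>(lborel :: ('a \<times> real) measure))"
    unfolding kap_def
  proof (rule nn_integral_mono)
    fix p :: "'a \<times> real"
    show "indicator half_space p * (ennreal (gker \<sigma> (0, 1) p) * \<rho> (snd p)) \<le> indicator {c..} (dist (0, 1) p) * ennreal (gker \<sigma> (0, 1) p)"
    proof (cases "p \<in> half_space \<and> c \<le> dist (0, 1) p")
      case True
      then have "\<rho> (snd p) \<le> 1" by (intro \<rho>(2)) (simp add: half_space_def)
      from mult_left_mono[OF this, of "ennreal (gker \<sigma> (0, 1) p)"] True show ?thesis by simp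
    next
      case False
      have "\<bar>snd p - 1\<bar> \<le> dist (0, 1) p"
        using dist_snd_le[of "(0, 1)" p] by (simp add: dist_real_def abs_minus_commute)
      with False have "p \<in> half_space \<Longrightarrow> \<rho> (snd p) = 0" by (intro \<rho>(1)) (auto simp: half_space_def)
      with False show ?thesis by (cases "p \<in> half_space") auto
    qed
  qed
  also have "\<dots> < \<infinity>" using C(2)[OF \<open>c > 0\<close>, of "(0, 1)"] by (simp add: le_less_trans)
  finally show ?thesis .
qed

section \<open>Hardy inequality and ground state bound\<close>

definition hmass :: "real \<Rightarrow> ('a::euclidean_space \<times> real \<Rightarrow> real) \<Rightarrow> ennreal" where
  "hmass \<sigma> f = (\<integral>\<^sup>+x. indicator half_space x * ennreal ((f x)\<^sup>2 * snd x powr (- 2 * \<sigma>)) \<partial>lborel)"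

lemma AE_gmeas_half_space: "AE z in gmeas \<sigma>. fst z \<in> half_space \<and> snd z \<in> half_space"
  by (rule AE_gmeas) simp

lemma nn_integral_gmeas_ratio:
  fixes f :: "'a::euclidean_space \<times> real \<Rightarrow> real"
  assumes [measurable]: "f \<in> borel_measurable borel" "\<rho> \<in> borel_measurable borel"
  shows "(\<integral>\<^sup>+z. ennreal ((f (fst z))\<^sup>2) * \<rho> (snd (snd z) / snd (fst z)) \<partial>gmeas \<sigma>) = hmass \<sigma> f * kap \<sigma> TYPE('a) \<rho>"
    and "(\<integral>\<^sup>+z. ennreal ((f (snd z))\<^sup>2) * \<rho> (snd (fst z) / snd (snd z)) \<partial>gmeas \<sigma>) = hmass \<sigma> f * kap \<sigma> TYPE('a) \<rho>"
proof -
  have "(\<integral>\<^sup>+z. ennreal ((f (fst z))\<^sup>2) * \<rho> (snd (snd z) / snd (fst z)) \<partial>gmeas \<sigma>) =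
    (\<integral>\<^sup>+x. indicator half_space x * ennreal ((f x)\<^sup>2) * (\<integral>\<^sup>+y. indicator half_space y * (ennreal (gker \<sigma> x y) * \<rho> (snd y / snd x)) \<partial>lborel) \<partial>lborel)"
    by (subst nn_integral_gmeas_fst[where \<rho>="\<lambda>z. \<rho> (snd (snd z) / snd (fst z))"]) simp_all
  also have "\<dots> = (\<integral>\<^sup>+x. (indicator half_space x * ennreal ((f x)\<^sup>2 * snd x powr (- 2 * \<sigma>))) * kap \<sigma> TYPE('a) \<rho> \<partial>lborel)"
  proof (rule nn_integral_cong)
    fix x :: "'a \<times> real"
    show "indicator half_space x * ennreal ((f x)\<^sup>2) * (\<integral>\<^sup>+y. indicator half_space y * (ennreal (gker \<sigma> x y) * \<rho> (snd y / snd x)) \<partial>lborel)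
      = (indicator half_space x * ennreal ((f x)\<^sup>2 * snd x powr (- 2 * \<sigma>))) * kap \<sigma> TYPE('a) \<rho>"
      by (cases "x \<in> half_space") (simp_all add: nn_integral_slice[OF assms(2)] ennreal_mult mult.assoc del: mult_minus_left)
  qed
  also have "\<dots> = hmass \<sigma> f * kap \<sigma> TYPE('a) \<rho>"
    unfolding hmass_def by (rule nn_integral_multc) measurable
  finally show 1: "(\<integral>\<^sup>+z. ennreal ((f (fst z))\<^sup>2) * \<rho> (snd (snd z) / snd (fst z)) \<partial>gmeas \<sigma>) = hmass \<sigma> f * kap \<sigma> TYPE('a) \<rho>" .
  show "(\<integral>\<^sup>+z. ennreal ((f (snd z))\<^sup>2) * \<rho> (snd (fst z) / snd (snd z)) \<partial>gmeas \<sigma>) = hmass \<sigma> f * kap \<sigma> TYPE('a) \<rho>"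
    using nn_integral_gmeas_swap[of "\<lambda>z. ennreal ((f (fst z))\<^sup>2) * \<rho> (snd (snd z) / snd (fst z))" \<sigma>] 1 by simp
qed

text \<open>The double integrals below only converge after removing the pairs with \<open>y\<^sub>n / x\<^sub>n\<close> close to 1.\<close>
definition off_diag :: "real \<Rightarrow> real \<Rightarrow> real" where
  "off_diag \<eta> s = indicator (- {1 / (1 + \<eta>)<..<1 + \<eta>}) s"

lemma off_diag_measurable [measurable]: "off_diag \<eta> \<in> borel_measurable borel"
  unfolding off_diag_def by measurable

lemma off_diag_nonneg [simp]: "0 \<le> off_diag \<eta> s" by (simp add: off_diag_def)

lemma off_diag_le_1 [simp]: "off_diag \<eta> s \<le> 1" by (simp add: off_diag_def indicator_def)

text \<open>The removed interval is invariant under \<open>s \<mapsto> 1 / s\<close>. Hence the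
  truncation is compatible with \<open>kap_inverse\<close> and does not change when the two points
  are exchanged.\<close>

lemma off_diag_inverse: "s > 0 \<Longrightarrow> \<eta> > 0 \<Longrightarrow> off_diag \<eta> (1 / s) = off_diag \<eta> s"
  by (auto simp: off_diag_def indicator_def field_simps)

lemma off_diag_near: "\<eta> > 0 \<Longrightarrow> \<bar>s - 1\<bar> < \<eta> / (1 + \<eta>) \<Longrightarrow> off_diag \<eta> s = 0"
proof -
  assume "\<eta> > 0" "\<bar>s - 1\<bar> < \<eta> / (1 + \<eta>)"
  moreover have "\<eta> / (1 + \<eta>) \<le> \<eta>" using \<open>\<eta> > 0\<close> by (simp add: field_simps)
  moreover have "1 - \<eta> / (1 + \<eta>) = 1 / (1 + \<eta>)" using \<open>\<eta> > 0\<close> by (simp add: field_simps)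
  ultimately have "1 / (1 + \<eta>) < s" "s < 1 + \<eta>" by linarith+
  then show ?thesis by (simp add: off_diag_def)
qed

text \<open>The second equation is the truncated harmonicity: on the retained pairs, the kernel
  integrals of \<open>(y\<^sub>n / x\<^sub>n) powr (2 * \<sigma> - 1)\<close> and of 1 coincide and
  are finite, so they may be cancelled.\<close>

lemma kap_off_diag:
  assumes "1/2 < \<sigma>" "\<sigma> < 1" "\<eta> > 0"
  shows "kap \<sigma> TYPE('a::euclidean_space) (\<lambda>s. ennreal (off_diag \<eta> s)) < \<infinity>"
    and "kap \<sigma> TYPE('a) (\<lambda>s. ennreal (s powr (2 * \<sigma> - 1) * off_diag \<eta> s)) = kap \<sigma> TYPE('a) (\<lambda>s. ennreal (off_diag \<eta> s))"
proof -
  show "kap \<sigma> TYPE('a) (\<lambda>s. ennreal (off_diag \<eta> s)) < \<infinity>"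
    using assms by (intro kap_finite[where c="\<eta> / (1 + \<eta>)"]) (auto simp: off_diag_near ennreal_le_1)
  have "kap \<sigma> TYPE('a) (\<lambda>s. ennreal (off_diag \<eta> s)) = kap \<sigma> TYPE('a) (\<lambda>s. ennreal (s powr (2 * \<sigma> - 1)) * ennreal (off_diag \<eta> (1 / s)))"
    by (rule kap_inverse) measurable
  also have "\<dots> = kap \<sigma> TYPE('a) (\<lambda>s. ennreal (s powr (2 * \<sigma> - 1) * off_diag \<eta> s))"
    by (rule kap_cong) (simp add: off_diag_inverse assms ennreal_mult)
  finally show "kap \<sigma> TYPE('a) (\<lambda>s. ennreal (s powr (2 * \<sigma> - 1) * off_diag \<eta> s)) = kap \<sigma> TYPE('a) (\<lambda>s. ennreal (off_diag \<eta> s))" ..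
qed

lemma kap_add:
  assumes [measurable]: "\<rho> \<in> borel_measurable borel" "\<rho>' \<in> borel_measurable borel"
  shows "kap \<sigma> TYPE('a::euclidean_space) (\<lambda>s. \<rho> s + \<rho>' s) = kap \<sigma> TYPE('a) \<rho> + kap \<sigma> TYPE('a) \<rho>'"
  unfolding kap_def by (subst nn_integral_add[symmetric]) (auto simp: distrib_left intro!: nn_integral_cong)

lemma ennreal_add_le_cancel:
  fixes a b c :: ennreal
  assumes "a + c \<le> b + c" "c < \<infinity>"
  shows "a \<le> b"
  using assms by (metis add.commute ennreal_add_left_cancel_le infinity_ennreal_def less_irrefl)

text \<open>With \<open>s = y\<^sub>n / x\<^sub>n\<close> and
  \<open>\<beta> = (2 * \<sigma> - 1) / 2\<close>, the product \<open>2 a b\<close> is at most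
  \<open>a\<^sup>2 s\<^sup>\<beta> + b\<^sup>2 s\<^sup>-\<^sup>\<beta>\<close>. Integrated over the
  retained pairs this gives \<open>hmass\<close> times \<open>2 A - 2 B\<close> as a lower bound for
  the energy. Harmonicity rewrites \<open>2 A\<close> as the integral of
  \<open>1 + s powr (2 * \<beta>)\<close>, so the difference is the integral \<open>K\<close> of
  \<open>(1 - s powr \<beta>)\<^sup>2\<close>. The truncation level 1 is arbitrary.\<close>

lemma hardy_inequality:
  assumes \<sigma>: "1/2 < \<sigma>" "\<sigma> < 1"
  obtains c where "c > 0" "\<And>f :: 'a::euclidean_space \<times> real \<Rightarrow> real. f \<in> borel_measurable borel \<Longrightarrow> hmass \<sigma> f < \<infinity> \<Longrightarrow>
    ennreal c * hmass \<sigma> f \<le> (\<integral>\<^sup>+z. ennreal ((f (fst z) - f (snd z))\<^sup>2) \<partial>gmeas \<sigma>)"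
proof -
  define \<beta> where "\<beta> = (2 * \<sigma> - 1) / 2"
  have \<beta>: "\<beta> > 0" "2 * \<beta> = 2 * \<sigma> - 1" using \<sigma> by (auto simp: \<beta>_def)
  let ?d = "off_diag 1"
  let ?kap = "kap \<sigma> TYPE('a)"
  define A where "A = ?kap (\<lambda>s. ennreal (?d s))"
  define B where "B = ?kap (\<lambda>s. ennreal (s powr \<beta> * ?d s))"
  define K where "K = ?kap (\<lambda>s. ennreal ((1 - s powr \<beta>)\<^sup>2 * ?d s))"
  have A: "A < \<infinity>" unfolding A_def by (rule kap_off_diag) (use \<sigma> in auto)
  have AA: "A + A = (B + B) + K"
  proof -
    have "A + A = ?kap (\<lambda>s. ennreal (?d s)) + ?kap (\<lambda>s. ennreal (s powr (2 * \<sigma> - 1) * ?d s))"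
      using kap_off_diag(2)[OF \<sigma>, of 1, where 'a='a] by (simp add: A_def)
    also have "\<dots> = ?kap (\<lambda>s. ennreal (?d s) + ennreal (s powr (2 * \<sigma> - 1) * ?d s))"
      by (rule kap_add[symmetric]) measurable
    also have "\<dots> = ?kap (\<lambda>s. (ennreal (s powr \<beta> * ?d s) + ennreal (s powr \<beta> * ?d s)) + ennreal ((1 - s powr \<beta>)\<^sup>2 * ?d s))"
    proof (rule kap_cong)
      fix s :: real assume "s > 0"
      have "s powr (2 * \<sigma> - 1) = (s powr \<beta>)\<^sup>2"
        unfolding \<beta>(2)[symmetric] power2_eq_square by (simp add: powr_add[symmetric])
      then have "?d s + s powr (2 * \<sigma> - 1) * ?d s = (s powr \<beta> * ?d s + s powr \<beta> * ?d s) + (1 - s powr \<beta>)\<^sup>2 * ?d s"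
        by (simp add: power2_eq_square algebra_simps)
      then show "ennreal (?d s) + ennreal (s powr (2 * \<sigma> - 1) * ?d s) = (ennreal (s powr \<beta> * ?d s) + ennreal (s powr \<beta> * ?d s)) + ennreal ((1 - s powr \<beta>)\<^sup>2 * ?d s)"
        by (simp add: ennreal_plus[symmetric] del: ennreal_plus)
    qed
    also have "\<dots> = (B + B) + K"
      unfolding B_def K_def by (simp add: kap_add)
    finally show ?thesis .
  qed
  have K_fin: "K < \<infinity>" and B_fin: "B < \<infinity>" using AA A by (auto simp: ennreal_add_eq_top less_top[symmetric])
  \<comment> \<open>The integrand is strictly positive above height 2, where
    \<open>off_diag 1\<close> is 1 and \<open>snd p powr \<beta>\<close> exceeds 1; that region
    contains an open set.\<close>
  have "K \<noteq> 0"
  proof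
    assume "K = 0"
    then have "AE p in (lborel :: ('a \<times> real) measure). indicator half_space p * (ennreal (gker \<sigma> (0, 1) p) * ennreal ((1 - snd p powr \<beta>)\<^sup>2 * ?d (snd p))) = 0"
      unfolding K_def kap_def by (subst (asm) nn_integral_0_iff_AE) auto
    then have "AE p in (lborel :: ('a \<times> real) measure). p \<notin> {p. 2 < snd p}"
    proof eventually_elim
      case (elim p)
      show ?case
      proof
        assume "p \<in> {p. 2 < snd p}"
        then have p: "2 < snd p" by simp
        then have "p \<in> half_space" "p \<noteq> (0, 1)" by (auto simp: half_space_def)
        then have "gker \<sigma> (0, 1) p > 0" by (auto simp: gker_def)
        moreover have "?d (snd p) = 1" using p by (simp add: off_diag_def)
        moreover have "snd p powr \<beta> \<noteq> 1" using p \<beta> by (smt (verit) gr_one_powr)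
        ultimately show False using elim \<open>p \<in> half_space\<close> by simp
      qed
    qed
    then have "{p :: 'a \<times> real. 2 < snd p} \<in> null_sets lborel"
      by (subst AE_iff_null_sets) auto
    moreover have "open {p :: 'a \<times> real. 2 < snd p}" by (intro open_Collect_less continuous_intros)
    moreover have "(0, 3) \<in> {p :: 'a \<times> real. 2 < snd p}" by simp
    ultimately show False
      using open_not_negligible[of "{p :: 'a \<times> real. 2 < snd p}"] by (metis empty_iff negligible_iff_null_sets null_sets_completionI)
  qed
  define c where "c = enn2real K"
  have c: "c > 0" using \<open>K \<noteq> 0\<close> K_fin by (simp add: c_def enn2real_positive_iff zero_less_iff_neq_zero)
  have cK: "ennreal c = K" using K_fin by (simp add: c_def)
  show ?thesis
  proof (rule that[OF c])
    fix f :: "'a \<times> real \<Rightarrow> real"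
    assume [measurable]: "f \<in> borel_measurable borel" and fin: "hmass \<sigma> f < \<infinity>"
    let ?s = "\<lambda>z :: ('a \<times> real) \<times> ('a \<times> real). snd (snd z) / snd (fst z)"
    let ?t = "\<lambda>z :: ('a \<times> real) \<times> ('a \<times> real). snd (fst z) / snd (snd z)"
    let ?I = "\<integral>\<^sup>+z. ennreal ((f (fst z) - f (snd z))\<^sup>2) \<partial>gmeas \<sigma>"
    have "hmass \<sigma> f * A + hmass \<sigma> f * A =
      (\<integral>\<^sup>+z. ennreal ((f (fst z))\<^sup>2) * ennreal (?d (?s z)) + ennreal ((f (snd z))\<^sup>2) * ennreal (?d (?t z)) \<partial>gmeas \<sigma>)"
      unfolding A_def
      by (subst nn_integral_add) (simp_all add: nn_integral_gmeas_ratio(1)[where \<rho>="\<lambda>s. ennreal (?d s)"]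
         nn_integral_gmeas_ratio(2)[where \<rho>="\<lambda>s. ennreal (?d s)"])
    also have "\<dots> \<le> (\<integral>\<^sup>+z. ennreal ((f (fst z) - f (snd z))\<^sup>2) + (ennreal ((f (fst z))\<^sup>2) * ennreal (?s z powr \<beta> * ?d (?s z)) + ennreal ((f (snd z))\<^sup>2) * ennreal (?t z powr \<beta> * ?d (?t z))) \<partial>gmeas \<sigma>)"
    proof (rule nn_integral_mono_AE, use AE_gmeas_half_space in eventually_elim)
      case (elim z)
      define a b s where "a = f (fst z)" and "b = f (snd z)" and "s = ?s z"
      have s: "s > 0" using elim by (simp add: s_def half_space_def)
      have t: "?t z = 1 / s" by (simp add: s_def)
      \<comment> \<open>The square root of \<open>s powr \<beta>\<close>, so that the weighted
        inequality becomes the square \<open>(a * e - b * (1 / e))\<^sup>2 \<ge> 0\<close>.\<close>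
      define e where "e = s powr (\<beta> / 2)"
      have e: "e > 0" "s powr \<beta> = e * e" "(1 / s) powr \<beta> = (1 / e) * (1 / e)"
        using s by (auto simp: e_def powr_divide powr_add[symmetric])
      have d: "?d (1 / s) = ?d s" using s by (simp add: off_diag_inverse)
      have "2 * a * b \<le> a\<^sup>2 * (e * e) + b\<^sup>2 * ((1 / e) * (1 / e))"
      proof -
        have "0 \<le> (a * e - b * (1 / e))\<^sup>2" by simp
        also have "\<dots> = a\<^sup>2 * (e * e) + b\<^sup>2 * ((1 / e) * (1 / e)) - 2 * a * b * (e * (1 / e))"
          by (simp add: power2_eq_square algebra_simps)
        finally show ?thesis using e(1) by simp
      qed
      then have *: "a\<^sup>2 + b\<^sup>2 \<le> (a - b)\<^sup>2 + (a\<^sup>2 * (s powr \<beta>) + b\<^sup>2 * ((1 / s) powr \<beta>))"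
        unfolding e by (simp add: power2_diff)
      have "a\<^sup>2 * ?d s + b\<^sup>2 * ?d s = (a\<^sup>2 + b\<^sup>2) * ?d s" by (simp add: algebra_simps)
      also have "\<dots> \<le> ((a - b)\<^sup>2 + (a\<^sup>2 * (s powr \<beta>) + b\<^sup>2 * ((1 / s) powr \<beta>))) * ?d s"
        by (intro mult_right_mono *) simp
      also have "\<dots> = (a - b)\<^sup>2 * ?d s + (a\<^sup>2 * (s powr \<beta> * ?d s) + b\<^sup>2 * ((1 / s) powr \<beta> * ?d s))"
        by (simp add: algebra_simps)
      also have "\<dots> \<le> (a - b)\<^sup>2 + (a\<^sup>2 * (s powr \<beta> * ?d s) + b\<^sup>2 * ((1 / s) powr \<beta> * ?d s))"
        by (simp add: mult_left_le)
      finally show ?case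
        unfolding t a_def[symmetric] b_def[symmetric] s_def[symmetric] d
        by (simp add: ennreal_mult[symmetric] ennreal_plus[symmetric] del: ennreal_plus)
    qed
    also have "\<dots> = ?I + (hmass \<sigma> f * B + hmass \<sigma> f * B)"
      unfolding B_def
      by (simp add: nn_integral_add nn_integral_gmeas_ratio(1)[where \<rho>="\<lambda>s. ennreal (s powr \<beta> * ?d s)"]
         nn_integral_gmeas_ratio(2)[where \<rho>="\<lambda>s. ennreal (s powr \<beta> * ?d s)"])
    finally have "hmass \<sigma> f * (A + A) \<le> ?I + hmass \<sigma> f * (B + B)" by (simp add: distrib_left)
    moreover have "hmass \<sigma> f * (A + A) = ennreal c * hmass \<sigma> f + hmass \<sigma> f * (B + B)"
      unfolding AA cK distrib_left by (simp only: ac_simps)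
    ultimately have "ennreal c * hmass \<sigma> f + hmass \<sigma> f * (B + B) \<le> ?I + hmass \<sigma> f * (B + B)"
      by simp
    then show "ennreal c * hmass \<sigma> f \<le> ?I"
      by (rule ennreal_add_le_cancel) (use fin B_fin in \<open>simp add: ennreal_mult_less_top\<close>)
  qed
qed

lemma off_diag_LIMSEQ:
  assumes "s \<noteq> 1"
  shows "eventually (\<lambda>k. off_diag (1 / real (Suc k)) s = 1) sequentially"
proof -
  have l1: "(\<lambda>k. 1 + 1 / real (Suc k)) \<longlonglongrightarrow> 1" using LIMSEQ_inverse_real_of_nat_add[of 1] by (simp add: inverse_eq_divide)
  then have l2: "(\<lambda>k. 1 / (1 + 1 / real (Suc k))) \<longlonglongrightarrow> 1"
    using tendsto_divide[OF tendsto_const[of 1] l1] by simp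
  show ?thesis
  proof (cases "s > 1")
    case True
    then have "eventually (\<lambda>k. 1 + 1 / real (Suc k) < s) sequentially" using order_tendstoD(2)[OF l1] by blast
    then show ?thesis by eventually_elim (simp add: off_diag_def)
  next
    case False
    then have "s < 1" using assms by simp
    then have "eventually (\<lambda>k. 1 / (1 + 1 / real (Suc k)) > s) sequentially" using order_tendstoD(1)[OF l2] by blast
    then show ?thesis by eventually_elim (simp add: off_diag_def)
  qed
qed

text \<open>Put \<open>e = (y\<^sub>n / x\<^sub>n) powr \<beta>\<close>. Adding
  \<open>(a - b / e)\<^sup>2 \<ge> 0\<close> and \<open>(a e - b)\<^sup>2 \<ge> 0\<close> bounds the
  cross term by \<open>a\<^sup>2 (1 + e\<^sup>2) / 2 + b\<^sup>2 (1 + 1 / e\<^sup>2) / 2\<close>.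
  Since \<open>e\<^sup>2\<close> is the harmonic power, these terms have the same truncated integral
  as \<open>a\<^sup>2 + b\<^sup>2\<close> and cancel; monotone convergence removes the truncation.
  Unlike Hardy's inequality, the result keeps a quadratic form that can absorb the cost of a
  weight.\<close>

lemma ground_state_bound:
  fixes f :: "'a::euclidean_space \<times> real \<Rightarrow> real"
  assumes \<sigma>: "1/2 < \<sigma>" "\<sigma> < 1" and \<beta>_def: "\<beta> = (2 * \<sigma> - 1) / 2"
    and [measurable]: "f \<in> borel_measurable borel" and f0: "\<And>x. f x \<ge> 0" and fin: "hmass \<sigma> f < \<infinity>"
  shows "(\<integral>\<^sup>+z. ennreal (f (fst z) * f (snd z) * ((snd (snd z) / snd (fst z)) powr \<beta> + (snd (fst z) / snd (snd z)) powr \<beta> - 2)) \<partial>gmeas \<sigma>)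
    \<le> (\<integral>\<^sup>+z. ennreal ((f (fst z) - f (snd z))\<^sup>2) \<partial>gmeas \<sigma>)"
proof -
  have \<beta>: "\<beta> > 0" "2 * \<beta> = 2 * \<sigma> - 1" using \<sigma> by (auto simp: \<beta>_def)
  let ?s = "\<lambda>z :: ('a \<times> real) \<times> ('a \<times> real). snd (snd z) / snd (fst z)"
  let ?t = "\<lambda>z :: ('a \<times> real) \<times> ('a \<times> real). snd (fst z) / snd (snd z)"
  let ?I = "\<integral>\<^sup>+z. ennreal ((f (fst z) - f (snd z))\<^sup>2) \<partial>gmeas \<sigma>"
  let ?L = "\<lambda>z. f (fst z) * f (snd z) * (?s z powr \<beta> + ?t z powr \<beta> - 2)"
  have trunc: "(\<integral>\<^sup>+z. ennreal (?L z * off_diag \<eta> (?s z)) \<partial>gmeas \<sigma>) \<le> ?I" if \<eta>: "\<eta> > 0" for \<eta>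
  proof -
    let ?d = "off_diag \<eta>"
    \<comment> \<open>The coefficient \<open>(1 + e\<^sup>2) / 2\<close> in truncated form; by
      harmonicity its \<open>kap\<close> equals that of the truncation alone.\<close>
    let ?r = "\<lambda>s. ennreal (1 / 2 * ?d s) + ennreal (1 / 2 * (s powr (2 * \<sigma> - 1) * ?d s))"
    let ?A = "kap \<sigma> TYPE('a) (\<lambda>s. ennreal (?d s))"
    have A: "?A < \<infinity>" by (rule kap_off_diag) (use \<sigma> \<eta> in auto)
    have half: "kap \<sigma> TYPE('a) (\<lambda>s. ennreal (1 / 2 * r s)) + kap \<sigma> TYPE('a) (\<lambda>s. ennreal (1 / 2 * r s)) = kap \<sigma> TYPE('a) (\<lambda>s. ennreal (r s))"
      if [measurable]: "r \<in> borel_measurable borel" and "\<And>s. r s \<ge> 0" for r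
      by (subst kap_add[symmetric]) (auto simp: ennreal_plus[symmetric] that simp del: ennreal_plus)
    have rr: "kap \<sigma> TYPE('a) ?r + kap \<sigma> TYPE('a) ?r = ?A + ?A"
    proof -
      let ?h1 = "kap \<sigma> TYPE('a) (\<lambda>s. ennreal (1 / 2 * ?d s))"
      let ?h2 = "kap \<sigma> TYPE('a) (\<lambda>s. ennreal (1 / 2 * (s powr (2 * \<sigma> - 1) * ?d s)))"
      have "kap \<sigma> TYPE('a) ?r = ?h1 + ?h2" by (rule kap_add) measurable
      then have "kap \<sigma> TYPE('a) ?r + kap \<sigma> TYPE('a) ?r = (?h1 + ?h1) + (?h2 + ?h2)"
        by (simp add: ac_simps)
      also have "\<dots> = ?A + ?A"
        using half[of ?d] half[of "\<lambda>s. s powr (2 * \<sigma> - 1) * ?d s"] kap_off_diag(2)[OF \<sigma> \<eta>, where 'a='a] by simp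
      finally show ?thesis .
    qed
    have "(\<integral>\<^sup>+z. ennreal (?L z * ?d (?s z)) \<partial>gmeas \<sigma>) + (hmass \<sigma> f * ?A + hmass \<sigma> f * ?A) =
      (\<integral>\<^sup>+z. ennreal (?L z * ?d (?s z)) + (ennreal ((f (fst z))\<^sup>2) * ennreal (?d (?s z)) + ennreal ((f (snd z))\<^sup>2) * ennreal (?d (?t z))) \<partial>gmeas \<sigma>)"
      by (simp add: nn_integral_add nn_integral_gmeas_ratio(1)[where \<rho>="\<lambda>s. ennreal (?d s)"]
         nn_integral_gmeas_ratio(2)[where \<rho>="\<lambda>s. ennreal (?d s)"])
    also have "\<dots> \<le> (\<integral>\<^sup>+z. ennreal ((f (fst z) - f (snd z))\<^sup>2) + (ennreal ((f (fst z))\<^sup>2) * ?r (?s z) + ennreal ((f (snd z))\<^sup>2) * ?r (?t z)) \<partial>gmeas \<sigma>)"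
    proof (rule nn_integral_mono_AE, use AE_gmeas_half_space in eventually_elim)
      case (elim z)
      define a b s where "a = f (fst z)" and "b = f (snd z)" and "s = ?s z"
      have s: "s > 0" using elim by (simp add: s_def half_space_def)
      have t: "?t z = 1 / s" by (simp add: s_def)
      have a0: "a \<ge> 0" "b \<ge> 0" using f0 by (auto simp: a_def b_def)
      define e where "e = s powr \<beta>"
      have e: "e > 0" "s powr (2 * \<sigma> - 1) = e * e" "(1 / s) powr (2 * \<sigma> - 1) = (1 / e) * (1 / e)" "(1 / s) powr \<beta> = 1 / e"
        using s unfolding \<beta>(2)[symmetric] by (auto simp: e_def powr_divide powr_add[symmetric])
      have L0: "e + 1 / e - 2 \<ge> 0"
      proof -
        have "e + 1 / e - 2 = (e - 1)\<^sup>2 / e" using e(1) by (simp add: field_simps power2_eq_square)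
        then show ?thesis using e(1) by simp
      qed
      have d: "?d (1 / s) = ?d s" using s \<eta> by (simp add: off_diag_inverse)
      have *: "a * b * (e + 1 / e - 2) + (a\<^sup>2 + b\<^sup>2) \<le> (a - b)\<^sup>2 + (a\<^sup>2 * (1 / 2 + 1 / 2 * (e * e)) + b\<^sup>2 * (1 / 2 + 1 / 2 * ((1 / e) * (1 / e))))"
      proof -
        have "0 \<le> (a - b * (1 / e))\<^sup>2 + (a * e - b)\<^sup>2" by simp
        also have "\<dots> = a\<^sup>2 + b\<^sup>2 * ((1 / e) * (1 / e)) + a\<^sup>2 * (e * e) + b\<^sup>2 - 2 * (a * b * (e + 1 / e))"
          by (simp add: power2_eq_square algebra_simps)
        finally have "0 \<le> a\<^sup>2 + b\<^sup>2 * ((1 / e) * (1 / e)) + a\<^sup>2 * (e * e) + b\<^sup>2 - 2 * (a * b * (e + 1 / e))" .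
        moreover have "0 \<le> Q - 2 * P \<Longrightarrow> P \<le> Q / 2" for P Q :: real by linarith
        ultimately have "a * b * (e + 1 / e) \<le> (a\<^sup>2 + b\<^sup>2 * ((1 / e) * (1 / e)) + a\<^sup>2 * (e * e) + b\<^sup>2) / 2" by blast
        moreover have "a * b * (e + 1 / e - 2) = a * b * (e + 1 / e) - 2 * a * b" by (simp add: algebra_simps)
        moreover have "a\<^sup>2 * (1 / 2 + 1 / 2 * (e * e)) = a\<^sup>2 / 2 + a\<^sup>2 * (e * e) / 2"
          "b\<^sup>2 * (1 / 2 + 1 / 2 * ((1 / e) * (1 / e))) = b\<^sup>2 / 2 + b\<^sup>2 * ((1 / e) * (1 / e)) / 2"
          by (simp_all add: distrib_left)
        ultimately show ?thesis by (simp only: power2_diff) argo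
      qed
      have "a * b * (e + 1 / e - 2) * ?d s + (a\<^sup>2 * ?d s + b\<^sup>2 * ?d s) = (a * b * (e + 1 / e - 2) + (a\<^sup>2 + b\<^sup>2)) * ?d s" by (simp add: algebra_simps)
      also have "\<dots> \<le> ((a - b)\<^sup>2 + (a\<^sup>2 * (1 / 2 + 1 / 2 * (e * e)) + b\<^sup>2 * (1 / 2 + 1 / 2 * ((1 / e) * (1 / e))))) * ?d s"
        by (intro mult_right_mono *) simp
      also have "\<dots> = (a - b)\<^sup>2 * ?d s + (a\<^sup>2 * (1 / 2 * ?d s + 1 / 2 * (e * e * ?d s)) + b\<^sup>2 * (1 / 2 * ?d s + 1 / 2 * ((1 / e) * (1 / e) * ?d s)))"
        by (simp add: algebra_simps)
      also have "\<dots> \<le> (a - b)\<^sup>2 + (a\<^sup>2 * (1 / 2 * ?d s + 1 / 2 * (e * e * ?d s)) + b\<^sup>2 * (1 / 2 * ?d s + 1 / 2 * ((1 / e) * (1 / e) * ?d s)))"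
        by (simp add: mult_left_le)
      finally show ?case
        unfolding t a_def[symmetric] b_def[symmetric] s_def[symmetric] d e e_def[symmetric]
        using L0 a0 e(1)
        by (simp add: ennreal_mult[symmetric] ennreal_plus[symmetric] del: ennreal_plus)
    qed
    also have "\<dots> = ?I + (hmass \<sigma> f * kap \<sigma> TYPE('a) ?r + hmass \<sigma> f * kap \<sigma> TYPE('a) ?r)"
    proof -
      have r: "?r \<in> borel_measurable borel" by measurable
      have "(\<integral>\<^sup>+z. u z + (v z + w z) \<partial>gmeas \<sigma>) = (\<integral>\<^sup>+z. u z \<partial>gmeas \<sigma>) + ((\<integral>\<^sup>+z. v z \<partial>gmeas \<sigma>) + (\<integral>\<^sup>+z. w z \<partial>gmeas \<sigma>))"
        if "u \<in> borel_measurable (borel \<Otimes>\<^sub>M borel)" "v \<in> borel_measurable (borel \<Otimes>\<^sub>M borel)" "w \<in> borel_measurable (borel \<Otimes>\<^sub>M borel)"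
        for u v w :: "('a \<times> real) \<times> ('a \<times> real) \<Rightarrow> ennreal"
        using that by (simp add: nn_integral_add)
      then have "(\<integral>\<^sup>+z. ennreal ((f (fst z) - f (snd z))\<^sup>2) + (ennreal ((f (fst z))\<^sup>2) * ?r (?s z) + ennreal ((f (snd z))\<^sup>2) * ?r (?t z)) \<partial>gmeas \<sigma>)
        = ?I + ((\<integral>\<^sup>+z. ennreal ((f (fst z))\<^sup>2) * ?r (?s z) \<partial>gmeas \<sigma>) + (\<integral>\<^sup>+z. ennreal ((f (snd z))\<^sup>2) * ?r (?t z) \<partial>gmeas \<sigma>))"
        by this measurable
      then show ?thesis
        using nn_integral_gmeas_ratio[OF assms(4) r, of \<sigma>] by presburger
    qed
    also have "\<dots> = ?I + (hmass \<sigma> f * ?A + hmass \<sigma> f * ?A)"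
      using rr by (simp add: distrib_left[symmetric])
    finally show ?thesis
      by (rule ennreal_add_le_cancel) (use fin A in \<open>simp add: ennreal_mult_less_top\<close>)
  qed
  have "(\<lambda>k. \<integral>\<^sup>+z. ennreal (?L z * off_diag (1 / real (Suc k)) (?s z)) \<partial>gmeas \<sigma>) \<longlonglongrightarrow> (\<integral>\<^sup>+z. ennreal (?L z) \<partial>gmeas \<sigma>)"
  proof (rule nn_integral_LIMSEQ)
    have mono: "off_diag (1 / real (Suc k)) s \<le> off_diag (1 / real (Suc k')) s" if "k \<le> k'" for k k' s
    proof -
      have "1 / real (Suc k') \<le> 1 / real (Suc k)" using that by (simp add: frac_le)
      moreover have "1 / (1 + 1 / real (Suc k)) \<le> 1 / (1 + 1 / real (Suc k'))"
        using calculation by (intro divide_left_mono) (auto intro!: mult_pos_pos add_pos_pos)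
      ultimately show ?thesis by (auto simp: off_diag_def indicator_def)
    qed
    show "incseq (\<lambda>k z. ennreal (?L z * off_diag (1 / real (Suc k)) (?s z)))"
    proof (intro incseq_SucI le_funI)
      fix k z
      show "ennreal (?L z * off_diag (1 / real (Suc k)) (?s z)) \<le> ennreal (?L z * off_diag (1 / real (Suc (Suc k))) (?s z))"
      \<comment> \<open>Monotonicity is required at every \<open>z\<close>, also off the half-space,
        where the sign of \<open>?L z\<close> is not controlled; if it is negative,
        \<open>ennreal\<close> sends it to 0.\<close>
      proof (cases "?L z \<ge> 0")
        case True then show ?thesis by (intro ennreal_leI mult_left_mono mono) auto
      next
        case False
        then have "?L z * off_diag (1 / real (Suc k)) (?s z) \<le> 0" using mult_nonpos_nonneg[OF _ off_diag_nonneg] by (simp only: not_le)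
        then show ?thesis by (simp add: ennreal_neg)
      qed
    qed
    fix z :: "('a \<times> real) \<times> ('a \<times> real)"
    show "(\<lambda>k. ennreal (?L z * off_diag (1 / real (Suc k)) (?s z))) \<longlonglongrightarrow> ennreal (?L z)"
    \<comment> \<open>On equal heights the truncation stays 0 for every \<open>k\<close>, but there
      \<open>?L z\<close> vanishes as well, so nothing is lost in the limit.\<close>
    proof (cases "?s z = 1")
      case True
      then have "?t z = 1" by (metis div_by_1 divide_divide_eq_right mult_1)
      with True have "?L z = 0" by simp
      then show ?thesis by (simp only: mult_zero_left tendsto_const)
    next
      case False
      from off_diag_LIMSEQ[OF this]
      have "eventually (\<lambda>k. ennreal (?L z * off_diag (1 / real (Suc k)) (?s z)) = ennreal (?L z)) sequentially"
        by eventually_elim simp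
      then show ?thesis by (rule tendsto_eventually)
    qed
  qed measurable
  then show ?thesis
    by (rule LIMSEQ_le_const2) (use trunc in auto)
qed

section \<open>The energy space\<close>

definition gen :: "real \<Rightarrow> ('a::euclidean_space \<times> real \<Rightarrow> real) \<Rightarrow> ennreal" where
  "gen \<sigma> f = (\<integral>\<^sup>+z. ennreal ((f (fst z) - f (snd z))\<^sup>2) \<partial>gmeas \<sigma>)"

lemma gag_half_space: "f \<in> borel_measurable borel \<Longrightarrow> gag \<sigma> half_space f = gen \<sigma> f"
  by (simp add: gag_eq_gmeas gen_def)

lemma young_square: "\<delta> > 0 \<Longrightarrow> (a + b)\<^sup>2 \<le> (1 + \<delta>) * a\<^sup>2 + (1 + 1 / \<delta>) * (b::real)\<^sup>2"
proof -
  assume \<delta>: "\<delta> > 0"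
  have "0 \<le> (\<delta> * a - b)\<^sup>2 / \<delta>" using \<delta> by simp
  also have "\<dots> = \<delta> * a\<^sup>2 - 2 * a * b + b\<^sup>2 / \<delta>" using \<delta> by (simp add: power2_eq_square field_simps)
  finally show ?thesis by (simp add: power2_sum algebra_simps)
qed

text \<open>A free \<open>\<delta>\<close> in Young's inequality replaces the triangle inequality
  for the square root of the energy, which would need roots of possibly infinite values.\<close>

lemma gen_add_le:
  assumes [measurable]: "f \<in> borel_measurable borel" "g \<in> borel_measurable borel" and \<delta>: "\<delta> > 0"
  shows "gen \<sigma> (\<lambda>x. f x + g x) \<le> ennreal (1 + \<delta>) * gen \<sigma> f + ennreal (1 + 1 / \<delta>) * gen \<sigma> g"
proof -
  have "gen \<sigma> (\<lambda>x. f x + g x) \<le> (\<integral>\<^sup>+z. ennreal (1 + \<delta>) * ennreal ((f (fst z) - f (snd z))\<^sup>2) + ennreal (1 + 1 / \<delta>) * ennreal ((g (fst z) - g (snd z))\<^sup>2) \<partial>gmeas \<sigma>)"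
    unfolding gen_def
  proof (rule nn_integral_mono)
    fix z
    have "(f (fst z) + g (fst z) - (f (snd z) + g (snd z)))\<^sup>2 \<le> (1 + \<delta>) * (f (fst z) - f (snd z))\<^sup>2 + (1 + 1 / \<delta>) * (g (fst z) - g (snd z))\<^sup>2"
      using young_square[OF \<delta>, of "f (fst z) - f (snd z)" "g (fst z) - g (snd z)"] by (simp add: algebra_simps)
    then show "ennreal ((f (fst z) + g (fst z) - (f (snd z) + g (snd z)))\<^sup>2) \<le> ennreal (1 + \<delta>) * ennreal ((f (fst z) - f (snd z))\<^sup>2) + ennreal (1 + 1 / \<delta>) * ennreal ((g (fst z) - g (snd z))\<^sup>2)"
      using \<delta> by (simp add: ennreal_mult[symmetric] ennreal_plus[symmetric] del: ennreal_plus)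
  qed
  also have "\<dots> = ennreal (1 + \<delta>) * gen \<sigma> f + ennreal (1 + 1 / \<delta>) * gen \<sigma> g"
    unfolding gen_def by (subst nn_integral_add) (auto simp: nn_integral_cmult)
  finally show ?thesis .
qed

lemma gen_cmult:
  assumes [measurable]: "f \<in> borel_measurable borel"
  shows "gen \<sigma> (\<lambda>x. c * f x) = ennreal (c\<^sup>2) * gen \<sigma> f"
  unfolding gen_def
  by (subst nn_integral_cmult[symmetric])
     (auto simp: ennreal_mult[symmetric] power_mult_distrib[symmetric] right_diff_distrib)

lemma gen_minus: "gen \<sigma> (\<lambda>x. - f x) = gen \<sigma> f"
  unfolding gen_def by (intro nn_integral_cong) (simp add: power2_commute)

lemma gen_diff_commute: "gen \<sigma> (\<lambda>x. f x - g x) = gen \<sigma> (\<lambda>x. g x - f x)"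
  using gen_minus[of \<sigma> "\<lambda>x. f x - g x"] by simp

lemma ennreal_le_of_le_one_plus:
  fixes X Y :: ennreal
  assumes "\<And>\<delta>. \<delta> > 0 \<Longrightarrow> X \<le> ennreal (1 + \<delta>) * Y"
  shows "X \<le> Y"
proof (cases Y)
  case (real y)
  have "(\<lambda>k. ennreal ((1 + 1 / real (Suc k)) * y)) \<longlonglongrightarrow> ennreal ((1 + 0) * y)"
    by (intro tendsto_ennrealI tendsto_intros LIMSEQ_Suc[OF lim_1_over_n])
  moreover have "X \<le> ennreal ((1 + 1 / real (Suc k)) * y)" for k
    using assms[of "1 / real (Suc k)"] real by (simp add: ennreal_mult)
  ultimately have "X \<le> ennreal ((1 + 0) * y)" by (intro LIMSEQ_le_const) auto
  then show ?thesis using real by simp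
qed simp

text \<open>The constant in front of the limit energy must be exactly 1, since sharp Sobolev
  constants are passed to the limit with it; hence \<open>\<delta>\<close> is sent to 0 only after
  the limsup is taken.\<close>

lemma limsup_gen_le:
  assumes [measurable]: "\<And>k. \<phi> k \<in> borel_measurable borel" "u \<in> borel_measurable borel"
    and lim: "(\<lambda>k. gen \<sigma> (\<lambda>x. \<phi> k x - u x)) \<longlonglongrightarrow> 0"
  shows "limsup (\<lambda>k. gen \<sigma> (\<phi> k)) \<le> gen \<sigma> u"
proof (rule ennreal_le_of_le_one_plus)
  fix \<delta> :: real assume \<delta>: "\<delta> > 0"
  have "limsup (\<lambda>k. gen \<sigma> (\<phi> k)) \<le> limsup (\<lambda>k. ennreal (1 + \<delta>) * gen \<sigma> u + ennreal (1 + 1 / \<delta>) * gen \<sigma> (\<lambda>x. \<phi> k x - u x))"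
  proof (intro Limsup_mono always_eventually allI)
    fix k
    show "gen \<sigma> (\<phi> k) \<le> ennreal (1 + \<delta>) * gen \<sigma> u + ennreal (1 + 1 / \<delta>) * gen \<sigma> (\<lambda>x. \<phi> k x - u x)"
      using gen_add_le[OF _ _ \<delta>, of u "\<lambda>x. \<phi> k x - u x"] by simp
  qed
  also have "\<dots> = ennreal (1 + \<delta>) * gen \<sigma> u + ennreal (1 + 1 / \<delta>) * 0"
    by (intro lim_imp_Limsup tendsto_add ennreal_tendsto_cmult tendsto_const lim) auto
  finally show "limsup (\<lambda>k. gen \<sigma> (\<phi> k)) \<le> ennreal (1 + \<delta>) * gen \<sigma> u" by simp
qed

section \<open>Calculus of continuously differentiable functions and of \<open>C1c\<close>\<close>

text \<open>This localizes the derivative clause of \<open>C1c\<close>, so that maps singular at one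
  point, such as inversions and powers of a distance, can be composed before the result is extended
  by zero.\<close>

definition C1_on :: "'a::real_normed_vector set \<Rightarrow> ('a \<Rightarrow> 'b::real_normed_vector) \<Rightarrow> bool" where
  "C1_on U f \<longleftrightarrow> (\<exists>f'. (\<forall>x\<in>U. (f has_derivative blinfun_apply (f' x)) (at x)) \<and> continuous_on U f')"

lemma C1_on_subset: "C1_on U f \<Longrightarrow> V \<subseteq> U \<Longrightarrow> C1_on V f"
  unfolding C1_on_def by (meson continuous_on_subset subsetD)

lemma C1_on_imp_continuous_on: "C1_on U f \<Longrightarrow> continuous_on U f"
  unfolding C1_on_def by (meson has_derivative_at_withinI has_derivative_continuous_on)

lemma C1_on_bounded_linear: "bounded_linear f \<Longrightarrow> C1_on U f"
  unfolding C1_on_def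
  by (rule exI[of _ "\<lambda>_. Blinfun f"]) (auto simp: bounded_linear_Blinfun_apply intro: bounded_linear_imp_has_derivative)

lemma C1_on_const: "C1_on U (\<lambda>_. c)"
  unfolding C1_on_def by (rule exI[of _ "\<lambda>_. 0"]) (auto simp: zero_blinfun.rep_eq)

lemma C1_on_add: "C1_on U f \<Longrightarrow> C1_on U g \<Longrightarrow> C1_on U (\<lambda>x. f x + g x)"
  unfolding C1_on_def
proof (elim exE conjE)
  fix f' g' assume "\<forall>x\<in>U. (f has_derivative blinfun_apply (f' x)) (at x)" "continuous_on U f'"
    "\<forall>x\<in>U. (g has_derivative blinfun_apply (g' x)) (at x)" "continuous_on U g'"
  then show "\<exists>h'. (\<forall>x\<in>U. ((\<lambda>x. f x + g x) has_derivative blinfun_apply (h' x)) (at x)) \<and> continuous_on U h'"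
    by (intro exI[of _ "\<lambda>x. f' x + g' x"])
       (auto simp: plus_blinfun.rep_eq intro!: has_derivative_add continuous_intros)
qed

lemma C1_on_scaleR:
  fixes f :: "'a::real_normed_vector \<Rightarrow> real"
  assumes "C1_on U f" "C1_on U g"
  shows "C1_on U (\<lambda>x. f x *\<^sub>R g x)"
proof -
  obtain f' g' where f: "\<And>x. x \<in> U \<Longrightarrow> (f has_derivative blinfun_apply (f' x)) (at x)" "continuous_on U f'"
    and g: "\<And>x. x \<in> U \<Longrightarrow> (g has_derivative blinfun_apply (g' x)) (at x)" "continuous_on U g'"
    using assms unfolding C1_on_def by blast
  define h' where "h' x = f x *\<^sub>R g' x + (blinfun_scaleR_left (g x) o\<^sub>L f' x)" for x
  have "((\<lambda>x. f x *\<^sub>R g x) has_derivative blinfun_apply (h' x)) (at x)" if "x \<in> U" for x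
  proof -
    have "((\<lambda>x. f x *\<^sub>R g x) has_derivative (\<lambda>h. f x *\<^sub>R blinfun_apply (g' x) h + blinfun_apply (f' x) h *\<^sub>R g x)) (at x)"
      by (rule has_derivative_scaleR[OF f(1)[OF that] g(1)[OF that]])
    moreover have "(\<lambda>h. f x *\<^sub>R blinfun_apply (g' x) h + blinfun_apply (f' x) h *\<^sub>R g x) = blinfun_apply (h' x)"
      by (auto simp: h'_def blinfun.add_left blinfun.scaleR_left)
    ultimately show ?thesis by simp
  qed
  moreover have "continuous_on U h'"
  proof -
    have "continuous_on U f" "continuous_on U g" using assms by (auto intro: C1_on_imp_continuous_on)
    moreover have "continuous_on U (\<lambda>x. blinfun_scaleR_left (g x))"
      by (rule bounded_linear.continuous_on[OF bounded_linear_blinfun_scaleR_left]) fact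
    ultimately show ?thesis unfolding h'_def
      by (intro continuous_intros f(2) g(2) bounded_bilinear.continuous_on[OF bounded_bilinear_blinfun_compose])
  qed
  ultimately show ?thesis unfolding C1_on_def by blast
qed

lemma C1_on_mult:
  fixes f g :: "'a::real_normed_vector \<Rightarrow> real"
  shows "C1_on U f \<Longrightarrow> C1_on U g \<Longrightarrow> C1_on U (\<lambda>x. f x * g x)"
  using C1_on_scaleR[of U f g] by simp

lemma C1_on_compose:
  assumes "C1_on U f" "C1_on V g" "f ` U \<subseteq> V"
  shows "C1_on U (\<lambda>x. g (f x))"
proof -
  obtain f' g' where f: "\<And>x. x \<in> U \<Longrightarrow> (f has_derivative blinfun_apply (f' x)) (at x)" "continuous_on U f'"
    and g: "\<And>x. x \<in> V \<Longrightarrow> (g has_derivative blinfun_apply (g' x)) (at x)" "continuous_on V g'"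
    using assms(1,2) unfolding C1_on_def by blast
  have "((\<lambda>x. g (f x)) has_derivative blinfun_apply (g' (f x) o\<^sub>L f' x)) (at x)" if "x \<in> U" for x
    using has_derivative_compose[OF f(1)[OF that] g(1)] assms(3) that
    by (auto simp: blinfun_compose.rep_eq o_def)
  moreover have "continuous_on U (\<lambda>x. g' (f x) o\<^sub>L f' x)"
    by (intro bounded_bilinear.continuous_on[OF bounded_bilinear_blinfun_compose] f(2)
        continuous_on_compose2[OF g(2) C1_on_imp_continuous_on[OF assms(1)] assms(3)])
  ultimately show ?thesis unfolding C1_on_def by (intro exI[of _ "\<lambda>x. g' (f x) o\<^sub>L f' x"]) blast
qed

lemma C1_on_real:
  fixes f :: "real \<Rightarrow> real"
  assumes "\<And>x. x \<in> U \<Longrightarrow> (f has_real_derivative f' x) (at x)" "continuous_on U f'"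
  shows "C1_on U f"
  unfolding C1_on_def
proof (intro exI[of _ "\<lambda>x. blinfun_mult_left (f' x)"] conjI ballI)
  fix x assume "x \<in> U"
  from assms(1)[OF this] show "(f has_derivative blinfun_apply (blinfun_mult_left (f' x))) (at x)"
    by (simp add: has_field_derivative_def mult_commute_abs)
next
  show "continuous_on U (\<lambda>x. blinfun_mult_left (f' x))"
    by (rule bounded_linear.continuous_on[OF bounded_linear_blinfun_mult_left assms(2)])
qed

text \<open>The derivative is glued from \<open>g'\<close> on \<open>U\<close> and 0 on the
  complement of \<open>K\<close>. The two agree on the overlap, an open set where \<open>g\<close>
  is locally zero, by uniqueness of the derivative.\<close>

lemma C1cI:
  assumes g: "C1_on U g" "open U" and K: "compact K" "K \<subseteq> U" "K \<subseteq> \<Omega>" "\<And>x. x \<notin> K \<Longrightarrow> g x = 0"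
  shows "g \<in> C1c \<Omega>"
proof -
  obtain g' where g': "\<And>x. x \<in> U \<Longrightarrow> (g has_derivative blinfun_apply (g' x)) (at x)" "continuous_on U g'"
    using g unfolding C1_on_def by blast
  define u' where "u' x = (if x \<in> K then g' x else 0)" for x
  have oK: "open (- K)" using K(1) by (simp add: compact_imp_closed open_Compl)
  have zero: "(g has_derivative (\<lambda>_. 0)) (at x)" if "x \<notin> K" for x
  proof (rule has_derivative_transform_within_open[OF _ oK])
    show "((\<lambda>_. 0) has_derivative (\<lambda>_. 0)) (at x)" by simp
  qed (use that K(4) in auto)
  have u'_U: "u' x = g' x" if "x \<in> U" for x
  proof (cases "x \<in> K")
    case False
    have "blinfun_apply (g' x) = (\<lambda>_. 0)" by (rule has_derivative_unique[OF g'(1)[OF that] zero[OF False]])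
    then have "g' x = 0" by (intro blinfun_eqI) simp
    then show ?thesis using False by (simp add: u'_def)
  qed (simp add: u'_def)
  have "(g has_derivative blinfun_apply (u' x)) (at x)" for x
  proof (cases "x \<in> K")
    case True
    then have "x \<in> U" using K(2) by blast
    from g'(1)[OF this] True show ?thesis by (simp add: u'_def)
  next
    case False
    with zero[OF False] show ?thesis by (simp add: u'_def zero_blinfun.rep_eq)
  qed
  moreover have "continuous_on UNIV u'"
  proof -
    have "continuous_on U u'" using g'(2) by (rule continuous_on_eq) (simp add: u'_U)
    moreover have "continuous_on (- K) u'"
      by (rule continuous_on_eq[of _ "\<lambda>_. 0"]) (auto simp: u'_def)
    ultimately have "continuous_on (U \<union> - K) u'" by (intro continuous_on_open_Un g oK)
    moreover have "U \<union> - K = UNIV" using K(2) by auto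
    ultimately show ?thesis by simp
  qed
  moreover have "closure {x. g x \<noteq> 0} \<subseteq> K"
    by (rule closure_minimal) (use K in \<open>auto simp: compact_imp_closed\<close>)
  ultimately show ?thesis unfolding C1c_def
    using K(3) compact_Int_closed[OF K(1), of "closure {x. g x \<noteq> 0}"] by (auto simp: Int_absorb1 inf_commute)
qed

lemma C1c_imp_C1_on: "f \<in> C1c \<Omega> \<Longrightarrow> C1_on UNIV f"
  unfolding C1c_def C1_on_def mem_Collect_eq Ball_def by (elim conjE exE, rule exI) (rule conjI; simp)

lemma C1c_support:
  assumes "f \<in> C1c \<Omega>"
  obtains K where "compact K" "K \<subseteq> \<Omega>" "\<And>x. x \<notin> K \<Longrightarrow> f x = 0"
proof (rule that[of "closure {x. f x \<noteq> 0}"])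
  fix x assume "x \<notin> closure {x. f x \<noteq> 0}"
  then show "f x = 0" using subsetD[OF closure_subset, of x "{x. f x \<noteq> 0}"] by blast
qed (use assms in \<open>simp_all add: C1c_def\<close>)

lemma C1c_measurable [measurable (raw)]: "f \<in> C1c \<Omega> \<Longrightarrow> f \<in> borel_measurable borel"
  by (intro borel_measurable_continuous_onI C1_on_imp_continuous_on C1c_imp_C1_on)

lemma C1c_mult:
  assumes "C1_on \<Omega> \<phi>" "open \<Omega>" "f \<in> C1c \<Omega>"
  shows "(\<lambda>x. \<phi> x * f x) \<in> C1c \<Omega>"
proof -
  obtain K where K: "compact K" "K \<subseteq> \<Omega>" "\<And>x. x \<notin> K \<Longrightarrow> f x = 0" using C1c_support[OF assms(3)] by metis
  show ?thesis
    by (rule C1cI[OF C1_on_mult[OF assms(1) C1_on_subset[OF C1c_imp_C1_on[OF assms(3)]]] assms(2) K(1,2)])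
       (use K in auto)
qed

lemma C1c_diff:
  assumes f: "f \<in> C1c \<Omega>" and g: "g \<in> C1c \<Omega>"
  shows "(\<lambda>x. f x - g x) \<in> C1c \<Omega>"
proof -
  obtain K where K: "compact K" "K \<subseteq> \<Omega>" "\<And>x. x \<notin> K \<Longrightarrow> f x = 0" using C1c_support[OF f] by metis
  obtain L where L: "compact L" "L \<subseteq> \<Omega>" "\<And>x. x \<notin> L \<Longrightarrow> g x = 0" using C1c_support[OF g] by metis
  have "C1_on UNIV (\<lambda>x. f x + (-1) * g x)"
    by (intro C1_on_add C1_on_mult C1_on_const C1c_imp_C1_on[OF f] C1c_imp_C1_on[OF g])
  then have "(\<lambda>x. f x + (-1) * g x) \<in> C1c \<Omega>"
    by (rule C1cI[where K="K \<union> L"]) (use K L in auto)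
  then show ?thesis by simp
qed

lemma open_half_space [simp]: "open half_space"
  unfolding half_space_def by (intro open_Collect_less continuous_intros)

lemma C1c_bounds:
  fixes f :: "'a::euclidean_space \<times> real \<Rightarrow> real"
  assumes f: "f \<in> C1c \<Omega>"
  obtains M where "M > 0" "\<And>x. \<bar>f x\<bar> \<le> M" "\<And>x y. \<bar>f x - f y\<bar> \<le> M * dist x y"
proof -
  obtain f' where f': "\<And>x. (f has_derivative blinfun_apply (f' x)) (at x)" "continuous_on UNIV f'"
    using C1c_imp_C1_on[OF f] unfolding C1_on_def by auto
  obtain K where K: "compact K" "K \<subseteq> \<Omega>" "\<And>x. x \<notin> K \<Longrightarrow> f x = 0" using C1c_support[OF f] by metis
  have oK: "open (- K)" using K(1) by (simp add: compact_imp_closed open_Compl)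
  have "bounded (f ` K)" "bounded (f' ` K)"
    using K(1) f' C1_on_imp_continuous_on[OF C1c_imp_C1_on[OF f]]
    by (auto intro!: compact_imp_bounded compact_continuous_image intro: continuous_on_subset)
  then obtain A B where AB: "\<And>x. x \<in> K \<Longrightarrow> norm (f x) \<le> A" "\<And>x. x \<in> K \<Longrightarrow> norm (f' x) \<le> B"
    unfolding bounded_iff by auto
  define M where "M = max 1 (max A B)"
  have f'0: "norm (f' x) \<le> M" for x
  proof (cases "x \<in> K")
    case True then show ?thesis using AB(2)[of x] by (auto simp: M_def)
  next
    case False
    have "(f has_derivative (\<lambda>_. 0)) (at x)"
    proof (rule has_derivative_transform_within_open[OF _ oK])
      show "((\<lambda>_. 0) has_derivative (\<lambda>_. 0)) (at x)" by simp
    qed (use False K(3) in auto)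
    then have "blinfun_apply (f' x) = (\<lambda>_. 0)" using f'(1) has_derivative_unique by blast
    then have "f' x = 0" by (intro blinfun_eqI) simp
    then show ?thesis by (simp add: M_def)
  qed
  have "\<bar>f x\<bar> \<le> M" for x
    using AB(1)[of x] K(3)[of x] by (cases "x \<in> K") (auto simp: M_def)
  moreover have "\<bar>f x - f y\<bar> \<le> M * dist x y" for x y
    using differentiable_bound[of UNIV f "\<lambda>x. blinfun_apply (f' x)" M y x] f'(1) f'0
    by (simp add: norm_blinfun.rep_eq[symmetric] dist_norm norm_minus_commute abs_minus_commute)
  ultimately show ?thesis using that[of M] by (auto simp: M_def)
qed

lemma C1c_half_space_support:
  fixes f :: "'a::euclidean_space \<times> real \<Rightarrow> real"
  assumes f: "f \<in> C1c half_space"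
  obtains K d where "compact K" "d > 0" "\<And>x. x \<in> K \<Longrightarrow> d \<le> snd x" "\<And>x. x \<notin> K \<Longrightarrow> f x = 0"
proof -
  obtain K where K: "compact K" "K \<subseteq> half_space" "\<And>x. x \<notin> K \<Longrightarrow> f x = 0" using C1c_support[OF f] by metis
  show ?thesis
  proof (cases "K = {}")
    case True then show ?thesis using that[of K 1] K by auto
  next
    case False
    have "continuous_on K snd" by (intro continuous_intros)
    then obtain x0 where "x0 \<in> K" "\<And>x. x \<in> K \<Longrightarrow> snd x0 \<le> snd x"
      using continuous_attains_inf[OF K(1) False] by blast
    then show ?thesis using that[of K "snd x0"] K by (auto simp: half_space_def)
  qed
qed

section \<open>Finite mass, energy and norm of compactly supported functions\<close>

lemma emeasure_compact_finite: "compact K \<Longrightarrow> emeasure lborel (K :: 'a::euclidean_space set) < \<infinity>"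
  by (rule emeasure_bounded_finite[OF compact_imp_bounded])

lemma C1c_hmass_finite:
  fixes f :: "'a::euclidean_space \<times> real \<Rightarrow> real"
  assumes f: "f \<in> C1c half_space" and "\<sigma> > 0"
  shows "hmass \<sigma> f < \<infinity>"
proof -
  obtain M where M: "M > 0" "\<And>x. \<bar>f x\<bar> \<le> M" using C1c_bounds[OF f] by metis
  obtain K d where K: "compact K" "d > 0" "\<And>x. x \<in> K \<Longrightarrow> d \<le> snd x" "\<And>x. x \<notin> K \<Longrightarrow> f x = 0"
    using C1c_half_space_support[OF f] by metis
  have [measurable]: "K \<in> sets borel" using K(1) by (simp add: borel_compact)
  have "hmass \<sigma> f \<le> (\<integral>\<^sup>+x. ennreal (M\<^sup>2 * d powr (- 2 * \<sigma>)) * indicator K x \<partial>lborel)"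
    unfolding hmass_def
  proof (rule nn_integral_mono)
    fix x :: "'a \<times> real"
    show "indicator half_space x * ennreal ((f x)\<^sup>2 * snd x powr (- 2 * \<sigma>)) \<le> ennreal (M\<^sup>2 * d powr (- 2 * \<sigma>)) * indicator K x"
    proof (cases "x \<in> K")
      case True
      have "(f x)\<^sup>2 \<le> M\<^sup>2" using M(2)[of x] M(1) by (simp add: abs_le_square_iff[symmetric])
      moreover have "snd x powr (- 2 * \<sigma>) \<le> d powr (- 2 * \<sigma>)"
        using K(2) K(3)[OF True] assms(2) by (intro powr_mono2') auto
      ultimately have "(f x)\<^sup>2 * snd x powr (- 2 * \<sigma>) \<le> M\<^sup>2 * d powr (- 2 * \<sigma>)"
        by (intro mult_mono) auto
      then show ?thesis using True by (auto simp: indicator_def intro: ennreal_leI)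
    qed (simp add: K(4))
  qed
  also have "\<dots> = ennreal (M\<^sup>2 * d powr (- 2 * \<sigma>)) * emeasure lborel K"
    by (rule nn_integral_cmult_indicator) simp
  also have "\<dots> < \<infinity>" using emeasure_compact_finite[OF K(1)] by (simp add: ennreal_mult_less_top)
  finally show ?thesis .
qed

text \<open>The squared difference is at most a multiple of
  \<open>min 1 ((dist x y)\<^sup>2)\<close> and vanishes unless one of the two points lies in the
  support; by symmetry that point may be the first, and the truncated kernel at scale 1 is
  integrated over the other.\<close>

lemma C1c_gen_finite:
  fixes f :: "'a::euclidean_space \<times> real \<Rightarrow> real"
  assumes f: "f \<in> C1c half_space" and \<sigma>: "0 < \<sigma>" "\<sigma> < 1"
  shows "gen \<sigma> f < \<infinity>"
proof -
  obtain M where M: "M > 0" "\<And>x. \<bar>f x\<bar> \<le> M" "\<And>x y. \<bar>f x - f y\<bar> \<le> M * dist x y" using C1c_bounds[OF f] by metis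
  obtain K where K: "compact K" "\<And>x. x \<notin> K \<Longrightarrow> f x = 0" using C1c_support[OF f] by metis
  have [measurable]: "K \<in> sets borel" using K(1) by (simp add: borel_compact)
  obtain C where C: "C > 0" "\<And>(x::'a \<times> real) s. s > 0 \<Longrightarrow>
    (\<integral>\<^sup>+y. ennreal (min 1 ((dist x y / s)\<^sup>2) * gker \<sigma> x y) \<partial>lborel) \<le> ennreal (C * s powr (- 2 * \<sigma>))"
    by (rule ex_gker_truncated[OF \<sigma>, where 'a='a]) (rule that)
  let ?\<rho> = "\<lambda>z :: ('a \<times> real) \<times> ('a \<times> real). ennreal (4 * M\<^sup>2 * min 1 ((dist (fst z) (snd z))\<^sup>2))"
  let ?J = "\<integral>\<^sup>+z. indicator K (fst z) * ?\<rho> z \<partial>gmeas \<sigma>"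
  have "gen \<sigma> f \<le> (\<integral>\<^sup>+z. indicator K (fst z) * ?\<rho> z + indicator K (snd z) * ?\<rho> (snd z, fst z) \<partial>gmeas \<sigma>)"
    unfolding gen_def
  proof (rule nn_integral_mono)
    fix z :: "('a \<times> real) \<times> ('a \<times> real)"
    have b: "(f (fst z) - f (snd z))\<^sup>2 \<le> 4 * M\<^sup>2 * min 1 ((dist (fst z) (snd z))\<^sup>2)"
    proof -
      have 1: "\<bar>f (fst z) - f (snd z)\<bar> \<le> 2 * M" using M(2)[of "fst z"] M(2)[of "snd z"] by linarith
      have 2: "\<bar>f (fst z) - f (snd z)\<bar> \<le> 2 * M * dist (fst z) (snd z)"
        using M(1) M(3)[of "fst z" "snd z"] mult_nonneg_nonneg[of M "dist (fst z) (snd z)"] by linarith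
      have "(f (fst z) - f (snd z))\<^sup>2 \<le> (2 * M)\<^sup>2"
        using 1 M(1) by (subst abs_le_square_iff[symmetric]) simp
      moreover have "(f (fst z) - f (snd z))\<^sup>2 \<le> (2 * M * dist (fst z) (snd z))\<^sup>2"
        using 2 M(1) by (subst abs_le_square_iff[symmetric]) simp
      ultimately show ?thesis by (simp add: power_mult_distrib min_def)
    qed
    show "ennreal ((f (fst z) - f (snd z))\<^sup>2) \<le> indicator K (fst z) * ?\<rho> z + indicator K (snd z) * ?\<rho> (snd z, fst z)"
    proof (cases "fst z \<in> K \<or> snd z \<in> K")
      case True
      then have "?\<rho> z \<le> indicator K (fst z) * ?\<rho> z + indicator K (snd z) * ?\<rho> (snd z, fst z)"
        by (auto simp: dist_commute)
      moreover have "ennreal ((f (fst z) - f (snd z))\<^sup>2) \<le> ?\<rho> z" by (rule ennreal_leI[OF b])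
      ultimately show ?thesis by (rule order_trans[rotated])
    qed (simp add: K(2))
  qed
  also have "\<dots> = ?J + ?J"
    by (subst nn_integral_add, measurable, subst nn_integral_gmeas_sym[of "indicator K" ?\<rho>]) simp_all
  finally have le: "gen \<sigma> f \<le> ?J + ?J" .
  have "?J = (\<integral>\<^sup>+x. indicator half_space x * indicator K x * (\<integral>\<^sup>+y. indicator half_space y * (ennreal (gker \<sigma> x y) * ?\<rho> (x, y)) \<partial>lborel) \<partial>lborel)"
    by (rule nn_integral_gmeas_fst) measurable
  also have "\<dots> \<le> (\<integral>\<^sup>+x. ennreal (4 * M\<^sup>2 * C) * indicator K x \<partial>lborel)"
  proof (rule nn_integral_mono)
    fix x :: "'a \<times> real"
    have "(\<integral>\<^sup>+y. indicator half_space y * (ennreal (gker \<sigma> x y) * ?\<rho> (x, y)) \<partial>lborel) \<le> (\<integral>\<^sup>+y. ennreal (4 * M\<^sup>2) * ennreal (min 1 ((dist x y / 1)\<^sup>2) * gker \<sigma> x y) \<partial>lborel)"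
      by (rule nn_integral_mono) (auto simp: indicator_def ennreal_mult[symmetric] ac_simps)
    also have "\<dots> = ennreal (4 * M\<^sup>2) * (\<integral>\<^sup>+y. ennreal (min 1 ((dist x y / 1)\<^sup>2) * gker \<sigma> x y) \<partial>lborel)"
      by (rule nn_integral_cmult) measurable
    also have "\<dots> \<le> ennreal (4 * M\<^sup>2) * ennreal (C * 1 powr (- 2 * \<sigma>))"
      by (intro mult_left_mono C(2)) auto
    also have "\<dots> = ennreal (4 * M\<^sup>2 * C)" using C(1) by (simp add: ennreal_mult)
    finally show "indicator half_space x * indicator K x * (\<integral>\<^sup>+y. indicator half_space y * (ennreal (gker \<sigma> x y) * ?\<rho> (x, y)) \<partial>lborel) \<le> ennreal (4 * M\<^sup>2 * C) * indicator K x"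
      by (auto simp: indicator_def)
  qed
  also have "\<dots> = ennreal (4 * M\<^sup>2 * C) * emeasure lborel K"
    by (rule nn_integral_cmult_indicator) simp
  also have "\<dots> < \<infinity>" using emeasure_compact_finite[OF K(1)] by (simp add: ennreal_mult_less_top)
  finally show ?thesis using le by (auto intro: le_less_trans)
qed

lemma crit_exp_gt_2: "0 < \<sigma> \<Longrightarrow> \<sigma> < 1 \<Longrightarrow> crit_exp \<sigma> TYPE('a::euclidean_space \<times> real) > 2"
  using dimn_ge_2[where 'a='a] by (simp add: crit_exp_def field_simps)

lemma C1c_lp_int_finite:
  fixes f :: "'a::euclidean_space \<times> real \<Rightarrow> real"
  assumes f: "f \<in> C1c \<Omega>" and \<sigma>: "0 < \<sigma>" "\<sigma> < 1"
  shows "lp_int \<sigma> half_space f < \<infinity>"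
proof -
  let ?p = "crit_exp \<sigma> TYPE('a \<times> real)"
  have p: "?p > 2" by (rule crit_exp_gt_2[OF \<sigma>])
  obtain M where M: "M > 0" "\<And>x. \<bar>f x\<bar> \<le> M" using C1c_bounds[OF f] by metis
  obtain K where K: "compact K" "\<And>x. x \<notin> K \<Longrightarrow> f x = 0" using C1c_support[OF f] by metis
  have [measurable]: "K \<in> sets borel" using K(1) by (simp add: borel_compact)
  have "lp_int \<sigma> half_space f \<le> (\<integral>\<^sup>+x. ennreal (M powr ?p) * indicator K x \<partial>lborel)"
    unfolding lp_int_def
  proof (rule nn_integral_mono)
    fix x :: "'a \<times> real"
    have "\<bar>f x\<bar> powr ?p \<le> M powr ?p" using M p by (intro powr_mono2) auto
    then show "indicator half_space x * ennreal (\<bar>f x\<bar> powr ?p) \<le> ennreal (M powr ?p) * indicator K x"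
      using K(2)[of x] by (cases "x \<in> K") (auto simp: indicator_def intro: ennreal_leI)
  qed
  also have "\<dots> = ennreal (M powr ?p) * emeasure lborel K"
    by (rule nn_integral_cmult_indicator) simp
  also have "\<dots> < \<infinity>" using emeasure_compact_finite[OF K(1)] by (simp add: ennreal_mult_less_top)
  finally show ?thesis .
qed

section \<open>Lower semicontinuity, and limits of functional inequalities\<close>

definition epow :: "real \<Rightarrow> ennreal \<Rightarrow> ennreal" where
  "epow q X = (if X = \<infinity> then \<infinity> else ennreal (enn2real X powr q))"

text \<open>A strict lower bound \<open>y\<close> for the power is converted into a strict lower
  bound \<open>c\<close>, its \<open>q\<close>-th root, for \<open>X\<close> itself; it then holds
  for eventually all \<open>Y k\<close> and is raised back to the power \<open>q\<close>.\<close>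

lemma epow_lsc:
  assumes q: "q > 0" and X: "X \<le> liminf Y"
  shows "epow q X \<le> liminf (\<lambda>k. epow q (Y k))"
  unfolding le_Liminf_iff
proof (intro allI impI)
  fix y assume y: "y < epow q X"
  then have "y < \<infinity>" by (metis infinity_ennreal_def less_top top.not_eq_extremum order_less_trans)
  then obtain r where r: "r \<ge> 0" "y = ennreal r" by (cases y) auto
  define c where "c = r powr (1 / q)"
  have cq: "c powr q = r" using q r by (simp add: c_def powr_powr)
  have "ennreal c < X"
  proof (cases X)
    case (real x)
    show ?thesis
    proof (rule ccontr)
      assume "\<not> ennreal c < X"
      then have "x \<le> c" using real by (simp add: not_less ennreal_le_iff c_def)
      then have "x powr q \<le> c powr q" using real q by (intro powr_mono2) auto
      then show False using y real r cq by (simp add: epow_def ennreal_less_iff)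
    qed
  qed simp
  then have "eventually (\<lambda>k. ennreal c < Y k) sequentially"
    using X unfolding le_Liminf_iff by blast
  then show "eventually (\<lambda>k. y < epow q (Y k)) sequentially"
  proof eventually_elim
    case (elim k)
    show ?case
    proof (cases "Y k")
      case (real z)
      then have "c < z" using elim by (simp add: ennreal_less_iff c_def)
      then have "c powr q < z powr q" using q by (intro powr_less_mono2) (auto simp: c_def)
      then show ?thesis using real r cq by (simp add: epow_def ennreal_less_iff)
    next
      case top
      then show ?thesis using r by (simp add: epow_def)
    qed
  qed
qed

lemma lp_den_epow: "lp_den \<sigma> \<Omega> u = epow ((dimn TYPE('a::euclidean_space \<times> real) - 2 * \<sigma>) / dimn TYPE('a \<times> real)) (lp_int \<sigma> \<Omega> (u :: 'a \<times> real \<Rightarrow> real))"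
  by (simp add: lp_den_def epow_def)

lemma liminf_add_ennreal:
  fixes f g :: "nat \<Rightarrow> ennreal"
  shows "liminf f + liminf g \<le> liminf (\<lambda>k. f k + g k)"
proof -
  have i: "incseq (\<lambda>n. INF m\<in>{n..}. h m)" for h :: "nat \<Rightarrow> ennreal"
    by (intro incseq_SucI INF_superset_mono) auto
  have "liminf f + liminf g = (SUP n. (INF m\<in>{n..}. f m) + (INF m\<in>{n..}. g m))"
    unfolding liminf_SUP_INF by (rule ennreal_SUP_add[symmetric]) (rule i)+
  also have "\<dots> \<le> (SUP n. INF m\<in>{n..}. f m + g m)"
    by (intro SUP_mono) (auto intro!: INF_greatest add_mono INF_lower)
  finally show ?thesis unfolding liminf_SUP_INF .
qed

lemma liminf_cmult_ennreal:
  fixes f :: "nat \<Rightarrow> ennreal"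
  assumes "c < \<infinity>"
  shows "liminf (\<lambda>k. c * f k) = c * liminf f"
proof (rule Liminf_compose_continuous_mono)
  show "continuous_on UNIV (\<lambda>x. c * x)"
    unfolding continuous_on_def using assms by (auto intro!: ennreal_tendsto_cmult tendsto_ident_at simp: infinity_ennreal_def)
qed (auto simp: mono_def mult_left_mono)

lemma lsc_integral:
  fixes w :: "'a::euclidean_space \<times> real \<Rightarrow> real"
  assumes [measurable]: "w \<in> borel_measurable borel" "\<And>k. \<psi> k \<in> borel_measurable borel" "h \<in> borel_measurable borel"
    and h: "\<And>t. isCont h t"
    and conv: "AE x in lborel. x \<in> half_space \<longrightarrow> (\<lambda>k. \<psi> k x) \<longlonglongrightarrow> (u x :: real)"
  shows "(\<integral>\<^sup>+x. indicator half_space x * ennreal (h (u x) * w x) \<partial>lborel) \<le>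
    liminf (\<lambda>k. \<integral>\<^sup>+x. indicator half_space x * ennreal (h (\<psi> k x) * w x) \<partial>lborel)"
proof -
  have "(\<integral>\<^sup>+x. indicator half_space x * ennreal (h (u x) * w x) \<partial>lborel) =
    (\<integral>\<^sup>+x. liminf (\<lambda>k. indicator half_space x * ennreal (h (\<psi> k x) * w x)) \<partial>lborel)"
  proof (rule nn_integral_cong_AE, use conv in eventually_elim)
    case (elim x)
    show ?case
    proof (cases "x \<in> half_space")
      case True
      then have "(\<lambda>k. ennreal (h (\<psi> k x) * w x)) \<longlonglongrightarrow> ennreal (h (u x) * w x)"
        using elim by (intro tendsto_ennrealI tendsto_mult tendsto_const isCont_tendsto_compose[OF h]) auto
      then show ?thesis using True by (simp add: lim_imp_Liminf)
    qed (simp add: Liminf_const)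
  qed
  also have "\<dots> \<le> liminf (\<lambda>k. \<integral>\<^sup>+x. indicator half_space x * ennreal (h (\<psi> k x) * w x) \<partial>lborel)"
    by (rule nn_integral_liminf) measurable
  finally show ?thesis .
qed

text \<open>The functions \<open>\<bar>\<phi> k - u\<bar> powr p\<close> tend to 0 in
  \<open>L\<^sup>1\<close>, so a subsequence does so almost everywhere, and roots may be
  taken.\<close>

lemma lp_int_AE_subseq:
  fixes u :: "'a::euclidean_space \<times> real \<Rightarrow> real"
  assumes \<sigma>: "0 < \<sigma>" "\<sigma> < 1" and [measurable]: "\<And>k. \<phi> k \<in> borel_measurable borel" "u \<in> borel_measurable borel"
    and lim: "(\<lambda>k. lp_int \<sigma> half_space (\<lambda>x. \<phi> k x - u x)) \<longlonglongrightarrow> 0"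
  obtains r where "strict_mono r" "AE x in lborel. x \<in> half_space \<longrightarrow> (\<lambda>k. \<phi> (r k) x) \<longlonglongrightarrow> u x"
proof -
  let ?p = "crit_exp \<sigma> TYPE('a \<times> real)"
  have p: "?p > 2" by (rule crit_exp_gt_2[OF \<sigma>])
  define g where "g k x = indicator half_space x * \<bar>\<phi> k x - u x\<bar> powr ?p" for k x
  have [measurable]: "g k \<in> borel_measurable borel" for k unfolding g_def by measurable
  have g0: "g k x \<ge> 0" for k x by (simp add: g_def)
  have gi: "(\<integral>\<^sup>+x. ennreal (g k x) \<partial>lborel) = lp_int \<sigma> half_space (\<lambda>x. \<phi> k x - u x)" for k
    unfolding lp_int_def g_def by (intro nn_integral_cong) (auto simp: indicator_def)
  have "eventually (\<lambda>k. (\<integral>\<^sup>+x. ennreal (g k x) \<partial>lborel) < \<infinity>) sequentially"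
    unfolding gi using order_tendstoD(2)[OF lim, of \<infinity>] by simp
  \<comment> \<open>Finitely many of the integrals may be infinite; the sequence is shifted past
    them so that every term is integrable.\<close>
  then obtain k0 where k0: "\<And>k. k \<ge> k0 \<Longrightarrow> (\<integral>\<^sup>+x. ennreal (g k x) \<partial>lborel) < \<infinity>"
    unfolding eventually_sequentially by blast
  have int: "integrable lborel (g (k + k0))" for k
    by (rule integrableI_bounded) (use k0[of "k + k0"] g0 in auto)
  have "(\<lambda>k. ennreal (\<integral>x. norm (g (k + k0) x) \<partial>lborel)) \<longlonglongrightarrow> ennreal 0"
  proof -
    have "ennreal (\<integral>x. norm (g (k + k0) x) \<partial>lborel) = lp_int \<sigma> half_space (\<lambda>x. \<phi> (k + k0) x - u x)" for k
      using nn_integral_eq_integral[OF int[of k]] g0 gi[of "k + k0"] by simp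
    then show ?thesis using LIMSEQ_ignore_initial_segment[OF lim, of k0] by simp
  qed
  then have "(\<lambda>k. (\<integral>x. norm (g (k + k0) x) \<partial>lborel)) \<longlonglongrightarrow> 0"
    by (subst (asm) tendsto_ennreal_iff) auto
  then obtain r where r: "strict_mono r" "AE x in lborel. (\<lambda>n. g (r n + k0) x) \<longlonglongrightarrow> 0"
    using tendsto_L1_AE_subseq[of lborel "\<lambda>k. g (k + k0)"] int by auto
  show ?thesis
  proof (rule that[of "\<lambda>n. r n + k0"])
    show "strict_mono (\<lambda>n. r n + k0)" using r(1) by (simp add: strict_mono_def)
    show "AE x in lborel. x \<in> half_space \<longrightarrow> (\<lambda>k. \<phi> (r k + k0) x) \<longlonglongrightarrow> u x"
      using r(2)
    proof eventually_elim
      case (elim x)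
      show ?case
      proof
        assume x: "x \<in> half_space"
        have "(\<lambda>n. (g (r n + k0) x) powr (1 / ?p)) \<longlonglongrightarrow> 0 powr (1 / ?p)"
          by (rule tendsto_powr') (use elim p g0 in auto)
        moreover have "(g (r n + k0) x) powr (1 / ?p) = \<bar>\<phi> (r n + k0) x - u x\<bar>" for n
          using x p by (simp add: g_def powr_powr)
        ultimately have "(\<lambda>n. \<bar>\<phi> (r n + k0) x - u x\<bar>) \<longlonglongrightarrow> 0" by simp
        then have "(\<lambda>n. \<phi> (r n + k0) x - u x) \<longlonglongrightarrow> 0" by (rule tendsto_rabs_zero_cancel)
        then show "(\<lambda>k. \<phi> (r k + k0) x) \<longlonglongrightarrow> u x" by (rule LIM_zero_cancel)
      qed
    qed
  qed
qed

definition wint :: "('a::euclidean_space \<times> real \<Rightarrow> real) \<Rightarrow> ('a \<times> real \<Rightarrow> real) \<Rightarrow> ennreal" where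
  "wint w f = (\<integral>\<^sup>+x. indicator half_space x * ennreal ((f x)\<^sup>2 * w x) \<partial>lborel)"

lemma hmass_wint: "hmass \<sigma> f = wint (\<lambda>x. snd x powr (- 2 * \<sigma>)) f"
  by (simp add: hmass_def wint_def)

text \<open>Convergence in energy and in \<open>L\<^sup>p\<close>; the limits of sequences in \<^term>\<open>C1c half_space\<close> form \<^term>\<open>Hdot \<sigma> half_space\<close>.\<close>
definition econv :: "real \<Rightarrow> (nat \<Rightarrow> 'a::euclidean_space \<times> real \<Rightarrow> real) \<Rightarrow> ('a \<times> real \<Rightarrow> real) \<Rightarrow> bool" where
  "econv \<sigma> \<phi> u \<longleftrightarrow> (\<forall>k. \<phi> k \<in> C1c half_space) \<and> u \<in> borel_measurable borel \<and>
     ((\<lambda>k. gen \<sigma> (\<lambda>x. \<phi> k x - u x)) \<longlonglongrightarrow> 0) \<and> ((\<lambda>k. lp_int \<sigma> half_space (\<lambda>x. \<phi> k x - u x)) \<longlonglongrightarrow> 0)"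

lemma econv_measurable:
  assumes "econv \<sigma> \<phi> u"
  shows "\<phi> k \<in> borel_measurable borel" "u \<in> borel_measurable borel"
proof -
  have "\<phi> k \<in> C1c half_space" "u \<in> borel_measurable borel" using assms unfolding econv_def by blast+
  then show "\<phi> k \<in> borel_measurable borel" "u \<in> borel_measurable borel" using C1c_measurable by blast+
qed

text \<open>The left side is lower semicontinuous by Fatou along an almost everywhere convergent
  subsequence, and the right side is upper semicontinuous under convergence in energy. With suitable
  \<open>s\<close>, \<open>v\<close> and \<open>w\<close> this transfers Hardy's inequality, the
  Sobolev inequality and its improved form.\<close>

lemma econv_ineq:
  fixes u :: "'a::euclidean_space \<times> real \<Rightarrow> real"
  assumes \<sigma>: "0 < \<sigma>" "\<sigma> < 1" and conv: "econv \<sigma> \<phi> u"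
    and [measurable]: "w \<in> borel_measurable borel"
    and le: "\<And>k. ennreal s * lp_den \<sigma> half_space (\<phi> k) + ennreal v * wint w (\<phi> k) \<le> gen \<sigma> (\<phi> k)"
  shows "ennreal s * lp_den \<sigma> half_space u + ennreal v * wint w u \<le> gen \<sigma> u"
proof -
  let ?p = "crit_exp \<sigma> TYPE('a \<times> real)"
  have p: "?p > 2" by (rule crit_exp_gt_2[OF \<sigma>])
  have [measurable]: "\<And>k. \<phi> k \<in> borel_measurable borel" "u \<in> borel_measurable borel"
    using econv_measurable[OF conv] by auto
  obtain r where r: "strict_mono r" "AE x in lborel. x \<in> half_space \<longrightarrow> (\<lambda>k. \<phi> (r k) x) \<longlonglongrightarrow> u x"
    by (rule lp_int_AE_subseq[OF \<sigma>, of \<phi> u]) (use conv in \<open>auto simp: econv_def\<close>)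
  have "lp_int \<sigma> half_space u \<le> liminf (\<lambda>k. lp_int \<sigma> half_space (\<phi> (r k)))"
  proof -
    have "isCont (\<lambda>t::real. \<bar>t\<bar> powr ?p) t" for t
    proof -
      have "continuous_on UNIV (\<lambda>t::real. \<bar>t\<bar> powr ?p)"
        using p by (intro continuous_on_powr' continuous_intros) auto
      then show ?thesis by (simp add: continuous_on_eq_continuous_at)
    qed
    from lsc_integral[where w="\<lambda>_. 1" and h="\<lambda>t. \<bar>t\<bar> powr ?p", OF _ _ _ this r(2)]
    show ?thesis by (simp add: lp_int_def)
  qed
  then have 1: "lp_den \<sigma> half_space u \<le> liminf (\<lambda>k. lp_den \<sigma> half_space (\<phi> (r k)))"
    unfolding lp_den_epow using \<sigma> dimn_ge_2[where 'a='a] by (intro epow_lsc) auto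
  have 2: "wint w u \<le> liminf (\<lambda>k. wint w (\<phi> (r k)))"
    unfolding wint_def by (rule lsc_integral[where h="\<lambda>t. t\<^sup>2"]) (use r(2) in \<open>auto intro!: continuous_intros\<close>)
  have "ennreal s * lp_den \<sigma> half_space u + ennreal v * wint w u \<le>
    liminf (\<lambda>k. ennreal s * lp_den \<sigma> half_space (\<phi> (r k))) + liminf (\<lambda>k. ennreal v * wint w (\<phi> (r k)))"
    using 1 2 by (intro add_mono) (auto simp: liminf_cmult_ennreal intro: mult_left_mono)
  also have "\<dots> \<le> liminf (\<lambda>k. ennreal s * lp_den \<sigma> half_space (\<phi> (r k)) + ennreal v * wint w (\<phi> (r k)))"
    by (rule liminf_add_ennreal)
  also have "\<dots> \<le> liminf (\<lambda>k. gen \<sigma> (\<phi> (r k)))"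
    by (intro Liminf_mono always_eventually allI le)
  also have "\<dots> \<le> limsup (\<lambda>k. gen \<sigma> (\<phi> (r k)))" by (rule Liminf_le_Limsup) simp
  also have "\<dots> \<le> limsup (\<lambda>k. gen \<sigma> (\<phi> k))" using limsup_subseq_mono[OF r(1), of "\<lambda>k. gen \<sigma> (\<phi> k)"] by (simp add: o_def)
  also have "\<dots> \<le> gen \<sigma> u" by (rule limsup_gen_le) (use conv in \<open>auto simp: econv_def\<close>)
  finally show ?thesis .
qed

lemma Hdot_iff_econv:
  "u \<in> Hdot \<sigma> half_space \<longleftrightarrow> u \<in> borel_measurable borel \<and> (AE x in lborel. x \<notin> half_space \<longrightarrow> u x = 0) \<and> (\<exists>\<phi>. econv \<sigma> \<phi> u)"
proof -
  have "gag \<sigma> half_space (\<lambda>x. \<phi> x - u x) = gen \<sigma> (\<lambda>x. \<phi> x - u x)"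
    if "\<phi> \<in> C1c half_space" "u \<in> borel_measurable borel" for \<phi>
    using that C1c_measurable[OF that(1)] by (intro gag_half_space) simp
  then show ?thesis unfolding Hdot_def econv_def by auto
qed

lemma Hdot_gen_finite:
  assumes \<sigma>: "0 < \<sigma>" "\<sigma> < 1" and u: "econv \<sigma> \<phi> u"
  shows "gen \<sigma> u < \<infinity>"
proof -
  have [measurable]: "\<And>k. \<phi> k \<in> borel_measurable borel" "u \<in> borel_measurable borel"
    using econv_measurable[OF u] by auto
  have "(\<lambda>k. gen \<sigma> (\<lambda>x. \<phi> k x - u x)) \<longlonglongrightarrow> 0" using u by (simp add: econv_def)
  from order_tendstoD(2)[OF this, of 1] obtain k where k: "gen \<sigma> (\<lambda>x. \<phi> k x - u x) < 1"
    by (auto simp: eventually_sequentially)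
  have "gen \<sigma> u \<le> ennreal (1 + 1) * gen \<sigma> (\<phi> k) + ennreal (1 + 1 / 1) * gen \<sigma> (\<lambda>x. u x - \<phi> k x)"
    using gen_add_le[of "\<phi> k" "\<lambda>x. u x - \<phi> k x" 1 \<sigma>] by simp
  moreover have "gen \<sigma> (\<phi> k) < \<infinity>" using u \<sigma> C1c_gen_finite unfolding econv_def by blast
  moreover have "gen \<sigma> (\<lambda>x. u x - \<phi> k x) < \<infinity>" using k by (subst gen_diff_commute) (simp add: order_less_trans[OF _ ennreal_one_less_top] infinity_ennreal_def)
  ultimately show ?thesis by (auto simp: ennreal_mult_less_top infinity_ennreal_def intro: le_less_trans)
qed

lemma Hdot_lp_finite:
  fixes u :: "'a::euclidean_space \<times> real \<Rightarrow> real"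
  assumes \<sigma>: "0 < \<sigma>" "\<sigma> < 1" and u: "econv \<sigma> \<phi> u"
  shows "lp_int \<sigma> half_space u < \<infinity>"
proof -
  let ?p = "crit_exp \<sigma> TYPE('a \<times> real)"
  have p: "?p > 2" by (rule crit_exp_gt_2[OF \<sigma>])
  have [measurable]: "\<And>k. \<phi> k \<in> borel_measurable borel" "u \<in> borel_measurable borel"
    using econv_measurable[OF u] by auto
  have "(\<lambda>k. lp_int \<sigma> half_space (\<lambda>x. \<phi> k x - u x)) \<longlonglongrightarrow> 0" using u by (simp add: econv_def)
  from order_tendstoD(2)[OF this, of 1] obtain k where k: "lp_int \<sigma> half_space (\<lambda>x. \<phi> k x - u x) < 1"
    by (auto simp: eventually_sequentially)
  have "lp_int \<sigma> half_space u \<le> (\<integral>\<^sup>+x. ennreal (2 powr ?p) * (indicator half_space x * ennreal (\<bar>\<phi> k x - u x\<bar> powr ?p)) + ennreal (2 powr ?p) * (indicator half_space x * ennreal (\<bar>\<phi> k x\<bar> powr ?p)) \<partial>lborel)"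
    unfolding lp_int_def
  proof (rule nn_integral_mono)
    fix x
    define m where "m = max \<bar>\<phi> k x - u x\<bar> \<bar>\<phi> k x\<bar>"
    have "\<bar>\<phi> k x - u x\<bar> \<le> m" "\<bar>\<phi> k x\<bar> \<le> m" unfolding m_def by (rule max.cobounded1, rule max.cobounded2)
    then have "\<bar>u x\<bar> \<le> 2 * m" by linarith
    then have "\<bar>u x\<bar> powr ?p \<le> (2 * m) powr ?p" using p by (intro powr_mono2) auto
    also have "\<dots> = 2 powr ?p * m powr ?p" by (simp add: powr_mult m_def)
    also have "\<dots> \<le> 2 powr ?p * (\<bar>\<phi> k x - u x\<bar> powr ?p + \<bar>\<phi> k x\<bar> powr ?p)"
      by (intro mult_left_mono) (auto simp: m_def max_def)
    finally show "indicator half_space x * ennreal (\<bar>u x\<bar> powr ?p) \<le> ennreal (2 powr ?p) * (indicator half_space x * ennreal (\<bar>\<phi> k x - u x\<bar> powr ?p)) + ennreal (2 powr ?p) * (indicator half_space x * ennreal (\<bar>\<phi> k x\<bar> powr ?p))"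
      by (auto simp: indicator_def ennreal_mult[symmetric] ennreal_plus[symmetric] distrib_left simp del: ennreal_plus intro!: ennreal_leI)
  qed
  also have "\<dots> = ennreal (2 powr ?p) * lp_int \<sigma> half_space (\<lambda>x. \<phi> k x - u x) + ennreal (2 powr ?p) * lp_int \<sigma> half_space (\<phi> k)"
    unfolding lp_int_def by (subst nn_integral_add) (auto simp: nn_integral_cmult)
  also have "\<dots> < \<infinity>"
    using k C1c_lp_int_finite[OF _ \<sigma>, of "\<phi> k" half_space] u
    by (auto simp: econv_def ennreal_mult_less_top infinity_ennreal_def intro: order_less_trans[OF _ ennreal_one_less_top])
  finally show ?thesis .
qed

lemma econv_diff:
  assumes u: "econv \<sigma> \<phi> u" and \<psi>: "\<psi> \<in> C1c half_space"
  shows "econv \<sigma> (\<lambda>k x. \<psi> x - \<phi> k x) (\<lambda>x. \<psi> x - u x)"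
proof -
  have g: "gen \<sigma> (\<lambda>x. \<psi> x - \<phi> k x - (\<psi> x - u x)) = gen \<sigma> (\<lambda>x. \<phi> k x - u x)" for k
    using gen_diff_commute[of \<sigma> "\<phi> k" u] by simp
  have l: "lp_int \<sigma> half_space (\<lambda>x. \<psi> x - \<phi> k x - (\<psi> x - u x)) = lp_int \<sigma> half_space (\<lambda>x. \<phi> k x - u x)" for k
    by (simp add: lp_int_def abs_minus_commute)
  have [measurable]: "\<psi> \<in> borel_measurable borel" "u \<in> borel_measurable borel"
    using C1c_measurable[OF \<psi>] econv_measurable[OF u] by auto
  have "(\<lambda>x. \<psi> x - u x) \<in> borel_measurable borel" by measurable
  then show ?thesis using u C1c_diff[OF \<psi>] unfolding econv_def g l by simp
qed

text \<open>Functions in \<open>C1c half_space\<close> stay away from the boundary and so have the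
  finite Hardy mass that \<open>hardy_inequality\<close> presupposes; the limit then inherits the
  bound, and with it finiteness of its own mass.\<close>

lemma hardy_Hdot:
  assumes \<sigma>: "1/2 < \<sigma>" "\<sigma> < 1"
  obtains c where "c > 0" "\<And>\<phi> (u :: 'a::euclidean_space \<times> real \<Rightarrow> real). econv \<sigma> \<phi> u \<Longrightarrow> ennreal c * hmass \<sigma> u \<le> gen \<sigma> u"
proof -
  obtain c where c: "c > 0" "\<And>f :: 'a \<times> real \<Rightarrow> real. f \<in> borel_measurable borel \<Longrightarrow> hmass \<sigma> f < \<infinity> \<Longrightarrow>
    ennreal c * hmass \<sigma> f \<le> (\<integral>\<^sup>+z. ennreal ((f (fst z) - f (snd z))\<^sup>2) \<partial>gmeas \<sigma>)"
    by (rule hardy_inequality[OF \<sigma>, where 'a='a]) (rule that)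
  show ?thesis
  proof (rule that[OF c(1)])
    fix \<phi> and u :: "'a \<times> real \<Rightarrow> real"
    assume u: "econv \<sigma> \<phi> u"
    have "ennreal 0 * lp_den \<sigma> half_space u + ennreal c * wint (\<lambda>x. snd x powr (- 2 * \<sigma>)) u \<le> gen \<sigma> u"
    proof (rule econv_ineq[OF _ _ u])
      fix k
      have "\<phi> k \<in> C1c half_space" using u by (simp add: econv_def)
      then have "ennreal c * hmass \<sigma> (\<phi> k) \<le> gen \<sigma> (\<phi> k)"
        unfolding gen_def using \<sigma> by (intro c(2) C1c_hmass_finite C1c_measurable) auto
      then show "ennreal 0 * lp_den \<sigma> half_space (\<phi> k) + ennreal c * wint (\<lambda>x. snd x powr (- 2 * \<sigma>)) (\<phi> k) \<le> gen \<sigma> (\<phi> k)"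
        by (simp add: hmass_wint)
    qed (use \<sigma> in auto)
    then show "ennreal c * hmass \<sigma> u \<le> gen \<sigma> u" by (simp add: hmass_wint)
  qed
qed

text \<open>The multiplied form is used from here on: it stays meaningful when the denominator is 0
  or infinite, where the quotient in \<open>ennreal\<close> says little.\<close>

lemma S_const_C1c:
  assumes "f \<in> C1c \<Omega>"
  shows "S_const \<sigma> \<Omega> * lp_den \<sigma> \<Omega> f \<le> gag \<sigma> \<Omega> f"
proof (cases "\<exists>x. f x \<noteq> 0")
  case False
  then have "f = (\<lambda>_. 0)" by auto
  then have "lp_den \<sigma> \<Omega> f = 0" by (simp add: lp_den_def lp_int_def)
  then show ?thesis by simp
next
  case True
  then have "S_const \<sigma> \<Omega> \<le> gag \<sigma> \<Omega> f / lp_den \<sigma> \<Omega> f"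
    unfolding S_const_def quot_def[symmetric] using assms by (intro INF_lower) auto
  then have "S_const \<sigma> \<Omega> * lp_den \<sigma> \<Omega> f \<le> gag \<sigma> \<Omega> f / lp_den \<sigma> \<Omega> f * lp_den \<sigma> \<Omega> f"
    by (rule mult_right_mono) simp
  also have "\<dots> \<le> gag \<sigma> \<Omega> f"
  proof (cases "lp_den \<sigma> \<Omega> f = 0 \<or> lp_den \<sigma> \<Omega> f = top")
    case True
    then show ?thesis by (auto simp: divide_ennreal_def)
  next
    case False
    then show ?thesis by (simp add: ennreal_divide_times ennreal_divide_self top.not_eq_extremum)
  qed
  finally show ?thesis .
qed

section \<open>Multipliers\<close>

text \<open>Multipliers whose oscillation on the scale \<open>x\<^sub>n\<close> is controlled act on the energy space, by Hardy's inequality.\<close>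
definition mult_bound :: "('a::euclidean_space \<times> real \<Rightarrow> real) \<Rightarrow> real \<Rightarrow> bool" where
  "mult_bound m C \<longleftrightarrow> C \<ge> 0 \<and> (\<forall>x\<in>half_space. \<bar>m x\<bar> \<le> C) \<and>
     (\<forall>x\<in>half_space. \<forall>y\<in>half_space. \<bar>m x - m y\<bar> \<le> C * (dist x y / snd x))"

definition multiplier :: "('a::euclidean_space \<times> real \<Rightarrow> real) \<Rightarrow> bool" where
  "multiplier m \<longleftrightarrow> m \<in> borel_measurable borel \<and> C1_on half_space m \<and> (\<exists>C. mult_bound m C)"

lemma multiplier_measurable: "multiplier m \<Longrightarrow> m \<in> borel_measurable borel"
  by (simp add: multiplier_def)

lemma multiplier_const: "multiplier (\<lambda>_. c)"
  unfolding multiplier_def mult_bound_def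
  by (auto intro!: C1_on_const exI[of _ "\<bar>c\<bar>"] simp: half_space_def)

lemma multiplier_add:
  assumes "multiplier f" "multiplier g"
  shows "multiplier (\<lambda>x. f x + g x)"
proof -
  obtain C D where C: "mult_bound f C" and D: "mult_bound g D" using assms by (auto simp: multiplier_def)
  have "mult_bound (\<lambda>x. f x + g x) (C + D)"
    unfolding mult_bound_def
  proof (intro conjI ballI)
    show "0 \<le> C + D" using C D by (auto simp: mult_bound_def)
    fix x :: "'a \<times> real" assume x: "x \<in> half_space"
    have "\<bar>f x\<bar> \<le> C" "\<bar>g x\<bar> \<le> D" using C D x unfolding mult_bound_def by blast+
    then show "\<bar>f x + g x\<bar> \<le> C + D" by linarith
    fix y :: "'a \<times> real" assume y: "y \<in> half_space"
    have "\<bar>f x - f y\<bar> \<le> C * (dist x y / snd x)" "\<bar>g x - g y\<bar> \<le> D * (dist x y / snd x)"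
      using C D x y unfolding mult_bound_def by blast+
    then show "\<bar>f x + g x - (f y + g y)\<bar> \<le> (C + D) * (dist x y / snd x)" unfolding distrib_right by linarith
  qed
  then show ?thesis using assms unfolding multiplier_def by (auto intro: C1_on_add)
qed

lemma multiplier_mult:
  assumes "multiplier f" "multiplier g"
  shows "multiplier (\<lambda>x. f x * g x)"
proof -
  obtain C D where C: "mult_bound f C" and D: "mult_bound g D" using assms by (auto simp: multiplier_def)
  have CD: "C \<ge> 0" "D \<ge> 0" using C D by (auto simp: mult_bound_def)
  have "mult_bound (\<lambda>x. f x * g x) (2 * (C * D))"
    unfolding mult_bound_def
  proof (intro conjI ballI)
    show "0 \<le> 2 * (C * D)" using CD by simp
    fix x :: "'a \<times> real" assume x: "x \<in> half_space"
    have fx: "\<bar>f x\<bar> \<le> C" and gx: "\<bar>g x\<bar> \<le> D" using C D x unfolding mult_bound_def by blast+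
    have "\<bar>f x * g x\<bar> \<le> C * D" unfolding abs_mult by (intro mult_mono fx gx) (use CD in auto)
    then show "\<bar>f x * g x\<bar> \<le> 2 * (C * D)" using mult_nonneg_nonneg[OF CD] by linarith
    fix y :: "'a \<times> real" assume y: "y \<in> half_space"
    define d where "d = dist x y / snd x"
    have d: "d \<ge> 0" using x by (simp add: d_def half_space_def)
    have gy: "\<bar>g y\<bar> \<le> D" using D y unfolding mult_bound_def by blast
    have fd: "\<bar>f x - f y\<bar> \<le> C * d" and gd: "\<bar>g x - g y\<bar> \<le> D * d"
      unfolding d_def using C D x y unfolding mult_bound_def by blast+
    have "f x * g x - f y * g y = f x * (g x - g y) + (f x - f y) * g y" by (simp add: algebra_simps)
    then have "\<bar>f x * g x - f y * g y\<bar> \<le> \<bar>f x\<bar> * \<bar>g x - g y\<bar> + \<bar>f x - f y\<bar> * \<bar>g y\<bar>"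
      by (metis abs_mult abs_triangle_ineq)
    also have "\<dots> \<le> C * (D * d) + C * d * D"
      by (intro add_mono mult_mono fx gd fd gy) (use CD d in auto)
    also have "\<dots> = 2 * (C * D) * d" by (simp add: algebra_simps)
    finally show "\<bar>f x * g x - f y * g y\<bar> \<le> 2 * (C * D) * (dist x y / snd x)" by (simp add: d_def)
  qed
  then show ?thesis using assms unfolding multiplier_def by (auto intro: C1_on_mult)
qed

text \<open>Splitting the difference as \<open>m y (f x - f y) + f x (m x - m y)\<close> leaves, in
  the second term, an oscillation bounded by \<open>min 1 ((dist x y / snd x)\<^sup>2)\<close>. The
  truncated kernel at scale \<open>snd x\<close> integrates it to a multiple of
  \<open>snd x powr (- 2 * \<sigma>)\<close>, the Hardy weight.\<close>

lemma mult_gen_le: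
  fixes m :: "'a::euclidean_space \<times> real \<Rightarrow> real"
  assumes \<sigma>: "0 < \<sigma>" "\<sigma> < 1" and m: "multiplier m"
  obtains K where "K \<ge> 0" "\<And>f. f \<in> borel_measurable borel \<Longrightarrow> gen \<sigma> (\<lambda>x. m x * f x) \<le> ennreal K * (gen \<sigma> f + hmass \<sigma> f)"
proof -
  obtain C where C: "mult_bound m C" using m by (auto simp: multiplier_def)
  have C0: "C \<ge> 0" using C by (simp add: mult_bound_def)
  have [measurable]: "m \<in> borel_measurable borel" by (rule multiplier_measurable[OF m])
  obtain D where D: "D > 0" "\<And>(x::'a \<times> real) s. s > 0 \<Longrightarrow>
    (\<integral>\<^sup>+y. ennreal (min 1 ((dist x y / s)\<^sup>2) * gker \<sigma> x y) \<partial>lborel) \<le> ennreal (D * s powr (- 2 * \<sigma>))"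
    by (rule ex_gker_truncated[OF \<sigma>, where 'a='a]) (rule that)
  define K where "K = max (2 * C\<^sup>2) (8 * C\<^sup>2 * D)"
  have K0: "K \<ge> 0" by (simp add: K_def max.coboundedI1)
  show ?thesis
  proof (rule that[OF K0])
    fix f :: "'a \<times> real \<Rightarrow> real" assume [measurable]: "f \<in> borel_measurable borel"
    let ?\<rho> = "\<lambda>z :: ('a \<times> real) \<times> ('a \<times> real). ennreal (8 * C\<^sup>2 * min 1 ((dist (fst z) (snd z) / snd (fst z))\<^sup>2))"
    have "gen \<sigma> (\<lambda>x. m x * f x) \<le> (\<integral>\<^sup>+z. ennreal (2 * C\<^sup>2) * ennreal ((f (fst z) - f (snd z))\<^sup>2) + ennreal ((f (fst z))\<^sup>2) * ?\<rho> z \<partial>gmeas \<sigma>)"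
      unfolding gen_def
    proof (rule nn_integral_mono_AE, use AE_gmeas_half_space in eventually_elim)
      case (elim z)
      define x y where "x = fst z" and "y = snd z"
      have xy: "x \<in> half_space" "y \<in> half_space" using elim by (auto simp: x_def y_def)
      define d where "d = dist x y / snd x"
      have d: "d \<ge> 0" using xy by (simp add: d_def half_space_def)
      have mx: "\<bar>m x\<bar> \<le> C" "\<bar>m y\<bar> \<le> C" and md: "\<bar>m x - m y\<bar> \<le> C * d"
        unfolding d_def using C xy unfolding mult_bound_def by blast+
      have md2: "(m x - m y)\<^sup>2 \<le> 4 * C\<^sup>2 * min 1 (d\<^sup>2)"
      proof -
        have 1: "\<bar>m x - m y\<bar> \<le> 2 * C" using mx by linarith
        have 2: "\<bar>m x - m y\<bar> \<le> 2 * C * d"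
          using md mult_nonneg_nonneg[OF C0 d] by linarith
        have "(m x - m y)\<^sup>2 \<le> (2 * C)\<^sup>2"
          using 1 C0 by (subst abs_le_square_iff[symmetric]) simp
        moreover have "(m x - m y)\<^sup>2 \<le> (2 * C * d)\<^sup>2"
          using 2 C0 d by (subst abs_le_square_iff[symmetric]) simp
        ultimately show ?thesis by (simp add: power_mult_distrib min_def)
      qed
      have "m x * f x - m y * f y = m y * (f x - f y) + f x * (m x - m y)" by (simp add: algebra_simps)
      then have "(m x * f x - m y * f y)\<^sup>2 \<le> 2 * (m y * (f x - f y))\<^sup>2 + 2 * (f x * (m x - m y))\<^sup>2"
        using young_square[of 1 "m y * (f x - f y)" "f x * (m x - m y)"] by simp
      also have "\<dots> = 2 * ((m y)\<^sup>2 * (f x - f y)\<^sup>2) + 2 * ((f x)\<^sup>2 * (m x - m y)\<^sup>2)" by (simp add: power_mult_distrib)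
      also have "\<dots> \<le> 2 * (C\<^sup>2 * (f x - f y)\<^sup>2) + 2 * ((f x)\<^sup>2 * (4 * C\<^sup>2 * min 1 (d\<^sup>2)))"
        using mx C0 by (intro add_mono mult_left_mono mult_right_mono md2) (auto simp: abs_le_square_iff[symmetric])
      also have "\<dots> = 2 * C\<^sup>2 * (f x - f y)\<^sup>2 + (f x)\<^sup>2 * (8 * C\<^sup>2 * min 1 (d\<^sup>2))" by (simp add: algebra_simps)
      finally show ?case
        unfolding x_def[symmetric] y_def[symmetric] d_def[symmetric]
        by (simp add: ennreal_mult[symmetric] ennreal_plus[symmetric] del: ennreal_plus)
    qed
    also have "\<dots> = ennreal (2 * C\<^sup>2) * gen \<sigma> f + (\<integral>\<^sup>+z. ennreal ((f (fst z))\<^sup>2) * ?\<rho> z \<partial>gmeas \<sigma>)"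
      unfolding gen_def by (subst nn_integral_add) (auto simp: nn_integral_cmult)
    also have "(\<integral>\<^sup>+z. ennreal ((f (fst z))\<^sup>2) * ?\<rho> z \<partial>gmeas \<sigma>) =
      (\<integral>\<^sup>+x. indicator half_space x * ennreal ((f x)\<^sup>2) * (\<integral>\<^sup>+y. indicator half_space y * (ennreal (gker \<sigma> x y) * ?\<rho> (x, y)) \<partial>lborel) \<partial>lborel)"
      by (rule nn_integral_gmeas_fst) measurable
    also have "\<dots> \<le> (\<integral>\<^sup>+x. ennreal (8 * C\<^sup>2 * D) * (indicator half_space x * ennreal ((f x)\<^sup>2 * snd x powr (- 2 * \<sigma>))) \<partial>lborel)"
    proof (rule nn_integral_mono)
      fix x :: "'a \<times> real"
      show "indicator half_space x * ennreal ((f x)\<^sup>2) * (\<integral>\<^sup>+y. indicator half_space y * (ennreal (gker \<sigma> x y) * ?\<rho> (x, y)) \<partial>lborel)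
        \<le> ennreal (8 * C\<^sup>2 * D) * (indicator half_space x * ennreal ((f x)\<^sup>2 * snd x powr (- 2 * \<sigma>)))"
      proof (cases "x \<in> half_space")
        case True
        have "(\<integral>\<^sup>+y. indicator half_space y * (ennreal (gker \<sigma> x y) * ?\<rho> (x, y)) \<partial>lborel) \<le> (\<integral>\<^sup>+y. ennreal (8 * C\<^sup>2) * ennreal (min 1 ((dist x y / snd x)\<^sup>2) * gker \<sigma> x y) \<partial>lborel)"
          by (rule nn_integral_mono) (auto simp: indicator_def ennreal_mult[symmetric] ac_simps)
        also have "\<dots> = ennreal (8 * C\<^sup>2) * (\<integral>\<^sup>+y. ennreal (min 1 ((dist x y / snd x)\<^sup>2) * gker \<sigma> x y) \<partial>lborel)"
          by (rule nn_integral_cmult) measurable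
        also have "\<dots> \<le> ennreal (8 * C\<^sup>2) * ennreal (D * snd x powr (- 2 * \<sigma>))"
          using True by (intro mult_left_mono D(2)) (auto simp: half_space_def)
        finally have "ennreal ((f x)\<^sup>2) * (\<integral>\<^sup>+y. indicator half_space y * (ennreal (gker \<sigma> x y) * ?\<rho> (x, y)) \<partial>lborel) \<le> ennreal ((f x)\<^sup>2) * (ennreal (8 * C\<^sup>2) * ennreal (D * snd x powr (- 2 * \<sigma>)))"
          by (rule mult_left_mono) simp
        also have "\<dots> = ennreal (8 * C\<^sup>2 * D) * ennreal ((f x)\<^sup>2 * snd x powr (- 2 * \<sigma>))"
          using D(1) by (simp add: ennreal_mult[symmetric] ac_simps)
        finally show ?thesis using True by simp
      qed simp
    qed
    also have "\<dots> = ennreal (8 * C\<^sup>2 * D) * hmass \<sigma> f"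
      unfolding hmass_def by (rule nn_integral_cmult) measurable
    also have "ennreal (2 * C\<^sup>2) * gen \<sigma> f + ennreal (8 * C\<^sup>2 * D) * hmass \<sigma> f \<le> ennreal K * gen \<sigma> f + ennreal K * hmass \<sigma> f"
      by (intro add_mono mult_right_mono) (auto simp: K_def intro!: ennreal_leI)
    finally show "gen \<sigma> (\<lambda>x. m x * f x) \<le> ennreal K * (gen \<sigma> f + hmass \<sigma> f)"
      by (simp add: distrib_left add_mono)
  qed
qed

text \<open>By \<open>mult_gen_le\<close> and Hardy's inequality, multiplication by \<open>m\<close>
  is bounded in energy on differences of the approximants and their limit; it is bounded in
  \<open>L\<^sup>p\<close> since \<open>m\<close> is bounded. So the products
  \<open>m \<phi> k\<close> approximate \<open>m u\<close>.\<close>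

lemma multiplier_econv:
  fixes u :: "'a::euclidean_space \<times> real \<Rightarrow> real"
  assumes \<sigma>: "1/2 < \<sigma>" "\<sigma> < 1" and m: "multiplier m" and u: "econv \<sigma> \<phi> u"
  shows "econv \<sigma> (\<lambda>k x. m x * \<phi> k x) (\<lambda>x. m x * u x)"
proof -
  let ?p = "crit_exp \<sigma> TYPE('a \<times> real)"
  have \<sigma>': "0 < \<sigma>" using \<sigma> by simp
  have p: "?p > 2" by (rule crit_exp_gt_2[OF \<sigma>' \<sigma>(2)])
  have [measurable]: "m \<in> borel_measurable borel" "\<And>k. \<phi> k \<in> borel_measurable borel" "u \<in> borel_measurable borel"
    using econv_measurable[OF u] multiplier_measurable[OF m] by auto
  obtain K where K: "K \<ge> 0" "\<And>f. f \<in> borel_measurable borel \<Longrightarrow> gen \<sigma> (\<lambda>x. m x * f x) \<le> ennreal K * (gen \<sigma> f + hmass \<sigma> f)"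
    using mult_gen_le[OF \<sigma>' \<sigma>(2) m] by metis
  obtain c where c: "c > 0" "\<And>\<phi> (u :: 'a \<times> real \<Rightarrow> real). econv \<sigma> \<phi> u \<Longrightarrow> ennreal c * hmass \<sigma> u \<le> gen \<sigma> u"
    by (rule hardy_Hdot[OF \<sigma>, where 'a='a]) (rule that)
  obtain C where C: "mult_bound m C" using m by (auto simp: multiplier_def)
  have C1c: "(\<lambda>x. m x * \<phi> k x) \<in> C1c half_space" for k
    by (rule C1c_mult) (use m u in \<open>simp_all add: multiplier_def econv_def\<close>)
  have diff: "m x * \<phi> k x - m x * u x = m x * (\<phi> k x - u x)" for x k by (simp add: algebra_simps)
  have "(\<lambda>k. gen \<sigma> (\<lambda>x. m x * (\<phi> k x - u x))) \<longlonglongrightarrow> 0"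
  proof (rule tendsto_sandwich[OF _ _ tendsto_const])
    show "eventually (\<lambda>k. 0 \<le> gen \<sigma> (\<lambda>x. m x * (\<phi> k x - u x))) sequentially" by simp
    show "eventually (\<lambda>k. gen \<sigma> (\<lambda>x. m x * (\<phi> k x - u x)) \<le> ennreal (K * (1 + 1 / c)) * gen \<sigma> (\<lambda>x. \<phi> k x - u x)) sequentially"
    proof (intro always_eventually allI)
      fix k
      let ?f = "\<lambda>x. \<phi> k x - u x"
      \<comment> \<open>Hardy's inequality has to be applied to the error
        \<open>\<phi> k - u\<close>, which is itself the limit of \<open>\<phi> k - \<phi> j\<close>
        in \<open>C1c half_space\<close>.\<close>
      have "econv \<sigma> (\<lambda>j x. \<phi> k x - \<phi> j x) ?f"
        by (rule econv_diff[OF u]) (use u in \<open>simp add: econv_def\<close>)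
      from c(2)[OF this] have "ennreal (1 / c) * (ennreal c * hmass \<sigma> ?f) \<le> ennreal (1 / c) * gen \<sigma> ?f"
        by (rule mult_left_mono) simp
      then have h: "hmass \<sigma> ?f \<le> ennreal (1 / c) * gen \<sigma> ?f"
        using c(1) by (simp add: mult.assoc[symmetric] ennreal_mult[symmetric])
      have "gen \<sigma> (\<lambda>x. m x * ?f x) \<le> ennreal K * (gen \<sigma> ?f + hmass \<sigma> ?f)" by (rule K(2)) measurable
      also have "\<dots> \<le> ennreal K * (gen \<sigma> ?f + ennreal (1 / c) * gen \<sigma> ?f)"
        by (intro mult_left_mono add_left_mono h) simp
      also have "\<dots> = ennreal (K * (1 + 1 / c)) * gen \<sigma> ?f"
      proof -
        have "gen \<sigma> ?f + ennreal (1 / c) * gen \<sigma> ?f = ennreal (1 + 1 / c) * gen \<sigma> ?f"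
          using c(1) by (simp add: ennreal_plus[of 1 "1/c"] distrib_right del: ennreal_plus)
        then show ?thesis using K(1) c(1) by (simp add: ennreal_mult mult.assoc)
      qed
      finally show "gen \<sigma> (\<lambda>x. m x * ?f x) \<le> ennreal (K * (1 + 1 / c)) * gen \<sigma> ?f" .
    qed
    show "(\<lambda>k. ennreal (K * (1 + 1 / c)) * gen \<sigma> (\<lambda>x. \<phi> k x - u x)) \<longlonglongrightarrow> 0"
      using ennreal_tendsto_cmult[of "ennreal (K * (1 + 1 / c))" "\<lambda>k. gen \<sigma> (\<lambda>x. \<phi> k x - u x)" 0] u by (simp add: econv_def)
  qed
  moreover have "(\<lambda>k. lp_int \<sigma> half_space (\<lambda>x. m x * (\<phi> k x - u x))) \<longlonglongrightarrow> 0"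
  proof (rule tendsto_sandwich[OF _ _ tendsto_const])
    show "eventually (\<lambda>k. 0 \<le> lp_int \<sigma> half_space (\<lambda>x. m x * (\<phi> k x - u x))) sequentially" by simp
    show "eventually (\<lambda>k. lp_int \<sigma> half_space (\<lambda>x. m x * (\<phi> k x - u x)) \<le> ennreal (C powr ?p) * lp_int \<sigma> half_space (\<lambda>x. \<phi> k x - u x)) sequentially"
    proof (intro always_eventually allI)
      fix k
      have "lp_int \<sigma> half_space (\<lambda>x. m x * (\<phi> k x - u x)) \<le> (\<integral>\<^sup>+x. ennreal (C powr ?p) * (indicator half_space x * ennreal (\<bar>\<phi> k x - u x\<bar> powr ?p)) \<partial>lborel)"
        unfolding lp_int_def
      proof (rule nn_integral_mono)
        fix x :: "'a \<times> real"
        show "indicator half_space x * ennreal (\<bar>m x * (\<phi> k x - u x)\<bar> powr ?p) \<le> ennreal (C powr ?p) * (indicator half_space x * ennreal (\<bar>\<phi> k x - u x\<bar> powr ?p))"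
        proof (cases "x \<in> half_space")
          case True
          then have "\<bar>m x\<bar> \<le> C" using C by (simp add: mult_bound_def)
          then have "\<bar>m x * (\<phi> k x - u x)\<bar> powr ?p \<le> (C * \<bar>\<phi> k x - u x\<bar>) powr ?p"
            using p by (intro powr_mono2) (auto simp: abs_mult intro: mult_right_mono)
          also have "\<dots> = C powr ?p * \<bar>\<phi> k x - u x\<bar> powr ?p"
            using C by (simp add: powr_mult mult_bound_def)
          finally show ?thesis using True by (simp add: ennreal_mult[symmetric] ennreal_leI)
        qed simp
      qed
      also have "\<dots> = ennreal (C powr ?p) * lp_int \<sigma> half_space (\<lambda>x. \<phi> k x - u x)"
        unfolding lp_int_def by (rule nn_integral_cmult) measurable
      finally show "lp_int \<sigma> half_space (\<lambda>x. m x * (\<phi> k x - u x)) \<le> ennreal (C powr ?p) * lp_int \<sigma> half_space (\<lambda>x. \<phi> k x - u x)" .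
    qed
    show "(\<lambda>k. ennreal (C powr ?p) * lp_int \<sigma> half_space (\<lambda>x. \<phi> k x - u x)) \<longlonglongrightarrow> 0"
      using ennreal_tendsto_cmult[of "ennreal (C powr ?p)" "\<lambda>k. lp_int \<sigma> half_space (\<lambda>x. \<phi> k x - u x)" 0] u by (simp add: econv_def)
  qed
  moreover have "(\<lambda>x. m x * u x) \<in> borel_measurable borel" by measurable
  ultimately show ?thesis unfolding econv_def diff using C1c by simp
qed

section \<open>Minimizers\<close>

text \<open>After normalization by \<open>a\<close> and \<open>b\<close> this is the integrated
  weighted arithmetic-geometric inequality. If \<open>a\<close> or \<open>b\<close> is 0,
  normalization fails, but then the product is zero almost everywhere.\<close>

lemma nn_integral_Hoelder:
  fixes F G :: "'a \<Rightarrow> real"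
  assumes [measurable]: "F \<in> borel_measurable M" "G \<in> borel_measurable M"
    and nonneg: "\<And>x. F x \<ge> 0" "\<And>x. G x \<ge> 0" and \<alpha>: "0 < \<alpha>" "\<alpha> < 1"
    and IF: "(\<integral>\<^sup>+x. ennreal (F x) \<partial>M) = ennreal a" and IG: "(\<integral>\<^sup>+x. ennreal (G x) \<partial>M) = ennreal b" and ab: "a \<ge> 0" "b \<ge> 0"
  shows "(\<integral>\<^sup>+x. ennreal (F x powr \<alpha> * G x powr (1 - \<alpha>)) \<partial>M) \<le> ennreal (a powr \<alpha> * b powr (1 - \<alpha>))"
proof (cases "a = 0 \<or> b = 0")
  case True
  have "AE x in M. F x powr \<alpha> * G x powr (1 - \<alpha>) = 0"
  proof (cases "a = 0")
    case True
    then have "AE x in M. ennreal (F x) = 0" using IF by (simp add: nn_integral_0_iff_AE)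
    then show ?thesis by eventually_elim (use nonneg(1) in \<open>auto simp: ennreal_eq_0_iff order_antisym\<close>)
  next
    case False
    then have "AE x in M. ennreal (G x) = 0" using IG True by (simp add: nn_integral_0_iff_AE)
    then show ?thesis by eventually_elim (use nonneg(2) in \<open>auto simp: ennreal_eq_0_iff order_antisym\<close>)
  qed
  then have "(\<integral>\<^sup>+x. ennreal (F x powr \<alpha> * G x powr (1 - \<alpha>)) \<partial>M) = (\<integral>\<^sup>+x. 0 \<partial>M)"
    by (intro nn_integral_cong_AE) (auto elim!: eventually_mono)
  then show ?thesis by simp
next
  case False
  then have ab: "a > 0" "b > 0" using ab by auto
  define c where "c = a powr \<alpha> * b powr (1 - \<alpha>)"
  have c: "c > 0" using ab by (simp add: c_def)
  have "(\<integral>\<^sup>+x. ennreal (F x powr \<alpha> * G x powr (1 - \<alpha>)) \<partial>M) \<le> (\<integral>\<^sup>+x. ennreal (c * \<alpha> / a) * ennreal (F x) + ennreal (c * (1 - \<alpha>) / b) * ennreal (G x) \<partial>M)"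
  proof (rule nn_integral_mono)
    fix x
    have "F x powr \<alpha> * G x powr (1 - \<alpha>) \<le> c * \<alpha> / a * F x + c * (1 - \<alpha>) / b * G x"
    proof (cases "F x = 0 \<or> G x = 0")
      case True
      moreover have "0 \<le> c * \<alpha> / a * F x + c * (1 - \<alpha>) / b * G x"
        using nonneg c ab \<alpha> by simp
      ultimately show ?thesis by auto
    next
      case False
      then have pos: "F x > 0" "G x > 0" using nonneg order_less_le by metis+
      have "(F x / a) powr \<alpha> * (G x / b) powr (1 - \<alpha>) \<le> \<alpha> * (F x / a) + (1 - \<alpha>) * (G x / b)"
        using \<alpha> pos ab by (intro Youngs_inequality_0) auto
      then have "c * ((F x / a) powr \<alpha> * (G x / b) powr (1 - \<alpha>)) \<le> c * (\<alpha> * (F x / a) + (1 - \<alpha>) * (G x / b))"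
        using c by (intro mult_left_mono) auto
      moreover have "c * ((F x / a) powr \<alpha> * (G x / b) powr (1 - \<alpha>)) = F x powr \<alpha> * G x powr (1 - \<alpha>)"
        unfolding c_def using ab pos by (simp add: powr_divide)
      ultimately show ?thesis by (simp add: algebra_simps)
    qed
    then show "ennreal (F x powr \<alpha> * G x powr (1 - \<alpha>)) \<le> ennreal (c * \<alpha> / a) * ennreal (F x) + ennreal (c * (1 - \<alpha>) / b) * ennreal (G x)"
      using nonneg c ab \<alpha> by (simp add: ennreal_mult[symmetric] ennreal_plus[symmetric] ennreal_leI del: ennreal_plus)
  qed
  also have "\<dots> = ennreal (c * \<alpha> / a) * ennreal a + ennreal (c * (1 - \<alpha>) / b) * ennreal b"
    by (subst nn_integral_add) (auto simp: nn_integral_cmult IF IG)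
  also have "\<dots> = ennreal (c * \<alpha> + c * (1 - \<alpha>))"
    using ab c \<alpha> by (simp add: ennreal_mult[symmetric] ennreal_plus[symmetric] del: ennreal_plus)
  also have "c * \<alpha> + c * (1 - \<alpha>) = c" by (simp add: algebra_simps)
  finally show ?thesis by (simp add: c_def)
qed

text \<open>Bernoulli's inequality, read off from the weighted arithmetic-geometric inequality for
  \<open>(1 - y) powr p\<close> and 1 with weight \<open>1 / p\<close>.\<close>

lemma one_minus_powr_ge:
  assumes "p > 1" "0 \<le> y" "y \<le> (1::real)"
  shows "(1 - y) powr p \<ge> 1 - p * y"
proof (cases "y = 1")
  case False
  then have "((1 - y) powr p) powr (1 / p) * 1 powr (1 - 1 / p) \<le> (1 / p) * (1 - y) powr p + (1 - 1 / p) * 1"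
    using assms by (intro Youngs_inequality_0) auto
  then have "1 - y \<le> (1 / p) * (1 - y) powr p + (1 - 1 / p)"
    using assms by (simp add: powr_powr)
  then have "p * (1 - y) \<le> p * ((1 / p) * (1 - y) powr p + (1 - 1 / p))"
    using assms by (intro mult_left_mono) auto
  then show ?thesis using assms by (simp add: algebra_simps)
qed (use assms in simp)

text \<open>The minimizer is normalized in \<open>L\<^sup>p\<close>, so its energy is the Sobolev
  constant \<open>S\<close> itself. The inequality \<open>sob\<close> is stated on
  \<open>C1c\<close> functions only and reaches products \<open>m u\<close> through
  \<open>sob_econv\<close>.\<close>

locale minimizer =
  fixes \<sigma> S N p :: real and u :: "'a::euclidean_space \<times> real \<Rightarrow> real" and \<phi>0 :: "nat \<Rightarrow> 'a \<times> real \<Rightarrow> real"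
  assumes N_def: "N = dimn TYPE('a \<times> real)" and p_def: "p = crit_exp \<sigma> TYPE('a \<times> real)"
    and \<sigma>: "1/2 < \<sigma>" "\<sigma> < 1" and conv: "econv \<sigma> \<phi>0 u" and lp_u: "lp_int \<sigma> half_space u = 1"
    and S0: "S \<ge> 0" and gen_u: "gen \<sigma> u = ennreal S"
    and sob: "\<And>f :: 'a \<times> real \<Rightarrow> real. f \<in> C1c half_space \<Longrightarrow> ennreal S * lp_den \<sigma> half_space f \<le> gen \<sigma> f"
begin

lemma \<sigma>_pos: "0 < \<sigma>" using \<sigma> by simp

lemma p_gt_2: "p > 2" unfolding p_def by (rule crit_exp_gt_2[OF \<sigma>_pos \<sigma>(2)])

lemma N_ge_2: "N \<ge> 2" unfolding N_def by (rule dimn_ge_2)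

lemma lp_int_p: "lp_int \<sigma> \<Omega> f = (\<integral>\<^sup>+x. indicator \<Omega> x * ennreal (\<bar>f x\<bar> powr p) \<partial>lborel)"
  for f :: "'a \<times> real \<Rightarrow> real"
  by (simp add: lp_int_def p_def)

lemma two_div_p: "(N - 2 * \<sigma>) / N = 2 / p"
  using N_ge_2 by (simp add: crit_exp_def p_def N_def field_simps)

lemma u_measurable [measurable]: "u \<in> borel_measurable borel"
  using econv_measurable[OF conv] by simp

lemma lp_den_real: "lp_int \<sigma> half_space f = ennreal L \<Longrightarrow> L \<ge> 0 \<Longrightarrow> lp_den \<sigma> half_space (f :: 'a \<times> real \<Rightarrow> real) = ennreal (L powr (2 / p))"
  by (simp add: lp_den_def two_div_p[symmetric] N_def)

lemma sob_econv: "econv \<sigma> \<psi> v \<Longrightarrow> ennreal S * lp_den \<sigma> half_space v \<le> gen \<sigma> v"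
  for v :: "'a \<times> real \<Rightarrow> real"
proof -
  assume v: "econv \<sigma> \<psi> v"
  have "\<psi> k \<in> C1c half_space" for k using v by (simp add: econv_def)
  then have "ennreal S * lp_den \<sigma> half_space (\<psi> k) \<le> gen \<sigma> (\<psi> k)" for k using sob by blast
  then show ?thesis using econv_ineq[OF \<sigma>_pos \<sigma>(2) v, of "\<lambda>_. 0" S 0] by simp
qed

definition pint :: "('a \<times> real \<Rightarrow> real) \<Rightarrow> ennreal" where
  "pint m = (\<integral>\<^sup>+x. indicator half_space x * ennreal (\<bar>u x\<bar> powr p * (m x)\<^sup>2) \<partial>lborel)"

text \<open>The localization error in \<open>(A a - D b)\<^sup>2 = (a - b) (A\<^sup>2 a - D\<^sup>2
  b) + a b (A - D)\<^sup>2\<close>, with \<open>A\<close> and \<open>D\<close> the values of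
  \<open>m\<close>. Absolute values on \<open>u\<close> keep it nonnegative for a minimizer of
  unknown sign.\<close>

definition lam :: "('a \<times> real \<Rightarrow> real) \<Rightarrow> ennreal" where
  "lam m = (\<integral>\<^sup>+z. ennreal (\<bar>u (fst z)\<bar> * \<bar>u (snd z)\<bar> * (m (fst z) - m (snd z))\<^sup>2) \<partial>gmeas \<sigma>)"

lemma pint_le:
  assumes "\<And>x. x \<in> half_space \<Longrightarrow> \<bar>m x\<bar> \<le> C"
  shows "pint m \<le> ennreal (C\<^sup>2)"
proof -
  have "pint m \<le> (\<integral>\<^sup>+x. ennreal (C\<^sup>2) * (indicator half_space x * ennreal (\<bar>u x\<bar> powr p)) \<partial>lborel)"
    unfolding pint_def
  proof (rule nn_integral_mono)
    fix x
    show "indicator half_space x * ennreal (\<bar>u x\<bar> powr p * (m x)\<^sup>2) \<le> ennreal (C\<^sup>2) * (indicator half_space x * ennreal (\<bar>u x\<bar> powr p))"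
    proof (cases "x \<in> half_space")
      case True
      have "\<bar>m x\<bar> \<le> \<bar>C\<bar>" using assms[OF True] by linarith
      then have "(m x)\<^sup>2 \<le> C\<^sup>2" by (simp add: abs_le_square_iff)
      then have "\<bar>u x\<bar> powr p * (m x)\<^sup>2 \<le> C\<^sup>2 * \<bar>u x\<bar> powr p" by (subst mult.commute) (rule mult_right_mono, auto)
      then show ?thesis using True by (simp add: ennreal_mult[symmetric] ennreal_leI)
    qed simp
  qed
  also have "\<dots> = ennreal (C\<^sup>2) * lp_int \<sigma> half_space u"
    unfolding lp_int_p by (rule nn_integral_cmult) measurable
  finally show ?thesis by (simp add: lp_u)
qed

text \<open>The Sobolev inequality for the competitor \<open>(1 - s m\<^sup>2) u\<close>.
  Bernoulli's inequality bounds its \<open>L\<^sup>p\<close> mass from below by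
  \<open>1 - p s B\<close>, and an exact expansion bounds its energy from above. Every negative term
  is moved across, as \<open>ennreal\<close> has no subtraction to rely on.\<close>

lemma perturbation:
  assumes m: "multiplier m" and C: "\<And>x. x \<in> half_space \<Longrightarrow> \<bar>m x\<bar> \<le> C"
    and B: "pint m = ennreal B" "B \<ge> 0" and G: "gen \<sigma> (\<lambda>x. m x * u x) = ennreal G" "G \<ge> 0"
    and L: "lam m = ennreal L" "L \<ge> 0" and Q: "gen \<sigma> (\<lambda>x. m x * m x * u x) = ennreal Q" "Q \<ge> 0"
    and s: "s > 0" "s * C\<^sup>2 \<le> 1" "p * s * B \<le> 1"
  shows "S * (1 - p * s * B) powr (2 / p) + 2 * s * G \<le> S + 2 * s * L + s\<^sup>2 * Q"
proof -
  have [measurable]: "m \<in> borel_measurable borel" by (rule multiplier_measurable[OF m])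
  define v where "v x = (1 + (- s) * (m x * m x)) * u x" for x
  have [measurable]: "v \<in> borel_measurable borel" unfolding v_def by measurable
  have "multiplier (\<lambda>x. 1 + (- s) * (m x * m x))"
    by (intro multiplier_add multiplier_mult multiplier_const m)
  then have v: "econv \<sigma> (\<lambda>k x. (1 + (- s) * (m x * m x)) * \<phi>0 k x) v"
    unfolding v_def by (rule multiplier_econv[OF \<sigma> _ conv])
  obtain V where V: "gen \<sigma> v = ennreal V" "V \<ge> 0"
    using Hdot_gen_finite[OF \<sigma>_pos \<sigma>(2) v] by (cases "gen \<sigma> v") auto
  obtain Lv where Lv: "lp_int \<sigma> half_space v = ennreal Lv" "Lv \<ge> 0"
    using Hdot_lp_finite[OF \<sigma>_pos \<sigma>(2) v] by (cases "lp_int \<sigma> half_space v") auto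
  have "1 \<le> ennreal Lv + ennreal (p * s) * ennreal B"
  proof -
    have "lp_int \<sigma> half_space u \<le> (\<integral>\<^sup>+x. indicator half_space x * ennreal (\<bar>v x\<bar> powr p) + ennreal (p * s) * (indicator half_space x * ennreal (\<bar>u x\<bar> powr p * (m x)\<^sup>2)) \<partial>lborel)"
      unfolding lp_int_p
    proof (rule nn_integral_mono)
      fix x
      show "indicator half_space x * ennreal (\<bar>u x\<bar> powr p) \<le> indicator half_space x * ennreal (\<bar>v x\<bar> powr p) + ennreal (p * s) * (indicator half_space x * ennreal (\<bar>u x\<bar> powr p * (m x)\<^sup>2))"
      proof (cases "x \<in> half_space")
        case True
        have "\<bar>m x\<bar> \<le> \<bar>C\<bar>" using C[OF True] by linarith
        then have "(m x)\<^sup>2 \<le> C\<^sup>2" by (simp add: abs_le_square_iff)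
        then have "s * (m x)\<^sup>2 \<le> s * C\<^sup>2" using s by (intro mult_left_mono) auto
        then have y: "s * (m x)\<^sup>2 \<le> 1" using s by linarith
        have "1 - p * (s * (m x)\<^sup>2) \<le> (1 - s * (m x)\<^sup>2) powr p"
          using p_gt_2 s y by (intro one_minus_powr_ge) auto
        then have "1 \<le> (1 - s * (m x)\<^sup>2) powr p + p * s * (m x)\<^sup>2" by (simp add: algebra_simps)
        from mult_left_mono[OF this, of "\<bar>u x\<bar> powr p"]
        have "\<bar>u x\<bar> powr p \<le> \<bar>u x\<bar> powr p * (1 - s * (m x)\<^sup>2) powr p + p * s * (\<bar>u x\<bar> powr p * (m x)\<^sup>2)"
          by (simp add: algebra_simps)
        also have "\<bar>u x\<bar> powr p * (1 - s * (m x)\<^sup>2) powr p = \<bar>v x\<bar> powr p"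
        proof -
          have "v x = (1 - s * (m x)\<^sup>2) * u x" by (simp add: v_def power2_eq_square)
          then have "\<bar>v x\<bar> = (1 - s * (m x)\<^sup>2) * \<bar>u x\<bar>" using y by (simp add: abs_mult)
          then show ?thesis using y by (simp add: powr_mult mult.commute)
        qed
        finally have "ennreal (\<bar>u x\<bar> powr p) \<le> ennreal (\<bar>v x\<bar> powr p + p * s * (\<bar>u x\<bar> powr p * (m x)\<^sup>2))" by (rule ennreal_leI)
        then show ?thesis using True s p_gt_2 by (simp add: ennreal_mult)
      qed simp
    qed
    also have "\<dots> = lp_int \<sigma> half_space v + ennreal (p * s) * pint m"
      unfolding lp_int_p pint_def by (subst nn_integral_add) (auto simp: nn_integral_cmult)
    finally show ?thesis by (simp add: lp_u Lv B)
  qed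
  then have "1 \<le> Lv + p * s * B"
    using s p_gt_2 B Lv by (simp add: ennreal_mult[symmetric] ennreal_plus[symmetric] del: ennreal_plus)
  then have "(1 - p * s * B) powr (2 / p) \<le> Lv powr (2 / p)"
    using s p_gt_2 by (intro powr_mono2) auto
  then have "S * (1 - p * s * B) powr (2 / p) \<le> S * Lv powr (2 / p)" using S0 by (rule mult_left_mono)
  also have "\<dots> \<le> V"
    using sob_econv[OF v] S0 V unfolding lp_den_real[OF Lv] by (simp add: ennreal_mult[symmetric])
  finally have 1: "S * (1 - p * s * B) powr (2 / p) \<le> V" .
  have "gen \<sigma> v + ennreal (2 * s) * gen \<sigma> (\<lambda>x. m x * u x) =
     (\<integral>\<^sup>+z. ennreal ((v (fst z) - v (snd z))\<^sup>2) + ennreal (2 * s) * ennreal ((m (fst z) * u (fst z) - m (snd z) * u (snd z))\<^sup>2) \<partial>gmeas \<sigma>)"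
    unfolding gen_def by (subst nn_integral_add) (auto simp: nn_integral_cmult)
  also have "\<dots> \<le> (\<integral>\<^sup>+z. ennreal ((u (fst z) - u (snd z))\<^sup>2) + (ennreal (2 * s) * ennreal (\<bar>u (fst z)\<bar> * \<bar>u (snd z)\<bar> * (m (fst z) - m (snd z))\<^sup>2)
      + ennreal (s\<^sup>2) * ennreal ((m (fst z) * m (fst z) * u (fst z) - m (snd z) * m (snd z) * u (snd z))\<^sup>2)) \<partial>gmeas \<sigma>)"
  proof (rule nn_integral_mono)
    fix z
    define a b A D where "a = u (fst z)" and "b = u (snd z)" and "A = m (fst z)" and "D = m (snd z)"
    have "a * b \<le> \<bar>a\<bar> * \<bar>b\<bar>" by (metis abs_ge_self abs_mult)
    then have ab: "2 * s * (a * b * (A - D)\<^sup>2) \<le> 2 * s * (\<bar>a\<bar> * \<bar>b\<bar> * (A - D)\<^sup>2)"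
      using s by (intro mult_left_mono mult_right_mono) auto
    \<comment> \<open>Expansion of the squared difference of the competitor; the localization
      identity has been applied to the term linear in \<open>s\<close>, and the quadratic term is
      the energy density of \<open>m\<^sup>2 u\<close>.\<close>
    have "((1 + (- s) * (A * A)) * a - (1 + (- s) * (D * D)) * b)\<^sup>2 + 2 * s * (A * a - D * b)\<^sup>2
      = (a - b)\<^sup>2 + (2 * s * (a * b * (A - D)\<^sup>2) + s\<^sup>2 * (A * A * a - D * D * b)\<^sup>2)"
      by (simp add: power2_eq_square algebra_simps)
    also have "\<dots> \<le> (a - b)\<^sup>2 + (2 * s * (\<bar>a\<bar> * \<bar>b\<bar> * (A - D)\<^sup>2) + s\<^sup>2 * (A * A * a - D * D * b)\<^sup>2)"
      using ab by linarith
    finally have "ennreal (((1 + (- s) * (A * A)) * a - (1 + (- s) * (D * D)) * b)\<^sup>2 + 2 * s * (A * a - D * b)\<^sup>2)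
      \<le> ennreal ((a - b)\<^sup>2 + (2 * s * (\<bar>a\<bar> * \<bar>b\<bar> * (A - D)\<^sup>2) + s\<^sup>2 * (A * A * a - D * D * b)\<^sup>2))" by (rule ennreal_leI)
    then show "ennreal ((v (fst z) - v (snd z))\<^sup>2) + ennreal (2 * s) * ennreal ((m (fst z) * u (fst z) - m (snd z) * u (snd z))\<^sup>2)
      \<le> ennreal ((u (fst z) - u (snd z))\<^sup>2) + (ennreal (2 * s) * ennreal (\<bar>u (fst z)\<bar> * \<bar>u (snd z)\<bar> * (m (fst z) - m (snd z))\<^sup>2)
      + ennreal (s\<^sup>2) * ennreal ((m (fst z) * m (fst z) * u (fst z) - m (snd z) * m (snd z) * u (snd z))\<^sup>2))"
      unfolding v_def a_def[symmetric] b_def[symmetric] A_def[symmetric] D_def[symmetric]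
      using s by (simp only: ennreal_mult[symmetric] ennreal_plus[symmetric] zero_le_power2 mult_nonneg_nonneg abs_ge_zero add_nonneg_nonneg less_imp_le zero_le_numeral)
  qed
  also have "\<dots> = gen \<sigma> u + (ennreal (2 * s) * lam m + ennreal (s\<^sup>2) * gen \<sigma> (\<lambda>x. m x * m x * u x))"
  proof -
    have "(\<integral>\<^sup>+z. f z + (ennreal (2 * s) * g z + ennreal (s\<^sup>2) * h z) \<partial>gmeas \<sigma>) = (\<integral>\<^sup>+z. f z \<partial>gmeas \<sigma>) + (ennreal (2 * s) * (\<integral>\<^sup>+z. g z \<partial>gmeas \<sigma>) + ennreal (s\<^sup>2) * (\<integral>\<^sup>+z. h z \<partial>gmeas \<sigma>))"
      if [measurable]: "f \<in> borel_measurable (borel \<Otimes>\<^sub>M borel)" "g \<in> borel_measurable (borel \<Otimes>\<^sub>M borel)" "h \<in> borel_measurable (borel \<Otimes>\<^sub>M borel)"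
      for f g h :: "('a \<times> real) \<times> ('a \<times> real) \<Rightarrow> ennreal"
      by (simp add: nn_integral_add nn_integral_cmult)
    then show ?thesis unfolding gen_def lam_def by this measurable
  qed
  finally have "ennreal V + ennreal (2 * s) * ennreal G \<le> ennreal S + (ennreal (2 * s) * ennreal L + ennreal (s\<^sup>2) * ennreal Q)"
    unfolding V G L Q gen_u .
  then have "V + 2 * s * G \<le> S + (2 * s * L + s\<^sup>2 * Q)"
    using s V G L Q S0 by (simp add: ennreal_mult[symmetric] ennreal_plus[symmetric] del: ennreal_plus)
  with 1 show ?thesis by linarith
qed

text \<open>One half of the weak Euler--Lagrange equation, tested with \<open>m\<^sup>2 u\<close>.\<close>
lemma euler_lagrange:
  assumes m: "multiplier m"
  shows "gen \<sigma> (\<lambda>x. m x * u x) \<le> ennreal S * pint m + lam m"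
proof (cases "lam m = \<infinity>")
  case False
  obtain C where C: "C \<ge> 0" "\<And>x. x \<in> half_space \<Longrightarrow> \<bar>m x\<bar> \<le> C"
    using m unfolding multiplier_def mult_bound_def by blast
  obtain B where B: "pint m = ennreal B" "B \<ge> 0"
  proof -
    have "pint m \<le> ennreal (C\<^sup>2)" by (rule pint_le) (rule C(2))
    then show ?thesis using that by (cases "pint m") (auto simp: top_unique)
  qed
  have mu: "econv \<sigma> (\<lambda>k x. m x * \<phi>0 k x) (\<lambda>x. m x * u x)" by (rule multiplier_econv[OF \<sigma> m conv])
  have mmu: "econv \<sigma> (\<lambda>k x. (m x * m x) * \<phi>0 k x) (\<lambda>x. (m x * m x) * u x)"
    by (rule multiplier_econv[OF \<sigma> multiplier_mult[OF m m] conv])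
  obtain G where G: "gen \<sigma> (\<lambda>x. m x * u x) = ennreal G" "G \<ge> 0"
    using Hdot_gen_finite[OF \<sigma>_pos \<sigma>(2) mu] by (cases "gen \<sigma> (\<lambda>x. m x * u x)") auto
  obtain Q where Q: "gen \<sigma> (\<lambda>x. m x * m x * u x) = ennreal Q" "Q \<ge> 0"
    using Hdot_gen_finite[OF \<sigma>_pos \<sigma>(2) mmu] by (cases "gen \<sigma> (\<lambda>x. m x * m x * u x)") auto
  obtain L where L: "lam m = ennreal L" "L \<ge> 0" using False by (cases "lam m") auto
  \<comment> \<open>At \<open>s = 0\<close> the value is \<open>S\<close> and the derivative is
    \<open>- 2 S B\<close>. Dividing \<open>perturbation\<close> by \<open>s\<close> and letting
    \<open>s\<close> decrease to 0 therefore leaves the first-order inequality and removes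
    \<open>Q\<close>.\<close>
  define h where "h s = S * (1 - p * s * B) powr (2 / p)" for s
  have "(h has_real_derivative S * ((2 / p) * (1 - p * 0 * B) powr (2 / p - 1) * (- p * B))) (at 0)"
    unfolding h_def by (auto intro!: derivative_eq_intros)
  then have "(h has_real_derivative - 2 * S * B) (at 0)" using p_gt_2 by (simp add: mult_ac)
  then have "((\<lambda>s. (h s - h 0) / (s - 0)) \<longlongrightarrow> - 2 * S * B) (at 0)"
    unfolding has_field_derivative_iff .
  moreover have "h 0 = S" by (simp add: h_def)
  ultimately have "((\<lambda>s. (h s - S) / s) \<longlongrightarrow> - 2 * S * B) (at 0)" by simp
  then have "((\<lambda>s. (h s - S) / s) \<longlongrightarrow> - 2 * S * B) (at_right 0)"
    by (rule tendsto_mono[OF at_le[OF subset_UNIV]])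
  then have "((\<lambda>s. (h s - S) / s + 2 * G) \<longlongrightarrow> - 2 * S * B + 2 * G) (at_right 0)"
    by (intro tendsto_intros)
  moreover have "((\<lambda>s. 2 * L + s * Q) \<longlongrightarrow> 2 * L + 0 * Q) (at_right 0)"
    by (intro tendsto_intros)
  moreover have "eventually (\<lambda>s. (h s - S) / s + 2 * G \<le> 2 * L + s * Q) (at_right 0)"
  proof -
    \<comment> \<open>These two bounds on \<open>s\<close> are the smallness conditions of
      \<open>perturbation\<close>; the added 1 avoids division by zero.\<close>
    have "eventually (\<lambda>s. s \<in> {0<..<min (1 / (C\<^sup>2 + 1)) (1 / (p * B + 1))}) (at_right 0)"
      using p_gt_2 B(2) by (intro eventually_at_right_real) (auto intro!: divide_pos_pos add_nonneg_pos)
    then show ?thesis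
    proof eventually_elim
      case (elim s)
      then have s: "s > 0" "s < 1 / (C\<^sup>2 + 1)" "s < 1 / (p * B + 1)" by auto
      have "s * (C\<^sup>2 + 1) < 1" using s(2) by (simp add: pos_less_divide_eq add_nonneg_pos)
      then have s2: "s * C\<^sup>2 \<le> 1" using s(1) by (simp add: algebra_simps)
      have "s * (p * B + 1) < 1" using s(3) p_gt_2 B(2) by (simp add: pos_less_divide_eq add_nonneg_pos)
      then have s3: "p * s * B \<le> 1" using s(1) by (simp add: algebra_simps)
      have "h s + 2 * s * G \<le> S + 2 * s * L + s\<^sup>2 * Q"
        unfolding h_def by (rule perturbation[OF m C(2) B G L Q s(1) s2 s3])
      then have "(h s - S) + 2 * G * s \<le> (2 * L + s * Q) * s" by (simp add: algebra_simps power2_eq_square)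
      then have "((h s - S) + 2 * G * s) / s \<le> 2 * L + s * Q" using s(1) by (simp add: pos_divide_le_eq)
      then show ?case using s(1) by (simp add: add_divide_distrib)
    qed
  qed
  ultimately have "- 2 * S * B + 2 * G \<le> 2 * L + 0 * Q"
    by (intro tendsto_le[OF trivial_limit_at_right_real])
  then have "G \<le> S * B + L" by simp
  then have "ennreal G \<le> ennreal (S * B + L)" by (rule ennreal_leI)
  then show ?thesis using S0 B(2) L(2) by (simp add: G B L ennreal_mult)
qed simp

definition strip :: "real \<Rightarrow> ennreal" where
  "strip \<delta> = (\<integral>\<^sup>+x. indicator half_space x * ennreal (\<bar>u x\<bar> powr p) * indicator {..<\<delta>} (snd x) \<partial>lborel)"

text \<open>The strips shrink to nothing inside the half-space, so dominated convergence applies.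
  This smallness absorbs the nonlinear term of the Euler-Lagrange inequality, both for boundary
  decay and near the chosen boundary point.\<close>

lemma strip_small:
  assumes "\<epsilon> > 0"
  obtains \<delta> where "\<delta> > 0" "strip \<delta> \<le> ennreal \<epsilon>"
proof -
  let ?f = "\<lambda>x. indicator half_space x * ennreal (\<bar>u x\<bar> powr p)"
  have "(\<lambda>k. \<integral>\<^sup>+x. ?f x * indicator {..<1 / real (Suc k)} (snd x) \<partial>lborel) \<longlonglongrightarrow> (\<integral>\<^sup>+x. 0 \<partial>(lborel :: ('a \<times> real) measure))"
  proof (rule nn_integral_dominated_convergence[where w="?f"])
    show "(\<integral>\<^sup>+x. ?f x \<partial>lborel) < \<infinity>" using lp_u unfolding lp_int_p by simp
    show "AE x in lborel. (\<lambda>k. ?f x * indicator {..<1 / real (Suc k)} (snd x)) \<longlonglongrightarrow> 0"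
    proof (rule AE_I2)
      fix x :: "'a \<times> real"
      show "(\<lambda>k. ?f x * indicator {..<1 / real (Suc k)} (snd x)) \<longlonglongrightarrow> 0"
      proof (cases "x \<in> half_space")
        case True
        then have x: "snd x > 0" by (simp add: half_space_def)
        have "(\<lambda>k. 1 / real (Suc k)) \<longlonglongrightarrow> 0" by (intro LIMSEQ_Suc[OF lim_1_over_n])
        then have "eventually (\<lambda>k. 1 / real (Suc k) < snd x) sequentially" using x by (rule order_tendstoD)
        then have "eventually (\<lambda>k. ?f x * indicator {..<1 / real (Suc k)} (snd x) = 0) sequentially"
          by eventually_elim simp
        then show ?thesis by (rule tendsto_eventually)
      qed simp
    qed
  qed (auto simp: indicator_def)
  then have "(\<lambda>k. strip (1 / real (Suc k))) \<longlonglongrightarrow> 0" by (simp add: strip_def)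
  then have "eventually (\<lambda>k. strip (1 / real (Suc k)) < ennreal \<epsilon>) sequentially"
    using assms by (intro order_tendstoD(2)) auto
  then obtain k where "strip (1 / real (Suc k)) < ennreal \<epsilon>" by (auto simp: eventually_sequentially)
  then show ?thesis using that[of "1 / real (Suc k)"] by (simp add: less_imp_le)
qed

end

section \<open>Decay of a minimizer at the boundary\<close>

lemma powr_minus_diff_le:
  fixes a b c \<alpha> :: real
  assumes "0 < c" "c \<le> a" "c \<le> b" "\<alpha> > 0"
  shows "\<bar>a powr (- \<alpha>) - b powr (- \<alpha>)\<bar> \<le> \<alpha> * c powr (- \<alpha> - 1) * \<bar>a - b\<bar>"
proof -
  have *: "\<bar>a powr (- \<alpha>) - b powr (- \<alpha>)\<bar> \<le> \<alpha> * c powr (- \<alpha> - 1) * \<bar>a - b\<bar>" if "a < b" "c \<le> a" for a b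
  proof -
    have "\<exists>z. z > a \<and> z < b \<and> b powr (- \<alpha>) - a powr (- \<alpha>) = (b - a) * (- \<alpha> * z powr (- \<alpha> - 1))"
      using that assms(1) by (intro MVT2) (auto intro!: derivative_eq_intros)
    then obtain z where z: "z > a" "b powr (- \<alpha>) - a powr (- \<alpha>) = (b - a) * (- \<alpha> * z powr (- \<alpha> - 1))" by blast
    have "\<bar>a powr (- \<alpha>) - b powr (- \<alpha>)\<bar> = \<alpha> * z powr (- \<alpha> - 1) * \<bar>a - b\<bar>"
      using z that assms(4) by (subst abs_minus_commute) (simp add: abs_mult abs_minus_commute)
    also have "\<dots> \<le> \<alpha> * c powr (- \<alpha> - 1) * \<bar>a - b\<bar>"
      using z that assms by (intro mult_right_mono mult_left_mono powr_mono2') auto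
    finally show ?thesis .
  qed
  consider "a < b" | "b < a" | "a = b" by linarith
  then show ?thesis
  proof cases
    case 1 then show ?thesis using * assms by blast
  next
    case 2
    then show ?thesis using *[of b a] assms by (simp add: abs_minus_commute)
  next
    case 3 then show ?thesis using assms by simp
  qed
qed

text \<open>The shift \<open>\<tau>\<close> makes the singular weight bounded. If
  \<open>snd y < snd x / 2\<close>, then \<open>dist x y\<close> exceeds \<open>snd x / 2\<close>
  and the sup bound is enough; otherwise the mean value theorem applies at heights above
  \<open>snd x / 2 + \<tau>\<close>.\<close>

lemma multiplier_shifted_power:
  assumes \<tau>: "\<tau> > 0" and \<alpha>: "0 < \<alpha>" "\<alpha> \<le> 1"
  shows "multiplier (\<lambda>x :: 'a::euclidean_space \<times> real. (snd x + \<tau>) powr (- \<alpha>))"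
proof -
  let ?w = "\<lambda>x :: 'a \<times> real. (snd x + \<tau>) powr (- \<alpha>)"
  define C where "C = 2 * \<tau> powr (- \<alpha>)"
  have C0: "C \<ge> 0" by (simp add: C_def)
  have w: "0 \<le> ?w x" "?w x \<le> \<tau> powr (- \<alpha>)" if "x \<in> half_space" for x
    using that \<tau> \<alpha> by (auto simp: half_space_def intro!: powr_mono2')
  have "mult_bound ?w C"
    unfolding mult_bound_def
  proof (intro conjI ballI C0)
    fix x :: "'a \<times> real" assume x: "x \<in> half_space"
    have "\<tau> powr (- \<alpha>) \<ge> 0" by simp
    with w[OF x] show "\<bar>?w x\<bar> \<le> C" unfolding C_def by linarith
    fix y :: "'a \<times> real" assume y: "y \<in> half_space"
    have sx: "snd x > 0" and sy: "snd y > 0" using x y by (auto simp: half_space_def)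
    have ds: "\<bar>snd x - snd y\<bar> \<le> dist x y" using dist_snd_le[of x y] by (simp add: dist_real_def)
    show "\<bar>?w x - ?w y\<bar> \<le> C * (dist x y / snd x)"
    proof (cases "snd y \<ge> snd x / 2")
      case False
      then have "1 \<le> 2 * (dist x y / snd x)" using ds sx by (simp add: field_simps)
      then have "\<tau> powr (- \<alpha>) * 1 \<le> \<tau> powr (- \<alpha>) * (2 * (dist x y / snd x))" by (intro mult_left_mono) auto
      moreover have "\<bar>?w x - ?w y\<bar> \<le> \<tau> powr (- \<alpha>)" using w[OF x] w[OF y] by linarith
      moreover have "C * (dist x y / snd x) = \<tau> powr (- \<alpha>) * (2 * (dist x y / snd x))" by (simp add: C_def)
      ultimately show ?thesis by linarith
    next
      case True
      define c where "c = snd x / 2 + \<tau>"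
      have "\<bar>?w x - ?w y\<bar> \<le> \<alpha> * c powr (- \<alpha> - 1) * \<bar>snd x + \<tau> - (snd y + \<tau>)\<bar>"
        using True sx \<tau> \<alpha> by (intro powr_minus_diff_le) (auto simp: c_def)
      also have "\<dots> \<le> 1 * (\<tau> powr (- \<alpha>) * (2 / snd x)) * dist x y"
      proof (intro mult_mono)
        have "c powr (- \<alpha> - 1) = c powr (- \<alpha>) * c powr (- 1)" by (simp only: powr_add[symmetric] diff_conv_add_uminus)
        also have "\<dots> \<le> \<tau> powr (- \<alpha>) * (snd x / 2) powr (- 1)"
          using sx \<tau> \<alpha> by (intro mult_mono powr_mono2') (auto simp: c_def)
        also have "(snd x / 2) powr (- 1) = 2 / snd x" using sx by (simp add: powr_minus_divide)
        finally show "c powr (- \<alpha> - 1) \<le> \<tau> powr (- \<alpha>) * (2 / snd x)" .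
      qed (use ds \<alpha> sx in auto)
      also have "\<dots> = C * (dist x y / snd x)" by (simp add: C_def)
      finally show ?thesis .
    qed
  qed
  moreover have "C1_on half_space ?w"
  proof (rule C1_on_compose[where V="{0<..}" and g="\<lambda>t. (t + \<tau>) powr (- \<alpha>)"])
    show "C1_on half_space (snd :: 'a \<times> real \<Rightarrow> real)" by (rule C1_on_bounded_linear[OF bounded_linear_snd])
    show "C1_on {0<..} (\<lambda>t. (t + \<tau>) powr (- \<alpha>))"
    proof (rule C1_on_real[where f'="\<lambda>t. (- \<alpha>) * (t + \<tau>) powr (- \<alpha> - 1)"])
      fix t :: real assume "t \<in> {0<..}"
      then show "((\<lambda>t. (t + \<tau>) powr (- \<alpha>)) has_real_derivative (- \<alpha>) * (t + \<tau>) powr (- \<alpha> - 1)) (at t)"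
        using \<tau> by (auto intro!: derivative_eq_intros)
    next
      show "continuous_on {0<..} (\<lambda>t. (- \<alpha>) * (t + \<tau>) powr (- \<alpha> - 1))"
        using \<tau> by (intro continuous_intros) auto
    qed
  qed (auto simp: half_space_def)
  ultimately show ?thesis unfolding multiplier_def by auto
qed

text \<open>Let \<open>A\<close> and \<open>B\<close> be the two powers and
  \<open>X = A / B\<close>. Then \<open>(A - B)\<^sup>2 = A B (X + 1 / X - 2)\<close>. For
  \<open>s \<le> t\<close> one has \<open>1 \<le> X \<le> (t / s) powr \<alpha>\<close>: the shift
  only brings the ratio closer to 1, and \<open>X + 1 / X\<close> increases for
  \<open>X \<ge> 1\<close>. Concavity of the power \<open>\<alpha> / \<beta>\<close> then yields the
  factor \<open>\<alpha> / \<beta> < 1\<close> in front of the form in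
  \<open>ground_state_bound\<close>, whatever \<open>\<tau>\<close> is.\<close>

lemma shifted_power_comparison:
  fixes s t \<tau> \<alpha> \<beta> :: real
  assumes st: "s > 0" "t > 0" and \<tau>: "\<tau> > 0" and \<alpha>: "0 < \<alpha>" "\<alpha> < \<beta>"
  shows "((s + \<tau>) powr (- \<alpha>) - (t + \<tau>) powr (- \<alpha>))\<^sup>2 \<le>
    (\<alpha> / \<beta>) * ((s + \<tau>) powr (- \<alpha>) * (t + \<tau>) powr (- \<alpha>)) * ((t / s) powr \<beta> + (s / t) powr \<beta> - 2)"
proof -
  have *: "((s + \<tau>) powr (- \<alpha>) - (t + \<tau>) powr (- \<alpha>))\<^sup>2 \<le>
    (\<alpha> / \<beta>) * ((s + \<tau>) powr (- \<alpha>) * (t + \<tau>) powr (- \<alpha>)) * ((t / s) powr \<beta> + (s / t) powr \<beta> - 2)"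
    if st: "s > 0" "s \<le> t" for s t
  proof -
    define A B where "A = (s + \<tau>) powr (- \<alpha>)" and "B = (t + \<tau>) powr (- \<alpha>)"
    define X Y where "X = ((t + \<tau>) / (s + \<tau>)) powr \<alpha>" and "Y = (t / s) powr \<alpha>"
    have AB: "A > 0" "B > 0" using st \<tau> by (auto simp: A_def B_def)
    have X: "X = A / B" using st \<tau> by (simp add: X_def A_def B_def powr_divide powr_minus_divide)
    have X1: "1 \<le> X" using st \<tau> \<alpha> by (auto simp: X_def intro!: ge_one_powr_ge_zero)
    have "(t + \<tau>) / (s + \<tau>) \<le> t / s" using st \<tau> by (simp add: field_simps mult_left_mono)
    then have XY: "X \<le> Y" using st \<tau> \<alpha> by (auto simp: X_def Y_def intro!: powr_mono2)
    have Y: "Y > 0" "1 / Y = (s / t) powr \<alpha>" using st by (auto simp: Y_def powr_divide)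
    have "X + 1 / X \<le> Y + 1 / Y"
    proof -
      have "Y + 1 / Y - (X + 1 / X) = (Y - X) * (1 - 1 / (X * Y))" using X1 Y(1) by (simp add: field_simps)
      also have "\<dots> \<ge> 0"
      proof (rule mult_nonneg_nonneg)
        have "1 * 1 \<le> X * Y" using X1 XY by (intro mult_mono) auto
        then show "0 \<le> 1 - 1 / (X * Y)" by (simp add: divide_le_eq_1)
      qed (use XY in simp)
      finally show ?thesis by simp
    qed
    moreover have pw: "r powr \<alpha> \<le> (\<alpha> / \<beta>) * r powr \<beta> + (1 - \<alpha> / \<beta>)" if "r > 0" for r :: real
    proof -
      have "(r powr \<beta>) powr (\<alpha> / \<beta>) * 1 powr (1 - \<alpha> / \<beta>) \<le> (\<alpha> / \<beta>) * r powr \<beta> + (1 - \<alpha> / \<beta>) * 1"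
        using that \<alpha> by (intro Youngs_inequality_0) auto
      then show ?thesis using \<alpha> by (simp add: powr_powr)
    qed
    have "Y \<le> (\<alpha> / \<beta>) * (t / s) powr \<beta> + (1 - \<alpha> / \<beta>)" "1 / Y \<le> (\<alpha> / \<beta>) * (s / t) powr \<beta> + (1 - \<alpha> / \<beta>)"
      unfolding Y(2) unfolding Y_def using pw[of "t / s"] pw[of "s / t"] st by auto
    ultimately have "X + 1 / X - 2 \<le> (\<alpha> / \<beta>) * (t / s) powr \<beta> + (1 - \<alpha> / \<beta>) + ((\<alpha> / \<beta>) * (s / t) powr \<beta> + (1 - \<alpha> / \<beta>)) - 2"
      by linarith
    also have "\<dots> = (\<alpha> / \<beta>) * ((t / s) powr \<beta> + (s / t) powr \<beta> - 2)" by (simp add: algebra_simps)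
    finally have "A * B * (X + 1 / X - 2) \<le> A * B * ((\<alpha> / \<beta>) * ((t / s) powr \<beta> + (s / t) powr \<beta> - 2))"
      using AB by (intro mult_left_mono) auto
    moreover have "A * B * (X + 1 / X - 2) = (A - B)\<^sup>2" using AB by (simp add: X field_simps power2_eq_square)
    ultimately show ?thesis by (simp add: A_def B_def mult_ac)
  qed
  show ?thesis
  proof (cases "s \<le> t")
    case True then show ?thesis using * st by blast
  next
    case False
    then show ?thesis using *[of t s] st by (simp add: power2_commute mult_ac add_ac)
  qed
qed

lemma gen_abs_le: "gen \<sigma> (\<lambda>x. \<bar>f x\<bar>) \<le> gen \<sigma> f"
  unfolding gen_def
proof (intro nn_integral_mono ennreal_leI)
  fix z
  have "\<bar>\<bar>f (fst z)\<bar> - \<bar>f (snd z)\<bar>\<bar> \<le> \<bar>f (fst z) - f (snd z)\<bar>" by (rule abs_triangle_ineq3)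
  then show "(\<bar>f (fst z)\<bar> - \<bar>f (snd z)\<bar>)\<^sup>2 \<le> (f (fst z) - f (snd z))\<^sup>2" by (simp add: abs_le_square_iff)
qed

context minimizer
begin

lemma hmass_mult_finite:
  assumes m: "multiplier m"
  shows "hmass \<sigma> (\<lambda>x. m x * u x) < \<infinity>"
proof -
  obtain c where c: "c > 0" "\<And>\<phi> (u :: 'a \<times> real \<Rightarrow> real). econv \<sigma> \<phi> u \<Longrightarrow> ennreal c * hmass \<sigma> u \<le> gen \<sigma> u"
    by (rule hardy_Hdot[OF \<sigma>, where 'a='a]) (rule that)
  have mu: "econv \<sigma> (\<lambda>k x. m x * \<phi>0 k x) (\<lambda>x. m x * u x)" by (rule multiplier_econv[OF \<sigma> m conv])
  have "ennreal c * hmass \<sigma> (\<lambda>x. m x * u x) < \<infinity>"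
    using c(2)[OF mu] Hdot_gen_finite[OF \<sigma>_pos \<sigma>(2) mu] by (rule le_less_trans)
  then show ?thesis using c(1) by (auto simp: ennreal_mult_less_top)
qed

text \<open>Hoelder's inequality with exponents \<open>p / 2\<close> and its dual: the nonlinear
  term on \<open>A\<close> is at most the Sobolev norm of \<open>f\<close> times a positive power of
  the mass of \<open>u\<close> on \<open>A\<close>, hence absorbable when that mass is
  small.\<close>

lemma lp_local:
  fixes f :: "'a \<times> real \<Rightarrow> real"
  assumes [measurable]: "f \<in> borel_measurable borel" "A \<in> sets borel"
    and F: "lp_int \<sigma> half_space f = ennreal F" "F \<ge> 0"
    and G: "(\<integral>\<^sup>+x. indicator half_space x * ennreal (\<bar>u x\<bar> powr p) * indicator A x \<partial>lborel) = ennreal G" "G \<ge> 0"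
  shows "(\<integral>\<^sup>+x. indicator half_space x * ennreal ((f x)\<^sup>2 * \<bar>u x\<bar> powr (p - 2)) * indicator A x \<partial>lborel) \<le> ennreal (F powr (2 / p) * G powr (1 - 2 / p))"
proof -
  have p: "p > 2" by (rule p_gt_2)
  let ?F = "\<lambda>x. indicator half_space x * \<bar>f x\<bar> powr p"
  let ?G = "\<lambda>x. indicator half_space x * indicator A x * \<bar>u x\<bar> powr p"
  have "(\<integral>\<^sup>+x. ennreal (?F x powr (2 / p) * ?G x powr (1 - 2 / p)) \<partial>lborel) \<le> ennreal (F powr (2 / p) * G powr (1 - 2 / p))"
  proof (rule nn_integral_Hoelder)
    show "(\<integral>\<^sup>+x. ennreal (?F x) \<partial>lborel) = ennreal F"
      unfolding F(1)[symmetric] lp_int_p by (intro nn_integral_cong) (auto simp: indicator_def)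
    show "(\<integral>\<^sup>+x. ennreal (?G x) \<partial>lborel) = ennreal G"
      unfolding G(1)[symmetric] by (intro nn_integral_cong) (auto simp: indicator_def)
  qed (use p F G in auto)
  moreover have "indicator half_space x * ennreal ((f x)\<^sup>2 * \<bar>u x\<bar> powr (p - 2)) * indicator A x = ennreal (?F x powr (2 / p) * ?G x powr (1 - 2 / p))" for x
  proof (cases "x \<in> half_space \<and> x \<in> A")
    case True
    have "(\<bar>f x\<bar> powr p) powr (2 / p) = (f x)\<^sup>2" using p by (simp add: powr_powr powr_numeral)
    moreover have "p * (1 - 2 / p) = p - 2" using p by (simp add: field_simps)
    then have "(\<bar>u x\<bar> powr p) powr (1 - 2 / p) = \<bar>u x\<bar> powr (p - 2)" by (simp add: powr_powr)
    ultimately show ?thesis using True by simp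
  qed auto
  ultimately show ?thesis by simp
qed

text \<open>Test the Euler-Lagrange inequality with the shifted weight. The localization error is at
  most \<open>\<theta> G\<close> by the ground state bound; the nonlinear term is at most
  \<open>\<kappa> G\<close> in a thin strip and bounded outside it. As
  \<open>\<theta> + \<kappa> < 1\<close>, both are absorbed, and what remains does not depend on
  \<open>\<tau>\<close>.\<close>

lemma boundary_decay_truncated:
  assumes \<alpha>: "0 < \<alpha>" "\<alpha> < (2 * \<sigma> - 1) / 2"
  obtains K where "\<And>\<tau>. \<tau> > 0 \<Longrightarrow> gen \<sigma> (\<lambda>x. (snd x + \<tau>) powr (- \<alpha>) * u x) \<le> ennreal K"
proof -
  define \<beta> where "\<beta> = (2 * \<sigma> - 1) / 2"
  define \<theta> where "\<theta> = \<alpha> / \<beta>"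
  have \<beta>: "\<beta> > 0" "\<alpha> < \<beta>" using \<sigma> \<alpha> by (auto simp: \<beta>_def)
  have \<theta>: "0 < \<theta>" "\<theta> < 1" using \<alpha> \<beta> by (auto simp: \<theta>_def)
  have p: "p > 2" by (rule p_gt_2)
  \<comment> \<open>Half of the gap \<open>1 - \<theta>\<close>: one half pays for the nonlinear
    term near the boundary, the other stays on the left. The threshold \<open>e\<close> below makes
    the Hoelder factor of the strip at most \<open>\<kappa>\<close>.\<close>
  define \<kappa> where "\<kappa> = (1 - \<theta>) / 2"
  have \<kappa>: "\<kappa> > 0" using \<theta> by (simp add: \<kappa>_def)
  define e where "e = \<kappa> powr (1 / (1 - 2 / p))"
  have e: "e > 0" using \<kappa> by (simp add: e_def)
  have ek: "e powr (1 - 2 / p) = \<kappa>" using p \<kappa> by (simp add: e_def powr_powr)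
  obtain \<delta> where \<delta>: "\<delta> > 0" "strip \<delta> \<le> ennreal e" using strip_small[OF e] .
  obtain T where T: "strip \<delta> = ennreal T" "T \<ge> 0" "T \<le> e"
    using \<delta>(2) e by (cases "strip \<delta>") (auto simp: top_unique)
  have T\<kappa>: "T powr (1 - 2 / p) \<le> \<kappa>"
    unfolding ek[symmetric] using T p by (intro powr_mono2) auto
  show ?thesis
  proof (rule that[of "S * \<delta> powr (- 2 * \<alpha>) / \<kappa>"])
    fix \<tau> :: real assume \<tau>: "\<tau> > 0"
    define w where "w x = (snd x + \<tau>) powr (- \<alpha>)" for x :: "'a \<times> real"
    have m: "multiplier w" unfolding w_def[abs_def] using \<sigma> \<alpha> \<tau> by (intro multiplier_shifted_power) auto
    have [measurable]: "w \<in> borel_measurable borel" by (rule multiplier_measurable[OF m])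
    have w0: "w x \<ge> 0" for x by (simp add: w_def)
    define f where "f x = w x * u x" for x
    have [measurable]: "f \<in> borel_measurable borel" unfolding f_def by measurable
    have f: "econv \<sigma> (\<lambda>k x. w x * \<phi>0 k x) f" unfolding f_def by (rule multiplier_econv[OF \<sigma> m conv])
    obtain G where G: "gen \<sigma> f = ennreal G" "G \<ge> 0"
      using Hdot_gen_finite[OF \<sigma>_pos \<sigma>(2) f] by (cases "gen \<sigma> f") auto
    obtain F where F: "lp_int \<sigma> half_space f = ennreal F" "F \<ge> 0"
      using Hdot_lp_finite[OF \<sigma>_pos \<sigma>(2) f] by (cases "lp_int \<sigma> half_space f") auto
    have SF: "S * F powr (2 / p) \<le> G"
      using sob_econv[OF f] S0 G unfolding lp_den_real[OF F] by (simp add: ennreal_mult[symmetric])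
    have lam: "lam w \<le> ennreal \<theta> * ennreal G"
    proof -
      have "lam w \<le> (\<integral>\<^sup>+z. ennreal \<theta> * ennreal (\<bar>f (fst z)\<bar> * \<bar>f (snd z)\<bar> * ((snd (snd z) / snd (fst z)) powr \<beta> + (snd (fst z) / snd (snd z)) powr \<beta> - 2)) \<partial>gmeas \<sigma>)"
        unfolding lam_def
      proof (rule nn_integral_mono_AE, use AE_gmeas_half_space in eventually_elim)
        case (elim z)
        have "(w (fst z) - w (snd z))\<^sup>2 \<le> \<theta> * (w (fst z) * w (snd z)) * ((snd (snd z) / snd (fst z)) powr \<beta> + (snd (fst z) / snd (snd z)) powr \<beta> - 2)"
          unfolding w_def \<theta>_def using elim \<tau> \<alpha> \<beta> by (intro shifted_power_comparison) (auto simp: half_space_def)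
        then have "\<bar>u (fst z)\<bar> * \<bar>u (snd z)\<bar> * (w (fst z) - w (snd z))\<^sup>2 \<le> \<bar>u (fst z)\<bar> * \<bar>u (snd z)\<bar> * (\<theta> * (w (fst z) * w (snd z)) * ((snd (snd z) / snd (fst z)) powr \<beta> + (snd (fst z) / snd (snd z)) powr \<beta> - 2))"
          by (intro mult_left_mono) auto
        also have "\<dots> = \<theta> * (\<bar>f (fst z)\<bar> * \<bar>f (snd z)\<bar> * ((snd (snd z) / snd (fst z)) powr \<beta> + (snd (fst z) / snd (snd z)) powr \<beta> - 2))"
          using w0 by (simp add: f_def abs_mult mult_ac)
        finally have "ennreal (\<bar>u (fst z)\<bar> * \<bar>u (snd z)\<bar> * (w (fst z) - w (snd z))\<^sup>2) \<le> ennreal (\<theta> * (\<bar>f (fst z)\<bar> * \<bar>f (snd z)\<bar> * ((snd (snd z) / snd (fst z)) powr \<beta> + (snd (fst z) / snd (snd z)) powr \<beta> - 2)))"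
          by (rule ennreal_leI)
        then show ?case using \<theta> by (simp add: ennreal_mult')
      qed
      also have "\<dots> = ennreal \<theta> * (\<integral>\<^sup>+z. ennreal (\<bar>f (fst z)\<bar> * \<bar>f (snd z)\<bar> * ((snd (snd z) / snd (fst z)) powr \<beta> + (snd (fst z) / snd (snd z)) powr \<beta> - 2)) \<partial>gmeas \<sigma>)"
        by (rule nn_integral_cmult) measurable
      also have "\<dots> \<le> ennreal \<theta> * gen \<sigma> (\<lambda>x. \<bar>f x\<bar>)"
      proof (rule mult_left_mono)
        have "hmass \<sigma> (\<lambda>x. \<bar>f x\<bar>) < \<infinity>" using hmass_mult_finite[OF m] by (simp add: hmass_def f_def)
        then show "(\<integral>\<^sup>+z. ennreal (\<bar>f (fst z)\<bar> * \<bar>f (snd z)\<bar> * ((snd (snd z) / snd (fst z)) powr \<beta> + (snd (fst z) / snd (snd z)) powr \<beta> - 2)) \<partial>gmeas \<sigma>) \<le> gen \<sigma> (\<lambda>x. \<bar>f x\<bar>)"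
          unfolding gen_def by (intro ground_state_bound \<sigma> \<beta>_def) auto
      qed simp
      also have "\<dots> \<le> ennreal \<theta> * ennreal G"
        unfolding G(1)[symmetric] by (intro mult_left_mono gen_abs_le) simp
      finally show ?thesis .
    qed
    have pint: "pint w \<le> ennreal (F powr (2 / p) * T powr (1 - 2 / p)) + ennreal (\<delta> powr (- 2 * \<alpha>))"
    proof -
      let ?A = "{x :: 'a \<times> real. snd x < \<delta>}"
      have "pint w \<le> (\<integral>\<^sup>+x. indicator half_space x * ennreal ((f x)\<^sup>2 * \<bar>u x\<bar> powr (p - 2)) * indicator ?A x + ennreal (\<delta> powr (- 2 * \<alpha>)) * (indicator half_space x * ennreal (\<bar>u x\<bar> powr p)) \<partial>lborel)"
        unfolding pint_def
      proof (rule nn_integral_mono)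
        fix x
        show "indicator half_space x * ennreal (\<bar>u x\<bar> powr p * (w x)\<^sup>2) \<le> indicator half_space x * ennreal ((f x)\<^sup>2 * \<bar>u x\<bar> powr (p - 2)) * indicator ?A x + ennreal (\<delta> powr (- 2 * \<alpha>)) * (indicator half_space x * ennreal (\<bar>u x\<bar> powr p))"
        proof (cases "x \<in> half_space")
          case True
          show ?thesis
          \<comment> \<open>Inside the strip the integrand is rewritten for \<open>lp_local\<close>;
            outside it the weight is at most \<open>\<delta> powr (- \<alpha>)\<close> and the
            normalization of \<open>u\<close> suffices.\<close>
          proof (cases "snd x < \<delta>")
            case snd: True
            have "\<bar>u x\<bar> powr p = (u x)\<^sup>2 * \<bar>u x\<bar> powr (p - 2)"
            proof (cases "u x = 0")
              case False
              then have "\<bar>u x\<bar> powr 2 = (u x)\<^sup>2" by (simp add: powr_numeral)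
              moreover have "\<bar>u x\<bar> powr p = \<bar>u x\<bar> powr 2 * \<bar>u x\<bar> powr (p - 2)" by (simp only: powr_add[symmetric]) simp
              ultimately show ?thesis by (simp only:)
            qed (use p in simp)
            then have "\<bar>u x\<bar> powr p * (w x)\<^sup>2 = (f x)\<^sup>2 * \<bar>u x\<bar> powr (p - 2)"
              by (simp add: f_def power_mult_distrib mult_ac)
            then show ?thesis using True snd by simp
          next
            case False
            have "w x \<le> \<delta> powr (- \<alpha>)" unfolding w_def using False \<delta> \<tau> \<alpha> by (intro powr_mono2') auto
            then have "(w x)\<^sup>2 \<le> (\<delta> powr (- \<alpha>))\<^sup>2" by (intro power_mono w0)
            also have "\<dots> = \<delta> powr (- 2 * \<alpha>)" using \<delta> by (simp add: power2_eq_square powr_add[symmetric])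
            finally have "\<bar>u x\<bar> powr p * (w x)\<^sup>2 \<le> \<delta> powr (- 2 * \<alpha>) * \<bar>u x\<bar> powr p"
              by (subst mult.commute) (rule mult_right_mono, auto)
            then have "ennreal (\<bar>u x\<bar> powr p * (w x)\<^sup>2) \<le> ennreal (\<delta> powr (- 2 * \<alpha>) * \<bar>u x\<bar> powr p)" by (rule ennreal_leI)
            then show ?thesis using True False by (simp add: ennreal_mult)
          qed
        qed simp
      qed
      also have "\<dots> = (\<integral>\<^sup>+x. indicator half_space x * ennreal ((f x)\<^sup>2 * \<bar>u x\<bar> powr (p - 2)) * indicator ?A x \<partial>lborel) + ennreal (\<delta> powr (- 2 * \<alpha>)) * lp_int \<sigma> half_space u"
        unfolding lp_int_p by (subst nn_integral_add) (auto simp: nn_integral_cmult)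
      also have "\<dots> \<le> ennreal (F powr (2 / p) * T powr (1 - 2 / p)) + ennreal (\<delta> powr (- 2 * \<alpha>))"
      proof (intro add_mono)
        have "(\<integral>\<^sup>+x. indicator half_space x * ennreal (\<bar>u x\<bar> powr p) * indicator ?A x \<partial>lborel) = ennreal T"
          unfolding T(1)[symmetric] strip_def by (intro nn_integral_cong) (auto simp: indicator_def)
        then show "(\<integral>\<^sup>+x. indicator half_space x * ennreal ((f x)\<^sup>2 * \<bar>u x\<bar> powr (p - 2)) * indicator ?A x \<partial>lborel) \<le> ennreal (F powr (2 / p) * T powr (1 - 2 / p))"
          by (intro lp_local F T(2)) auto
      qed (simp add: lp_u)
      finally show ?thesis .
    qed
    have "ennreal G \<le> ennreal S * pint w + lam w"
      using euler_lagrange[OF m] by (simp add: G(1)[symmetric] f_def[abs_def])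
    also have "\<dots> \<le> ennreal S * (ennreal (F powr (2 / p) * T powr (1 - 2 / p)) + ennreal (\<delta> powr (- 2 * \<alpha>))) + ennreal \<theta> * ennreal G"
      by (intro add_mono mult_left_mono pint lam) simp
    finally have "G \<le> S * (F powr (2 / p) * T powr (1 - 2 / p) + \<delta> powr (- 2 * \<alpha>)) + \<theta> * G"
      using S0 \<theta> G by (simp add: ennreal_mult[symmetric] ennreal_plus[symmetric] del: ennreal_plus)
    also have "\<dots> = (S * F powr (2 / p)) * T powr (1 - 2 / p) + S * \<delta> powr (- 2 * \<alpha>) + \<theta> * G" by (simp add: algebra_simps)
    also have "\<dots> \<le> G * \<kappa> + S * \<delta> powr (- 2 * \<alpha>) + \<theta> * G"
      using SF T\<kappa> G S0 by (intro add_mono mult_mono order_refl) auto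
    finally have "\<kappa> * G \<le> S * \<delta> powr (- 2 * \<alpha>)"
    proof -
      have "\<theta> * G = G - 2 * (\<kappa> * G)" by (simp add: \<kappa>_def field_simps)
      moreover assume "G \<le> G * \<kappa> + S * \<delta> powr (- 2 * \<alpha>) + \<theta> * G"
      ultimately show ?thesis by (simp add: mult.commute)
    qed
    then have "G \<le> S * \<delta> powr (- 2 * \<alpha>) / \<kappa>" using \<kappa> by (simp add: field_simps)
    then show "gen \<sigma> (\<lambda>x. (snd x + \<tau>) powr (- \<alpha>) * u x) \<le> ennreal (S * \<delta> powr (- 2 * \<alpha>) / \<kappa>)"
      using G by (simp add: f_def[abs_def] w_def[abs_def] ennreal_leI)
  qed
qed

text \<open>Hardy's inequality turns the energy bound, uniform in \<open>\<tau>\<close>, into a mass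
  bound, and Fatou's lemma lets \<open>\<tau>\<close> run to 0 along
  \<open>1 / (k + 1)\<close>.\<close>

lemma boundary_decay:
  assumes \<alpha>: "0 < \<alpha>" "\<alpha> < (2 * \<sigma> - 1) / 2"
  shows "wint (\<lambda>x. snd x powr (- 2 * \<sigma> - 2 * \<alpha>)) u < \<infinity>"
proof -
  obtain K where K: "\<And>\<tau>. \<tau> > 0 \<Longrightarrow> gen \<sigma> (\<lambda>x. (snd x + \<tau>) powr (- \<alpha>) * u x) \<le> ennreal K"
    using boundary_decay_truncated[OF \<alpha>] by metis
  obtain c where c: "c > 0" "\<And>\<phi> (u :: 'a \<times> real \<Rightarrow> real). econv \<sigma> \<phi> u \<Longrightarrow> ennreal c * hmass \<sigma> u \<le> gen \<sigma> u"
    by (rule hardy_Hdot[OF \<sigma>, where 'a='a]) (rule that)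
  define f where "f k x = (snd x + 1 / real (Suc k)) powr (- \<alpha>) * u x" for k and x :: "'a \<times> real"
  have [measurable]: "f k \<in> borel_measurable borel" for k unfolding f_def by measurable
  have hf: "hmass \<sigma> (f k) \<le> ennreal (1 / c) * ennreal K" for k
  proof -
    have "multiplier (\<lambda>x :: 'a \<times> real. (snd x + 1 / real (Suc k)) powr (- \<alpha>))"
      using \<alpha> \<sigma> by (intro multiplier_shifted_power) auto
    from multiplier_econv[OF \<sigma> this conv]
    have "econv \<sigma> (\<lambda>j x. (snd x + 1 / real (Suc k)) powr (- \<alpha>) * \<phi>0 j x) (f k)" unfolding f_def .
    from c(2)[OF this] have "ennreal c * hmass \<sigma> (f k) \<le> ennreal K"
      using K[of "1 / real (Suc k)"] by (auto simp: f_def[abs_def] intro: order_trans)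
    from mult_left_mono[OF this, of "ennreal (1 / c)"] show ?thesis
      using c(1) by (simp add: mult.assoc[symmetric] ennreal_mult[symmetric])
  qed
  have "wint (\<lambda>x. snd x powr (- 2 * \<sigma> - 2 * \<alpha>)) u =
    (\<integral>\<^sup>+x. liminf (\<lambda>k. indicator half_space x * ennreal ((f k x)\<^sup>2 * snd x powr (- 2 * \<sigma>))) \<partial>lborel)"
    unfolding wint_def
  proof (rule nn_integral_cong)
    fix x :: "'a \<times> real"
    show "indicator half_space x * ennreal ((u x)\<^sup>2 * snd x powr (- 2 * \<sigma> - 2 * \<alpha>)) = liminf (\<lambda>k. indicator half_space x * ennreal ((f k x)\<^sup>2 * snd x powr (- 2 * \<sigma>)))"
    proof (cases "x \<in> half_space")
      case True
      then have x: "snd x > 0" by (simp add: half_space_def)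
      have lim: "(\<lambda>k. snd x + 1 / real (Suc k)) \<longlonglongrightarrow> snd x + 0"
        by (intro tendsto_intros LIMSEQ_Suc[OF lim_1_over_n])
      have "(\<lambda>k. (f k x)\<^sup>2 * snd x powr (- 2 * \<sigma>)) \<longlonglongrightarrow> ((snd x + 0) powr (- \<alpha>) * u x)\<^sup>2 * snd x powr (- 2 * \<sigma>)"
        unfolding f_def
        by (rule tendsto_mult[OF tendsto_power[OF tendsto_mult[OF tendsto_powr[OF lim tendsto_const] tendsto_const]] tendsto_const])
           (use x in simp)
      also have "((snd x + 0) powr (- \<alpha>) * u x)\<^sup>2 * snd x powr (- 2 * \<sigma>) = (u x)\<^sup>2 * snd x powr (- 2 * \<sigma> - 2 * \<alpha>)"
        using x by (simp add: power2_eq_square powr_diff powr_minus_divide powr_add[symmetric] field_simps)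
      finally have "(\<lambda>k. ennreal ((f k x)\<^sup>2 * snd x powr (- 2 * \<sigma>))) \<longlonglongrightarrow> ennreal ((u x)\<^sup>2 * snd x powr (- 2 * \<sigma> - 2 * \<alpha>))"
        by (rule tendsto_ennrealI)
      from lim_imp_Liminf[OF trivial_limit_sequentially this] show ?thesis using True by simp
    qed (simp add: Liminf_const)
  qed
  also have "\<dots> \<le> liminf (\<lambda>k. hmass \<sigma> (f k))"
    unfolding hmass_def by (rule nn_integral_liminf) measurable
  also have "\<dots> \<le> liminf (\<lambda>k. ennreal (1 / c) * ennreal K)"
    by (intro Liminf_mono always_eventually allI hf)
  also have "\<dots> < \<infinity>" by (simp add: Liminf_const ennreal_mult_less_top)
  finally show ?thesis .
qed

end

section \<open>A good boundary point\<close>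

text \<open>The singularity has order \<open>1 - s / 2\<close>, less than the boundary dimension
  \<open>d \<ge> 1\<close>: within distance 1 of \<open>y\<close> it is dominated by the integrable
  order \<open>d - s / 2\<close>, and farther away by 1.\<close>

lemma boundary_potential_bounded:
  assumes s: "0 < s" "s < 2"
  obtains C where "C \<ge> 0" "\<And>y :: 'a::euclidean_space. (\<integral>\<^sup>+b. indicator (ball 0 1) b * ennreal (norm (y - b) powr (- (1 - s / 2))) \<partial>lborel) \<le> ennreal C"
proof -
  let ?d = "real DIM('a)"
  let ?h = "\<lambda>t :: real. indicator {..1} t * ennreal (t powr (- (?d - s / 2)))"
  define A where "A = (\<integral>\<^sup>+z. ?h (norm z) \<partial>(lborel :: 'a measure)) + emeasure lborel (ball 0 1 :: 'a set)"
  have "A < \<infinity>"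
    using nn_integral_norm_powr_inside[of "s / 2", where 'a='a] s emeasure_lborel_ball_finite[of "0::'a" 1]
    by (simp add: A_def)
  then obtain C where C: "A = ennreal C" "C \<ge> 0" by (cases A) auto
  have "(\<integral>\<^sup>+b. indicator (ball 0 1) b * ennreal (norm (y - b) powr (- (1 - s / 2))) \<partial>lborel) \<le> ennreal C" for y :: 'a
  proof -
    have "(\<integral>\<^sup>+b. indicator (ball 0 1) b * ennreal (norm (y - b) powr (- (1 - s / 2))) \<partial>lborel) \<le> (\<integral>\<^sup>+b. ?h (norm (y - b)) + indicator (ball 0 1) b \<partial>lborel)"
    proof (rule nn_integral_mono)
      fix b
      define t where "t = norm (y - b)"
      show "indicator (ball 0 1) b * ennreal (norm (y - b) powr (- (1 - s / 2))) \<le> ?h (norm (y - b)) + indicator (ball 0 1) b"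
      proof (cases "t \<le> 1")
        case True
        have d1: "?d \<ge> 1" using DIM_positive[where 'a='a] by (simp add: Suc_le_eq)
        have "t powr (- (1 - s / 2)) \<le> t powr (- (?d - s / 2))"
        proof (cases "t = 0")
          case False
          then have "0 < t" by (simp add: t_def)
          then show ?thesis using True d1 by (intro powr_mono') auto
        qed simp
        then show ?thesis using True by (auto simp: t_def indicator_def intro!: ennreal_leI add_increasing2)
      next
        case False
        then have "t powr (- (1 - s / 2)) \<le> t powr 0" using s by (intro powr_mono) auto
        then have "ennreal (t powr (- (1 - s / 2))) \<le> 1" using False by (simp add: ennreal_le_1)
        then show ?thesis by (auto simp: t_def indicator_def intro: add_increasing)
      qed
    qed
    also have "\<dots> = (\<integral>\<^sup>+b. ?h (norm (y - b)) \<partial>lborel) + emeasure lborel (ball 0 1 :: 'a set)"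
    proof -
      have [measurable]: "ball (0::'a) 1 \<in> sets borel" by simp
      show ?thesis by (subst nn_integral_add) auto
    qed
    also have "(\<integral>\<^sup>+b. ?h (norm (y - b)) \<partial>lborel) = (\<integral>\<^sup>+z. ?h (norm z) \<partial>(lborel :: 'a measure))"
      using nn_integral_affine[of "\<lambda>b. ?h (norm (y - b))" 1 y] by simp
    finally show ?thesis using C(1) unfolding A_def by (simp only:)
  qed
  with C(2) show ?thesis using that by blast
qed

lemma wint_measurable_param:
  fixes w :: "'b::euclidean_space \<Rightarrow> 'a::euclidean_space \<times> real \<Rightarrow> real"
  assumes [measurable]: "(\<lambda>z. w (fst z) (snd z)) \<in> borel_measurable (borel \<Otimes>\<^sub>M borel)" "f \<in> borel_measurable borel"
  shows "(\<lambda>b. wint (w b) f) \<in> borel_measurable borel"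
proof -
  have m: "(\<lambda>z. indicator half_space (snd z) * ennreal ((f (snd z))\<^sup>2 * w (fst z) (snd z))) \<in> borel_measurable (borel \<Otimes>\<^sub>M lborel)"
    by measurable
  show ?thesis unfolding wint_def
    by (rule lborel.borel_measurable_nn_integral) (use m in \<open>simp add: case_prod_beta'\<close>)
qed

context minimizer
begin

text \<open>The weight is split between horizontal and vertical distance, both at most
  \<open>dist x (b, 0)\<close>. Averaging over \<open>b\<close> integrates the horizontal factor to
  a constant; the vertical one is covered by \<open>boundary_decay\<close>. A finite average gives
  finiteness for almost every \<open>b\<close>.\<close>

lemma AE_boundary_decay:
  assumes s: "0 < s" "s \<le> 1 / 2" "s \<le> 2 * \<sigma> - 1"
  shows "AE b in (lborel :: 'a measure). b \<in> ball 0 1 \<longrightarrow> wint (\<lambda>x. dist x (b, 0) powr (s - 4 * \<sigma>)) u < \<infinity>"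
proof -
  \<comment> \<open>Chosen so that
    \<open>2 * \<sigma> + 2 * \<alpha> = 4 * \<sigma> - 1 - s / 2\<close>: half of the available
    \<open>s\<close> keeps \<open>\<alpha>\<close> below its limit, the other half makes the
    horizontal exponent integrable.\<close>
  define \<alpha> where "\<alpha> = (2 * \<sigma> - 1) / 2 - s / 4"
  have "s / 4 < s / 2" using s by simp
  also have "s / 2 \<le> (2 * \<sigma> - 1) / 2" using s by (intro divide_right_mono) auto
  finally have "0 < \<alpha>" by (simp add: \<alpha>_def)
  moreover have lt: "y > 0 \<Longrightarrow> x - y < x" for x y :: real by simp
  have "\<alpha> < (2 * \<sigma> - 1) / 2" unfolding \<alpha>_def by (rule lt) (use s in simp)
  ultimately have \<alpha>: "0 < \<alpha>" "\<alpha> < (2 * \<sigma> - 1) / 2" by blast+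
  have fin: "wint (\<lambda>x. snd x powr (- 2 * \<sigma> - 2 * \<alpha>)) u < \<infinity>" by (rule boundary_decay[OF \<alpha>])
  have e: "- 2 * \<sigma> - 2 * \<alpha> = - (4 * \<sigma> - 1 - s / 2)" by (simp add: \<alpha>_def field_simps)
  obtain C where C: "C \<ge> 0" "\<And>y :: 'a. (\<integral>\<^sup>+b. indicator (ball 0 1) b * ennreal (norm (y - b) powr (- (1 - s / 2))) \<partial>lborel) \<le> ennreal C"
    by (rule boundary_potential_bounded[of s, where 'a='a]) (use s in auto)
  have [measurable]: "ball (0::'a) 1 \<in> sets borel" by simp
  let ?W = "\<lambda>b x. indicator half_space x * ennreal ((u x)\<^sup>2 * dist x (b, 0) powr (s - 4 * \<sigma>))"
  have "(\<integral>\<^sup>+b. indicator (ball 0 1) b * wint (\<lambda>x. dist x (b, 0) powr (s - 4 * \<sigma>)) u \<partial>(lborel :: 'a measure)) =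
    (\<integral>\<^sup>+b. \<integral>\<^sup>+x. indicator (ball 0 1) b * ?W b x \<partial>lborel \<partial>(lborel :: 'a measure))"
    unfolding wint_def by (subst nn_integral_cmult) auto
  also have "\<dots> = (\<integral>\<^sup>+x. \<integral>\<^sup>+b. indicator (ball 0 1) b * ?W b x \<partial>(lborel :: 'a measure) \<partial>lborel)"
  proof (rule lborel_pair.Fubini'[symmetric])
    have "(\<lambda>z :: 'a \<times> ('a \<times> real). indicator (ball 0 1) (fst z) * ?W (fst z) (snd z)) \<in> borel_measurable (borel \<Otimes>\<^sub>M borel)"
      by measurable
    then show "(\<lambda>(b, x). indicator (ball 0 1) b * ?W b x) \<in> borel_measurable ((lborel :: 'a measure) \<Otimes>\<^sub>M lborel)"
      by (simp add: case_prod_beta')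
  qed
  also have "\<dots> \<le> (\<integral>\<^sup>+x. ennreal C * (indicator half_space x * ennreal ((u x)\<^sup>2 * snd x powr (- 2 * \<sigma> - 2 * \<alpha>))) \<partial>lborel)"
  proof (rule nn_integral_mono)
    fix x :: "'a \<times> real"
    show "(\<integral>\<^sup>+b. indicator (ball 0 1) b * ?W b x \<partial>(lborel :: 'a measure)) \<le> ennreal C * (indicator half_space x * ennreal ((u x)\<^sup>2 * snd x powr (- 2 * \<sigma> - 2 * \<alpha>)))"
    proof (cases "x \<in> half_space")
      case True
      then have sx: "snd x > 0" by (simp add: half_space_def)
      have "(\<integral>\<^sup>+b. indicator (ball 0 1) b * ?W b x \<partial>(lborel :: 'a measure)) \<le>
        (\<integral>\<^sup>+b. ennreal ((u x)\<^sup>2 * snd x powr (- 2 * \<sigma> - 2 * \<alpha>)) * (indicator (ball 0 1) b * ennreal (norm (fst x - b) powr (- (1 - s / 2)))) \<partial>(lborel :: 'a measure))"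
      proof (rule nn_integral_mono_AE)
        have "AE b in (lborel :: 'a measure). b \<notin> {fst x}"
          using AE_lborel_singleton[of "fst x"] by simp
        then show "AE b in (lborel :: 'a measure). indicator (ball 0 1) b * ?W b x \<le> ennreal ((u x)\<^sup>2 * snd x powr (- 2 * \<sigma> - 2 * \<alpha>)) * (indicator (ball 0 1) b * ennreal (norm (fst x - b) powr (- (1 - s / 2))))"
        proof eventually_elim
          case (elim b)
          have d1: "norm (fst x - b) \<le> dist x (b, 0)" using dist_fst_le[of x "(b, 0)"] by (simp add: dist_norm)
          have d2: "snd x \<le> dist x (b, 0)" using dist_snd_le[of x "(b, 0)"] by (simp add: dist_real_def)
          have "dist x (b, 0) powr (s - 4 * \<sigma>) = dist x (b, 0) powr (- (1 - s / 2)) * dist x (b, 0) powr (- (4 * \<sigma> - 1 - s / 2))"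
          proof -
            have "s - 4 * \<sigma> = - (1 - s / 2) + - (4 * \<sigma> - 1 - s / 2)" by (simp add: field_simps)
            then show ?thesis by (simp only: powr_add)
          qed
          also have "\<dots> \<le> norm (fst x - b) powr (- (1 - s / 2)) * snd x powr (- (4 * \<sigma> - 1 - s / 2))"
            using elim sx d1 d2 s \<sigma> by (intro mult_mono powr_mono2') auto
          finally have "(u x)\<^sup>2 * dist x (b, 0) powr (s - 4 * \<sigma>) \<le> (u x)\<^sup>2 * (norm (fst x - b) powr (- (1 - s / 2)) * snd x powr (- (4 * \<sigma> - 1 - s / 2)))"
            by (rule mult_left_mono) simp
          also have "\<dots> = ((u x)\<^sup>2 * snd x powr (- 2 * \<sigma> - 2 * \<alpha>)) * norm (fst x - b) powr (- (1 - s / 2))"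
            unfolding e by (simp only: mult_ac)
          finally have "ennreal ((u x)\<^sup>2 * dist x (b, 0) powr (s - 4 * \<sigma>)) \<le> ennreal ((u x)\<^sup>2 * snd x powr (- 2 * \<sigma> - 2 * \<alpha>)) * ennreal (norm (fst x - b) powr (- (1 - s / 2)))"
            by (simp add: ennreal_mult[symmetric] ennreal_leI)
          then show ?case using True by (auto simp: indicator_def)
        qed
      qed
      also have "\<dots> = ennreal ((u x)\<^sup>2 * snd x powr (- 2 * \<sigma> - 2 * \<alpha>)) * (\<integral>\<^sup>+b. indicator (ball 0 1) b * ennreal (norm (fst x - b) powr (- (1 - s / 2))) \<partial>(lborel :: 'a measure))"
        by (rule nn_integral_cmult) measurable
      also have "\<dots> \<le> ennreal ((u x)\<^sup>2 * snd x powr (- 2 * \<sigma> - 2 * \<alpha>)) * ennreal C"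
        by (intro mult_left_mono C(2)) simp
      finally show ?thesis using True by (simp add: mult.commute)
    qed simp
  qed
  also have "\<dots> = ennreal C * wint (\<lambda>x. snd x powr (- 2 * \<sigma> - 2 * \<alpha>)) u"
    unfolding wint_def by (rule nn_integral_cmult) measurable
  also have "\<dots> < \<infinity>" using fin by (simp add: ennreal_mult_less_top)
  finally have "(\<integral>\<^sup>+b. indicator (ball 0 1) b * wint (\<lambda>x. dist x (b, 0) powr (s - 4 * \<sigma>)) u \<partial>(lborel :: 'a measure)) \<noteq> \<infinity>" by simp
  moreover have "(\<lambda>b. wint (\<lambda>x. dist x (b, 0) powr (s - 4 * \<sigma>)) u) \<in> borel_measurable (borel :: 'a measure)"
    by (rule wint_measurable_param[where w="\<lambda>b x. dist x (b, 0) powr (s - 4 * \<sigma>)"]) measurable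
  then have "(\<lambda>b. indicator (ball 0 1) b * wint (\<lambda>x. dist x (b, 0) powr (s - 4 * \<sigma>)) u) \<in> borel_measurable (lborel :: 'a measure)"
    by simp
  ultimately have "AE b in (lborel :: 'a measure). indicator (ball 0 1) b * wint (\<lambda>x. dist x (b, 0) powr (s - 4 * \<sigma>)) u \<noteq> \<infinity>"
    by (intro nn_integral_PInf_AE)
  then show ?thesis by eventually_elim (auto simp: less_top)
qed

text \<open>The exceptional set of \<open>b\<close> depends on the exponent, so only the countably
  many values \<open>s1 / (j + 1)\<close> are treated; their exceptional sets have a null union,
  which cannot contain the unit ball, and the values tend to 0.\<close>

lemma good_boundary_point:
  obtains b :: "'a \<times> real" and s1 where "snd b = 0" "0 < s1" "s1 \<le> 1 / 2"
    "\<And>j. wint (\<lambda>x. dist x b powr (s1 / real (Suc j) - 4 * \<sigma>)) u < \<infinity>"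
proof -
  define s1 where "s1 = min (1 / 2) (2 * \<sigma> - 1)"
  have s1: "0 < s1" "s1 \<le> 1 / 2" "s1 \<le> 2 * \<sigma> - 1" using \<sigma> unfolding s1_def by linarith+
  have sj: "0 < s1 / real (Suc j)" "s1 / real (Suc j) \<le> s1" for j
    using s1(1) by (auto simp: divide_le_eq)
  have "AE b in (lborel :: 'a measure). \<forall>j. b \<in> ball 0 1 \<longrightarrow> wint (\<lambda>x. dist x (b, 0) powr (s1 / real (Suc j) - 4 * \<sigma>)) u < \<infinity>"
    unfolding AE_all_countable
  proof
    fix j
    show "AE b in (lborel :: 'a measure). b \<in> ball 0 1 \<longrightarrow> wint (\<lambda>x. dist x (b, 0) powr (s1 / real (Suc j) - 4 * \<sigma>)) u < \<infinity>"
      using sj[of j] s1 by (intro AE_boundary_decay) auto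
  qed
  then obtain M where M: "M \<in> null_sets (lborel :: 'a measure)"
    "\<And>b. b \<notin> M \<Longrightarrow> \<forall>j. b \<in> ball 0 1 \<longrightarrow> wint (\<lambda>x. dist x (b, 0) powr (s1 / real (Suc j) - 4 * \<sigma>)) u < \<infinity>"
    by (auto elim!: AE_E3)
  have "\<not> ball 0 1 \<subseteq> M"
  proof
    assume "ball 0 1 \<subseteq> M"
    then have "ball (0::'a) 1 \<in> null_sets lborel" using M(1) by (rule null_sets_subset[rotated 2]) auto
    then show False using open_not_negligible[of "ball (0::'a) 1"]
      by (metis ball_eq_empty negligible_iff_null_sets not_one_le_zero null_sets_completionI open_ball)
  qed
  then obtain b where "b \<in> ball 0 1" "b \<notin> M" by blast
  then show ?thesis using M(2)[of b] that[of "(b, 0)" s1] s1 by auto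
qed

end

section \<open>Cutting off near a boundary point\<close>

lemma powr_divide_minus:
  fixes x y q :: real
  assumes "x > 0" "y > 0"
  shows "(x / y) powr (- q) = y powr q * x powr (- q)" "(x / y) powr q = x powr q * y powr (- q)"
  using assms by (simp_all add: powr_divide powr_minus_divide)

section \<open>Continuously differentiable cutoff functions\<close>

lemma has_real_derivative_max_square:
  "((\<lambda>t :: real. (max 0 t)\<^sup>2) has_real_derivative 2 * max 0 x) (at x)"
proof -
  consider "x < 0" | "x > 0" | "x = 0" by linarith
  then show ?thesis
  proof cases
    case 1
    have "((\<lambda>t. 0) has_real_derivative 0) (at x)" by simp
    then have "((\<lambda>t :: real. (max 0 t)\<^sup>2) has_real_derivative 0) (at x)"
      by (rule has_field_derivative_transform_within_open[where S="{..<0}"]) (use 1 in auto)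
    then show ?thesis using 1 by simp
  next
    case 2
    have "((\<lambda>t. t\<^sup>2) has_real_derivative 2 * x) (at x)" by (auto intro!: derivative_eq_intros)
    then have "((\<lambda>t :: real. (max 0 t)\<^sup>2) has_real_derivative 2 * x) (at x)"
      by (rule has_field_derivative_transform_within_open[where S="{0<..}"]) (use 2 in auto)
    then show ?thesis using 2 by simp
  next
    case 3
    have "((\<lambda>h :: real. ((max 0 h)\<^sup>2 - (max 0 0)\<^sup>2) / (h - 0)) \<longlongrightarrow> 0) (at 0)"
    proof (rule Lim_null_comparison)
      show "eventually (\<lambda>h :: real. norm (((max 0 h)\<^sup>2 - (max 0 0)\<^sup>2) / (h - 0)) \<le> \<bar>h\<bar>) (at 0)"
        by (intro always_eventually allI) (auto simp: max_def power2_eq_square)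
      show "((\<lambda>h :: real. \<bar>h\<bar>) \<longlongrightarrow> 0) (at 0)" by (rule tendsto_eq_intros refl | simp)+
    qed
    then show ?thesis using 3 by (simp add: has_field_derivative_iff)
  qed
qed

lemma C1_on_max_square: "C1_on U (\<lambda>t :: real. (max 0 t)\<^sup>2)"
  by (rule C1_on_real[where f'="\<lambda>x. 2 * max 0 x"]) (auto intro!: has_real_derivative_max_square continuous_intros)

lemma C1_on_inverse_real:
  assumes "\<And>x. x \<in> U \<Longrightarrow> x \<noteq> (0 :: real)"
  shows "C1_on U inverse"
  by (rule C1_on_real[where f'="\<lambda>x. - (inverse x * inverse x)"])
     (use assms in \<open>auto intro!: derivative_eq_intros continuous_intros simp: power2_eq_square\<close>)

lemma C1_on_norm_square: "C1_on U (\<lambda>x :: 'a::euclidean_space. (norm x)\<^sup>2)"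
proof -
  have "C1_on U (\<lambda>x :: 'a. x \<bullet> x)"
    unfolding C1_on_def
  proof (intro exI conjI ballI)
    fix x :: 'a
    show "((\<lambda>x. x \<bullet> x) has_derivative blinfun_apply (2 *\<^sub>R blinfun_inner_right x)) (at x)"
      by (rule derivative_eq_intros refl)+ (auto simp: scaleR_blinfun.rep_eq inner_commute)
  next
    show "continuous_on U (\<lambda>x :: 'a. 2 *\<^sub>R blinfun_inner_right x)"
      by (intro continuous_intros bounded_linear.continuous_on[OF bounded_linear_blinfun_inner_right])
  qed
  then show ?thesis by (simp add: power2_norm_eq_inner)
qed

lemma ex_bump:
  obtains \<eta> :: "'a::euclidean_space \<times> real \<Rightarrow> real" where "\<eta> \<in> C1c UNIV" "\<And>x. 0 \<le> \<eta> x" "\<And>x. \<eta> x \<le> 1"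
    "\<And>x. norm x \<le> 1 \<Longrightarrow> \<eta> x = 1" "\<And>x. norm x \<ge> 2 \<Longrightarrow> \<eta> x = 0"
proof -
  define q where "q t = (max 0 t)\<^sup>2" for t :: real
  have q0: "q t \<ge> 0" for t by (simp add: q_def)
  have q1: "q (4 - t) + q (t - 1) > 0" for t
  proof (cases "t < 4")
    case True
    then have "q (4 - t) > 0" by (simp add: q_def)
    with q0[of "t - 1"] show ?thesis by linarith
  next
    case False
    then have "q (t - 1) > 0" by (simp add: q_def)
    with q0[of "4 - t"] show ?thesis by linarith
  qed
  \<comment> \<open>A quotient of one-sided \<open>C\<^sup>1\<close> ramps in the variable
    \<open>(norm x)\<^sup>2\<close>: it is 1 up to 1 and 0 from 4 on, that is, for norms up to 1 and
    from 2 on. The ramps never vanish together, so the denominator is positive.\<close>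
  define \<zeta> where "\<zeta> t = q (4 - t) * inverse (q (4 - t) + q (t - 1))" for t
  have aff: "C1_on UNIV (\<lambda>t :: real. q (4 - t))" "C1_on UNIV (\<lambda>t :: real. q (t - 1))"
  proof -
    have l: "C1_on UNIV (\<lambda>t :: real. 4 - t)" "C1_on UNIV (\<lambda>t :: real. t - 1)"
      by (rule C1_on_real[where f'="\<lambda>_. - 1"], auto intro!: derivative_eq_intros)
         (rule C1_on_real[where f'="\<lambda>_. 1"], auto intro!: derivative_eq_intros)
    show "C1_on UNIV (\<lambda>t :: real. q (4 - t))" "C1_on UNIV (\<lambda>t :: real. q (t - 1))"
      unfolding q_def by (rule C1_on_compose[OF l(1) C1_on_max_square subset_UNIV], rule C1_on_compose[OF l(2) C1_on_max_square subset_UNIV])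
  qed
  have inv: "C1_on UNIV (\<lambda>t. inverse (q (4 - t) + q (t - 1)))"
  proof (rule C1_on_compose[OF C1_on_add[OF aff], of "{0<..}" inverse])
    show "C1_on {0<..} (inverse :: real \<Rightarrow> real)" by (rule C1_on_inverse_real) auto
    show "range (\<lambda>t. q (4 - t) + q (t - 1)) \<subseteq> {0<..}" using q1 by auto
  qed
  have \<zeta>: "C1_on UNIV \<zeta>" unfolding \<zeta>_def by (rule C1_on_mult[OF aff(1) inv])
  have \<zeta>1: "\<zeta> t = 1" if "t \<le> 1" for t
  proof -
    have "q (t - 1) = 0" using that by (simp add: q_def)
    then show ?thesis using q1[of t] by (simp add: \<zeta>_def)
  qed
  have \<zeta>0: "\<zeta> t = 0" if "t \<ge> 4" for t using that by (simp add: \<zeta>_def q_def)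
  define \<eta> where "\<eta> x = \<zeta> ((norm x)\<^sup>2)" for x :: "'a \<times> real"
  show ?thesis
  proof (rule that[of \<eta>])
    have far: "\<eta> x = 0" if "norm x \<ge> 2" for x
    proof -
      have "2\<^sup>2 \<le> (norm x)\<^sup>2" using that by (intro power_mono) auto
      then show ?thesis by (simp add: \<eta>_def \<zeta>0)
    qed
    then show "\<And>x. norm x \<ge> 2 \<Longrightarrow> \<eta> x = 0" .
    show "\<eta> x = 1" if "norm x \<le> 1" for x
      using that by (simp add: \<eta>_def \<zeta>1 power_le_one)
    have "C1_on UNIV \<eta>" unfolding \<eta>_def by (rule C1_on_compose[OF C1_on_norm_square \<zeta> subset_UNIV])
    then show "\<eta> \<in> C1c UNIV"
      by (rule C1cI[where K="cball 0 2"]) (use far in auto)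
    show "0 \<le> \<eta> x" for x using q0 q1[of "(norm x)\<^sup>2"] by (simp add: \<eta>_def \<zeta>_def)
    show "\<eta> x \<le> 1" for x
      using q0 q1[of "(norm x)\<^sup>2"] by (simp add: \<eta>_def \<zeta>_def divide_inverse[symmetric])
  qed
qed

text \<open>The centre lies on the boundary, so points higher than \<open>2 * r\<close> are outside
  the support. Therefore either both values vanish, or \<open>snd x\<close> is at most
  \<open>4 * r\<close> and the Lipschitz constant \<open>M / r\<close> is at most
  \<open>4 * M / snd x\<close>, or the points are as far apart as their heights and boundedness
  suffices.\<close>

lemma bump_multiplier:
  fixes \<eta> :: "'a::euclidean_space \<times> real \<Rightarrow> real"
  assumes \<eta>: "\<eta> \<in> C1c UNIV" "\<And>x. 0 \<le> \<eta> x" "\<And>x. \<eta> x \<le> 1" "\<And>x. norm x \<ge> 2 \<Longrightarrow> \<eta> x = 0"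
    and r: "r > 0" and b: "snd b = 0"
  shows "multiplier (\<lambda>x. \<eta> ((1 / r) *\<^sub>R (x - b)))"
proof -
  obtain M where M: "M > 0" "\<And>x y. \<bar>\<eta> x - \<eta> y\<bar> \<le> M * dist x y" using C1c_bounds[OF \<eta>(1)] by metis
  let ?m = "\<lambda>x. \<eta> ((1 / r) *\<^sub>R (x - b))"
  have lip: "\<bar>?m x - ?m y\<bar> \<le> M / r * dist x y" for x y
  proof -
    have "dist ((1 / r) *\<^sub>R (x - b)) ((1 / r) *\<^sub>R (y - b)) = dist x y / r"
      using r by (simp add: dist_norm scaleR_diff_right[symmetric])
    then show ?thesis using M(2)[of "(1 / r) *\<^sub>R (x - b)" "(1 / r) *\<^sub>R (y - b)"] by simp
  qed
  have "mult_bound ?m (2 + 4 * M)"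
    unfolding mult_bound_def
  proof (intro conjI ballI)
    show "0 \<le> 2 + 4 * M" using M by simp
    fix x :: "'a \<times> real" assume x: "x \<in> half_space"
    show "\<bar>?m x\<bar> \<le> 2 + 4 * M" using \<eta>(2,3)[of "(1 / r) *\<^sub>R (x - b)"] M(1) by linarith
    fix y :: "'a \<times> real" assume y: "y \<in> half_space"
    have sx: "snd x > 0" and sy: "snd y > 0" using x y by (auto simp: half_space_def)
    define d where "d = dist x y / snd x"
    have d: "d \<ge> 0" using sx by (simp add: d_def)
    have ds: "\<bar>snd x - snd y\<bar> \<le> dist x y" using dist_snd_le[of x y] by (simp add: dist_real_def)
    have m1: "\<bar>?m x - ?m y\<bar> \<le> 1" using \<eta>(2,3)[of "(1 / r) *\<^sub>R (x - b)"] \<eta>(2,3)[of "(1 / r) *\<^sub>R (y - b)"] by linarith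
    have nz: "?m z = 0" if "snd z \<ge> 2 * r" for z
    proof (rule \<eta>(4))
      have "snd z \<le> norm (z - b)" using dist_snd_le[of z b] b by (simp add: dist_norm)
      then have "2 * r \<le> norm (z - b)" using that by linarith
      moreover have "norm ((1 / r) *\<^sub>R (z - b)) = norm (z - b) / r" using r by simp
      ultimately show "2 \<le> norm ((1 / r) *\<^sub>R (z - b))" using r by (simp only: pos_le_divide_eq)
    qed
    consider "snd y \<le> snd x / 2" | "snd y > snd x / 2" "snd x \<le> 4 * r" | "snd y > snd x / 2" "snd x > 4 * r" by linarith
    then have "\<bar>?m x - ?m y\<bar> \<le> (2 + 4 * M) * d"
    proof cases
      case 1
      then have "1 \<le> 2 * d" using ds sx by (simp add: d_def field_simps)
      moreover have "0 \<le> 4 * M * d" using M d by simp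
      ultimately show ?thesis using m1 by (simp add: distrib_right)
    next
      case 2
      have "dist x y / r = (snd x / r) * d" using sx by (simp add: d_def)
      also have "\<dots> \<le> 4 * d" using 2(2) r d by (intro mult_right_mono) (auto simp: field_simps)
      finally have "M * (dist x y / r) \<le> M * (4 * d)" using M by (intro mult_left_mono) auto
      then have "\<bar>?m x - ?m y\<bar> \<le> M * (4 * d)" using lip[of x y] by simp
      also have "\<dots> \<le> (2 + 4 * M) * d" using d by (simp add: distrib_right)
      finally show ?thesis .
    next
      case 3
      then have "?m x = 0" "?m y = 0" using r by (auto intro!: nz)
      then show ?thesis using M d by simp
    qed
    then show "\<bar>?m x - ?m y\<bar> \<le> (2 + 4 * M) * (dist x y / snd x)" by (simp add: d_def)
  qed
  moreover have "C1_on half_space ?m"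
  proof (rule C1_on_compose[OF _ C1c_imp_C1_on[OF \<eta>(1)] subset_UNIV])
    have "C1_on half_space (\<lambda>x :: 'a \<times> real. (1 / r) *\<^sub>R x + (- (1 / r) *\<^sub>R b))"
      by (intro C1_on_add C1_on_const C1_on_bounded_linear bounded_linear_scaleR_right)
    then show "C1_on half_space (\<lambda>x. (1 / r) *\<^sub>R (x - b))" by (simp add: scaleR_diff_right)
  qed
  moreover have "?m \<in> borel_measurable borel"
  proof -
    have [measurable]: "\<eta> \<in> borel_measurable borel" by (rule C1c_measurable[OF \<eta>(1)])
    show ?thesis by measurable
  qed
  ultimately show ?thesis unfolding multiplier_def by auto
qed

text \<open>The weight controlling the energy needed to cut off at scale \<open>r\<close> around \<open>b\<close>.\<close>
definition cutw :: "real \<Rightarrow> 'a::euclidean_space \<times> real \<Rightarrow> real \<Rightarrow> 'a \<times> real \<Rightarrow> real" where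
  "cutw \<sigma> b r x = r powr (- 2 * \<sigma>) * min 1 (r / dist x b) powr (dimn TYPE('a \<times> real) + 2 * \<sigma>)"

lemma cutw_measurable [measurable]: "cutw \<sigma> b r \<in> borel_measurable borel"
  unfolding cutw_def[abs_def] by measurable

text \<open>Within \<open>4 * r\<close> of the centre, the bump varies at scale \<open>r\<close> and
  the truncated kernel gives \<open>r powr (- 2 * \<sigma>)\<close>. Farther out it vanishes at
  \<open>x\<close>, and only the ball of radius \<open>2 * r\<close> contributes, seen from distance
  at least \<open>dist x b / 2\<close>. The weight \<open>cutw\<close> covers both regimes up to a
  constant.\<close>

lemma bump_oscillation:
  fixes \<eta> :: "'a::euclidean_space \<times> real \<Rightarrow> real"
  assumes \<sigma>: "0 < \<sigma>" "\<sigma> < 1" and \<eta>: "\<eta> \<in> C1c UNIV" "\<And>x. 0 \<le> \<eta> x" "\<And>x. \<eta> x \<le> 1" "\<And>x. norm x \<ge> 2 \<Longrightarrow> \<eta> x = 0"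
  obtains C where "C > 0" "\<And>r b x. r > 0 \<Longrightarrow> x \<noteq> b \<Longrightarrow>
    (\<integral>\<^sup>+y. ennreal ((\<eta> ((1 / r) *\<^sub>R (x - b)) - \<eta> ((1 / r) *\<^sub>R (y - b)))\<^sup>2 * gker \<sigma> x y) \<partial>lborel) \<le> ennreal (C * cutw \<sigma> b r x)"
proof -
  let ?N = "dimn TYPE('a \<times> real)"
  let ?q = "?N + 2 * \<sigma>"
  have N: "?N \<ge> 2" by (rule dimn_ge_2)
  have q: "?q > 0" using N \<sigma> by linarith
  obtain M where M: "M > 0" "\<And>x y. \<bar>\<eta> x - \<eta> y\<bar> \<le> M * dist x y" using C1c_bounds[OF \<eta>(1)] by metis
  obtain D where D: "D > 0" "\<And>(x::'a \<times> real) s. s > 0 \<Longrightarrow>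
    (\<integral>\<^sup>+y. ennreal (min 1 ((dist x y / s)\<^sup>2) * gker \<sigma> x y) \<partial>lborel) \<le> ennreal (D * s powr (- 2 * \<sigma>))"
    by (rule ex_gker_truncated[OF \<sigma>, where 'a='a]) (rule that)
  define A where "A = max 1 (M\<^sup>2)"
  have A: "A \<ge> 1" "A \<ge> M\<^sup>2" by (auto simp: A_def)
  define V where "V = unit_ball_vol (real DIM('a \<times> real))"
  have V: "V \<ge> 0" by (simp add: V_def)
  define C where "C = max (A * D * 4 powr ?q) (V * 2 powr ?N * 2 powr ?q) + 1"
  have C: "C \<ge> A * D * 4 powr ?q" "C \<ge> V * 2 powr ?N * 2 powr ?q" unfolding C_def by (simp_all add: le_max_iff_disj add_increasing2)
  have "A * D * 4 powr ?q \<ge> 0" using A D by simp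
  then have C0: "C > 0" unfolding C_def by (simp add: max_def)
  show ?thesis
  proof (rule that[OF C0])
    fix r :: real and b x :: "'a \<times> real"
    assume r: "r > 0" and xb: "x \<noteq> b"
    let ?m = "\<lambda>x. \<eta> ((1 / r) *\<^sub>R (x - b))"
    let ?I = "\<integral>\<^sup>+y. ennreal ((?m x - ?m y)\<^sup>2 * gker \<sigma> x y) \<partial>lborel"
    have \<rho>: "dist x b > 0" using xb by simp
    have far: "?m z = 0" if "2 * r \<le> dist z b" for z
    proof (rule \<eta>(4))
      have "norm ((1 / r) *\<^sub>R (z - b)) = norm (z - b) / r" using r by simp
      then show "2 \<le> norm ((1 / r) *\<^sub>R (z - b))" using that r by (simp only: pos_le_divide_eq dist_norm)
    qed
    show "?I \<le> ennreal (C * cutw \<sigma> b r x)"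
    proof (cases "dist x b \<le> 4 * r")
      case True
      have sq: "(?m x - ?m y)\<^sup>2 \<le> A * min 1 ((dist x y / r)\<^sup>2)" for y
      proof -
        have 1: "\<bar>?m x - ?m y\<bar> \<le> 1" using \<eta>(2,3)[of "(1 / r) *\<^sub>R (x - b)"] \<eta>(2,3)[of "(1 / r) *\<^sub>R (y - b)"] by linarith
        have "dist ((1 / r) *\<^sub>R (x - b)) ((1 / r) *\<^sub>R (y - b)) = dist x y / r"
          using r by (simp add: dist_norm scaleR_diff_right[symmetric])
        then have 2: "\<bar>?m x - ?m y\<bar> \<le> M * (dist x y / r)"
          using M(2)[of "(1 / r) *\<^sub>R (x - b)" "(1 / r) *\<^sub>R (y - b)"] by simp
        have "(?m x - ?m y)\<^sup>2 \<le> 1\<^sup>2" using 1 by (subst abs_le_square_iff[symmetric]) simp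
        then have 3: "(?m x - ?m y)\<^sup>2 \<le> A * 1" using A by simp
        have "(?m x - ?m y)\<^sup>2 \<le> (M * (dist x y / r))\<^sup>2"
          using 2 M r by (subst abs_le_square_iff[symmetric]) simp
        also have "\<dots> = M\<^sup>2 * (dist x y / r)\<^sup>2" by (rule power_mult_distrib)
        also have "\<dots> \<le> A * (dist x y / r)\<^sup>2" by (intro mult_right_mono A) simp
        finally show ?thesis using 3 by (simp add: min_def)
      qed
      have "?I \<le> (\<integral>\<^sup>+y. ennreal A * ennreal (min 1 ((dist x y / r)\<^sup>2) * gker \<sigma> x y) \<partial>lborel)"
      proof (rule nn_integral_mono)
        fix y
        have "(?m x - ?m y)\<^sup>2 * gker \<sigma> x y \<le> A * min 1 ((dist x y / r)\<^sup>2) * gker \<sigma> x y" by (intro mult_right_mono sq) simp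
        then show "ennreal ((?m x - ?m y)\<^sup>2 * gker \<sigma> x y) \<le> ennreal A * ennreal (min 1 ((dist x y / r)\<^sup>2) * gker \<sigma> x y)"
          using A by (simp add: ennreal_mult[symmetric] ennreal_leI mult.assoc)
      qed
      also have "\<dots> = ennreal A * (\<integral>\<^sup>+y. ennreal (min 1 ((dist x y / r)\<^sup>2) * gker \<sigma> x y) \<partial>lborel)"
        by (rule nn_integral_cmult) measurable
      also have "\<dots> \<le> ennreal A * ennreal (D * r powr (- 2 * \<sigma>))" by (intro mult_left_mono D(2) r) simp
      also have "\<dots> = ennreal (A * D * r powr (- 2 * \<sigma>))" using A D by (simp add: ennreal_mult[symmetric] mult.assoc)
      also have "\<dots> \<le> ennreal (C * cutw \<sigma> b r x)"
      proof (rule ennreal_leI)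
        have "1 / 4 \<le> min 1 (r / dist x b)" using True \<rho> by (simp add: field_simps)
        then have "(1 / 4) powr ?q \<le> min 1 (r / dist x b) powr ?q" using q by (intro powr_mono2) auto
        then have "4 powr ?q * (1 / 4) powr ?q \<le> 4 powr ?q * min 1 (r / dist x b) powr ?q" by (intro mult_left_mono) auto
        then have "1 \<le> 4 powr ?q * min 1 (r / dist x b) powr ?q" by (simp add: powr_mult[symmetric])
        then have "A * D * r powr (- 2 * \<sigma>) * 1 \<le> A * D * r powr (- 2 * \<sigma>) * (4 powr ?q * min 1 (r / dist x b) powr ?q)"
          using A D by (intro mult_left_mono) auto
        also have "\<dots> = A * D * 4 powr ?q * cutw \<sigma> b r x" by (simp add: cutw_def mult_ac)
        also have "\<dots> \<le> C * cutw \<sigma> b r x" by (intro mult_right_mono C) (simp add: cutw_def)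
        finally show "A * D * r powr (- 2 * \<sigma>) \<le> C * cutw \<sigma> b r x" by simp
      qed
      finally show ?thesis .
    next
      case False
      then have x0: "?m x = 0" using r by (intro far) linarith
      have "?I \<le> (\<integral>\<^sup>+y. ennreal ((dist x b / 2) powr (- ?q)) * indicator (ball b (2 * r)) y \<partial>lborel)"
      proof (rule nn_integral_mono)
        fix y
        show "ennreal ((?m x - ?m y)\<^sup>2 * gker \<sigma> x y) \<le> ennreal ((dist x b / 2) powr (- ?q)) * indicator (ball b (2 * r)) y"
        proof (cases "dist y b < 2 * r")
          case True
          have "dist x b \<le> dist x y + dist y b" by (rule dist_triangle)
          then have "dist x b / 2 \<le> dist x y" using True False by linarith
          then have "gker \<sigma> x y \<le> (dist x b / 2) powr (- ?q)"
            unfolding gker_def using q \<rho> by (intro powr_mono2') auto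
          moreover have "(?m x - ?m y)\<^sup>2 \<le> 1"
            using \<eta>(2,3)[of "(1 / r) *\<^sub>R (y - b)"] x0 by (simp add: power_le_one)
          ultimately have "(?m x - ?m y)\<^sup>2 * gker \<sigma> x y \<le> 1 * (dist x b / 2) powr (- ?q)"
            by (intro mult_mono) auto
          then show ?thesis using True by (simp add: dist_commute ennreal_leI)
        next
          case False
          then have "?m y = 0" by (intro far) simp
          then show ?thesis by (simp add: x0)
        qed
      qed
      also have "\<dots> = ennreal ((dist x b / 2) powr (- ?q)) * emeasure lborel (ball b (2 * r))"
        by (rule nn_integral_cmult_indicator) simp
      also have "emeasure lborel (ball b (2 * r)) = ennreal (V * (2 * r) powr ?N)"
      proof -
        have "2 * r > 0" using r by simp
        from powr_realpow[OF this, of "DIM('a \<times> real)"] emeasure_ball[of "2 * r" b] r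
        show ?thesis by (simp only: V_def dimn_def)
      qed
      also have "ennreal ((dist x b / 2) powr (- ?q)) * ennreal (V * (2 * r) powr ?N) = ennreal ((dist x b / 2) powr (- ?q) * (V * (2 * r) powr ?N))"
        using V by (simp add: ennreal_mult)
      also have "\<dots> \<le> ennreal (C * cutw \<sigma> b r x)"
      proof (rule ennreal_leI)
        have min: "min 1 (r / dist x b) = r / dist x b" using False \<rho> r by (simp add: min_def field_simps)
        have e1: "(dist x b / 2) powr (- ?q) = 2 powr ?q * dist x b powr (- ?q)"
          using \<rho> by (intro powr_divide_minus) auto
        have e2: "(2 * r) powr ?N = 2 powr ?N * r powr ?N" using r by (simp add: powr_mult)
        have e3: "cutw \<sigma> b r x = r powr ?N * dist x b powr (- ?q)"
        proof -
          have "(r / dist x b) powr ?q = r powr ?q * dist x b powr (- ?q)"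
            using \<rho> r by (intro powr_divide_minus)
          moreover have "r powr (- 2 * \<sigma>) * r powr ?q = r powr ?N" by (simp add: powr_add[symmetric])
          ultimately show ?thesis unfolding cutw_def min by (simp add: mult.assoc[symmetric])
        qed
        have "(dist x b / 2) powr (- ?q) * (V * (2 * r) powr ?N) = V * 2 powr ?N * 2 powr ?q * cutw \<sigma> b r x"
          unfolding e1 e2 e3 by (simp only: mult_ac)
        also have "\<dots> \<le> C * cutw \<sigma> b r x" by (intro mult_right_mono C) (simp add: cutw_def)
        finally show "(dist x b / 2) powr (- ?q) * (V * (2 * r) powr ?N) \<le> C * cutw \<sigma> b r x" .
      qed
      finally show ?thesis .
    qed
  qed
qed

context minimizer
begin

text \<open>By \<open>a c \<le> (a\<^sup>2 + c\<^sup>2) / 2\<close> and the symmetry of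
  \<open>gmeas\<close>, all the mass of \<open>u\<close> is moved to the first point; the integral
  over the second sees only the multiplier.\<close>

lemma lam_le_wint:
  assumes m: "multiplier m" and w: "w \<in> borel_measurable borel" "C > 0"
    and le: "\<And>x. x \<in> half_space \<Longrightarrow> (\<integral>\<^sup>+y. ennreal ((m x - m y)\<^sup>2 * gker \<sigma> x y) \<partial>lborel) \<le> ennreal (C * w x)"
    and w0: "\<And>x. w x \<ge> 0"
  shows "lam m \<le> ennreal C * wint w u"
proof -
  have [measurable]: "m \<in> borel_measurable borel" "w \<in> borel_measurable borel" using multiplier_measurable[OF m] w by auto
  let ?\<rho> = "\<lambda>z. ennreal ((m (fst z) - m (snd z))\<^sup>2)"
  let ?h = "\<lambda>x. ennreal ((u x)\<^sup>2 / 2)"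
  have "lam m \<le> (\<integral>\<^sup>+z. ?h (fst z) * ?\<rho> z + ?h (snd z) * ?\<rho> (snd z, fst z) \<partial>gmeas \<sigma>)"
    unfolding lam_def
  proof (rule nn_integral_mono)
    fix z :: "('a \<times> real) \<times> ('a \<times> real)"
    define a c where "a = \<bar>u (fst z)\<bar>" and "c = \<bar>u (snd z)\<bar>"
    have "0 \<le> (a - c)\<^sup>2" by simp
    then have "a * c \<le> a\<^sup>2 / 2 + c\<^sup>2 / 2" by (simp add: power2_diff)
    then have "a * c * (m (fst z) - m (snd z))\<^sup>2 \<le> (a\<^sup>2 / 2 + c\<^sup>2 / 2) * (m (fst z) - m (snd z))\<^sup>2" by (rule mult_right_mono) simp
    also have "\<dots> = (u (fst z))\<^sup>2 / 2 * (m (fst z) - m (snd z))\<^sup>2 + (u (snd z))\<^sup>2 / 2 * (m (snd z) - m (fst z))\<^sup>2"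
      by (simp add: a_def c_def distrib_right power2_commute)
    finally have "ennreal (\<bar>u (fst z)\<bar> * \<bar>u (snd z)\<bar> * (m (fst z) - m (snd z))\<^sup>2) \<le> ennreal ((u (fst z))\<^sup>2 / 2 * (m (fst z) - m (snd z))\<^sup>2 + (u (snd z))\<^sup>2 / 2 * (m (snd z) - m (fst z))\<^sup>2)"
      unfolding a_def c_def by (rule ennreal_leI)
    also have "\<dots> = ?h (fst z) * ?\<rho> z + ?h (snd z) * ?\<rho> (snd z, fst z)"
      by (simp only: ennreal_plus ennreal_mult zero_le_power2 divide_nonneg_nonneg mult_nonneg_nonneg zero_le_numeral fst_conv snd_conv)
    finally show "ennreal (\<bar>u (fst z)\<bar> * \<bar>u (snd z)\<bar> * (m (fst z) - m (snd z))\<^sup>2) \<le> ?h (fst z) * ?\<rho> z + ?h (snd z) * ?\<rho> (snd z, fst z)" .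
  qed
  also have "\<dots> = (\<integral>\<^sup>+z. ?h (fst z) * ?\<rho> z \<partial>gmeas \<sigma>) + (\<integral>\<^sup>+z. ?h (snd z) * ?\<rho> (snd z, fst z) \<partial>gmeas \<sigma>)"
    by (rule nn_integral_add) measurable
  also have "(\<integral>\<^sup>+z. ?h (snd z) * ?\<rho> (snd z, fst z) \<partial>gmeas \<sigma>) = (\<integral>\<^sup>+z. ?h (fst z) * ?\<rho> z \<partial>gmeas \<sigma>)"
    by (rule nn_integral_gmeas_sym) measurable
  also have "(\<integral>\<^sup>+z. ?h (fst z) * ?\<rho> z \<partial>gmeas \<sigma>) + (\<integral>\<^sup>+z. ?h (fst z) * ?\<rho> z \<partial>gmeas \<sigma>) = (\<integral>\<^sup>+z. ennreal ((u (fst z))\<^sup>2) * ?\<rho> z \<partial>gmeas \<sigma>)"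
    by (subst nn_integral_add[symmetric]) (auto simp: distrib_right[symmetric] ennreal_plus[symmetric] simp del: ennreal_plus)
  also have "\<dots> = (\<integral>\<^sup>+x. indicator half_space x * ennreal ((u x)\<^sup>2) * (\<integral>\<^sup>+y. indicator half_space y * (ennreal (gker \<sigma> x y) * ?\<rho> (x, y)) \<partial>lborel) \<partial>lborel)"
    by (rule nn_integral_gmeas_fst) measurable
  also have "\<dots> \<le> (\<integral>\<^sup>+x. ennreal C * (indicator half_space x * ennreal ((u x)\<^sup>2 * w x)) \<partial>lborel)"
  proof (rule nn_integral_mono)
    fix x
    show "indicator half_space x * ennreal ((u x)\<^sup>2) * (\<integral>\<^sup>+y. indicator half_space y * (ennreal (gker \<sigma> x y) * ?\<rho> (x, y)) \<partial>lborel) \<le> ennreal C * (indicator half_space x * ennreal ((u x)\<^sup>2 * w x))"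
    proof (cases "x \<in> half_space")
      case True
      have "(\<integral>\<^sup>+y. indicator half_space y * (ennreal (gker \<sigma> x y) * ?\<rho> (x, y)) \<partial>lborel) \<le> (\<integral>\<^sup>+y. ennreal ((m x - m y)\<^sup>2 * gker \<sigma> x y) \<partial>lborel)"
        by (intro nn_integral_mono) (auto simp: indicator_def ennreal_mult mult.commute)
      also have "\<dots> \<le> ennreal (C * w x)" by (rule le[OF True])
      finally have "ennreal ((u x)\<^sup>2) * (\<integral>\<^sup>+y. indicator half_space y * (ennreal (gker \<sigma> x y) * ?\<rho> (x, y)) \<partial>lborel) \<le> ennreal ((u x)\<^sup>2) * ennreal (C * w x)"
        by (rule mult_left_mono) simp
      also have "\<dots> = ennreal C * ennreal ((u x)\<^sup>2 * w x)" using w(2) w0[of x] by (simp add: ennreal_mult[symmetric] mult_ac)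
      finally show ?thesis using True by simp
    qed simp
  qed
  also have "\<dots> = ennreal C * wint w u" unfolding wint_def by (rule nn_integral_cmult) measurable
  finally show ?thesis .
qed

end

section \<open>Kelvin transform\<close>

lemma inversion_scaleR: "inversion (c *\<^sub>R x) = (1 / c) *\<^sub>R inversion x"
  by (cases "c = 0") (simp_all add: inversion_def)

lemma sphere_inv_inverse: "l \<noteq> 0 \<Longrightarrow> sphere_inv b l a (sphere_inv a l b x) = x"
  by (simp add: sphere_inv_def inversion_scaleR)

lemma dist_sphere_inv_centre: "l > 0 \<Longrightarrow> dist (sphere_inv a l b x) a = l / dist x b"
  by (simp add: sphere_inv_def dist_norm norm_inversion)

lemma dist_sphere_inv:
  assumes "l > 0" "x \<noteq> b" "y \<noteq> b"
  shows "dist (sphere_inv a l b x) (sphere_inv a l b y) = l * dist x y / (dist x b * dist y b)"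
proof -
  have "sphere_inv a l b x - sphere_inv a l b y = l *\<^sub>R (inversion (x - b) - inversion (y - b))"
    by (simp add: sphere_inv_def scaleR_diff_right)
  then show ?thesis using assms norm_inversion_diff[of "x - b" "y - b"] by (simp add: dist_norm)
qed

text \<open>With both centres on the boundary, the map multiplies the height of a point by a
  positive factor.\<close>

lemma sphere_inv_half_space:
  fixes a b x :: "'a::euclidean_space \<times> real"
  assumes "snd a = 0" "snd b = 0" "l > 0"
  shows "sphere_inv a l b x \<in> half_space \<longleftrightarrow> x \<in> half_space"
proof (cases "x = b")
  case True
  then show ?thesis using assms by (simp add: sphere_inv_def inversion_def half_space_def)
next
  case False
  define c where "c = l / ((x - b) \<bullet> (x - b))"
  have "c > 0" using False assms(3) by (simp add: c_def)
  moreover have "snd (sphere_inv a l b x) = c * snd x"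
    using assms by (simp add: sphere_inv_def inversion_def c_def)
  ultimately show ?thesis by (simp add: half_space_def zero_less_mult_iff)
qed

lemma C1_on_inversion: "C1_on (- {0}) (inversion :: 'a::euclidean_space \<Rightarrow> 'a)"
proof -
  have "C1_on (- {0}) (\<lambda>x :: 'a. inverse ((norm x)\<^sup>2))"
  proof (rule C1_on_compose[OF C1_on_norm_square, where V="{0<..}" and g=inverse])
    show "C1_on {0<..} (inverse :: real \<Rightarrow> real)" by (rule C1_on_inverse_real) auto
  qed auto
  then have "C1_on (- {0}) (\<lambda>x :: 'a. inverse ((norm x)\<^sup>2) *\<^sub>R x)"
    by (rule C1_on_scaleR) (rule C1_on_bounded_linear[OF bounded_linear_ident])
  moreover have "(\<lambda>x :: 'a. inverse ((norm x)\<^sup>2) *\<^sub>R x) = inversion"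
    by (auto simp: inversion_def power2_norm_eq_inner inverse_eq_divide)
  ultimately show ?thesis by simp
qed

lemma C1_on_sphere_inv: "C1_on (- {b}) (sphere_inv a l b :: 'a::euclidean_space \<Rightarrow> 'a)"
proof -
  have "C1_on (- {b}) (\<lambda>x. x + (- b))"
    by (intro C1_on_add C1_on_const C1_on_bounded_linear bounded_linear_ident)
  then have "C1_on (- {b}) (\<lambda>x. inversion (x + (- b)))"
    by (rule C1_on_compose[OF _ C1_on_inversion]) auto
  then have "C1_on (- {b}) (\<lambda>x. a + l *\<^sub>R inversion (x + (- b)))"
    by (intro C1_on_add C1_on_const C1_on_scaleR)
  then show ?thesis by (simp add: sphere_inv_def[abs_def])
qed

text \<open>Up to the constant \<open>l powr (n - 2 * \<sigma>)\<close> this is the classical Kelvin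
  transform, since \<open>dist (sphere_inv b l a y) b = l / dist y a\<close>. Writing the factor
  through the preimage makes its pullback a power of \<open>dist x b\<close>.\<close>

definition kelvin :: "real \<Rightarrow> 'a::euclidean_space \<times> real \<Rightarrow> real \<Rightarrow> 'a \<times> real \<Rightarrow> ('a \<times> real \<Rightarrow> real) \<Rightarrow> 'a \<times> real \<Rightarrow> real" where
  "kelvin \<sigma> a l b v y = dist (sphere_inv b l a y) b powr (dimn TYPE('a \<times> real) - 2 * \<sigma>) * v (sphere_inv b l a y)"

lemma kelvin_sphere_inv:
  fixes v :: "'a::euclidean_space \<times> real \<Rightarrow> real"
  shows "l > 0 \<Longrightarrow> kelvin \<sigma> a l b v (sphere_inv a l b x) = dist x b powr (dimn TYPE('a \<times> real) - 2 * \<sigma>) * v x"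
  by (simp add: kelvin_def sphere_inv_inverse)

lemma kelvin_measurable [measurable]:
  assumes [measurable]: "v \<in> borel_measurable borel"
  shows "kelvin \<sigma> a l b v \<in> borel_measurable borel"
  unfolding kelvin_def[abs_def] by measurable

text \<open>Points of the support keep distance \<open>r\<close> from \<open>b\<close>, so their
  images lie within \<open>l / r < \<epsilon>\<close> of \<open>a\<close>; the support also avoids
  both singular points, which keeps the transform continuously differentiable.\<close>

lemma kelvin_C1c:
  fixes v :: "'a::euclidean_space \<times> real \<Rightarrow> real"
  assumes v: "v \<in> C1c half_space" "\<And>x. dist x b < r \<Longrightarrow> v x = 0" and r: "r > 0" and l: "0 < l" "l / r < \<epsilon>"
    and ab: "snd a = 0" "snd b = 0" and \<Omega>: "half_ball a \<epsilon> \<subseteq> \<Omega>"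
  shows "kelvin \<sigma> a l b v \<in> C1c \<Omega>" and "\<And>y. kelvin \<sigma> a l b v y \<noteq> 0 \<Longrightarrow> y \<in> half_ball a \<epsilon>"
proof -
  let ?m = "dimn TYPE('a \<times> real) - 2 * \<sigma>"
  let ?\<Phi> = "sphere_inv a l b"
  let ?\<Psi> = "sphere_inv b l a"
  obtain K0 where K0: "compact K0" "K0 \<subseteq> half_space" "\<And>x. x \<notin> K0 \<Longrightarrow> v x = 0" using C1c_support[OF v(1)] by metis
  define K where "K = K0 - ball b r"
  have K: "compact K" "K \<subseteq> half_space" "\<And>x. x \<notin> K \<Longrightarrow> v x = 0" "\<And>x. x \<in> K \<Longrightarrow> r \<le> dist x b"
    using K0 v(2) by (auto simp: K_def dist_commute intro: compact_diff)
  have Kb: "K \<subseteq> - {b}" using K(4) r by fastforce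
  have cK: "compact (?\<Phi> ` K)"
    by (rule compact_continuous_image[OF continuous_on_subset[OF C1_on_imp_continuous_on[OF C1_on_sphere_inv] Kb] K(1)])
  have ball: "?\<Phi> ` K \<subseteq> half_ball a \<epsilon>"
  proof
    fix y assume "y \<in> ?\<Phi> ` K"
    then obtain x where x: "x \<in> K" "y = ?\<Phi> x" by blast
    have "dist y a = l / dist x b" unfolding x(2) by (rule dist_sphere_inv_centre[OF l(1)])
    also have "\<dots> \<le> l / r" using K(4)[OF x(1)] r l(1) by (intro divide_left_mono mult_pos_pos) auto
    also have "\<dots> < \<epsilon>" by (rule l(2))
    finally have "dist y a < \<epsilon>" .
    moreover have "y \<in> half_space" using sphere_inv_half_space[OF ab l(1)] x K(2) by auto
    ultimately show "y \<in> half_ball a \<epsilon>" by (simp add: half_ball_def)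
  qed
  have zero: "kelvin \<sigma> a l b v y = 0" if "y \<notin> ?\<Phi> ` K" for y
  proof -
    have "?\<Phi> (?\<Psi> y) = y" using l(1) by (intro sphere_inv_inverse) simp
    then have "?\<Psi> y \<notin> K" using that by (metis image_eqI)
    then show ?thesis by (simp add: kelvin_def K(3))
  qed
  have "C1_on (- {a}) (kelvin \<sigma> a l b v)"
  proof -
    have 1: "C1_on (- {a}) (\<lambda>y. v (?\<Psi> y))"
      by (rule C1_on_compose[OF C1_on_sphere_inv C1c_imp_C1_on[OF v(1)] subset_UNIV])
    \<comment> \<open>The power of the distance is taken as a power of the squared norm, which is
      differentiable everywhere.\<close>
    have "C1_on (- {b}) (\<lambda>x. (norm (x + (- b)))\<^sup>2)"
      by (rule C1_on_compose[OF C1_on_add[OF C1_on_bounded_linear[OF bounded_linear_ident] C1_on_const] C1_on_norm_square subset_UNIV])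
    then have "C1_on (- {b}) (\<lambda>x. ((norm (x + (- b)))\<^sup>2) powr (?m / 2))"
    proof (rule C1_on_compose[where V="{0<..}" and g="\<lambda>t. t powr (?m / 2)"])
      show "C1_on {0<..} (\<lambda>t :: real. t powr (?m / 2))"
      proof (rule C1_on_real[where f'="\<lambda>t. ?m / 2 * t powr (?m / 2 - 1)"])
        show "continuous_on {0<..} (\<lambda>t. ?m / 2 * t powr (?m / 2 - 1))" by (intro continuous_intros) auto
      qed (auto intro!: derivative_eq_intros)
    qed auto
    moreover have "((norm (x + (- b)))\<^sup>2) powr (?m / 2) = dist x b powr ?m" for x
    proof (cases "x = b")
      case False
      then have "(norm (x - b))\<^sup>2 = norm (x - b) powr 2" by simp
      moreover have "2 * (?m / 2) = ?m" by (simp add: field_simps)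
      ultimately show ?thesis by (simp only: powr_powr dist_norm add_uminus_conv_diff)
    qed simp
    ultimately have "C1_on (- {b}) (\<lambda>x. dist x b powr ?m)" by simp
    then have 2: "C1_on (- {a}) (\<lambda>y. dist (?\<Psi> y) b powr ?m)"
    proof (rule C1_on_compose[OF C1_on_sphere_inv])
      show "?\<Psi> ` (- {a}) \<subseteq> - {b}" using l(1) by (auto simp: sphere_inv_def)
    qed
    show ?thesis unfolding kelvin_def[abs_def] by (rule C1_on_mult[OF 2 1])
  qed
  then show "kelvin \<sigma> a l b v \<in> C1c \<Omega>"
  proof (rule C1cI[OF _ _ cK])
    show "?\<Phi> ` K \<subseteq> - {a}" using Kb l(1) by (auto simp: sphere_inv_def)
  qed (use ball \<Omega> zero in auto)
  show "\<And>y. kelvin \<sigma> a l b v y \<noteq> 0 \<Longrightarrow> y \<in> half_ball a \<epsilon>" using zero ball by blast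
qed

section \<open>Norm, mass and energy under the Kelvin transform\<close>

lemma nn_integral_kelvin:
  fixes v :: "'a::euclidean_space \<times> real \<Rightarrow> real"
  assumes [measurable]: "v \<in> borel_measurable borel" "h \<in> borel_measurable borel" and l: "l > 0" and ab: "snd a = 0" "snd b = 0"
  shows "(\<integral>\<^sup>+y. indicator half_space y * ennreal (h (kelvin \<sigma> a l b v y)) \<partial>lborel) =
    ennreal (l powr dimn TYPE('a \<times> real)) * (\<integral>\<^sup>+x. indicator half_space x * (ennreal (dist x b powr (- 2 * dimn TYPE('a \<times> real))) * ennreal (h (dist x b powr (dimn TYPE('a \<times> real) - 2 * \<sigma>) * v x))) \<partial>lborel)"
proof -
  let ?N = "dimn TYPE('a \<times> real)"
  have "(\<integral>\<^sup>+y. indicator half_space y * ennreal (h (kelvin \<sigma> a l b v y)) \<partial>lborel) =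
    (\<integral>\<^sup>+x. ennreal (l powr ?N * norm (x - b) powr (- 2 * ?N)) * (indicator half_space (sphere_inv a l b x) * ennreal (h (kelvin \<sigma> a l b v (sphere_inv a l b x)))) \<partial>lborel)"
    unfolding dimn_def by (rule nn_integral_sphere_inv) (use l in measurable)
  also have "\<dots> = (\<integral>\<^sup>+x. ennreal (l powr ?N) * (indicator half_space x * (ennreal (dist x b powr (- 2 * ?N)) * ennreal (h (dist x b powr (?N - 2 * \<sigma>) * v x)))) \<partial>lborel)"
    by (intro nn_integral_cong)
       (auto simp: indicator_def sphere_inv_half_space[OF ab l] kelvin_sphere_inv[OF l] ennreal_mult dist_norm mult_ac)
  also have "\<dots> = ennreal (l powr ?N) * (\<integral>\<^sup>+x. indicator half_space x * (ennreal (dist x b powr (- 2 * ?N)) * ennreal (h (dist x b powr (?N - 2 * \<sigma>) * v x))) \<partial>lborel)"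
    by (rule nn_integral_cmult) measurable
  finally show ?thesis .
qed

text \<open>For the critical exponent \<open>(n - 2 * \<sigma>) p = 2 n\<close>, so the prefactor
  cancels the Jacobian \<open>dist x b powr (- 2 n)\<close> exactly.\<close>

lemma kelvin_lp_int:
  fixes v :: "'a::euclidean_space \<times> real \<Rightarrow> real"
  assumes [measurable]: "v \<in> borel_measurable borel" and \<sigma>: "0 < \<sigma>" "\<sigma> < 1" and l: "l > 0" and ab: "snd a = 0" "snd b = 0"
  shows "lp_int \<sigma> half_space (kelvin \<sigma> a l b v) = ennreal (l powr dimn TYPE('a \<times> real)) * lp_int \<sigma> half_space v"
proof -
  let ?N = "dimn TYPE('a \<times> real)"
  let ?p = "crit_exp \<sigma> TYPE('a \<times> real)"
  have N: "?N \<ge> 2" by (rule dimn_ge_2)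
  have mp: "(?N - 2 * \<sigma>) * ?p = 2 * ?N" using N \<sigma> by (simp add: crit_exp_def)
  have "indicator half_space x * (ennreal (dist x b powr (- 2 * ?N)) * ennreal (\<bar>dist x b powr (?N - 2 * \<sigma>) * v x\<bar> powr ?p)) = indicator half_space x * ennreal (\<bar>v x\<bar> powr ?p)" for x
  proof (cases "x \<in> half_space")
    case True
    then have "x \<noteq> b" using ab by (auto simp: half_space_def)
    have "\<bar>dist x b powr (?N - 2 * \<sigma>) * v x\<bar> powr ?p = dist x b powr (2 * ?N) * \<bar>v x\<bar> powr ?p"
      by (simp add: abs_mult powr_mult powr_powr mp)
    moreover have "dist x b powr (- 2 * ?N) * dist x b powr (2 * ?N) = 1"
      using \<open>x \<noteq> b\<close> by (simp add: powr_add[symmetric])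
    ultimately show ?thesis using True by (simp add: ennreal_mult[symmetric] mult.assoc[symmetric])
  qed simp
  then show ?thesis
    unfolding lp_int_def using nn_integral_kelvin[OF assms(1) _ l ab, of "\<lambda>t. \<bar>t\<bar> powr ?p" \<sigma>] by simp
qed

text \<open>The square integral is not conformally invariant:
  \<open>- 2 n + 2 (n - 2 * \<sigma>) = - 4 * \<sigma>\<close> is left over. This is the origin of
  the weight in the improved Sobolev inequality.\<close>

lemma kelvin_square_int:
  fixes v :: "'a::euclidean_space \<times> real \<Rightarrow> real"
  assumes [measurable]: "v \<in> borel_measurable borel" and l: "l > 0" and ab: "snd a = 0" "snd b = 0"
  shows "wint (\<lambda>_. 1) (kelvin \<sigma> a l b v) = ennreal (l powr dimn TYPE('a \<times> real)) * wint (\<lambda>x. dist x b powr (- 4 * \<sigma>)) v"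
proof -
  let ?N = "dimn TYPE('a \<times> real)"
  have "indicator half_space x * (ennreal (dist x b powr (- 2 * ?N)) * ennreal ((dist x b powr (?N - 2 * \<sigma>) * v x)\<^sup>2)) = indicator half_space x * ennreal ((v x)\<^sup>2 * dist x b powr (- 4 * \<sigma>))" for x
  proof (cases "x \<in> half_space")
    case True
    have "dist x b powr (- 2 * ?N) * (dist x b powr (?N - 2 * \<sigma>))\<^sup>2 = dist x b powr (- 4 * \<sigma>)"
      by (simp add: power2_eq_square powr_add[symmetric])
    then have "dist x b powr (- 2 * ?N) * (dist x b powr (?N - 2 * \<sigma>) * v x)\<^sup>2 = (v x)\<^sup>2 * dist x b powr (- 4 * \<sigma>)"
      by (simp only: power_mult_distrib mult.assoc[symmetric]) (simp only: mult.commute)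
    then show ?thesis using True by (simp add: ennreal_mult[symmetric])
  qed simp
  then show ?thesis
    unfolding wint_def using nn_integral_kelvin[OF assms(1) _ l ab, of "\<lambda>t. t\<^sup>2" \<sigma>] by simp
qed

text \<open>The function \<open>dist x b powr (2 * \<sigma> - n)\<close> is the Kelvin transform of a constant, hence harmonic
  for the form on the half-space; as before this is used away from the diagonal only.\<close>
lemma kelvin_harmonic:
  fixes x b :: "'a::euclidean_space \<times> real"
  assumes x: "x \<in> half_space" and b: "snd b = 0" and \<eta>: "\<eta> > 0"
  shows "(\<integral>\<^sup>+y. indicator half_space y * (ennreal (gker \<sigma> x y) * ennreal ((dist x b / dist y b) powr (dimn TYPE('a \<times> real) - 2 * \<sigma>) * off_diag \<eta> (dist y b / dist x b))) \<partial>lborel)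
    = (\<integral>\<^sup>+y. indicator half_space y * (ennreal (gker \<sigma> x y) * ennreal (off_diag \<eta> (dist y b / dist x b))) \<partial>lborel)"
proof -
  let ?N = "dimn TYPE('a \<times> real)"
  define \<rho> where "\<rho> = dist x b"
  have xb: "x \<noteq> b" using x b by (auto simp: half_space_def)
  then have \<rho>: "\<rho> > 0" by (simp add: \<rho>_def)
  \<comment> \<open>The inversion in the sphere about \<open>b\<close> through \<open>x\<close>; it
    fixes \<open>x\<close> and preserves the half-space, so the integral over \<open>y\<close> can
    be compared with itself.\<close>
  let ?\<Phi> = "sphere_inv b (\<rho>\<^sup>2) b"
  have \<Phi>x: "?\<Phi> x = x" using \<rho> xb by (simp add: sphere_inv_def inversion_def \<rho>_def dist_norm power2_norm_eq_inner)
  have "(\<integral>\<^sup>+y. indicator half_space y * (ennreal (gker \<sigma> x y) * ennreal (off_diag \<eta> (dist y b / \<rho>))) \<partial>lborel) =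
    (\<integral>\<^sup>+y. ennreal ((\<rho>\<^sup>2) powr ?N * norm (y - b) powr (- 2 * ?N)) * (indicator half_space (?\<Phi> y) * (ennreal (gker \<sigma> x (?\<Phi> y)) * ennreal (off_diag \<eta> (dist (?\<Phi> y) b / \<rho>)))) \<partial>lborel)"
    unfolding dimn_def by (rule nn_integral_sphere_inv, measurable) (use \<rho> in simp)
  also have "\<dots> = (\<integral>\<^sup>+y. indicator half_space y * (ennreal (gker \<sigma> x y) * ennreal ((\<rho> / dist y b) powr (?N - 2 * \<sigma>) * off_diag \<eta> (dist y b / \<rho>))) \<partial>lborel)"
  proof (rule nn_integral_cong)
    fix y :: "'a \<times> real"
    show "ennreal ((\<rho>\<^sup>2) powr ?N * norm (y - b) powr (- 2 * ?N)) * (indicator half_space (?\<Phi> y) * (ennreal (gker \<sigma> x (?\<Phi> y)) * ennreal (off_diag \<eta> (dist (?\<Phi> y) b / \<rho>)))) =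
      indicator half_space y * (ennreal (gker \<sigma> x y) * ennreal ((\<rho> / dist y b) powr (?N - 2 * \<sigma>) * off_diag \<eta> (dist y b / \<rho>)))"
    proof (cases "y \<in> half_space")
      case True
      then have yb: "y \<noteq> b" using b by (auto simp: half_space_def)
      define t where "t = dist y b"
      have t: "t > 0" using yb by (simp add: t_def)
      have H: "?\<Phi> y \<in> half_space" using sphere_inv_half_space[OF b b, of "\<rho>\<^sup>2" y] \<rho> True by simp
      have "dist x (?\<Phi> y) = dist (?\<Phi> x) (?\<Phi> y)" by (simp add: \<Phi>x)
      also have "\<dots> = \<rho>\<^sup>2 * dist x y / (\<rho> * t)" unfolding \<rho>_def t_def
        by (rule dist_sphere_inv) (use \<rho> xb yb in \<open>auto simp: \<rho>_def\<close>)
      also have "\<dots> = (\<rho> / t) * dist x y" using \<rho> by (simp add: power2_eq_square)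
      finally have k: "gker \<sigma> x (?\<Phi> y) = (\<rho> / t) powr (- (?N + 2 * \<sigma>)) * gker \<sigma> x y"
        unfolding gker_def by (simp only: powr_mult)
      \<comment> \<open>The ratio of distances is inverted, and the truncation is invariant under
        that.\<close>
      have "dist (?\<Phi> y) b / \<rho> = 1 / (t / \<rho>)"
        using dist_sphere_inv_centre[of "\<rho>\<^sup>2" b b y] \<rho> t by (simp add: t_def power2_eq_square)
      then have d: "off_diag \<eta> (dist (?\<Phi> y) b / \<rho>) = off_diag \<eta> (t / \<rho>)"
        using \<rho> t \<eta> by (simp only: off_diag_inverse divide_pos_pos)
      have j: "(\<rho>\<^sup>2) powr ?N * norm (y - b) powr (- 2 * ?N) = (\<rho> / t) powr (2 * ?N)"
      proof -
        have "(\<rho>\<^sup>2) powr ?N = \<rho> powr (2 * ?N)" using \<rho> by (simp add: power2_eq_square powr_mult powr_add[symmetric])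
        moreover have "norm (y - b) powr (- 2 * ?N) = 1 / t powr (2 * ?N)" by (simp add: t_def dist_norm powr_minus_divide)
        ultimately show ?thesis using \<rho> t by (simp add: powr_divide)
      qed
      have "(\<rho> / t) powr (2 * ?N) * ((\<rho> / t) powr (- (?N + 2 * \<sigma>)) * gker \<sigma> x y * off_diag \<eta> (t / \<rho>)) =
         ((\<rho> / t) powr (2 * ?N) * (\<rho> / t) powr (- (?N + 2 * \<sigma>))) * (gker \<sigma> x y * off_diag \<eta> (t / \<rho>))" by (simp only: mult_ac)
      also have "(\<rho> / t) powr (2 * ?N) * (\<rho> / t) powr (- (?N + 2 * \<sigma>)) = (\<rho> / t) powr (?N - 2 * \<sigma>)"
        by (simp add: powr_add[symmetric])
      finally have "(\<rho> / t) powr (2 * ?N) * ((\<rho> / t) powr (- (?N + 2 * \<sigma>)) * gker \<sigma> x y * off_diag \<eta> (t / \<rho>)) =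
         gker \<sigma> x y * ((\<rho> / t) powr (?N - 2 * \<sigma>) * off_diag \<eta> (t / \<rho>))" by (simp only: mult_ac)
      then show ?thesis using True H unfolding j k d t_def[symmetric]
        by (simp add: ennreal_mult[symmetric])
    next
      case False
      then show ?thesis using sphere_inv_half_space[OF b b, of "\<rho>\<^sup>2" y] \<rho> by simp
    qed
  qed
  finally show ?thesis unfolding \<rho>_def by simp
qed

text \<open>The energy density of the Kelvin transform pulled back to the original variables: the
  ground state form of the energy with respect to \<open>dist x b powr (- m)\<close>.\<close>

definition kel_form :: "real \<Rightarrow> 'a::euclidean_space \<times> real \<Rightarrow> ('a \<times> real \<Rightarrow> real) \<Rightarrow> ('a \<times> real) \<times> ('a \<times> real) \<Rightarrow> real" where
  "kel_form m b v z = (dist (fst z) b powr m * v (fst z) - dist (snd z) b powr m * v (snd z))\<^sup>2 * (dist (fst z) b powr (- m) * dist (snd z) b powr (- m))"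

lemma kel_form_measurable [measurable]:
  assumes [measurable]: "v \<in> borel_measurable borel"
  shows "kel_form m b v \<in> borel_measurable (borel \<Otimes>\<^sub>M borel)"
  unfolding kel_form_def[abs_def] by measurable

lemma kel_form_nonneg: "kel_form m b v z \<ge> 0" by (simp add: kel_form_def)

text \<open>An exact change of variables in both points. The image distance is
  \<open>l * dist x y / (dist x b * dist y b)\<close>, so the two Jacobians and the kernel combine
  to \<open>l powr (2 n - (n + 2 * \<sigma>))\<close> and, for each point, the power
  \<open>- 2 n + (n + 2 * \<sigma>) = - (n - 2 * \<sigma>)\<close> of its distance to
  \<open>b\<close>.\<close>

lemma gen_kelvin:
  fixes v :: "'a::euclidean_space \<times> real \<Rightarrow> real"
  assumes [measurable]: "v \<in> borel_measurable borel" and l: "l > 0" and ab: "snd a = 0" "snd b = 0"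
  shows "gen \<sigma> (kelvin \<sigma> a l b v) = ennreal (l powr (dimn TYPE('a \<times> real) - 2 * \<sigma>)) *
    (\<integral>\<^sup>+z. ennreal (kel_form (dimn TYPE('a \<times> real) - 2 * \<sigma>) b v z) \<partial>gmeas \<sigma>)"
proof -
  let ?N = "dimn TYPE('a \<times> real)"
  let ?m = "?N - 2 * \<sigma>"
  let ?\<Phi> = "sphere_inv a l b"
  let ?k = "kelvin \<sigma> a l b v"
  let ?J = "\<lambda>x :: 'a \<times> real. ennreal (l powr ?N * norm (x - b) powr (- 2 * ?N))"
  have "gen \<sigma> ?k = (\<integral>\<^sup>+X. indicator half_space X * (\<integral>\<^sup>+Y. indicator half_space Y * (ennreal (gker \<sigma> X Y) * ennreal ((?k X - ?k Y)\<^sup>2)) \<partial>lborel) \<partial>lborel)"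
    unfolding gen_def by (subst nn_integral_gmeas) simp_all
  also have "\<dots> = (\<integral>\<^sup>+x. ?J x * (indicator half_space (?\<Phi> x) * (\<integral>\<^sup>+Y. indicator half_space Y * (ennreal (gker \<sigma> (?\<Phi> x) Y) * ennreal ((?k (?\<Phi> x) - ?k Y)\<^sup>2)) \<partial>lborel)) \<partial>lborel)"
    unfolding dimn_def by (rule nn_integral_sphere_inv, measurable) (rule l)
  also have "\<dots> = (\<integral>\<^sup>+x. ?J x * (indicator half_space (?\<Phi> x) * (\<integral>\<^sup>+y. ?J y * (indicator half_space (?\<Phi> y) * (ennreal (gker \<sigma> (?\<Phi> x) (?\<Phi> y)) * ennreal ((?k (?\<Phi> x) - ?k (?\<Phi> y))\<^sup>2))) \<partial>lborel)) \<partial>lborel)"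
  proof -
    have "(\<integral>\<^sup>+Y. indicator half_space Y * (ennreal (gker \<sigma> (?\<Phi> x) Y) * ennreal ((?k (?\<Phi> x) - ?k Y)\<^sup>2)) \<partial>lborel) =
      (\<integral>\<^sup>+y. ?J y * (indicator half_space (?\<Phi> y) * (ennreal (gker \<sigma> (?\<Phi> x) (?\<Phi> y)) * ennreal ((?k (?\<Phi> x) - ?k (?\<Phi> y))\<^sup>2))) \<partial>lborel)" for x
      unfolding dimn_def by (rule nn_integral_sphere_inv, measurable) (rule l)
    then show ?thesis by simp
  qed
  also have "\<dots> = (\<integral>\<^sup>+x. ennreal (l powr ?m) * (indicator half_space x * (\<integral>\<^sup>+y. indicator half_space y * (ennreal (gker \<sigma> x y) * ennreal (kel_form ?m b v (x, y))) \<partial>lborel)) \<partial>lborel)"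
  proof (rule nn_integral_cong)
    fix x :: "'a \<times> real"
    show "?J x * (indicator half_space (?\<Phi> x) * (\<integral>\<^sup>+y. ?J y * (indicator half_space (?\<Phi> y) * (ennreal (gker \<sigma> (?\<Phi> x) (?\<Phi> y)) * ennreal ((?k (?\<Phi> x) - ?k (?\<Phi> y))\<^sup>2))) \<partial>lborel)) =
      ennreal (l powr ?m) * (indicator half_space x * (\<integral>\<^sup>+y. indicator half_space y * (ennreal (gker \<sigma> x y) * ennreal (kel_form ?m b v (x, y))) \<partial>lborel))"
    proof (cases "x \<in> half_space")
      case True
      then have xb: "x \<noteq> b" using ab by (auto simp: half_space_def)
      have "?J x * (?J y * (indicator half_space (?\<Phi> y) * (ennreal (gker \<sigma> (?\<Phi> x) (?\<Phi> y)) * ennreal ((?k (?\<Phi> x) - ?k (?\<Phi> y))\<^sup>2))))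
         = ennreal (l powr ?m) * (indicator half_space y * (ennreal (gker \<sigma> x y) * ennreal (kel_form ?m b v (x, y))))" for y
      proof (cases "y \<in> half_space")
        case y: True
        then have yb: "y \<noteq> b" using ab by (auto simp: half_space_def)
        define s t d where "s = dist x b" and "t = dist y b" and "d = dist x y"
        have st: "s > 0" "t > 0" using xb yb by (auto simp: s_def t_def)
        define Q where "Q = (s powr ?m * v x - t powr ?m * v y)\<^sup>2"
        have "dist (?\<Phi> x) (?\<Phi> y) = (l / (s * t)) * d"
          unfolding s_def t_def d_def by (simp add: dist_sphere_inv[OF l xb yb])
        then have g: "gker \<sigma> (?\<Phi> x) (?\<Phi> y) = (l / (s * t)) powr (- (?N + 2 * \<sigma>)) * d powr (- (?N + 2 * \<sigma>))"
          unfolding gker_def by (simp only: powr_mult)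
        have g2: "(l / (s * t)) powr (- (?N + 2 * \<sigma>)) = s powr (?N + 2 * \<sigma>) * t powr (?N + 2 * \<sigma>) * l powr (- (?N + 2 * \<sigma>))"
          using st l by (subst powr_divide_minus(1)) (auto simp: powr_mult)
        have gd: "gker \<sigma> x y = d powr (- (?N + 2 * \<sigma>))" by (simp add: gker_def d_def)
        have e1: "l powr ?N * l powr ?N * l powr (- (?N + 2 * \<sigma>)) = l powr ?m" by (simp add: powr_add[symmetric])
        have e2: "r powr (- 2 * ?N) * r powr (?N + 2 * \<sigma>) = r powr (- ?m)" for r :: real by (simp add: powr_add[symmetric])
        have "(l powr ?N * s powr (- 2 * ?N)) * ((l powr ?N * t powr (- 2 * ?N)) * (gker \<sigma> (?\<Phi> x) (?\<Phi> y) * Q))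
          = (l powr ?N * l powr ?N * l powr (- (?N + 2 * \<sigma>))) * (s powr (- 2 * ?N) * s powr (?N + 2 * \<sigma>)) * (t powr (- 2 * ?N) * t powr (?N + 2 * \<sigma>)) * d powr (- (?N + 2 * \<sigma>)) * Q"
          unfolding g g2 by (simp only: mult_ac)
        also have "\<dots> = l powr ?m * (gker \<sigma> x y * (Q * (s powr (- ?m) * t powr (- ?m))))"
          unfolding e1 e2 gd by (simp only: mult_ac)
        finally have eq: "(l powr ?N * s powr (- 2 * ?N)) * ((l powr ?N * t powr (- 2 * ?N)) * (gker \<sigma> (?\<Phi> x) (?\<Phi> y) * Q)) = l powr ?m * (gker \<sigma> x y * (Q * (s powr (- ?m) * t powr (- ?m))))" .
        have k: "kel_form ?m b v (x, y) = Q * (s powr (- ?m) * t powr (- ?m))" by (simp add: kel_form_def Q_def s_def t_def)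
        have kQ: "(?k (?\<Phi> x) - ?k (?\<Phi> y))\<^sup>2 = Q" by (simp add: kelvin_sphere_inv[OF l] Q_def s_def t_def)
        have Q0: "Q \<ge> 0" by (simp add: Q_def)
        have ind: "indicator half_space (?\<Phi> y) = (1 :: ennreal)" "indicator half_space y = (1 :: ennreal)"
          using y sphere_inv_half_space[OF ab l, of y] by auto
        have "?J x * (?J y * (1 * (ennreal (gker \<sigma> (?\<Phi> x) (?\<Phi> y)) * ennreal Q))) = ennreal ((l powr ?N * s powr (- 2 * ?N)) * ((l powr ?N * t powr (- 2 * ?N)) * (gker \<sigma> (?\<Phi> x) (?\<Phi> y) * Q)))"
          using Q0 by (simp add: ennreal_mult s_def t_def dist_norm)
        also have "\<dots> = ennreal (l powr ?m) * (1 * (ennreal (gker \<sigma> x y) * ennreal (kel_form ?m b v (x, y))))"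
          unfolding eq k using Q0 by (simp add: ennreal_mult)
        finally show ?thesis unfolding ind kQ .
      next
        case False
        then show ?thesis using sphere_inv_half_space[OF ab l, of y] by simp
      qed
      then have "(\<integral>\<^sup>+y. ?J x * (?J y * (indicator half_space (?\<Phi> y) * (ennreal (gker \<sigma> (?\<Phi> x) (?\<Phi> y)) * ennreal ((?k (?\<Phi> x) - ?k (?\<Phi> y))\<^sup>2)))) \<partial>lborel)
         = (\<integral>\<^sup>+y. ennreal (l powr ?m) * (indicator half_space y * (ennreal (gker \<sigma> x y) * ennreal (kel_form ?m b v (x, y)))) \<partial>lborel)" by presburger
      moreover have "(\<integral>\<^sup>+y. ?J x * (?J y * (indicator half_space (?\<Phi> y) * (ennreal (gker \<sigma> (?\<Phi> x) (?\<Phi> y)) * ennreal ((?k (?\<Phi> x) - ?k (?\<Phi> y))\<^sup>2)))) \<partial>lborel)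
         = ?J x * (\<integral>\<^sup>+y. ?J y * (indicator half_space (?\<Phi> y) * (ennreal (gker \<sigma> (?\<Phi> x) (?\<Phi> y)) * ennreal ((?k (?\<Phi> x) - ?k (?\<Phi> y))\<^sup>2))) \<partial>lborel)"
        by (rule nn_integral_cmult) measurable
      moreover have "(\<integral>\<^sup>+y. ennreal (l powr ?m) * (indicator half_space y * (ennreal (gker \<sigma> x y) * ennreal (kel_form ?m b v (x, y)))) \<partial>lborel)
         = ennreal (l powr ?m) * (\<integral>\<^sup>+y. indicator half_space y * (ennreal (gker \<sigma> x y) * ennreal (kel_form ?m b v (x, y))) \<partial>lborel)"
        by (rule nn_integral_cmult) measurable
      moreover have "indicator half_space (?\<Phi> x) = (1 :: ennreal)" "indicator half_space x = (1 :: ennreal)"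
        using True sphere_inv_half_space[OF ab l, of x] by auto
      ultimately show ?thesis by (simp only: mult_1)
    next
      case False
      then show ?thesis using sphere_inv_half_space[OF ab l, of x] by simp
    qed
  qed
  also have "\<dots> = ennreal (l powr ?m) * (\<integral>\<^sup>+x. indicator half_space x * (\<integral>\<^sup>+y. indicator half_space y * (ennreal (gker \<sigma> x y) * ennreal (kel_form ?m b v (x, y))) \<partial>lborel) \<partial>lborel)"
    by (rule nn_integral_cmult) measurable
  also have "(\<integral>\<^sup>+x. indicator half_space x * (\<integral>\<^sup>+y. indicator half_space y * (ennreal (gker \<sigma> x y) * ennreal (kel_form ?m b v (x, y))) \<partial>lborel) \<partial>lborel)
    = (\<integral>\<^sup>+z. ennreal (kel_form ?m b v z) \<partial>gmeas \<sigma>)"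
    by (subst nn_integral_gmeas) simp_all
  finally show ?thesis .
qed

text \<open>Spheres about \<open>b\<close> are null sets. This concerns the pairs that a truncation
  in the ratio of distances never reaches.\<close>

lemma AE_gmeas_dist_neq:
  fixes b :: "'a::euclidean_space \<times> real"
  shows "AE z in gmeas \<sigma>. dist (fst z) b \<noteq> dist (snd z) b"
proof -
  let ?P = "\<lambda>z. if dist (fst z) b = dist (snd z) b then 1 else 0 :: ennreal"
  have "(\<integral>\<^sup>+y. indicator half_space y * (ennreal (gker \<sigma> x y) * ?P (x, y)) \<partial>lborel) = 0" for x
  proof -
    have "sphere b (dist x b) \<in> null_sets lborel"
      using negligible_sphere[of b "dist x b"] by (simp add: negligible_iff_null_sets null_sets_def)
    then have "AE y in lborel. y \<notin> sphere b (dist x b)" by (rule AE_not_in)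
    then have "AE y in lborel. indicator half_space y * (ennreal (gker \<sigma> x y) * ?P (x, y)) = 0"
      by eventually_elim (simp add: dist_commute)
    then have "(\<integral>\<^sup>+y. indicator half_space y * (ennreal (gker \<sigma> x y) * ?P (x, y)) \<partial>lborel) = (\<integral>\<^sup>+(y :: 'a \<times> real). 0 \<partial>lborel)"
      by (rule nn_integral_cong_AE)
    then show ?thesis by simp
  qed
  then have "(\<integral>\<^sup>+z. ?P z \<partial>gmeas \<sigma>) = 0" by (subst nn_integral_gmeas) simp_all
  then have "AE z in gmeas \<sigma>. ?P z = 0" by (subst (asm) nn_integral_0_iff_AE) auto
  then show ?thesis by eventually_elim (simp split: if_splits)
qed

text \<open>Expanding the form gives the energy density plus
  \<open>(v x)\<^sup>2 (P / Q - 1) + (v y)\<^sup>2 (Q / P - 1)\<close>, with \<open>P\<close> and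
  \<open>Q\<close> the powers of the two distances. On the retained pairs the extra terms integrate
  to zero by \<open>kelvin_harmonic\<close>, and the limit is taken afterwards.\<close>

lemma kel_form_le:
  fixes v :: "'a::euclidean_space \<times> real \<Rightarrow> real"
  assumes \<sigma>: "0 < \<sigma>" "\<sigma> < 1" and [measurable]: "v \<in> borel_measurable borel" and fin: "hmass \<sigma> v < \<infinity>" and b: "snd b = 0"
  shows "(\<integral>\<^sup>+z. ennreal (kel_form (dimn TYPE('a \<times> real) - 2 * \<sigma>) b v z) \<partial>gmeas \<sigma>) \<le> gen \<sigma> v"
proof -
  let ?m = "dimn TYPE('a \<times> real) - 2 * \<sigma>"
  let ?E = "kel_form ?m b v"
  let ?t = "\<lambda>z :: ('a \<times> real) \<times> ('a \<times> real). dist (snd z) b / dist (fst z) b"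
  let ?s = "\<lambda>z :: ('a \<times> real) \<times> ('a \<times> real). dist (fst z) b / dist (snd z) b"
  have trunc: "(\<integral>\<^sup>+z. ennreal (?E z * off_diag \<eta> (?t z)) \<partial>gmeas \<sigma>) \<le> gen \<sigma> v" if \<eta>: "\<eta> > 0" for \<eta>
  proof -
    let ?d = "off_diag \<eta>"
    let ?h = "\<lambda>x. ennreal ((v x)\<^sup>2)"
    define A where "A = (\<integral>\<^sup>+z. ?h (fst z) * ennreal (?d (?t z)) \<partial>gmeas \<sigma>)"
    have A2: "(\<integral>\<^sup>+z. ?h (snd z) * ennreal (?d (?s z)) \<partial>gmeas \<sigma>) = A"
      using nn_integral_gmeas_sym[of ?h "\<lambda>z. ennreal (?d (?t z))" \<sigma>] by (simp add: A_def)
    have A3: "(\<integral>\<^sup>+z. ?h (fst z) * ennreal (?s z powr ?m * ?d (?t z)) \<partial>gmeas \<sigma>) = A"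
    proof -
      have 1: "(\<integral>\<^sup>+z. ?h (fst z) * ennreal (?s z powr ?m * ?d (?t z)) \<partial>gmeas \<sigma>) = (\<integral>\<^sup>+x. indicator half_space x * ?h x *
        (\<integral>\<^sup>+y. indicator half_space y * (ennreal (gker \<sigma> x y) * ennreal (?s (x, y) powr ?m * ?d (?t (x, y)))) \<partial>lborel) \<partial>lborel)"
        by (rule nn_integral_gmeas_fst) measurable
      have 2: "A = (\<integral>\<^sup>+x. indicator half_space x * ?h x *
        (\<integral>\<^sup>+y. indicator half_space y * (ennreal (gker \<sigma> x y) * ennreal (?d (?t (x, y)))) \<partial>lborel) \<partial>lborel)"
        unfolding A_def by (rule nn_integral_gmeas_fst) measurable
      show ?thesis unfolding 1 2
      proof (rule nn_integral_cong)
        fix x :: "'a \<times> real"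
        show "indicator half_space x * ?h x * (\<integral>\<^sup>+y. indicator half_space y * (ennreal (gker \<sigma> x y) * ennreal (?s (x, y) powr ?m * ?d (?t (x, y)))) \<partial>lborel)
          = indicator half_space x * ?h x * (\<integral>\<^sup>+y. indicator half_space y * (ennreal (gker \<sigma> x y) * ennreal (?d (?t (x, y)))) \<partial>lborel)"
          using kelvin_harmonic[of x b \<eta> \<sigma>] b \<eta> by (cases "x \<in> half_space") auto
      qed
    qed
    have A4: "(\<integral>\<^sup>+z. ?h (snd z) * ennreal (?t z powr ?m * ?d (?s z)) \<partial>gmeas \<sigma>) = A"
      using nn_integral_gmeas_sym[of ?h "\<lambda>z. ennreal (?s z powr ?m * ?d (?t z))" \<sigma>] A3 by simp
    \<comment> \<open>A retained ratio of distances differs from 1 by at least \<open>c\<close>,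
      which forces \<open>dist x y\<close> to be at least \<open>c * dist x b\<close> and so at
      least \<open>c * snd x\<close>; the kernel integral is then controlled by the Hardy
      weight.\<close>
    have Afin: "A < \<infinity>"
    proof -
      obtain C where C: "C > 0" "\<And>(x::'a \<times> real) s. s > 0 \<Longrightarrow>
        (\<integral>\<^sup>+y. indicator {s..} (dist x y) * ennreal (gker \<sigma> x y) \<partial>lborel) \<le> ennreal (C * s powr (- 2 * \<sigma>))"
        by (rule ex_gker_truncated[OF \<sigma>, where 'a='a]) (rule that)
      define c where "c = \<eta> / (1 + \<eta>)"
      have c: "c > 0" using \<eta> by (simp add: c_def)
      have "A = (\<integral>\<^sup>+x. indicator half_space x * ?h x *
        (\<integral>\<^sup>+y. indicator half_space y * (ennreal (gker \<sigma> x y) * ennreal (?d (?t (x, y)))) \<partial>lborel) \<partial>lborel)"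
        unfolding A_def by (rule nn_integral_gmeas_fst) measurable
      also have "\<dots> \<le> (\<integral>\<^sup>+x. ennreal (C * c powr (- 2 * \<sigma>)) * (indicator half_space x * ennreal ((v x)\<^sup>2 * snd x powr (- 2 * \<sigma>))) \<partial>lborel)"
      proof (rule nn_integral_mono)
        fix x :: "'a \<times> real"
        show "indicator half_space x * ?h x * (\<integral>\<^sup>+y. indicator half_space y * (ennreal (gker \<sigma> x y) * ennreal (?d (?t (x, y)))) \<partial>lborel)
          \<le> ennreal (C * c powr (- 2 * \<sigma>)) * (indicator half_space x * ennreal ((v x)\<^sup>2 * snd x powr (- 2 * \<sigma>)))"
        proof (cases "x \<in> half_space")
          case True
          then have sx: "snd x > 0" by (simp add: half_space_def)
          have dx: "snd x \<le> dist x b" using dist_snd_le[of x b] b by (simp add: dist_real_def)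
          then have \<rho>: "dist x b > 0" using sx by linarith
          have "(\<integral>\<^sup>+y. indicator half_space y * (ennreal (gker \<sigma> x y) * ennreal (?d (?t (x, y)))) \<partial>lborel)
            \<le> (\<integral>\<^sup>+y. indicator {c * snd x..} (dist x y) * ennreal (gker \<sigma> x y) \<partial>lborel)"
          proof (rule nn_integral_mono)
            fix y :: "'a \<times> real"
            show "indicator half_space y * (ennreal (gker \<sigma> x y) * ennreal (?d (?t (x, y)))) \<le> indicator {c * snd x..} (dist x y) * ennreal (gker \<sigma> x y)"
            proof (cases "c * snd x \<le> dist x y")
              case True
              have "ennreal (?d (?t (x, y))) \<le> 1" by (simp add: ennreal_le_1)
              from mult_left_mono[OF this, of "ennreal (gker \<sigma> x y)"] True show ?thesis
                by (auto simp: indicator_def)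
            next
              case False
              have "\<bar>dist y b - dist x b\<bar> \<le> dist x y"
                using dist_triangle[of x b y] dist_triangle[of y b x] by (simp add: dist_commute)
              also have "\<dots> < c * dist x b" using False dx c by (meson less_le_trans mult_left_mono not_le less_imp_le)
              finally have "\<bar>dist y b / dist x b - 1\<bar> < c" using \<rho> by (simp add: abs_less_iff field_simps)
              then have "?d (?t (x, y)) = 0" using off_diag_near[OF \<eta>, of "?t (x, y)"] by (simp add: c_def)
              then show ?thesis by simp
            qed
          qed
          also have "\<dots> \<le> ennreal (C * (c * snd x) powr (- 2 * \<sigma>))" using c sx by (intro C(2)) simp
          finally have "?h x * (\<integral>\<^sup>+y. indicator half_space y * (ennreal (gker \<sigma> x y) * ennreal (?d (?t (x, y)))) \<partial>lborel) \<le> ?h x * ennreal (C * (c * snd x) powr (- 2 * \<sigma>))"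
            by (rule mult_left_mono) simp
          also have "\<dots> = ennreal (C * c powr (- 2 * \<sigma>)) * ennreal ((v x)\<^sup>2 * snd x powr (- 2 * \<sigma>))"
            using C(1) c sx by (simp add: ennreal_mult[symmetric] powr_mult mult_ac)
          finally show ?thesis using True by simp
        qed simp
      qed
      also have "\<dots> = ennreal (C * c powr (- 2 * \<sigma>)) * hmass \<sigma> v"
        unfolding hmass_def by (rule nn_integral_cmult) measurable
      also have "\<dots> < \<infinity>" using fin by (simp add: ennreal_mult_less_top)
      finally show ?thesis .
    qed
    have "(\<integral>\<^sup>+z. ennreal (?E z * ?d (?t z)) \<partial>gmeas \<sigma>) + (A + A) =
      (\<integral>\<^sup>+z. ennreal (?E z * ?d (?t z)) + (?h (fst z) * ennreal (?d (?t z)) + ?h (snd z) * ennreal (?d (?s z))) \<partial>gmeas \<sigma>)"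
      using A2 by (simp add: nn_integral_add A_def)
    also have "\<dots> \<le> (\<integral>\<^sup>+z. ennreal ((v (fst z) - v (snd z))\<^sup>2) + (?h (fst z) * ennreal (?s z powr ?m * ?d (?t z)) + ?h (snd z) * ennreal (?t z powr ?m * ?d (?s z))) \<partial>gmeas \<sigma>)"
    proof (rule nn_integral_mono_AE, use AE_gmeas_half_space in eventually_elim)
      case (elim z)
      define x y where "x = fst z" and "y = snd z"
      have xy: "x \<noteq> b" "y \<noteq> b" using elim b by (auto simp: x_def y_def half_space_def)
      define P Q where "P = dist x b powr ?m" and "Q = dist y b powr ?m"
      have PQ: "P > 0" "Q > 0" using xy by (auto simp: P_def Q_def)
      have inv: "dist x b powr (- ?m) = 1 / P" "dist y b powr (- ?m) = 1 / Q"
        by (simp_all only: P_def Q_def powr_minus_divide)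
      have sp: "(dist x b / dist y b) powr ?m = P / Q" "(dist y b / dist x b) powr ?m = Q / P"
        by (simp_all add: P_def Q_def powr_divide)
      have dd: "?d (dist x b / dist y b) = ?d (dist y b / dist x b)"
        using off_diag_inverse[of "dist y b / dist x b" \<eta>] xy \<eta> by simp
      define d where "d = ?d (dist y b / dist x b)"
      have d: "0 \<le> d" "d \<le> 1" by (auto simp: d_def)
      have "(P * v x - Q * v y)\<^sup>2 * (1 / P * (1 / Q)) + ((v x)\<^sup>2 + (v y)\<^sup>2) = (v x - v y)\<^sup>2 + ((v x)\<^sup>2 * (P / Q) + (v y)\<^sup>2 * (Q / P))"
        using PQ by (simp add: power2_eq_square field_simps)
      then have "((P * v x - Q * v y)\<^sup>2 * (1 / P * (1 / Q)) + ((v x)\<^sup>2 + (v y)\<^sup>2)) * d = ((v x - v y)\<^sup>2 + ((v x)\<^sup>2 * (P / Q) + (v y)\<^sup>2 * (Q / P))) * d" by simp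
      also have "\<dots> = (v x - v y)\<^sup>2 * d + ((v x)\<^sup>2 * (P / Q * d) + (v y)\<^sup>2 * (Q / P * d))" by (simp add: algebra_simps)
      also have "\<dots> \<le> (v x - v y)\<^sup>2 + ((v x)\<^sup>2 * (P / Q * d) + (v y)\<^sup>2 * (Q / P * d))" using d by (simp add: mult_left_le)
      finally have "(P * v x - Q * v y)\<^sup>2 * (1 / P * (1 / Q)) * d + ((v x)\<^sup>2 * d + (v y)\<^sup>2 * d) \<le> (v x - v y)\<^sup>2 + ((v x)\<^sup>2 * (P / Q * d) + (v y)\<^sup>2 * (Q / P * d))"
        by (simp add: algebra_simps)
      then have "ennreal ((P * v x - Q * v y)\<^sup>2 * (1 / P * (1 / Q)) * d + ((v x)\<^sup>2 * d + (v y)\<^sup>2 * d)) \<le> ennreal ((v x - v y)\<^sup>2 + ((v x)\<^sup>2 * (P / Q * d) + (v y)\<^sup>2 * (Q / P * d)))"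
        by (rule ennreal_leI)
      then show ?case
        unfolding kel_form_def x_def[symmetric] y_def[symmetric] inv sp dd d_def[symmetric] P_def[symmetric] Q_def[symmetric]
        using d PQ by (simp add: ennreal_mult[symmetric] ennreal_plus[symmetric] del: ennreal_plus)
    qed
    also have "\<dots> = gen \<sigma> v + (A + A)"
    proof -
      have "(\<integral>\<^sup>+z. f z + (g z + h z) \<partial>gmeas \<sigma>) = (\<integral>\<^sup>+z. f z \<partial>gmeas \<sigma>) + ((\<integral>\<^sup>+z. g z \<partial>gmeas \<sigma>) + (\<integral>\<^sup>+z. h z \<partial>gmeas \<sigma>))"
        if [measurable]: "f \<in> borel_measurable (borel \<Otimes>\<^sub>M borel)" "g \<in> borel_measurable (borel \<Otimes>\<^sub>M borel)" "h \<in> borel_measurable (borel \<Otimes>\<^sub>M borel)"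
        for f g h :: "('a \<times> real) \<times> ('a \<times> real) \<Rightarrow> ennreal"
        by (simp add: nn_integral_add)
      then have "(\<integral>\<^sup>+z. ennreal ((v (fst z) - v (snd z))\<^sup>2) + (?h (fst z) * ennreal (?s z powr ?m * ?d (?t z)) + ?h (snd z) * ennreal (?t z powr ?m * ?d (?s z))) \<partial>gmeas \<sigma>)
        = (\<integral>\<^sup>+z. ennreal ((v (fst z) - v (snd z))\<^sup>2) \<partial>gmeas \<sigma>) + ((\<integral>\<^sup>+z. ?h (fst z) * ennreal (?s z powr ?m * ?d (?t z)) \<partial>gmeas \<sigma>) + (\<integral>\<^sup>+z. ?h (snd z) * ennreal (?t z powr ?m * ?d (?s z)) \<partial>gmeas \<sigma>))"
        by this measurable
      then show ?thesis unfolding A3 A4 gen_def .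
    qed
    finally show ?thesis by (rule ennreal_add_le_cancel) (use Afin in simp)
  qed
  \<comment> \<open>On pairs equidistant from \<open>b\<close> the truncation is 0 for all
    \<open>k\<close>, while \<open>?E z\<close> need not vanish; the limit is therefore stated with
    a case distinction, undone below by \<open>AE_gmeas_dist_neq\<close>.\<close>
  have "(\<lambda>k. \<integral>\<^sup>+z. ennreal (?E z * off_diag (1 / real (Suc k)) (?t z)) \<partial>gmeas \<sigma>) \<longlonglongrightarrow> (\<integral>\<^sup>+z. ennreal (if ?t z = 1 then 0 else ?E z) \<partial>gmeas \<sigma>)"
  proof (rule nn_integral_LIMSEQ)
    have mono: "off_diag (1 / real (Suc k)) s \<le> off_diag (1 / real (Suc k')) s" if "k \<le> k'" for k k' s
    proof -
      have "1 / real (Suc k') \<le> 1 / real (Suc k)" using that by (simp add: frac_le)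
      moreover have "1 / (1 + 1 / real (Suc k)) \<le> 1 / (1 + 1 / real (Suc k'))"
        using calculation by (intro divide_left_mono) (auto intro!: mult_pos_pos add_pos_pos)
      ultimately show ?thesis by (auto simp: off_diag_def indicator_def)
    qed
    show "incseq (\<lambda>k z. ennreal (?E z * off_diag (1 / real (Suc k)) (?t z)))"
      by (intro incseq_SucI le_funI ennreal_leI mult_left_mono mono kel_form_nonneg) simp
    fix z :: "('a \<times> real) \<times> ('a \<times> real)"
    show "(\<lambda>k. ennreal (?E z * off_diag (1 / real (Suc k)) (?t z))) \<longlonglongrightarrow> ennreal (if ?t z = 1 then 0 else ?E z)"
    proof (cases "?t z = 1")
      case True
      have "off_diag (1 / real (Suc k)) 1 = 0" for k by (rule off_diag_near) (simp_all add: add_pos_pos)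
      then show ?thesis unfolding True by simp
    next
      case False
      from off_diag_LIMSEQ[OF this]
      have "eventually (\<lambda>k. ennreal (?E z * off_diag (1 / real (Suc k)) (?t z)) = ennreal (if ?t z = 1 then 0 else ?E z)) sequentially"
        by eventually_elim (simp only: False if_False mult_1_right)
      then show ?thesis by (rule tendsto_eventually)
    qed
  qed measurable
  then have "(\<integral>\<^sup>+z. ennreal (if ?t z = 1 then 0 else ?E z) \<partial>gmeas \<sigma>) \<le> gen \<sigma> v"
    by (rule LIMSEQ_le_const2) (use trunc in auto)
  moreover have "(\<integral>\<^sup>+z. ennreal (?E z) \<partial>gmeas \<sigma>) = (\<integral>\<^sup>+z. ennreal (if ?t z = 1 then 0 else ?E z) \<partial>gmeas \<sigma>)"
    by (rule nn_integral_cong_AE, use AE_gmeas_dist_neq[of b \<sigma>] in eventually_elim) (auto simp: divide_eq_1_iff)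
  ultimately show ?thesis by simp
qed

section \<open>Comparison of the two domains\<close>

text \<open>Pairs with \<open>x\<close> in the half-ball and \<open>y\<close> in the missing ball
  count on the half-space but not on \<open>\<Omega>\<close>. There \<open>w y = 0\<close>, the
  squared difference is \<open>(w x)\<^sup>2\<close>, and the kernel is bounded below.\<close>

lemma energy_gain:
  fixes \<Omega> :: "('a::euclidean_space \<times> real) set"
  assumes \<sigma>: "0 < \<sigma>" and \<Omega>: "open \<Omega>" "\<Omega> \<subseteq> half_space" "half_ball a \<epsilon> \<subseteq> \<Omega>" and c: "ball c \<delta> \<subseteq> half_space - \<Omega>" "\<delta> > 0" and \<epsilon>: "\<epsilon> > 0"
  obtains v0 where "v0 > 0" "\<And>w. w \<in> borel_measurable borel \<Longrightarrow> (\<And>y. w y \<noteq> 0 \<Longrightarrow> y \<in> half_ball a \<epsilon>) \<Longrightarrow>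
    gag \<sigma> \<Omega> w + ennreal v0 * wint (\<lambda>_. 1) w \<le> gen \<sigma> w"
proof -
  let ?q = "dimn TYPE('a \<times> real) + 2 * \<sigma>"
  have q: "?q > 0" using dimn_ge_2[where 'a='a] \<sigma> by linarith
  \<comment> \<open>An upper bound for the distance between a point of the half-ball and a point of
    the missing ball.\<close>
  define D where "D = \<epsilon> + dist a c + \<delta>"
  have D: "D > 0" using \<epsilon> c(2) by (simp add: D_def add_pos_nonneg)
  define V where "V = unit_ball_vol (real DIM('a \<times> real)) * \<delta> ^ DIM('a \<times> real)"
  have V: "V > 0" unfolding V_def using c(2) by (intro mult_pos_pos zero_less_power) (auto simp del: DIM_prod)
  have emV: "emeasure lborel (ball c \<delta>) = ennreal V" unfolding V_def using c(2) by (intro emeasure_ball) simp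
  have [measurable]: "\<Omega> \<in> sets borel" using \<Omega>(1) by simp
  show ?thesis
  proof (rule that[of "D powr (- ?q) * V"])
    show "D powr (- ?q) * V > 0" using D V by simp
    fix w :: "'a \<times> real \<Rightarrow> real"
    assume [measurable]: "w \<in> borel_measurable borel" and supp: "\<And>y. w y \<noteq> 0 \<Longrightarrow> y \<in> half_ball a \<epsilon>"
    let ?A = "\<lambda>x y. ennreal (gker \<sigma> x y) * ennreal ((w x - w y)\<^sup>2)"
    have gag: "gag \<sigma> \<Omega> w = (\<integral>\<^sup>+x. \<integral>\<^sup>+y. indicator \<Omega> x * indicator \<Omega> y * ?A x y \<partial>lborel \<partial>lborel)"
    proof -
      have "X / Y powr Z = Y powr (- Z) * X" for X Y Z :: real by (simp add: powr_minus divide_inverse)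
      then show ?thesis unfolding gag_def gker_def by (simp add: ennreal_mult indicator_times del: powr_minus_divide)
    qed
    have "gag \<sigma> \<Omega> w + ennreal (D powr (- ?q) * V) * wint (\<lambda>_. 1) w =
      (\<integral>\<^sup>+x. (\<integral>\<^sup>+y. indicator \<Omega> x * indicator \<Omega> y * ?A x y \<partial>lborel) + ennreal (D powr (- ?q) * V) * (indicator half_space x * ennreal ((w x)\<^sup>2 * 1)) \<partial>lborel)"
      unfolding gag wint_def
      by (subst nn_integral_add) (auto simp: nn_integral_cmult)
    also have "\<dots> \<le> (\<integral>\<^sup>+x. indicator half_space x * (\<integral>\<^sup>+y. indicator half_space y * ?A x y \<partial>lborel) \<partial>lborel)"
    proof (rule nn_integral_mono)
      fix x :: "'a \<times> real"
      have [measurable]: "(\<lambda>y. ?A x y) \<in> borel_measurable borel" by measurable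
      show "(\<integral>\<^sup>+y. indicator \<Omega> x * indicator \<Omega> y * ?A x y \<partial>lborel) + ennreal (D powr (- ?q) * V) * (indicator half_space x * ennreal ((w x)\<^sup>2 * 1))
        \<le> indicator half_space x * (\<integral>\<^sup>+y. indicator half_space y * ?A x y \<partial>lborel)"
      proof (cases "x \<in> \<Omega>")
        case False
        then have "w x = 0" using supp \<Omega>(3) by blast
        then show ?thesis using False by (simp add: indicator_times)
      next
        case True
        then have xH: "x \<in> half_space" using \<Omega>(2) by blast
        have eq: "ennreal (D powr (- ?q) * V) * ennreal ((w x)\<^sup>2) = (\<integral>\<^sup>+y. ennreal (D powr (- ?q) * (w x)\<^sup>2) * indicator (ball c \<delta>) y \<partial>lborel)"
        proof -
          have 1: "D powr (- ?q) * V * (w x)\<^sup>2 = D powr (- ?q) * (w x)\<^sup>2 * V" by (simp only: mult_ac)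
          have 2: "(\<integral>\<^sup>+y. ennreal (D powr (- ?q) * (w x)\<^sup>2) * indicator (ball c \<delta>) y \<partial>lborel) = ennreal (D powr (- ?q) * (w x)\<^sup>2) * emeasure lborel (ball c \<delta>)"
            by (rule nn_integral_cmult_indicator) simp
          have "ennreal (D powr (- ?q) * V) * ennreal ((w x)\<^sup>2) = ennreal (D powr (- ?q) * V * (w x)\<^sup>2)"
            by (rule ennreal_mult[symmetric]) (use V in auto)
          also have "\<dots> = ennreal (D powr (- ?q) * (w x)\<^sup>2) * ennreal V"
            unfolding 1 by (rule ennreal_mult) (use V in auto)
          finally show ?thesis unfolding 2 emV .
        qed
        have "(\<integral>\<^sup>+y. indicator \<Omega> x * indicator \<Omega> y * ?A x y \<partial>lborel) + ennreal (D powr (- ?q) * V) * ennreal ((w x)\<^sup>2)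
          = (\<integral>\<^sup>+y. indicator \<Omega> x * indicator \<Omega> y * ?A x y + ennreal (D powr (- ?q) * (w x)\<^sup>2) * indicator (ball c \<delta>) y \<partial>lborel)"
        proof -
          have "(\<lambda>y. indicator \<Omega> x * indicator \<Omega> y * ?A x y) \<in> borel_measurable lborel"
            by (intro borel_measurable_times_ennreal borel_measurable_const) simp_all
          moreover have "(\<lambda>y. ennreal (D powr (- ?q) * (w x)\<^sup>2) * indicator (ball c \<delta>) y) \<in> borel_measurable lborel"
            by (intro borel_measurable_times_ennreal borel_measurable_const borel_measurable_indicator) simp
          ultimately show ?thesis unfolding eq by (simp only: nn_integral_add)
        qed
        also have "\<dots> \<le> (\<integral>\<^sup>+y. indicator half_space y * ?A x y \<partial>lborel)"
        proof (rule nn_integral_mono)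
          fix y :: "'a \<times> real"
          show "indicator \<Omega> x * indicator \<Omega> y * ?A x y + ennreal (D powr (- ?q) * (w x)\<^sup>2) * indicator (ball c \<delta>) y \<le> indicator half_space y * ?A x y"
          proof (cases "y \<in> ball c \<delta>")
            case yB: True
            then have y: "y \<in> half_space" "y \<notin> \<Omega>" using c(1) by auto
            have wy: "w y = 0" using supp \<Omega>(3) y(2) by blast
            have "D powr (- ?q) * (w x)\<^sup>2 \<le> gker \<sigma> x y * (w x - w y)\<^sup>2"
            proof (cases "w x = 0")
              case False
              then have "dist x a < \<epsilon>" using supp by (auto simp: half_ball_def)
              then have "dist x y \<le> D"
                using dist_triangle[of x y a] dist_triangle[of a y c] yB by (simp add: D_def)
              moreover have "dist x y > 0" using True y(2) by auto
              ultimately have "D powr (- ?q) \<le> gker \<sigma> x y" unfolding gker_def using q by (intro powr_mono2') auto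
              then show ?thesis unfolding wy by (intro mult_mono) auto
            qed simp
            then have "ennreal (D powr (- ?q) * (w x)\<^sup>2) \<le> ?A x y" by (simp add: ennreal_mult[symmetric] ennreal_leI)
            then show ?thesis using yB y by simp
          next
            case False
            then show ?thesis using \<Omega>(2) by (auto simp: indicator_def)
          qed
        qed
        finally show ?thesis using xH by simp
      qed
    qed
    also have "\<dots> = gen \<sigma> w" unfolding gen_def by (subst nn_integral_gmeas) simp_all
    finally show "gag \<sigma> \<Omega> w + ennreal (D powr (- ?q) * V) * wint (\<lambda>_. 1) w \<le> gen \<sigma> w" .
  qed
qed

text \<open>Apply the inequality on \<open>\<Omega>\<close>, with its gain, to the Kelvin transform
  of \<open>v\<close>. Energy and norm scale like \<open>l powr (n - 2 * \<sigma>)\<close> and the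
  square integral like \<open>l powr n\<close>; after division the gain keeps the factor
  \<open>l powr (2 * \<sigma>)\<close>.\<close>

lemma kelvin_inequality:
  fixes \<Omega> :: "('a::euclidean_space \<times> real) set" and v :: "'a \<times> real \<Rightarrow> real"
  assumes \<sigma>: "0 < \<sigma>" "\<sigma> < 1" and S: "S \<ge> 0" "\<And>f. f \<in> C1c \<Omega> \<Longrightarrow> ennreal S * lp_den \<sigma> \<Omega> f \<le> gag \<sigma> \<Omega> f"
    and gain: "\<And>w. w \<in> borel_measurable borel \<Longrightarrow> (\<And>y. w y \<noteq> 0 \<Longrightarrow> y \<in> half_ball a \<epsilon>) \<Longrightarrow> gag \<sigma> \<Omega> w + ennreal v0 * wint (\<lambda>_. 1) w \<le> gen \<sigma> w"
    and v0: "v0 > 0" and \<Omega>: "\<Omega> \<subseteq> half_space" "half_ball a \<epsilon> \<subseteq> \<Omega>" and ab: "snd a = 0" "snd b = 0"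
    and v: "v \<in> C1c half_space" "\<And>x. dist x b < r \<Longrightarrow> v x = 0" and r: "r > 0" and l: "0 < l" "l / r < \<epsilon>"
  shows "ennreal S * lp_den \<sigma> half_space v + ennreal (v0 * l powr (2 * \<sigma>)) * wint (\<lambda>x. dist x b powr (- 4 * \<sigma>)) v \<le> gen \<sigma> v"
proof -
  let ?N = "dimn TYPE('a \<times> real)"
  let ?m = "?N - 2 * \<sigma>"
  have N: "?N \<ge> 2" by (rule dimn_ge_2)
  define f where "f = kelvin \<sigma> a l b v"
  have [measurable]: "v \<in> borel_measurable borel" by (rule C1c_measurable[OF v(1)])
  have [measurable]: "f \<in> borel_measurable borel" unfolding f_def by measurable
  have "f \<in> C1c \<Omega>" unfolding f_def by (rule kelvin_C1c(1)[OF v r l ab \<Omega>(2)])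
  moreover have "y \<in> half_ball a \<epsilon>" if "f y \<noteq> 0" for y
    by (rule kelvin_C1c(2)[OF v r l ab \<Omega>(2) that[unfolded f_def]])
  ultimately have f: "f \<in> C1c \<Omega>" "\<And>y. f y \<noteq> 0 \<Longrightarrow> y \<in> half_ball a \<epsilon>" by blast+
  obtain L where L: "lp_int \<sigma> half_space v = ennreal L" "L \<ge> 0"
    using C1c_lp_int_finite[OF v(1) \<sigma>] by (cases "lp_int \<sigma> half_space v") auto
  have "lp_int \<sigma> \<Omega> f = lp_int \<sigma> half_space f"
    unfolding lp_int_def
  proof (rule nn_integral_cong)
    fix y
    show "indicator \<Omega> y * ennreal (\<bar>f y\<bar> powr crit_exp \<sigma> TYPE('a \<times> real)) = indicator half_space y * ennreal (\<bar>f y\<bar> powr crit_exp \<sigma> TYPE('a \<times> real))"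
    proof (cases "f y = 0")
      case False
      then have "y \<in> \<Omega>" "y \<in> half_space" using f(2)[of y] \<Omega> by auto
      then show ?thesis by simp
    qed simp
  qed
  also have "\<dots> = ennreal (l powr ?N * L)"
    unfolding f_def kelvin_lp_int[OF \<open>v \<in> borel_measurable borel\<close> \<sigma> l(1) ab] L using L(2) by (simp add: ennreal_mult)
  finally have "lp_den \<sigma> \<Omega> f = ennreal ((l powr ?N * L) powr (?m / ?N))"
    using L(2) by (simp add: lp_den_def)
  also have "(l powr ?N * L) powr (?m / ?N) = l powr ?m * L powr (?m / ?N)"
    using N L(2) by (simp add: powr_mult powr_powr)
  finally have den: "lp_den \<sigma> \<Omega> f = ennreal (l powr ?m) * lp_den \<sigma> half_space v"
    using L(2) by (simp add: lp_den_def L(1) ennreal_mult)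
  have "ennreal S * (ennreal (l powr ?m) * lp_den \<sigma> half_space v) + ennreal v0 * (ennreal (l powr ?N) * wint (\<lambda>x. dist x b powr (- 4 * \<sigma>)) v)
    \<le> gag \<sigma> \<Omega> f + ennreal v0 * wint (\<lambda>_. 1) f"
    unfolding den[symmetric] f_def[symmetric] kelvin_square_int[OF \<open>v \<in> borel_measurable borel\<close> l(1) ab, of \<sigma>, symmetric]
    by (intro add_mono S f order_refl)
  also have "\<dots> \<le> gen \<sigma> f" by (rule gain) (use f(2) in auto)
  also have "\<dots> \<le> ennreal (l powr ?m) * gen \<sigma> v"
    unfolding f_def gen_kelvin[OF \<open>v \<in> borel_measurable borel\<close> l(1) ab]
    by (intro mult_left_mono kel_form_le \<sigma> C1c_hmass_finite v ab) simp_all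
  finally have "ennreal (l powr (- ?m)) * (ennreal S * (ennreal (l powr ?m) * lp_den \<sigma> half_space v) + ennreal v0 * (ennreal (l powr ?N) * wint (\<lambda>x. dist x b powr (- 4 * \<sigma>)) v))
    \<le> ennreal (l powr (- ?m)) * (ennreal (l powr ?m) * gen \<sigma> v)"
    by (rule mult_left_mono) simp
  moreover have "ennreal (l powr (- ?m)) * (ennreal (l powr ?m) * X) = X" for X
  proof -
    have "l powr (- ?m) * l powr ?m = 1" using l(1) by (simp only: powr_add[symmetric]) simp
    then show ?thesis by (simp add: mult.assoc[symmetric] ennreal_mult[symmetric])
  qed
  moreover have "ennreal (l powr (- ?m)) * (ennreal S * (ennreal (l powr ?m) * X) + ennreal v0 * (ennreal (l powr ?N) * Y)) = ennreal S * X + ennreal (v0 * l powr (2 * \<sigma>)) * Y" for X Y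
  proof -
    have 1: "l powr (- ?m) * l powr ?m = 1" using l(1) by (simp only: powr_add[symmetric]) simp
    have 2: "l powr (- ?m) * l powr ?N = l powr (2 * \<sigma>)" by (simp add: powr_add[symmetric])
    have "ennreal (l powr (- ?m)) * (ennreal S * (ennreal (l powr ?m) * X)) = ennreal (l powr (- ?m) * l powr ?m) * (ennreal S * X)"
      by (simp only: ennreal_mult powr_ge_zero) (simp only: mult_ac)
    moreover have "ennreal (l powr (- ?m)) * (ennreal v0 * (ennreal (l powr ?N) * Y)) = ennreal v0 * ennreal (l powr (- ?m) * l powr ?N) * Y"
      by (simp only: ennreal_mult powr_ge_zero) (simp only: mult_ac)
    ultimately show ?thesis using v0 unfolding distrib_left 1 2 by (simp add: ennreal_mult)
  qed
  ultimately show ?thesis by simp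
qed

section \<open>The bound at a single scale\<close>

lemma cutw_double:
  assumes "r > 0" "0 < \<sigma>"
  shows "cutw \<sigma> b (2 * r) x \<le> 2 powr (dimn TYPE('a::euclidean_space \<times> real) + 2 * \<sigma>) * cutw \<sigma> b r (x :: 'a \<times> real)"
proof -
  let ?q = "dimn TYPE('a \<times> real) + 2 * \<sigma>"
  have q: "?q > 0" using dimn_ge_2[where 'a='a] assms by linarith
  have "min 1 (2 * r / dist x b) \<le> 2 * min 1 (r / dist x b)" using assms by (simp add: min_def)
  then have "min 1 (2 * r / dist x b) powr ?q \<le> (2 * min 1 (r / dist x b)) powr ?q"
    using q assms by (intro powr_mono2) auto
  also have "\<dots> = 2 powr ?q * min 1 (r / dist x b) powr ?q" using assms by (simp add: powr_mult)
  finally have 1: "min 1 (2 * r / dist x b) powr ?q \<le> 2 powr ?q * min 1 (r / dist x b) powr ?q" .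
  have 2: "(2 * r) powr (- 2 * \<sigma>) \<le> r powr (- 2 * \<sigma>)" using assms by (intro powr_mono2') auto
  have "cutw \<sigma> b (2 * r) x \<le> r powr (- 2 * \<sigma>) * (2 powr ?q * min 1 (r / dist x b) powr ?q)"
    unfolding cutw_def by (intro mult_mono 1 2) auto
  then show ?thesis by (simp add: cutw_def mult_ac)
qed

lemma wint_mono: "(\<And>x. x \<in> half_space \<Longrightarrow> w x \<le> w' x) \<Longrightarrow> wint w f \<le> wint w' f"
  unfolding wint_def
  by (intro nn_integral_mono) (auto simp: indicator_def intro!: ennreal_leI mult_left_mono)

lemma wint_cmult:
  assumes [measurable]: "w \<in> borel_measurable borel" "f \<in> borel_measurable borel" and "c \<ge> 0"
  shows "wint (\<lambda>x. c * w x) f = ennreal c * wint w f"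
proof -
  have "indicator half_space x * ennreal ((f x)\<^sup>2 * (c * w x)) = ennreal c * (indicator half_space x * ennreal ((f x)\<^sup>2 * w x))" for x
    using assms(3) by (auto simp: indicator_def ennreal_mult'[symmetric] mult_ac)
  then show ?thesis unfolding wint_def by (simp add: nn_integral_cmult)
qed

context minimizer
begin

text \<open>The improved inequality for \<open>ph u\<close>, which vanishes near \<open>b\<close>,
  is played against the Euler-Lagrange upper bound for its energy. Removing the ball loses at most
  \<open>F\<close> of the \<open>L\<^sup>p\<close> mass, and \<open>F\<close> is in turn controlled
  by the cutoff cost \<open>W\<close> through the Euler-Lagrange inequality at the doubled scale.
  The terms \<open>S\<close> cancel, so the gain is at most a multiple of \<open>W\<close>.\<close>

lemma local_bound:
  assumes b: "snd b = 0" and v1: "v1 > 0"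
    and kel: "\<And>r v. r > 0 \<Longrightarrow> v \<in> C1c half_space \<Longrightarrow> (\<And>x. dist x b < r \<Longrightarrow> v x = 0) \<Longrightarrow>
      ennreal S * lp_den \<sigma> half_space v + ennreal (v1 * r powr (2 * \<sigma>)) * wint (\<lambda>x. dist x b powr (- 4 * \<sigma>)) v \<le> gen \<sigma> v"
  obtains C r0 where "C > 0" "r0 > 0" "\<And>r. 0 < r \<Longrightarrow> r < r0 \<Longrightarrow>
    wint (\<lambda>x. indicator {2 * r..} (dist x b) * dist x b powr (- 4 * \<sigma>)) u \<le> ennreal C * wint (\<lambda>x. r powr (- 2 * \<sigma>) * cutw \<sigma> b r x) u"
proof -
  have p: "p > 2" by (rule p_gt_2)
  let ?q = "N + 2 * \<sigma>"
  obtain \<eta> :: "'a \<times> real \<Rightarrow> real" where \<eta>: "\<eta> \<in> C1c UNIV" "\<And>x. 0 \<le> \<eta> x" "\<And>x. \<eta> x \<le> 1"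
    "\<And>x. norm x \<le> 1 \<Longrightarrow> \<eta> x = 1" "\<And>x. norm x \<ge> 2 \<Longrightarrow> \<eta> x = 0"
    by (rule ex_bump[where 'a='a]) (rule that)
  obtain C where C: "C > 0" "\<And>r b x. r > 0 \<Longrightarrow> x \<noteq> b \<Longrightarrow>
    (\<integral>\<^sup>+y. ennreal ((\<eta> ((1 / r) *\<^sub>R (x - b)) - \<eta> ((1 / r) *\<^sub>R (y - b)))\<^sup>2 * gker \<sigma> x y) \<partial>lborel) \<le> ennreal (C * cutw \<sigma> b r x)"
    by (rule bump_oscillation[OF \<sigma>_pos \<sigma>(2) \<eta>(1,2,3,5)]) (assumption, rule that)
  \<comment> \<open>With this threshold the Hoelder factor of the strip is at most
    \<open>1 / 2\<close>, so half of the Sobolev term survives absorption.\<close>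
  define e where "e = (1 / 2) powr (1 / (1 - 2 / p))"
  have e: "e > 0" by (simp add: e_def)
  have ek: "e powr (1 - 2 / p) = 1 / 2" using p by (simp add: e_def powr_powr)
  obtain \<delta> where \<delta>: "\<delta> > 0" "strip \<delta> \<le> ennreal e" using strip_small[OF e] .
  \<comment> \<open>\<open>2 * 2 powr ?q\<close> pays for the lost mass \<open>F\<close> at scale
    \<open>2 * r\<close>, and 1 for the cutoff at scale \<open>r\<close>.\<close>
  define C' where "C' = (2 * 2 powr ?q + 1) * C / v1"
  have C': "C' > 0" using C v1 by (simp add: C'_def add_pos_pos)
  show ?thesis
  proof (rule that[OF C', of "\<delta> / 4"])
    show "\<delta> / 4 > 0" using \<delta> by simp
    fix r :: real assume r: "0 < r" "r < \<delta> / 4"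
    define m1 where "m1 x = \<eta> ((1 / r) *\<^sub>R (x - b))" for x
    define m2 where "m2 x = \<eta> ((1 / (2 * r)) *\<^sub>R (x - b))" for x
    have M1: "multiplier m1" unfolding m1_def[abs_def] by (rule bump_multiplier[OF \<eta>(1,2,3,5) r(1) b])
    have M2: "multiplier m2" unfolding m2_def[abs_def] using r by (intro bump_multiplier[OF \<eta>(1,2,3,5) _ b]) simp_all
    \<comment> \<open>The complementary cutoff: 0 within \<open>r\<close> of \<open>b\<close> and 1
      beyond \<open>2 * r\<close>. The second bump \<open>m2\<close> equals 1 up to
      \<open>2 * r\<close>, so everywhere one of the two products equals \<open>u\<close>.\<close>
    define ph where "ph x = 1 + (- 1) * m1 x" for x
    have Mph: "multiplier ph" unfolding ph_def[abs_def] by (intro multiplier_add multiplier_mult multiplier_const M1)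
    have [measurable]: "m1 \<in> borel_measurable borel" "m2 \<in> borel_measurable borel" "ph \<in> borel_measurable borel"
      using M1 M2 Mph by (auto intro: multiplier_measurable)
    have nrm: "norm ((1 / s) *\<^sub>R (x - b)) = dist x b / s" if "s > 0" for s x using that by (simp add: dist_norm)
    have m1_in: "m1 x = 1" if "dist x b \<le> r" for x
      unfolding m1_def using that r by (intro \<eta>(4)) (simp only: nrm, simp)
    have m1_out: "m1 x = 0" if "dist x b \<ge> 2 * r" for x
      unfolding m1_def using that r by (intro \<eta>(5)) (simp only: nrm pos_le_divide_eq)
    have m2_in: "m2 x = 1" if "dist x b \<le> 2 * r" for x
      unfolding m2_def using that r by (intro \<eta>(4)) (simp only: nrm mult_pos_pos zero_less_numeral, simp)
    have m2_out: "m2 x = 0" if "dist x b \<ge> 4 * r" for x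
    proof -
      have "2 * (2 * r) \<le> dist x b" using that by simp
      then show ?thesis unfolding m2_def using r by (intro \<eta>(5)) (simp only: nrm pos_le_divide_eq mult_pos_pos zero_less_numeral)
    qed
    have m01: "0 \<le> m1 x" "m1 x \<le> 1" "0 \<le> m2 x" "m2 x \<le> 1" for x by (auto simp: m1_def m2_def \<eta>)
    have ph01: "0 \<le> ph x" "ph x \<le> 1" for x using m01[of x] by (auto simp: ph_def)
    let ?W = "wint (cutw \<sigma> b r) u"
    have cutw0: "cutw \<sigma> b s x \<ge> 0" for s x by (simp add: cutw_def)
    have Hb: "x \<noteq> b" if "x \<in> half_space" for x using that b by (auto simp: half_space_def)
    show "wint (\<lambda>x. indicator {2 * r..} (dist x b) * dist x b powr (- 4 * \<sigma>)) u \<le> ennreal C' * wint (\<lambda>x. r powr (- 2 * \<sigma>) * cutw \<sigma> b r x) u"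
    proof (cases "?W = \<infinity>")
      case True
      have "wint (\<lambda>x. r powr (- 2 * \<sigma>) * cutw \<sigma> b r x) u = ennreal (r powr (- 2 * \<sigma>)) * ?W"
        by (rule wint_cmult) auto
      also have "\<dots> = \<infinity>" using True r by (simp add: ennreal_mult_top)
      finally show ?thesis using C' by (simp add: ennreal_mult_top)
    next
      case False
      then obtain W where W: "?W = ennreal W" "W \<ge> 0" by (cases ?W) auto
      have lam1: "lam ph \<le> ennreal (C * W)"
      proof -
        have "lam ph = lam m1" unfolding lam_def ph_def by (intro nn_integral_cong) (simp add: power2_commute)
        also have "\<dots> \<le> ennreal C * ?W"
          by (rule lam_le_wint[OF M1 cutw_measurable C(1) _ cutw0]) (use C(2)[OF r(1) Hb] in \<open>simp add: m1_def\<close>)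
        finally show ?thesis using W C(1) by (simp add: ennreal_mult)
      qed
      have lam2: "lam m2 \<le> ennreal (C * (2 powr ?q * W))"
      proof -
        have r2: "2 * r > 0" using r by simp
        have "lam m2 \<le> ennreal C * wint (cutw \<sigma> b (2 * r)) u"
          by (rule lam_le_wint[OF M2 cutw_measurable C(1) _ cutw0]) (use C(2)[OF r2 Hb] in \<open>simp add: m2_def\<close>)
        also have "wint (cutw \<sigma> b (2 * r)) u \<le> wint (\<lambda>x. 2 powr ?q * cutw \<sigma> b r x) u"
          unfolding N_def by (intro wint_mono cutw_double r \<sigma>_pos)
        also have "\<dots> = ennreal (2 powr ?q) * ennreal W"
          unfolding W(1)[symmetric] by (rule wint_cmult) auto
        finally show ?thesis using W(2) C(1) by (simp add: ennreal_mult mult_left_mono)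
      qed
      define f where "f x = m2 x * u x" for x
      have [measurable]: "f \<in> borel_measurable borel" unfolding f_def by measurable
      have f: "econv \<sigma> (\<lambda>k x. m2 x * \<phi>0 k x) f" unfolding f_def by (rule multiplier_econv[OF \<sigma> M2 conv])
      obtain F where F: "lp_int \<sigma> half_space f = ennreal F" "F \<ge> 0"
        using Hdot_lp_finite[OF \<sigma>_pos \<sigma>(2) f] by (cases "lp_int \<sigma> half_space f") auto
      have F1: "F \<le> 1"
      proof -
        have "lp_int \<sigma> half_space f \<le> lp_int \<sigma> half_space u"
          unfolding lp_int_p
        proof (rule nn_integral_mono)
          fix x
          have "\<bar>f x\<bar> \<le> 1 * \<bar>u x\<bar>" unfolding f_def abs_mult using m01[of x] by (intro mult_right_mono) auto
          then have "\<bar>f x\<bar> powr p \<le> \<bar>u x\<bar> powr p" using p by (intro powr_mono2) auto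
          then show "indicator half_space x * ennreal (\<bar>f x\<bar> powr p) \<le> indicator half_space x * ennreal (\<bar>u x\<bar> powr p)"
            by (intro mult_left_mono ennreal_leI) auto
        qed
        then show ?thesis using F by (simp add: lp_u)
      qed
      have SF: "S * F powr (2 / p) \<le> 2 * (C * (2 powr ?q * W))"
      proof -
        let ?A = "{x :: 'a \<times> real. dist x b < 4 * r}"
        let ?G = "\<integral>\<^sup>+x. indicator half_space x * ennreal (\<bar>u x\<bar> powr p) * indicator ?A x \<partial>lborel"
        \<comment> \<open>Since \<open>b\<close> lies on the boundary, a point within
          \<open>4 * r < \<delta>\<close> of it has height below \<open>\<delta>\<close>.\<close>
        have "?G \<le> strip \<delta>" unfolding strip_def
        proof (rule nn_integral_mono)
          fix x :: "'a \<times> real"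
          have "snd x < \<delta>" if "dist x b < 4 * r" using that r dist_snd_le[of x b] b by (simp add: dist_real_def)
          then show "indicator half_space x * ennreal (\<bar>u x\<bar> powr p) * indicator ?A x \<le> indicator half_space x * ennreal (\<bar>u x\<bar> powr p) * indicator {..<\<delta>} (snd x)"
            by (auto simp: indicator_def)
        qed
        then have "?G \<le> ennreal e" using \<delta>(2) by (rule order_trans)
        then obtain G where G: "?G = ennreal G" "G \<ge> 0" "G \<le> e" using e by (cases ?G) (auto simp: top_unique)
        have G2: "G powr (1 - 2 / p) \<le> 1 / 2" unfolding ek[symmetric] using G p by (intro powr_mono2) auto
        have "pint m2 \<le> (\<integral>\<^sup>+x. indicator half_space x * ennreal ((f x)\<^sup>2 * \<bar>u x\<bar> powr (p - 2)) * indicator ?A x \<partial>lborel)"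
          unfolding pint_def
        proof (rule nn_integral_mono)
          fix x
          show "indicator half_space x * ennreal (\<bar>u x\<bar> powr p * (m2 x)\<^sup>2) \<le> indicator half_space x * ennreal ((f x)\<^sup>2 * \<bar>u x\<bar> powr (p - 2)) * indicator ?A x"
          proof (cases "dist x b < 4 * r")
            case True
            have "\<bar>u x\<bar> powr p = (u x)\<^sup>2 * \<bar>u x\<bar> powr (p - 2)"
            proof (cases "u x = 0")
              case False
              then have "\<bar>u x\<bar> powr 2 = (u x)\<^sup>2" by (simp add: powr_numeral)
              moreover have "\<bar>u x\<bar> powr p = \<bar>u x\<bar> powr 2 * \<bar>u x\<bar> powr (p - 2)" by (simp only: powr_add[symmetric]) simp
              ultimately show ?thesis by (simp only:)
            qed (use p in simp)
            then have "\<bar>u x\<bar> powr p * (m2 x)\<^sup>2 = (f x)\<^sup>2 * \<bar>u x\<bar> powr (p - 2)"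
              by (simp add: f_def power_mult_distrib mult_ac)
            then show ?thesis using True by simp
          next
            case False
            then have "m2 x = 0" by (intro m2_out) simp
            then show ?thesis by simp
          qed
        qed
        also have "\<dots> \<le> ennreal (F powr (2 / p) * G powr (1 - 2 / p))" by (intro lp_local F G) auto
        finally have pint: "pint m2 \<le> ennreal (F powr (2 / p) * G powr (1 - 2 / p))" .
        have "ennreal (S * F powr (2 / p)) \<le> gen \<sigma> f"
          using sob_econv[OF f] S0 unfolding lp_den_real[OF F] by (simp add: ennreal_mult)
        also have "\<dots> \<le> ennreal S * pint m2 + lam m2" unfolding f_def by (rule euler_lagrange[OF M2])
        also have "\<dots> \<le> ennreal S * ennreal (F powr (2 / p) * G powr (1 - 2 / p)) + ennreal (C * (2 powr ?q * W))"
          by (intro add_mono mult_left_mono pint lam2) simp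
        finally have "S * F powr (2 / p) \<le> S * (F powr (2 / p) * G powr (1 - 2 / p)) + C * (2 powr ?q * W)"
          using S0 C(1) W(2) by (simp add: ennreal_mult[symmetric] ennreal_plus[symmetric] del: ennreal_plus)
        moreover have "S * (F powr (2 / p) * G powr (1 - 2 / p)) \<le> S * (F powr (2 / p) * (1 / 2))"
          using S0 G2 by (intro mult_left_mono) auto
        ultimately show ?thesis by simp
      qed
      define g where "g x = ph x * u x" for x
      have [measurable]: "g \<in> borel_measurable borel" unfolding g_def by measurable
      have g: "econv \<sigma> (\<lambda>k x. ph x * \<phi>0 k x) g" unfolding g_def by (rule multiplier_econv[OF \<sigma> Mph conv])
      obtain L where L: "lp_int \<sigma> half_space g = ennreal L" "L \<ge> 0"
        using Hdot_lp_finite[OF \<sigma>_pos \<sigma>(2) g] by (cases "lp_int \<sigma> half_space g") auto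
      have LF: "1 \<le> L + F"
      proof -
        have "lp_int \<sigma> half_space u \<le> (\<integral>\<^sup>+x. indicator half_space x * ennreal (\<bar>g x\<bar> powr p) + indicator half_space x * ennreal (\<bar>f x\<bar> powr p) \<partial>lborel)"
          unfolding lp_int_p
        proof (rule nn_integral_mono)
          fix x
          show "indicator half_space x * ennreal (\<bar>u x\<bar> powr p) \<le> indicator half_space x * ennreal (\<bar>g x\<bar> powr p) + indicator half_space x * ennreal (\<bar>f x\<bar> powr p)"
          proof (cases "dist x b \<le> 2 * r")
            case True
            then show ?thesis by (simp add: f_def m2_in)
          next
            case False
            then show ?thesis by (simp add: g_def ph_def m1_out)
          qed
        qed
        also have "\<dots> = ennreal L + ennreal F"
          unfolding L(1)[symmetric] F(1)[symmetric] lp_int_p by (rule nn_integral_add) measurable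
        finally show ?thesis using L F by (simp add: lp_u ennreal_plus[symmetric] del: ennreal_plus)
      qed
      have "1 - F \<le> L powr (2 / p)"
      proof (cases "L \<ge> 1")
        case True
        then have "1 \<le> L powr (2 / p)" using p by (intro ge_one_powr_ge_zero) auto
        then show ?thesis using F by linarith
      next
        case False
        have "L powr 1 \<le> L powr (2 / p)"
        proof (cases "L = 0")
          case False
          then show ?thesis using L(2) \<open>\<not> L \<ge> 1\<close> p by (intro powr_mono') auto
        qed simp
        then show ?thesis using LF L by simp
      qed
      then have SL: "S - S * F \<le> S * L powr (2 / p)"
        using mult_left_mono[OF _ S0, of "1 - F" "L powr (2 / p)"] by (simp add: right_diff_distrib)
      \<comment> \<open>Here \<open>F \<le> 1\<close> and \<open>2 / p < 1\<close>; this replaces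
        the power, which is what the Sobolev term controls, by the mass itself.\<close>
      have "F \<le> F powr (2 / p)"
      proof (cases "F = 0")
        case False
        then have "F powr 1 \<le> F powr (2 / p)" using F F1 p by (intro powr_mono') auto
        then show ?thesis using F by simp
      qed simp
      then have SF': "S * F \<le> 2 * (C * (2 powr ?q * W))"
        using mult_left_mono[OF _ S0, of F "F powr (2 / p)"] SF by linarith
      let ?w = "\<lambda>x. dist x b powr (- 4 * \<sigma>)"
      \<comment> \<open>\<open>kel\<close> speaks of \<open>C1c\<close> functions vanishing near
        \<open>b\<close>. The products \<open>ph \<phi>0 k\<close> are of this kind, and
        \<open>econv_ineq\<close> passes to the limit.\<close>
      have ineq: "ennreal S * lp_den \<sigma> half_space g + ennreal (v1 * r powr (2 * \<sigma>)) * wint ?w g \<le> gen \<sigma> g"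
      proof (rule econv_ineq[OF \<sigma>_pos \<sigma>(2) g])
        fix k
        show "ennreal S * lp_den \<sigma> half_space (\<lambda>x. ph x * \<phi>0 k x) + ennreal (v1 * r powr (2 * \<sigma>)) * wint ?w (\<lambda>x. ph x * \<phi>0 k x) \<le> gen \<sigma> (\<lambda>x. ph x * \<phi>0 k x)"
        proof (rule kel[OF r(1)])
          show "(\<lambda>x. ph x * \<phi>0 k x) \<in> C1c half_space" using g by (simp add: econv_def)
        qed (simp add: ph_def m1_in)
      qed measurable
      have "pint ph \<le> ennreal (1\<^sup>2)" by (rule pint_le) (use ph01 in auto)
      then have pint1: "pint ph \<le> 1" by simp
      have "gen \<sigma> g \<le> ennreal S * pint ph + lam ph" unfolding g_def by (rule euler_lagrange[OF Mph])
      also have "\<dots> \<le> ennreal S * 1 + ennreal (C * W)" by (intro add_mono mult_left_mono pint1 lam1) simp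
      finally have up: "gen \<sigma> g \<le> ennreal (S + C * W)" using S0 C(1) W(2) by simp
      have "ennreal (v1 * r powr (2 * \<sigma>)) * wint ?w g \<le> gen \<sigma> g" using ineq by (rule order_trans[OF add_increasing[OF zero_le order_refl]])
      then have "ennreal (v1 * r powr (2 * \<sigma>)) * wint ?w g < \<infinity>" using le_less_trans[OF order_trans[OF _ up] ennreal_less_top] by (simp only: infinity_ennreal_def)
      then have "wint ?w g < \<infinity>" using v1 r by (auto simp: ennreal_mult_less_top)
      then obtain Y where Y: "wint ?w g = ennreal Y" "Y \<ge> 0" by (cases "wint ?w g") auto
      have "ennreal (S * L powr (2 / p) + v1 * r powr (2 * \<sigma>) * Y) \<le> ennreal (S + C * W)"
        using order_trans[OF ineq up] S0 v1 Y unfolding lp_den_real[OF L] by (simp add: ennreal_mult ennreal_plus)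
      then have "S * L powr (2 / p) + v1 * r powr (2 * \<sigma>) * Y \<le> S + C * W" using S0 C(1) W(2) by (simp add: ennreal_le_iff del: ennreal_plus)
      then have "v1 * r powr (2 * \<sigma>) * Y \<le> S * F + C * W" using SL by linarith
      also have "\<dots> \<le> (2 * 2 powr ?q + 1) * C * W" using SF' by (simp add: algebra_simps)
      finally have "Y * (v1 * r powr (2 * \<sigma>)) \<le> (2 * 2 powr ?q + 1) * C * W" by (simp only: mult.commute)
      then have "Y \<le> (2 * 2 powr ?q + 1) * C * W / (v1 * r powr (2 * \<sigma>))" using v1 r by (simp add: pos_le_divide_eq)
      also have "\<dots> = C' * (r powr (- 2 * \<sigma>) * W)" using r by (simp add: C'_def powr_minus_divide)
      finally have Y': "Y \<le> C' * (r powr (- 2 * \<sigma>) * W)" .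
      have "wint (\<lambda>x. indicator {2 * r..} (dist x b) * dist x b powr (- 4 * \<sigma>)) u \<le> wint ?w g"
        unfolding wint_def
      proof (rule nn_integral_mono)
        fix x
        show "indicator half_space x * ennreal ((u x)\<^sup>2 * (indicator {2 * r..} (dist x b) * dist x b powr (- 4 * \<sigma>))) \<le> indicator half_space x * ennreal ((g x)\<^sup>2 * dist x b powr (- 4 * \<sigma>))"
          by (cases "dist x b \<ge> 2 * r") (simp_all add: g_def ph_def m1_out)
      qed
      also have "\<dots> \<le> ennreal (C' * (r powr (- 2 * \<sigma>) * W))" unfolding Y(1) by (rule ennreal_leI[OF Y'])
      also have "\<dots> = ennreal C' * wint (\<lambda>x. r powr (- 2 * \<sigma>) * cutw \<sigma> b r x) u"
        using C' W by (subst wint_cmult) (auto simp: ennreal_mult)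
      finally show ?thesis .
    qed
  qed
qed

end

section \<open>Integration over all scales and the contradiction\<close>

lemma wint_scale_integral:
  fixes w :: "real \<Rightarrow> 'a::euclidean_space \<times> real \<Rightarrow> real"
  assumes [measurable]: "(\<lambda>z. w (fst z) (snd z)) \<in> borel_measurable (borel \<Otimes>\<^sub>M borel)" "f \<in> borel_measurable borel" "g \<in> borel_measurable borel"
    and nn: "\<And>r x. 0 \<le> w r x" "\<And>r. 0 \<le> g r"
  shows "(\<integral>\<^sup>+r. ennreal (g r) * wint (w r) f \<partial>lborel) = (\<integral>\<^sup>+x. indicator half_space x * ennreal ((f x)\<^sup>2) * (\<integral>\<^sup>+r. ennreal (g r * w r x) \<partial>lborel) \<partial>lborel)"
proof -
  let ?W = "\<lambda>r x. indicator half_space x * ennreal ((f x)\<^sup>2 * w r x)"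
  have sec: "(\<lambda>x. w r x) \<in> borel_measurable borel" for r
  proof -
    have "(\<lambda>x. (\<lambda>z. w (fst z) (snd z)) (r, x)) \<in> borel_measurable borel" by measurable
    then show ?thesis by simp
  qed
  have sec': "(\<lambda>r. w r x) \<in> borel_measurable borel" for x
  proof -
    have "(\<lambda>r. (\<lambda>z. w (fst z) (snd z)) (r, x)) \<in> borel_measurable borel" by measurable
    then show ?thesis by simp
  qed
  note [measurable] = sec sec'
  have "(\<integral>\<^sup>+r. ennreal (g r) * wint (w r) f \<partial>lborel) = (\<integral>\<^sup>+r. \<integral>\<^sup>+x. ennreal (g r) * ?W r x \<partial>lborel \<partial>lborel)"
    unfolding wint_def by (subst nn_integral_cmult) simp_all
  also have "\<dots> = (\<integral>\<^sup>+x. \<integral>\<^sup>+r. ennreal (g r) * ?W r x \<partial>lborel \<partial>lborel)"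
  proof (rule lborel_pair.Fubini'[symmetric])
    have "(\<lambda>z. ennreal (g (fst z)) * ?W (fst z) (snd z)) \<in> borel_measurable (borel \<Otimes>\<^sub>M borel)" by measurable
    then show "(\<lambda>(r, x). ennreal (g r) * ?W r x) \<in> borel_measurable (lborel \<Otimes>\<^sub>M lborel)"
      by (simp add: case_prod_beta')
  qed
  also have "\<dots> = (\<integral>\<^sup>+x. \<integral>\<^sup>+r. indicator half_space x * ennreal ((f x)\<^sup>2) * ennreal (g r * w r x) \<partial>lborel \<partial>lborel)"
    using nn by (simp add: ennreal_mult mult_ac)
  also have "\<dots> = (\<integral>\<^sup>+x. indicator half_space x * ennreal ((f x)\<^sup>2) * (\<integral>\<^sup>+r. ennreal (g r * w r x) \<partial>lborel) \<partial>lborel)"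
    by (subst nn_integral_cmult) simp_all
  finally show ?thesis .
qed

text \<open>Below \<open>r = dist x b\<close> the integrand grows like the power
  \<open>n - 2 * \<sigma> + s - 1\<close> of \<open>r\<close>; above it decays like the power
  \<open>s - 4 * \<sigma> - 1\<close>. The bounds \<open>s > 0\<close> and
  \<open>s \<le> 1 / 2\<close> give a constant free of \<open>s\<close>.\<close>

lemma cutw_scale_integral:
  fixes x b :: "'a::euclidean_space \<times> real"
  assumes \<sigma>: "1/2 < \<sigma>" "\<sigma> < 1" and s: "0 < s" "s \<le> 1 / 2" and xb: "x \<noteq> b"
  shows "(\<integral>\<^sup>+r. ennreal (indicator {0<..} r * r powr (s - 1) * (r powr (- 2 * \<sigma>) * cutw \<sigma> b r x)) \<partial>lborel)
    \<le> ennreal ((1 / (dimn TYPE('a \<times> real) - 2 * \<sigma>) + 1 / (4 * \<sigma> - 1)) * dist x b powr (s - 4 * \<sigma>))"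
proof -
  let ?N = "dimn TYPE('a \<times> real)"
  let ?q = "?N + 2 * \<sigma>"
  have N: "?N \<ge> 2" by (rule dimn_ge_2)
  define \<rho> where "\<rho> = dist x b"
  have \<rho>: "\<rho> > 0" using xb by (simp add: \<rho>_def)
  have a1: "?N - 2 * \<sigma> + s > 0" and a2: "4 * \<sigma> - s > 0" using N \<sigma> s by linarith+
  let ?h = "\<lambda>r. ennreal (\<rho> powr (- ?q)) * (ennreal (r powr (?N - 2 * \<sigma> + s - 1)) * indicator {0<..\<rho>} r)"
  let ?t = "\<lambda>r. ennreal (r powr (- (4 * \<sigma> - s) - 1)) * indicator {\<rho>..} r"
  have "(\<integral>\<^sup>+r. ennreal (indicator {0<..} r * r powr (s - 1) * (r powr (- 2 * \<sigma>) * cutw \<sigma> b r x)) \<partial>lborel) \<le> (\<integral>\<^sup>+r. ?h r + ?t r \<partial>lborel)"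
  proof (rule nn_integral_mono)
    fix r :: real
    have e: "r powr (s - 1) * (r powr (- 2 * \<sigma>) * r powr (- 2 * \<sigma>)) = r powr (- (4 * \<sigma> - s) - 1)"
      by (simp add: powr_add[symmetric] algebra_simps)
    show "ennreal (indicator {0<..} r * r powr (s - 1) * (r powr (- 2 * \<sigma>) * cutw \<sigma> b r x)) \<le> ?h r + ?t r"
    proof (cases "r \<le> 0")
      case False
      then have r: "r > 0" by simp
      show ?thesis
      proof (cases "r \<le> \<rho>")
        case True
        have "min 1 (r / \<rho>) = r / \<rho>" using True \<rho> by (simp add: min_def)
        then have "min 1 (r / \<rho>) powr ?q = r powr ?q * \<rho> powr (- ?q)"
          using r \<rho> by (simp only: powr_divide_minus less_imp_le)
        moreover have "r powr (- (4 * \<sigma> - s) - 1) * r powr ?q = r powr (?N - 2 * \<sigma> + s - 1)"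
          by (simp add: powr_add[symmetric] algebra_simps)
        ultimately have "r powr (s - 1) * (r powr (- 2 * \<sigma>) * cutw \<sigma> b r x) = \<rho> powr (- ?q) * r powr (?N - 2 * \<sigma> + s - 1)"
          unfolding cutw_def \<rho>_def[symmetric] e[symmetric]
        proof (simp only:)
          have "A * (B * (B * (Q * P))) = P * (A * (B * B) * Q)" for A B P Q :: real by (simp only: mult_ac)
          moreover assume "r powr (s - 1) * (r powr (- 2 * \<sigma>) * r powr (- 2 * \<sigma>)) * r powr ?q = r powr (?N - 2 * \<sigma> + s - 1)"
          ultimately show "r powr (s - 1) * (r powr (- 2 * \<sigma>) * (r powr (- 2 * \<sigma>) * (r powr ?q * \<rho> powr (- ?q)))) = \<rho> powr (- ?q) * r powr (?N - 2 * \<sigma> + s - 1)"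
            by (simp only:)
        qed
        then have "ennreal (indicator {0<..} r * r powr (s - 1) * (r powr (- 2 * \<sigma>) * cutw \<sigma> b r x)) = ?h r"
          using r True by (simp add: ennreal_mult)
        then show ?thesis by simp
      next
        case False
        then have "min 1 (r / \<rho>) = 1" using \<rho> by (simp add: min_def)
        then have "r powr (s - 1) * (r powr (- 2 * \<sigma>) * cutw \<sigma> b r x) = r powr (- (4 * \<sigma> - s) - 1)"
          unfolding cutw_def \<rho>_def[symmetric] e[symmetric] by (simp only: powr_one_eq_one mult_1_right)
        then have "ennreal (indicator {0<..} r * r powr (s - 1) * (r powr (- 2 * \<sigma>) * cutw \<sigma> b r x)) = ?t r"
          using r False by simp
        then show ?thesis by simp
      qed
    qed simp
  qed
  also have "\<dots> = (\<integral>\<^sup>+r. ?h r \<partial>lborel) + (\<integral>\<^sup>+r. ?t r \<partial>lborel)" by (rule nn_integral_add) simp_all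
  also have "(\<integral>\<^sup>+r. ?h r \<partial>lborel) = ennreal (\<rho> powr (- ?q)) * ennreal (\<rho> powr (?N - 2 * \<sigma> + s) / (?N - 2 * \<sigma> + s))"
    by (subst nn_integral_cmult) (simp, simp only: nn_integral_powr_head[OF a1 \<rho>])
  also have "\<dots> = ennreal (\<rho> powr (s - 4 * \<sigma>) / (?N - 2 * \<sigma> + s))"
  proof -
    have "\<rho> powr (- ?q) * \<rho> powr (?N - 2 * \<sigma> + s) = \<rho> powr (s - 4 * \<sigma>)" by (simp add: powr_add[symmetric])
    then have "\<rho> powr (- ?q) * (\<rho> powr (?N - 2 * \<sigma> + s) / (?N - 2 * \<sigma> + s)) = \<rho> powr (s - 4 * \<sigma>) / (?N - 2 * \<sigma> + s)"
      by (simp only: times_divide_eq_right)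
    then show ?thesis using a1 by (subst ennreal_mult[symmetric]) simp_all
  qed
  also have "(\<integral>\<^sup>+r. ?t r \<partial>lborel) = ennreal (\<rho> powr (s - 4 * \<sigma>) / (4 * \<sigma> - s))"
    using nn_integral_powr_tail[OF a2 \<rho>] by simp
  also have "ennreal (\<rho> powr (s - 4 * \<sigma>) / (?N - 2 * \<sigma> + s)) + ennreal (\<rho> powr (s - 4 * \<sigma>) / (4 * \<sigma> - s))
    = ennreal (\<rho> powr (s - 4 * \<sigma>) / (?N - 2 * \<sigma> + s) + \<rho> powr (s - 4 * \<sigma>) / (4 * \<sigma> - s))"
    by (rule ennreal_plus[symmetric]) (use a1 a2 in \<open>simp_all add: divide_nonneg_pos\<close>)
  also have "\<dots> \<le> ennreal ((1 / (?N - 2 * \<sigma>) + 1 / (4 * \<sigma> - 1)) * \<rho> powr (s - 4 * \<sigma>))"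
  proof (rule ennreal_leI)
    have "\<rho> powr (s - 4 * \<sigma>) / (?N - 2 * \<sigma> + s) \<le> \<rho> powr (s - 4 * \<sigma>) / (?N - 2 * \<sigma>)"
      using N \<sigma> s by (intro divide_left_mono mult_pos_pos) auto
    moreover have "\<rho> powr (s - 4 * \<sigma>) / (4 * \<sigma> - s) \<le> \<rho> powr (s - 4 * \<sigma>) / (4 * \<sigma> - 1)"
      using \<sigma> s by (intro divide_left_mono mult_pos_pos) auto
    ultimately show "\<rho> powr (s - 4 * \<sigma>) / (?N - 2 * \<sigma> + s) + \<rho> powr (s - 4 * \<sigma>) / (4 * \<sigma> - s) \<le> (1 / (?N - 2 * \<sigma>) + 1 / (4 * \<sigma> - 1)) * \<rho> powr (s - 4 * \<sigma>)"
      by (simp add: distrib_right)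
  qed
  finally show ?thesis by (simp add: \<rho>_def)
qed

text \<open>This is the source of the factor \<open>1 / s\<close>: the weight stays constant for all
  \<open>r\<close> from 0 up to a multiple of \<open>\<rho>\<close>, where
  \<open>r powr (s - 1)\<close> is barely integrable.\<close>

lemma far_weight_scale_integral:
  fixes \<rho> :: real
  assumes s: "0 < s" and \<rho>: "0 < \<rho>" "\<rho> \<le> \<Lambda>" and r0: "0 < r0" "r0 \<le> \<Lambda>"
  shows "ennreal ((r0 / (4 * \<Lambda>)) powr s / s * \<rho> powr (s + k)) \<le> (\<integral>\<^sup>+r. ennreal (indicator {0<..<r0} r * r powr (s - 1) * (indicator {2 * r..} \<rho> * \<rho> powr k)) \<partial>lborel)"
proof -
  have \<Lambda>: "\<Lambda> > 0" using \<rho> by linarith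
  \<comment> \<open>A multiple of \<open>\<rho>\<close> below both \<open>r0\<close> and
    \<open>\<rho> / 2\<close>, which the assumptions \<open>\<rho> \<le> \<Lambda>\<close> and
    \<open>r0 \<le> \<Lambda>\<close> ensure.\<close>
  define c where "c = r0 / (4 * \<Lambda>) * \<rho>"
  have c: "c > 0" unfolding c_def using \<rho> r0 \<Lambda> by simp
  have c1: "c < r0"
  proof -
    have "c = r0 * (\<rho> / (4 * \<Lambda>))" by (simp add: c_def)
    also have "\<dots> < r0 * 1" using r0 \<rho> \<Lambda> by (intro mult_strict_left_mono) auto
    finally show ?thesis by simp
  qed
  have c2: "2 * c \<le> \<rho>"
  proof -
    have "2 * c = \<rho> * (r0 / (2 * \<Lambda>))" by (simp add: c_def)
    also have "\<dots> \<le> \<rho> * 1" using r0 \<rho> \<Lambda> by (intro mult_left_mono) auto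
    finally show ?thesis by simp
  qed
  have "(r0 / (4 * \<Lambda>)) powr s / s * \<rho> powr (s + k) = \<rho> powr k * (c powr s / s)"
  proof -
    have "c powr s = (r0 / (4 * \<Lambda>)) powr s * \<rho> powr s" unfolding c_def by (rule powr_mult)
    then show ?thesis by (simp add: powr_add)
  qed
  then have "ennreal ((r0 / (4 * \<Lambda>)) powr s / s * \<rho> powr (s + k)) = ennreal (\<rho> powr k) * ennreal (c powr s / s)"
    using s by (simp only:) (rule ennreal_mult; simp)
  also have "\<dots> = (\<integral>\<^sup>+r. ennreal (\<rho> powr k) * (ennreal (r powr (s - 1)) * indicator {0<..c} r) \<partial>lborel)"
    by (subst nn_integral_cmult) (simp, simp only: nn_integral_powr_head[OF s c])
  also have "\<dots> \<le> (\<integral>\<^sup>+r. ennreal (indicator {0<..<r0} r * r powr (s - 1) * (indicator {2 * r..} \<rho> * \<rho> powr k)) \<partial>lborel)"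
  proof (rule nn_integral_mono)
    fix r :: real
    show "ennreal (\<rho> powr k) * (ennreal (r powr (s - 1)) * indicator {0<..c} r) \<le> ennreal (indicator {0<..<r0} r * r powr (s - 1) * (indicator {2 * r..} \<rho> * \<rho> powr k))"
    proof (cases "r \<in> {0<..c}")
      case True
      then have "r < r0" "2 * r \<le> \<rho>" "r > 0" using c1 c2 by auto
      then show ?thesis using True by (simp add: ennreal_mult[symmetric] mult.commute)
    qed simp
  qed
  finally show ?thesis .
qed

context minimizer
begin

text \<open>If all truncations vanished, \<open>u\<close> would be zero almost everywhere in the
  half-space, against its normalization. The bound \<open>R\<close> lets later arguments demand that
  \<open>\<Lambda>\<close> be large.\<close>

lemma truncated_mass_positive:
  obtains \<Lambda> where "\<Lambda> \<ge> R" "wint (\<lambda>x. indicator {..\<Lambda>} (dist x b) * dist x b powr k) u > 0"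
proof (rule ccontr)
  assume "\<not> thesis"
  then have 0: "\<Lambda> \<ge> R \<Longrightarrow> wint (\<lambda>x. indicator {..\<Lambda>} (dist x b) * dist x b powr k) u = 0" for \<Lambda>
    using that by (auto simp: zero_less_iff_neq_zero)
  have "AE x in lborel. indicator half_space x * ennreal ((u x)\<^sup>2 * (indicator {..R + real n} (dist x b) * dist x b powr k)) = 0" for n
  proof -
    have "R \<le> R + real n" by simp
    from 0[OF this] show ?thesis unfolding wint_def by (subst (asm) nn_integral_0_iff_AE) simp_all
  qed
  then have "AE x in lborel. \<forall>n. indicator half_space x * ennreal ((u x)\<^sup>2 * (indicator {..R + real n} (dist x b) * dist x b powr k)) = 0"
    by (simp only: AE_all_countable) blast
  moreover have "AE x in lborel. x \<noteq> b" by (rule AE_lborel_singleton)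
  ultimately have "AE x in lborel. indicator half_space x * ennreal (\<bar>u x\<bar> powr p) = 0"
  proof eventually_elim
    case (elim x)
    obtain n :: nat where n: "dist x b - R \<le> real n" using real_arch_simple by blast
    show ?case
    proof (cases "x \<in> half_space")
      case True
      have "ennreal ((u x)\<^sup>2 * dist x b powr k) = 0" using elim(1)[rule_format, of n] n True by (simp add: indicator_def)
      then have "u x = 0" using elim(2) by (simp add: ennreal_eq_0_iff mult_le_0_iff)
      then show ?thesis by simp
    qed simp
  qed
  then have "lp_int \<sigma> half_space u = 0" unfolding lp_int_p by (subst nn_integral_0_iff_AE) simp_all
  then show False using lp_u by simp
qed

text \<open>Multiply the single-scale bound by \<open>r powr (s - 1)\<close> and exchange integrals.
  Because only \<open>r < r0\<close> is available, the factor \<open>1 / s\<close> is gained on the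
  part within \<open>\<Lambda>\<close> of \<open>b\<close>.\<close>

lemma scale_integrated_bound:
  assumes b: "snd b = 0" and C: "C > 0" and r0: "r0 > 0"
    and lb: "\<And>r. 0 < r \<Longrightarrow> r < r0 \<Longrightarrow>
      wint (\<lambda>x. indicator {2 * r..} (dist x b) * dist x b powr (- 4 * \<sigma>)) u \<le> ennreal C * wint (\<lambda>x. r powr (- 2 * \<sigma>) * cutw \<sigma> b r x) u"
    and s: "0 < s" "s \<le> 1 / 2" and \<Lambda>: "r0 \<le> \<Lambda>"
  shows "ennreal ((r0 / (4 * \<Lambda>)) powr s / s) * wint (\<lambda>x. indicator {..\<Lambda>} (dist x b) * dist x b powr (s - 4 * \<sigma>)) u
    \<le> ennreal (C * (1 / (N - 2 * \<sigma>) + 1 / (4 * \<sigma> - 1))) * wint (\<lambda>x. dist x b powr (s - 4 * \<sigma>)) u"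
proof -
  let ?c1 = "1 / (N - 2 * \<sigma>) + 1 / (4 * \<sigma> - 1)"
  let ?\<kappa> = "(r0 / (4 * \<Lambda>)) powr s / s"
  let ?w1 = "\<lambda>r x. indicator {2 * r..} (dist x b) * dist x b powr (- 4 * \<sigma>)"
  let ?w2 = "\<lambda>r x. r powr (- 2 * \<sigma>) * cutw \<sigma> b r x"
  let ?g1 = "\<lambda>r. indicator {0<..<r0} r * r powr (s - 1)"
  let ?g2 = "\<lambda>r. indicator {0<..} r * r powr (s - 1) :: real"
  have N: "N \<ge> 2" unfolding N_def by (rule dimn_ge_2)
  have c1: "?c1 \<ge> 0" using N \<sigma> by (intro add_nonneg_nonneg divide_nonneg_nonneg) auto
  have Hb: "x \<noteq> b" if "x \<in> half_space" for x using that b by (auto simp: half_space_def)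
  have cutw0: "cutw \<sigma> b r x \<ge> 0" for r x by (simp add: cutw_def)
  have m1: "(\<lambda>z. ?w1 (fst z) (snd z)) \<in> borel_measurable (borel \<Otimes>\<^sub>M borel)"
  proof -
    have "(\<lambda>z. (if 2 * fst z \<le> dist (snd z) b then 1 else 0) * dist (snd z) b powr (- 4 * \<sigma>)) \<in> borel_measurable (borel \<Otimes>\<^sub>M (borel :: ('a \<times> real) measure))"
      by measurable
    then show ?thesis by (simp add: indicator_def of_bool_def)
  qed
  have m2: "(\<lambda>z. ?w2 (fst z) (snd z)) \<in> borel_measurable (borel \<Otimes>\<^sub>M borel)"
    unfolding cutw_def by measurable
  have "ennreal ?\<kappa> * wint (\<lambda>x. indicator {..\<Lambda>} (dist x b) * dist x b powr (s - 4 * \<sigma>)) u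
    = (\<integral>\<^sup>+x. ennreal ?\<kappa> * (indicator half_space x * ennreal ((u x)\<^sup>2 * (indicator {..\<Lambda>} (dist x b) * dist x b powr (s - 4 * \<sigma>)))) \<partial>lborel)"
    unfolding wint_def by (rule nn_integral_cmult[symmetric]) measurable
  also have "\<dots> \<le> (\<integral>\<^sup>+x. indicator half_space x * ennreal ((u x)\<^sup>2) * (\<integral>\<^sup>+r. ennreal (?g1 r * ?w1 r x) \<partial>lborel) \<partial>lborel)"
  proof (rule nn_integral_mono)
    fix x :: "'a \<times> real"
    show "ennreal ?\<kappa> * (indicator half_space x * ennreal ((u x)\<^sup>2 * (indicator {..\<Lambda>} (dist x b) * dist x b powr (s - 4 * \<sigma>))))
      \<le> indicator half_space x * ennreal ((u x)\<^sup>2) * (\<integral>\<^sup>+r. ennreal (?g1 r * ?w1 r x) \<partial>lborel)"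
    proof (cases "x \<in> half_space \<and> dist x b \<le> \<Lambda>")
      case True
      then have \<rho>: "0 < dist x b" "dist x b \<le> \<Lambda>" using Hb by auto
      have "ennreal (?\<kappa> * dist x b powr (s + - 4 * \<sigma>)) \<le> (\<integral>\<^sup>+r. ennreal (?g1 r * ?w1 r x) \<partial>lborel)"
        by (rule far_weight_scale_integral[OF s(1) \<rho> r0 \<Lambda>])
      then have "ennreal ((u x)\<^sup>2) * ennreal (?\<kappa> * dist x b powr (s + - 4 * \<sigma>)) \<le> ennreal ((u x)\<^sup>2) * (\<integral>\<^sup>+r. ennreal (?g1 r * ?w1 r x) \<partial>lborel)"
        by (rule mult_left_mono) simp
      moreover have "ennreal ?\<kappa> * ennreal ((u x)\<^sup>2 * dist x b powr (s - 4 * \<sigma>)) = ennreal ((u x)\<^sup>2) * ennreal (?\<kappa> * dist x b powr (s + - 4 * \<sigma>))"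
        using s by (simp add: ennreal_mult[symmetric] mult_ac)
      ultimately show ?thesis using True by simp
    next
      case False
      then have "indicator half_space x * ennreal ((u x)\<^sup>2 * (indicator {..\<Lambda>} (dist x b) * dist x b powr (s - 4 * \<sigma>))) = 0"
        by (auto simp: indicator_def)
      then show ?thesis by (simp only: mult_zero_right zero_le)
    qed
  qed
  also have "\<dots> = (\<integral>\<^sup>+r. ennreal (?g1 r) * wint (?w1 r) u \<partial>lborel)"
    by (rule wint_scale_integral[OF m1, symmetric]) simp_all
  \<comment> \<open>On the right the range of \<open>r\<close> may be enlarged to all positive
    reals, since that integral is bounded anyway.\<close>
  also have "\<dots> \<le> (\<integral>\<^sup>+r. ennreal C * (ennreal (?g2 r) * wint (?w2 r) u) \<partial>lborel)"
  proof (rule nn_integral_mono)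
    fix r :: real
    show "ennreal (?g1 r) * wint (?w1 r) u \<le> ennreal C * (ennreal (?g2 r) * wint (?w2 r) u)"
    proof (cases "r \<in> {0<..<r0}")
      case True
      then have "ennreal (r powr (s - 1)) * wint (?w1 r) u \<le> ennreal (r powr (s - 1)) * (ennreal C * wint (?w2 r) u)"
        by (intro mult_left_mono lb) auto
      then show ?thesis using True by (simp add: mult.left_commute)
    qed simp
  qed
  also have "\<dots> = ennreal C * (\<integral>\<^sup>+r. ennreal (?g2 r) * wint (?w2 r) u \<partial>lborel)"
    by (intro nn_integral_cmult borel_measurable_times_ennreal)
       (simp, use wint_measurable_param[OF m2 u_measurable] in simp)
  also have "(\<integral>\<^sup>+r. ennreal (?g2 r) * wint (?w2 r) u \<partial>lborel) = (\<integral>\<^sup>+x. indicator half_space x * ennreal ((u x)\<^sup>2) * (\<integral>\<^sup>+r. ennreal (?g2 r * ?w2 r x) \<partial>lborel) \<partial>lborel)"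
    by (rule wint_scale_integral[OF m2]) (simp_all add: cutw0)
  also have "\<dots> \<le> (\<integral>\<^sup>+x. ennreal ?c1 * (indicator half_space x * ennreal ((u x)\<^sup>2 * dist x b powr (s - 4 * \<sigma>))) \<partial>lborel)"
  proof (rule nn_integral_mono)
    fix x :: "'a \<times> real"
    show "indicator half_space x * ennreal ((u x)\<^sup>2) * (\<integral>\<^sup>+r. ennreal (?g2 r * ?w2 r x) \<partial>lborel) \<le> ennreal ?c1 * (indicator half_space x * ennreal ((u x)\<^sup>2 * dist x b powr (s - 4 * \<sigma>)))"
    proof (cases "x \<in> half_space")
      case True
      have "ennreal ((u x)\<^sup>2) * (\<integral>\<^sup>+r. ennreal (?g2 r * ?w2 r x) \<partial>lborel) \<le> ennreal ((u x)\<^sup>2) * ennreal (?c1 * dist x b powr (s - 4 * \<sigma>))"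
        unfolding N_def by (intro mult_left_mono cutw_scale_integral \<sigma> s Hb True) simp
      also have "\<dots> = ennreal ?c1 * ennreal ((u x)\<^sup>2 * dist x b powr (s - 4 * \<sigma>))"
        using c1 by (simp only: ennreal_mult powr_ge_zero zero_le_power2 mult_ac)
      finally show ?thesis using True by simp
    qed simp
  qed
  also have "\<dots> = ennreal ?c1 * wint (\<lambda>x. dist x b powr (s - 4 * \<sigma>)) u"
    unfolding wint_def by (rule nn_integral_cmult) measurable
  finally show ?thesis using C c1 by (simp add: ennreal_mult mult.assoc mult_left_mono)
qed

text \<open>As \<open>s\<close> tends to 0, the mass beyond \<open>\<Lambda>\<close> stays bounded
  by \<open>O'\<close> and the mass \<open>t\<close> within \<open>\<Lambda>\<close> stays above
  \<open>P'\<close>. Hence the full mass is at most a fixed multiple of \<open>t\<close>, which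
  contradicts a lower bound by \<open>t\<close> times a factor growing like
  \<open>1 / s\<close>.\<close>

lemma local_bound_False:
  assumes b: "snd b = 0" and C: "C > 0" and r0: "r0 > 0"
    and lb: "\<And>r. 0 < r \<Longrightarrow> r < r0 \<Longrightarrow>
      wint (\<lambda>x. indicator {2 * r..} (dist x b) * dist x b powr (- 4 * \<sigma>)) u \<le> ennreal C * wint (\<lambda>x. r powr (- 2 * \<sigma>) * cutw \<sigma> b r x) u"
    and s1: "0 < s1" "s1 \<le> 1 / 2" and fin: "\<And>j. wint (\<lambda>x. dist x b powr (s1 / real (Suc j) - 4 * \<sigma>)) u < \<infinity>"
  shows False
proof -
  obtain \<Lambda> where \<Lambda>: "\<Lambda> \<ge> max 1 r0" "wint (\<lambda>x. indicator {..\<Lambda>} (dist x b) * dist x b powr (s1 - 4 * \<sigma>)) u > 0"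
    by (rule truncated_mass_positive)
  have \<Lambda>1: "\<Lambda> \<ge> 1" "r0 \<le> \<Lambda>" using \<Lambda>(1) by auto
  let ?T = "\<lambda>s. wint (\<lambda>x. dist x b powr (s - 4 * \<sigma>)) u"
  let ?A = "\<lambda>s. wint (\<lambda>x. indicator {..\<Lambda>} (dist x b) * dist x b powr (s - 4 * \<sigma>)) u"
  have Hb: "x \<noteq> b" if "x \<in> half_space" for x using that b by (auto simp: half_space_def)
  have AT: "?A s \<le> ?T s" for s by (intro wint_mono) (simp add: indicator_def)
  have T1: "?T s1 < \<infinity>" using fin[of 0] by simp
  obtain O' where O': "?T s1 = ennreal O'" "O' \<ge> 0" using T1 by (cases "?T s1") auto
  have "?A s1 < \<infinity>" using AT T1 by (rule le_less_trans)
  then obtain P where P: "?A s1 = ennreal P" "P > 0" using \<Lambda>(2) by (cases "?A s1") auto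
  define K where "K = C * (1 / (N - 2 * \<sigma>) + 1 / (4 * \<sigma> - 1))"
  have N: "N \<ge> 2" unfolding N_def by (rule dimn_ge_2)
  have K: "K > 0" unfolding K_def using C N \<sigma> by (intro mult_pos_pos add_pos_pos) auto
  define \<kappa> where "\<kappa> = r0 / (4 * \<Lambda>)"
  have \<kappa>: "0 < \<kappa>" "\<kappa> \<le> 1" unfolding \<kappa>_def using r0 \<Lambda>1 by auto
  define P' where "P' = \<Lambda> powr (- s1) * P"
  have P': "P' > 0" unfolding P'_def using \<Lambda>1 P by simp
  \<comment> \<open>With \<open>s = s1 / (j + 1)\<close> and \<open>\<kappa> \<le> 1\<close> this
    makes \<open>\<kappa> powr s / s\<close> exceed \<open>K + K * O' / P'\<close>, whatever the
    value of \<open>t \<ge> P'\<close>.\<close>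
  obtain j :: nat where j: "(K + K * O' / P') * s1 / \<kappa> powr s1 < real j" using reals_Archimedean2 by blast
  define s where "s = s1 / real (Suc j)"
  have s: "0 < s" "s \<le> s1" "s \<le> 1 / 2"
  proof -
    show "0 < s" using s1 by (simp add: s_def)
    have "s1 / real (Suc j) \<le> s1 / 1" using s1 by (intro divide_left_mono) auto
    then show "s \<le> s1" by (simp add: s_def)
    then show "s \<le> 1 / 2" using s1 by simp
  qed
  have "?T s < \<infinity>" unfolding s_def by (rule fin)
  then have "?A s < \<infinity>" using AT le_less_trans by blast
  then obtain t where t: "?A s = ennreal t" "t \<ge> 0" by (cases "?A s") auto
  \<comment> \<open>Beyond \<open>\<Lambda> \<ge> 1\<close> the weight with exponent
    \<open>s\<close> is at most the one with the larger exponent \<open>s1\<close>, whose total mass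
    \<open>O'\<close> is fixed.\<close>
  have "?T s \<le> (\<integral>\<^sup>+x. indicator half_space x * ennreal ((u x)\<^sup>2 * dist x b powr (s1 - 4 * \<sigma>))
      + indicator half_space x * ennreal ((u x)\<^sup>2 * (indicator {..\<Lambda>} (dist x b) * dist x b powr (s - 4 * \<sigma>))) \<partial>lborel)"
    unfolding wint_def
  proof (rule nn_integral_mono)
    fix x :: "'a \<times> real"
    show "indicator half_space x * ennreal ((u x)\<^sup>2 * dist x b powr (s - 4 * \<sigma>)) \<le> indicator half_space x * ennreal ((u x)\<^sup>2 * dist x b powr (s1 - 4 * \<sigma>))
      + indicator half_space x * ennreal ((u x)\<^sup>2 * (indicator {..\<Lambda>} (dist x b) * dist x b powr (s - 4 * \<sigma>)))"
    proof (cases "dist x b \<le> \<Lambda>")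
      case False
      then have "dist x b powr (s - 4 * \<sigma>) \<le> dist x b powr (s1 - 4 * \<sigma>)" using \<Lambda>1 s by (intro powr_mono) auto
      then have "indicator half_space x * ennreal ((u x)\<^sup>2 * dist x b powr (s - 4 * \<sigma>)) \<le> indicator half_space x * ennreal ((u x)\<^sup>2 * dist x b powr (s1 - 4 * \<sigma>))"
        by (intro mult_left_mono ennreal_leI) simp_all
      then show ?thesis by (rule add_increasing2[OF zero_le])
    qed simp
  qed
  also have "\<dots> = ennreal O' + ennreal t"
    unfolding O'(1)[symmetric] t(1)[symmetric] wint_def by (rule nn_integral_add) measurable
  finally have Tle: "?T s \<le> ennreal (O' + t)" using O'(2) t(2) by simp
  \<comment> \<open>Within distance \<open>\<Lambda>\<close> the two weights differ by a factor
    \<open>dist x b powr (s - s1)\<close>, which is at least \<open>\<Lambda> powr (- s1)\<close>;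
    so the lower bound does not depend on \<open>s\<close>.\<close>
  have tP: "P' \<le> t"
  proof -
    have "ennreal P' = wint (\<lambda>x. \<Lambda> powr (- s1) * (indicator {..\<Lambda>} (dist x b) * dist x b powr (s1 - 4 * \<sigma>))) u"
      using P unfolding P'_def by (subst wint_cmult) (simp_all add: ennreal_mult)
    also have "\<dots> \<le> ?A s"
    proof (rule wint_mono)
      fix x :: "'a \<times> real"
      assume "x \<in> half_space"
      then have \<rho>: "dist x b > 0" using Hb by simp
      show "\<Lambda> powr (- s1) * (indicator {..\<Lambda>} (dist x b) * dist x b powr (s1 - 4 * \<sigma>)) \<le> indicator {..\<Lambda>} (dist x b) * dist x b powr (s - 4 * \<sigma>)"
      proof (cases "dist x b \<le> \<Lambda>")
        case True
        have "\<Lambda> powr (- s1) \<le> \<Lambda> powr (s - s1)" using \<Lambda>1 s by (intro powr_mono) auto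
        also have "\<dots> \<le> dist x b powr (s - s1)" using True \<rho> s by (intro powr_mono2') auto
        finally have "\<Lambda> powr (- s1) * dist x b powr (s1 - 4 * \<sigma>) \<le> dist x b powr (s - s1) * dist x b powr (s1 - 4 * \<sigma>)"
          by (rule mult_right_mono) simp
        also have "\<dots> = dist x b powr (s - 4 * \<sigma>)" by (simp add: powr_add[symmetric])
        finally show ?thesis using True by simp
      qed simp
    qed
    finally show ?thesis using t by simp
  qed
  have "ennreal (\<kappa> powr s / s) * ennreal t \<le> ennreal K * ?T s"
    unfolding t(1)[symmetric] \<kappa>_def K_def by (rule scale_integrated_bound[OF b C r0 lb s(1,3) \<Lambda>1(2)])
  also have "\<dots> \<le> ennreal K * ennreal (O' + t)" by (rule mult_left_mono[OF Tle]) simp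
  finally have main: "\<kappa> powr s / s * t \<le> K * (O' + t)"
    using K s t(2) O'(2) by (simp add: ennreal_mult[symmetric] ennreal_le_iff del: ennreal_plus)
  have "K + K * O' / P' < \<kappa> powr s1 * real j / s1"
    using j \<kappa> s1 by (simp add: field_simps)
  also have "\<dots> \<le> \<kappa> powr s1 * real (Suc j) / s1" using s1 by (intro divide_right_mono mult_left_mono) auto
  also have "\<dots> = \<kappa> powr s1 / s" by (simp add: s_def)
  also have "\<dots> \<le> \<kappa> powr s / s" using \<kappa> s by (intro divide_right_mono powr_mono') auto
  finally have "(K + K * O' / P') * t < \<kappa> powr s / s * t" using P' tP by (intro mult_strict_right_mono) auto
  moreover have "K * O' \<le> K * O' / P' * t"
  proof -
    have "K * O' / P' * P' \<le> K * O' / P' * t" using K O'(2) P' tP by (intro mult_left_mono) auto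
    then show ?thesis using P' by simp
  qed
  ultimately show False using main by (simp add: distrib_left distrib_right)
qed

end

section \<open>Normalization of the minimizer and conclusion\<close>

lemma lp_int_cmult:
  fixes u :: "'a::euclidean_space \<times> real \<Rightarrow> real"
  assumes [measurable]: "u \<in> borel_measurable borel"
  shows "lp_int \<sigma> half_space (\<lambda>x. c * u x) = ennreal (\<bar>c\<bar> powr crit_exp \<sigma> TYPE('a \<times> real)) * lp_int \<sigma> half_space u"
proof -
  let ?p = "crit_exp \<sigma> TYPE('a \<times> real)"
  have "indicator half_space x * ennreal (\<bar>c * u x\<bar> powr ?p) = ennreal (\<bar>c\<bar> powr ?p) * (indicator half_space x * ennreal (\<bar>u x\<bar> powr ?p))" for x
    by (simp add: abs_mult powr_mult ennreal_mult mult_ac)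
  then show ?thesis unfolding lp_int_def by (simp add: nn_integral_cmult)
qed

text \<open>The quotient is invariant under scaling, so the extremal function may be multiplied by
  \<open>L powr (- 1 / p)\<close>; constants are multipliers, hence the approximating sequence is
  carried along. In particular the Sobolev constant is finite.\<close>

lemma attained_minimizer:
  assumes \<sigma>: "1/2 < \<sigma>" "\<sigma> < 1" and att: "S_attained \<sigma> (half_space :: ('a::euclidean_space \<times> real) set)"
  obtains S N p and u :: "'a::euclidean_space \<times> real \<Rightarrow> real" and \<phi> where "minimizer \<sigma> S N p u \<phi>" "S_const \<sigma> (half_space :: ('a \<times> real) set) = ennreal S"
proof -
  let ?N = "dimn TYPE('a \<times> real)"
  let ?p = "crit_exp \<sigma> TYPE('a \<times> real)"
  let ?\<theta> = "(?N - 2 * \<sigma>) / ?N"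
  have \<sigma>0: "0 < \<sigma>" using \<sigma> by simp
  have p: "?p > 2" by (rule crit_exp_gt_2[OF \<sigma>0 \<sigma>(2)])
  have N: "?N \<ge> 2" by (rule dimn_ge_2)
  obtain u0 :: "'a \<times> real \<Rightarrow> real" where u0: "u0 \<in> Hdot \<sigma> half_space" "\<not> (AE x in lborel. u0 x = 0)" "quot \<sigma> half_space u0 = S_const \<sigma> (half_space :: ('a \<times> real) set)"
    using att unfolding S_attained_def by (elim bexE conjE) (rule that)
  from u0(1) obtain \<phi> where [measurable]: "u0 \<in> borel_measurable borel" and out: "AE x in lborel. x \<notin> half_space \<longrightarrow> u0 x = 0" and conv: "econv \<sigma> \<phi> u0"
    unfolding Hdot_iff_econv by (elim conjE exE) (rule that)
  obtain L where L: "lp_int \<sigma> half_space u0 = ennreal L" "L \<ge> 0"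
    using Hdot_lp_finite[OF \<sigma>0 \<sigma>(2) conv] by (cases "lp_int \<sigma> half_space u0") auto
  \<comment> \<open>A function of \<open>Hdot\<close> vanishes almost everywhere off the half-space,
    so zero \<open>L\<^sup>p\<close> mass there would make \<open>u0\<close> zero almost
    everywhere.\<close>
  have L0: "L > 0"
  proof (rule ccontr)
    assume "\<not> L > 0"
    then have "lp_int \<sigma> half_space u0 = 0" using L by simp
    then have "AE x in lborel. indicator half_space x * ennreal (\<bar>u0 x\<bar> powr ?p) = 0"
      unfolding lp_int_def by (subst (asm) nn_integral_0_iff_AE) simp_all
    then have "AE x in lborel. u0 x = 0"
      using out by eventually_elim (use p in \<open>auto simp: indicator_def split: if_splits\<close>)
    then show False using u0(2) by simp
  qed
  obtain G where G: "gen \<sigma> u0 = ennreal G" "G \<ge> 0"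
    using Hdot_gen_finite[OF \<sigma>0 \<sigma>(2) conv] by (cases "gen \<sigma> u0") auto
  have den: "lp_den \<sigma> half_space u0 = ennreal (L powr ?\<theta>)" using L by (simp add: lp_den_def)
  define S where "S = G / L powr ?\<theta>"
  have S: "S \<ge> 0" using G by (simp add: S_def)
  have SH: "S_const \<sigma> (half_space :: ('a \<times> real) set) = ennreal S"
    unfolding u0(3)[symmetric] quot_def den S_def using G L0 by (simp add: gag_half_space divide_ennreal)
  define c where "c = L powr (- 1 / ?p)"
  have c: "c > 0" using L0 by (simp add: c_def)
  have "minimizer \<sigma> S ?N ?p (\<lambda>x. c * u0 x) (\<lambda>k x. c * \<phi> k x)"
  proof
    show "econv \<sigma> (\<lambda>k x. c * \<phi> k x) (\<lambda>x. c * u0 x)" by (rule multiplier_econv[OF \<sigma> multiplier_const conv])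
    have "c powr ?p = L powr - 1" unfolding c_def powr_powr using p by simp
    then have "c powr ?p * L = 1" using L0 by (simp only: powr_minus) simp
    then show "lp_int \<sigma> half_space (\<lambda>x. c * u0 x) = 1"
      using c L by (simp add: lp_int_cmult ennreal_mult[symmetric])
    have "c\<^sup>2 = L powr (- 2 / ?p)"
      using L0 by (simp add: c_def power2_eq_square powr_add[symmetric])
    also have "- 2 / ?p = - ?\<theta>" using N \<sigma> by (simp add: crit_exp_def field_simps)
    finally have "c\<^sup>2 * G = S" by (simp add: S_def powr_minus divide_inverse mult.commute)
    then show "gen \<sigma> (\<lambda>x. c * u0 x) = ennreal S" using G by (simp add: gen_cmult ennreal_mult[symmetric])
    fix f :: "'a \<times> real \<Rightarrow> real"
    assume f: "f \<in> C1c half_space"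
    show "ennreal S * lp_den \<sigma> half_space f \<le> gen \<sigma> f"
      using S_const_C1c[OF f, of \<sigma>] unfolding SH gag_half_space[OF C1c_measurable[OF f]] .
  qed (use \<sigma> S in simp_all)
  then show ?thesis using SH by (rule that)
qed

theorem theorem1p3:
  fixes \<sigma> \<epsilon> :: real and \<Omega> :: "('a::euclidean_space \<times> real) set" and a :: "'a \<times> real"
  assumes "1/2 < \<sigma>" and "\<sigma> < 1"
    and "S_attained \<sigma> (half_space :: ('a \<times> real) set)"
    and "open \<Omega>" and "\<Omega> \<subseteq> half_space"
    and "\<epsilon> > 0" and "a \<in> UNIV \<times> {0}" and "half_ball a \<epsilon> \<subseteq> \<Omega>"
    and "interior (half_space - \<Omega>) \<noteq> {}"
  shows "S_const \<sigma> \<Omega> < S_const \<sigma> (half_space :: ('a \<times> real) set)"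
proof (rule ccontr)
  assume "\<not> ?thesis"
  \<comment> \<open>The negated claim says that the half-space constant is admissible on
    \<open>\<Omega>\<close>, which is what feeds the Kelvin transform argument.\<close>
  then have le: "S_const \<sigma> (half_space :: ('a \<times> real) set) \<le> S_const \<sigma> \<Omega>" by simp
  have \<sigma>0: "0 < \<sigma>" using assms(1) by simp
  have a: "snd a = 0" using assms(7) by (simp add: mem_Times_iff)
  obtain S N p and u :: "'a \<times> real \<Rightarrow> real" and \<phi> where "minimizer \<sigma> S N p u \<phi>"
    and SH: "S_const \<sigma> (half_space :: ('a \<times> real) set) = ennreal S"
    by (rule attained_minimizer[OF assms(1-3)])
  then interpret minimizer \<sigma> S N p u \<phi> by simp
  have sob\<Omega>: "ennreal S * lp_den \<sigma> \<Omega> f \<le> gag \<sigma> \<Omega> f" if "f \<in> C1c \<Omega>" for f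
  proof -
    have "ennreal S * lp_den \<sigma> \<Omega> f \<le> S_const \<sigma> \<Omega> * lp_den \<sigma> \<Omega> f"
      using le unfolding SH by (rule mult_right_mono) simp
    also have "\<dots> \<le> gag \<sigma> \<Omega> f" by (rule S_const_C1c[OF that])
    finally show ?thesis .
  qed
  obtain c where "c \<in> interior (half_space - \<Omega>)" using assms(9) by blast
  then obtain \<delta> where \<delta>: "\<delta> > 0" "ball c \<delta> \<subseteq> half_space - \<Omega>" by (auto simp: mem_interior)
  obtain v0 where v0: "v0 > 0" and gain: "\<And>w. w \<in> borel_measurable borel \<Longrightarrow> (\<And>y. w y \<noteq> 0 \<Longrightarrow> y \<in> half_ball a \<epsilon>) \<Longrightarrow>
      gag \<sigma> \<Omega> w + ennreal v0 * wint (\<lambda>_. 1) w \<le> gen \<sigma> w"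
    by (rule energy_gain[OF \<sigma>0 assms(4,5,8) \<delta>(2,1) assms(6)]) blast
  obtain b :: "'a \<times> real" and s1 where b: "snd b = 0" and s1: "0 < s1" "s1 \<le> 1 / 2"
    and fin: "\<And>j. wint (\<lambda>x. dist x b powr (s1 / real (Suc j) - 4 * \<sigma>)) u < \<infinity>"
    by (rule good_boundary_point) (rule that)
  \<comment> \<open>Obtained from the choice \<open>l = \<epsilon> / 2 * r\<close>: it keeps
    \<open>l / r\<close> below \<open>\<epsilon>\<close>, and the gain
    \<open>v0 * l powr (2 * \<sigma>)\<close> becomes
    \<open>v1 * r powr (2 * \<sigma>)\<close>.\<close>
  define v1 where "v1 = v0 * (\<epsilon> / 2) powr (2 * \<sigma>)"
  have v1: "v1 > 0" using v0 assms(6) by (simp add: v1_def)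
  have kel: "ennreal S * lp_den \<sigma> half_space v + ennreal (v1 * r powr (2 * \<sigma>)) * wint (\<lambda>x. dist x b powr (- 4 * \<sigma>)) v \<le> gen \<sigma> v"
    if r: "r > 0" and v: "v \<in> C1c half_space" "\<And>x. dist x b < r \<Longrightarrow> v x = 0" for r v
  proof -
    have l: "0 < \<epsilon> / 2 * r" "\<epsilon> / 2 * r / r < \<epsilon>" using r assms(6) by simp_all
    have "v1 * r powr (2 * \<sigma>) = v0 * (\<epsilon> / 2 * r) powr (2 * \<sigma>)"
      unfolding v1_def mult.assoc by (simp only: powr_mult)
    then show ?thesis
      using kelvin_inequality[OF \<sigma>0 assms(2) S0 sob\<Omega> gain v0 assms(5,8) a b v r l] by simp
  qed
  obtain C r0 where "C > 0" "r0 > 0" and bound: "\<And>r. 0 < r \<Longrightarrow> r < r0 \<Longrightarrow>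
    wint (\<lambda>x. indicator {2 * r..} (dist x b) * dist x b powr (- 4 * \<sigma>)) u \<le> ennreal C * wint (\<lambda>x. r powr (- 2 * \<sigma>) * cutw \<sigma> b r x) u"
    by (rule local_bound[OF b v1 kel]) (assumption+, rule that)
  then show False by (intro local_bound_False[OF b _ _ _ s1 fin, of C r0])
qed

end
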